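(* There exist positive constants $C_3, C_4, C_5, C_6$ such that $$C_{3}e^{-C_{4}t}t^{-\frac{d}{\alpha}}\left(1 \wedge \frac{t^{1/\alpha}}{|x-z|}\right)^{d+\alpha} \leq q(t,x,z) \leq C_{5}e^{C_{6}t}t^{-\frac{d}{\alpha}}\left(1 \wedge \frac{t^{1/\alpha}}{|x-z|}\right)^{d+\alpha}$$ for all $(t,x,z)\in (0,\infty)\times\mathbb{R}^d\times\mathbb{R}^d$, where $q$ is the density (with respect to $m$) of the Feynman-Kac semigroup $S^F_tf(x)=\mathbb{E}_x(e^{-A_t}f(X_t))$ constructed in the context.
   Context: Setting. Let $d\ge 1$ and $\alpha\in(0,2)$. $X=(X_t,\mathbb{P}_x)$ is a Hunt process on $\mathbb{R}^d$ (not assumed symmetric) with Lévy system $(N,H)$ given by $H_t=t$ and the kernel $N(x,dy)=2C(x,y)|x-y|^{-(d+\alpha)}m(dy)$, where $m(dx)=M(x)\,dx$ and $0<M_0\le M(x)\le\overline{M}$ for constants $M_0,\overline M$; that is, for every nonnegative function $f$ on $\mathbb{R}^d\times\mathbb{R}^d$ vanishing on the diagonal, every $x$ and every $t>0$, $$\mathbb{E}_x\Big(\sum_{s\le t}f(X_{s-},X_s)\Big)=\mathbb{E}_x\int_0^t\int_{\mathbb{R}^d}\frac{2C(X_s,y)f(X_s,y)}{|X_s-y|^{d+\alpha}}\,m(dy)\,ds.$$ $C(x,y)$ is bounded ($X$ is then called an $\alpha$-stable-like process); $\overline C>0$ is a constant with $|2C(x,y)|\le\overline C$. $X$ has a transition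 density $p(t,x,y)$ with respect to $m$, jointly continuous on $(0,\infty)\times\mathbb{R}^d\times\mathbb{R}^d$, and there are positive constants $M_1,M_2$ with $$M_{1}t^{-\frac{d}{\alpha}}\Big(1\wedge\frac{t^{1/\alpha}}{|x-y|}\Big)^{d+\alpha}\le p(t,x,y)\le M_{2}t^{-\frac{d}{\alpha}}\Big(1\wedge\frac{t^{1/\alpha}}{|x-y|}\Big)^{d+\alpha}$$ for all $(t,x,y)\in(0,\infty)\times\mathbb{R}^d\times\mathbb{R}^d$. A function $V$ on $\mathbb{R}^d$ is in the Kato class $\mathbf{K_{d,\alpha}}$ if $\lim_{t\downarrow0}\sup_{x}\int_0^t\int_{\mathbb{R}^d}p(s,x,y)|V(y)|\,dy\,ds=0$. A function $F$ on $\mathbb{R}^d\times\mathbb{R}^d$ is in $\mathbf{J_{d,\alpha}}$ if it is bounded, vanishes on the diagonal, and $x\mapsto\int_{\mathbb{R}^d}\frac{|F(x,y)|}{|x-y|^{d+\alpha}}dy$ is in $\mathbf{K_{d,\alpha}}$. $F$ is a (not necessarily symmetric) function such that both $F$ and $\tilde F(x,y):=F(y,x)$ belong to $\mathbf{J_{d,\alpha}}$, and $L>0$ is a constant with $|F|\le L/2$. Put $A_t=\sum_{s\le t}F(X_{s-},X_s)$ and $S^F_tf(x)=\mathbb{E}_x(e^{-A_t}f(X_t))$. Notation. $C^i_n=\frac{n!}{i!(n-i)!}$; $\overline F(w,y)=|F(w,y)|+|F(y,w)|$; $\overline p(t,x,y)=p(t,x,y)+p(t,y,x)$; $\mu(dw)=\Big(\int_{\mathbb{R}^d}\frac{\overline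 F(w,y)}{|w-y|^{d+\alpha}}dy\Big)dw$; $C_t=\sup_x\int_0^t\int_{\mathbb{R}^d}\overline p(s,x,w)\,\mu(dw)\,ds$, which decreases to $0$ as $t\downarrow0$. Construction of $q$. Set $q_0=p$ and, for $n\ge1$, $$q_n(t,x,z)=\sum_{i=1}^nC^i_n\int_0^t\int_{\mathbb{R}^d}p(s,x,w)\,m(dw)\int_{\mathbb{R}^d}\frac{2C(w,y)F^i(w,y)}{|w-y|^{d+\alpha}}\,q_{n-i}(t-s,y,z)\,m(dy)\,ds.$$ Fix $K\in(0,1)$ and $t_0>0$ such that $2^{1+d/\alpha}\,\overline M^2\,\overline C\,C_{t_0}\sum_{i=1}^nK^{n-i}\frac{L^{i-1}}{i!}\le K^n$ for all $n\ge1$. For $0<t\le t_0$ put $q(t,x,z)=\sum_{n=0}^\infty(-1)^n\frac{q_n(t,x,z)}{n!}$ (the series converges absolutely). For $t>t_0$, let $N$ be the smallest integer with $t/N\le t_0$ and put $$q(t,x,z)=\int_{\mathbb{R}^d}\cdots\int_{\mathbb{R}^d}q(t/N,x,y_1)q(t/N,y_1,y_2)\cdots q(t/N,y_{N-1},z)\,m(dy_1)\cdots m(dy_{N-1}).$$ *)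

theory Defs
  imports "HOL-Probability.Probability"
begin

section \<open>Hunt processes\<close>

text \<open>
  The state space is the one-point compactification of the Euclidean space, with \<open>None\<close> in the
  role of the cemetery. Time runs through \<open>[0, \<infinity>]\<close>, represented by \<^typ>\<open>ennreal\<close>, so that
  stopping times may be infinite.
\<close>

definition cemetery_top :: "'a::euclidean_space option topology" where
  "cemetery_top = Alexandroff_compactification euclidean"

definition cemetery_borel :: "'a::euclidean_space option measure" where
  "cemetery_borel = sigma UNIV {U. openin cemetery_top U}"

text \<open>
  Strong Markov property and quasi-left-continuity are required with respect to some right
  continuous filtration to which the process is adapted. It suffices to ask for them under each
  \<open>P x\<close>: integrating over \<open>x\<close> gives them for every initial distribution. The simple Markov
  property is the strong one at constant times. Since \<open>X \<infinity>\<close> is the cemetery, no restriction to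
  finite values of the stopping time is needed in the strong Markov property.
\<close>

locale hunt_process = filtration "space \<M>" \<F>
  for \<M> :: "'w measure" and \<F> :: "ennreal \<Rightarrow> 'w measure" +
  fixes X :: "ennreal \<Rightarrow> 'w \<Rightarrow> 'a::euclidean_space option"
    and P :: "'a option \<Rightarrow> 'w measure"
  assumes prob_space_P: "\<And>x. prob_space (P x)"
    and sets_P: "\<And>x. sets (P x) = sets \<M>"
    and filtration_sub: "\<And>t. sets (\<F> t) \<subseteq> sets \<M>"
    and filtration_right_continuous:
      "\<And>t. t < \<infinity> \<Longrightarrow> sets (\<F> t) = (\<Inter>s\<in>{t<..}. sets (\<F> s))"
    and adapted: "\<And>t. X t \<in> measurable (\<F> t) cemetery_borel"
    and kernel_measurable: "\<And>t E. E \<in> sets cemetery_borel \<Longrightarrow>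
      (\<lambda>x. measure (P x) {\<omega> \<in> space \<M>. X t \<omega> \<in> E}) \<in> borel_measurable cemetery_borel"
    and normal: "\<And>x. AE \<omega> in P x. X 0 \<omega> = x"
    and X_infinity: "\<And>\<omega>. \<omega> \<in> space \<M> \<Longrightarrow> X \<infinity> \<omega> = None"
    and cemetery_absorbing:
      "\<And>s t \<omega>. \<omega> \<in> space \<M> \<Longrightarrow> s \<le> t \<Longrightarrow> X s \<omega> = None \<Longrightarrow> X t \<omega> = None"
    and shift: "\<And>t. t < \<infinity> \<Longrightarrow>
      \<exists>\<theta> \<in> space \<M> \<rightarrow> space \<M>. \<forall>s. \<forall>\<omega>\<in>space \<M>. X s (\<theta> \<omega>) = X (s + t) \<omega>"
    and right_continuous: "\<And>t \<omega>. \<omega> \<in> space \<M> \<Longrightarrow> t < \<infinity> \<Longrightarrow>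
      limitin cemetery_top (\<lambda>s. X s \<omega>) (X t \<omega>) (at_right t)"
    and left_limits: "\<And>t \<omega>. \<omega> \<in> space \<M> \<Longrightarrow> 0 < t \<Longrightarrow> t < \<infinity> \<Longrightarrow>
      \<exists>l. limitin cemetery_top (\<lambda>s. X s \<omega>) l (at_left t)"
    and strong_markov: "\<And>x \<sigma> s E. stopping_time \<F> \<sigma> \<Longrightarrow> s < \<infinity> \<Longrightarrow> E \<in> sets cemetery_borel \<Longrightarrow>
      AE \<omega> in P x.
        real_cond_exp (P x) (pre_sigma \<sigma>) (indicat_real {\<omega> \<in> space \<M>. X (\<sigma> \<omega> + s) \<omega> \<in> E}) \<omega> =
        measure (P (X (\<sigma> \<omega>) \<omega>)) {\<omega>' \<in> space \<M>. X s \<omega>' \<in> E}"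
    and quasi_left_continuous: "\<And>x \<sigma>. (\<And>n::nat. stopping_time \<F> (\<sigma> n)) \<Longrightarrow>
      (\<And>\<omega>. \<omega> \<in> space \<M> \<Longrightarrow> incseq (\<lambda>n. \<sigma> n \<omega>)) \<Longrightarrow>
      AE \<omega> in P x. (SUP n. \<sigma> n \<omega>) < \<infinity> \<longrightarrow>
        limitin cemetery_top (\<lambda>n. X (\<sigma> n \<omega>) \<omega>) (X (SUP n. \<sigma> n \<omega>) \<omega>) sequentially"

text \<open>Functions on the state space vanish at the cemetery.\<close>

definition off_cemetery ::
    "('a \<Rightarrow> 'a \<Rightarrow> 'b::zero) \<Rightarrow> 'a option \<Rightarrow> 'a option \<Rightarrow> 'b" where
  "off_cemetery f u v = (case (u, v) of (Some x, Some y) \<Rightarrow> f x y | _ \<Rightarrow> 0)"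

definition left_limit ::
    "(ennreal \<Rightarrow> 'w \<Rightarrow> 'a::euclidean_space option) \<Rightarrow> ennreal \<Rightarrow> 'w \<Rightarrow> 'a option" where
  "left_limit X t \<omega> = (THE l. limitin cemetery_top (\<lambda>s. X s \<omega>) l (at_left t))"

text \<open>
  The Levy system \<open>(N, H)\<close> with \<open>H\<^sub>t = t\<close>. Time \<open>0\<close> is left out of the sum of jumps, because
  \<open>X\<^sub>0\<^sub>-\<close> is by convention \<open>X\<^sub>0\<close> and \<open>f\<close> vanishes on the diagonal.
\<close>

definition levy_system ::
    "(ennreal \<Rightarrow> 'w \<Rightarrow> 'a::euclidean_space option) \<Rightarrow> ('a option \<Rightarrow> 'w measure) \<Rightarrow>
     ('a \<Rightarrow> 'a measure) \<Rightarrow> bool" where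
  "levy_system X P N \<longleftrightarrow>
    (\<forall>(f :: 'a \<Rightarrow> 'a \<Rightarrow> ennreal) x (t::real).
      (\<lambda>(u, v). f u v) \<in> borel_measurable borel \<longrightarrow> (\<forall>u. f u u = 0) \<longrightarrow> 0 < t \<longrightarrow>
      (\<integral>\<^sup>+\<omega>. (\<Sum>\<^sub>\<infinity>s\<in>{0<..t}. off_cemetery f (left_limit X (ennreal s) \<omega>) (X (ennreal s) \<omega>))
         \<partial>P (Some x)) =
      (\<integral>\<^sup>+\<omega>. (\<integral>\<^sup>+s\<in>{0..t}.
           (case X (ennreal s) \<omega> of None \<Rightarrow> 0 | Some u \<Rightarrow> \<integral>\<^sup>+y. f u y \<partial>N u) \<partial>lborel)
         \<partial>P (Some x)))"

definition transition_density ::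
    "(ennreal \<Rightarrow> 'w \<Rightarrow> 'a::euclidean_space option) \<Rightarrow> ('a option \<Rightarrow> 'w measure) \<Rightarrow>
     'a measure \<Rightarrow> (real \<Rightarrow> 'a \<Rightarrow> 'a \<Rightarrow> real) \<Rightarrow> bool" where
  "transition_density X P m p \<longleftrightarrow>
    (\<forall>t>0. \<forall>x. \<forall>B\<in>sets borel.
      emeasure (P (Some x)) {\<omega> \<in> space (P (Some x)). X (ennreal t) \<omega> \<in> Some ` B} =
      (\<integral>\<^sup>+y\<in>B. ennreal (p t x y) \<partial>m))"


section \<open>Stable-like processes\<close>

text \<open>On the diagonal \<open>t powr (1 / \<alpha>) / norm (x - y)\<close> has to be read as infinity, not as \<open>0\<close>.\<close>

definition stable_bound :: "real \<Rightarrow> real \<Rightarrow> 'a::euclidean_space \<Rightarrow> 'a \<Rightarrow> real" where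
  "stable_bound \<alpha> t x y =
    t powr (- real DIM('a) / \<alpha>) *
    (if x = y then 1 else min 1 (t powr (1 / \<alpha>) / norm (x - y))) powr (real DIM('a) + \<alpha>)"

definition stable_kernel ::
    "real \<Rightarrow> 'a::euclidean_space measure \<Rightarrow> ('a \<Rightarrow> 'a \<Rightarrow> real) \<Rightarrow> 'a \<Rightarrow> 'a measure" where
  "stable_kernel \<alpha> m C x =
    density m (\<lambda>y. ennreal (2 * C x y / norm (x - y) powr (real DIM('a) + \<alpha>)))"

text \<open>
  Members of the Kato class may take infinite values, as the integral in the definition
  of \<open>J_class\<close> can be infinite on a null set.
\<close>

definition kato_class :: "(real \<Rightarrow> 'a \<Rightarrow> 'a \<Rightarrow> real) \<Rightarrow> ('a::euclidean_space \<Rightarrow> ereal) set" where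
  "kato_class p = {V \<in> borel_measurable borel.
    ((\<lambda>t. SUP x. \<integral>\<^sup>+s\<in>{0<..t}. (\<integral>\<^sup>+y. ennreal (p s x y) * e2ennreal \<bar>V y\<bar> \<partial>lborel) \<partial>lborel)
      \<longlongrightarrow> 0) (at_right 0)}"

definition jump_integral :: "real \<Rightarrow> ('a::euclidean_space \<Rightarrow> 'a \<Rightarrow> real) \<Rightarrow> 'a \<Rightarrow> ennreal" where
  "jump_integral \<alpha> F x =
    (\<integral>\<^sup>+y. ennreal (\<bar>F x y\<bar> / norm (x - y) powr (real DIM('a) + \<alpha>)) \<partial>lborel)"

definition J_class ::
    "real \<Rightarrow> (real \<Rightarrow> 'a \<Rightarrow> 'a \<Rightarrow> real) \<Rightarrow> ('a::euclidean_space \<Rightarrow> 'a \<Rightarrow> real) set" where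
  "J_class \<alpha> p = {F. (\<lambda>(x, y). F x y) \<in> borel_measurable borel \<and>
    bounded (range (\<lambda>(x, y). F x y)) \<and> (\<forall>x. F x x = 0) \<and>
    (\<lambda>x. enn2ereal (jump_integral \<alpha> F x)) \<in> kato_class p}"

definition jump_measure :: "real \<Rightarrow> ('a::euclidean_space \<Rightarrow> 'a \<Rightarrow> real) \<Rightarrow> 'a measure" where
  "jump_measure \<alpha> F = density lborel (jump_integral \<alpha> (\<lambda>w y. \<bar>F w y\<bar> + \<bar>F y w\<bar>))"

definition jump_sup ::
    "real \<Rightarrow> (real \<Rightarrow> 'a \<Rightarrow> 'a \<Rightarrow> real) \<Rightarrow> ('a::euclidean_space \<Rightarrow> 'a \<Rightarrow> real) \<Rightarrow> real \<Rightarrow> ennreal"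
  where
  "jump_sup \<alpha> p F t =
    (SUP x. \<integral>\<^sup>+s\<in>{0<..t}. (\<integral>\<^sup>+w. ennreal (p s x w + p s w x) \<partial>jump_measure \<alpha> F) \<partial>lborel)"


section \<open>The Feynman-Kac semigroup and its density\<close>

text \<open>
  \<open>jump_functional\<close> is the additive functional \<open>A\<^sub>t\<close> and \<open>feynman_kac\<close> the semigroup \<open>S\<^sup>F\<^sub>t\<close>. The
  function \<open>fk_density\<close> constructed below is the density of this semigroup; its definition, and
  hence any estimate of it, involves only \<open>p\<close>, \<open>m\<close>, \<open>C\<close> and \<open>F\<close>.
\<close>

definition jump_functional ::
    "(ennreal \<Rightarrow> 'w \<Rightarrow> 'a::euclidean_space option) \<Rightarrow> ('a \<Rightarrow> 'a \<Rightarrow> real) \<Rightarrow> real \<Rightarrow> 'w \<Rightarrow> real" where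
  "jump_functional X F t \<omega> =
    (\<Sum>\<^sub>\<infinity>s\<in>{0<..t}. off_cemetery F (left_limit X (ennreal s) \<omega>) (X (ennreal s) \<omega>))"

definition feynman_kac ::
    "(ennreal \<Rightarrow> 'w \<Rightarrow> 'a::euclidean_space option) \<Rightarrow> ('a option \<Rightarrow> 'w measure) \<Rightarrow>
     ('a \<Rightarrow> 'a \<Rightarrow> real) \<Rightarrow> real \<Rightarrow> ('a \<Rightarrow> real) \<Rightarrow> 'a \<Rightarrow> real" where
  "feynman_kac X P F t f x =
    (\<integral>\<omega>. exp (- jump_functional X F t \<omega>) *
          (case X (ennreal t) \<omega> of None \<Rightarrow> 0 | Some y \<Rightarrow> f y) \<partial>P (Some x))"

context
  notes sum.cong [fundef_cong]
begin

function fk_term ::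
    "real \<Rightarrow> (real \<Rightarrow> 'a \<Rightarrow> 'a \<Rightarrow> real) \<Rightarrow> 'a::euclidean_space measure \<Rightarrow> ('a \<Rightarrow> 'a \<Rightarrow> real) \<Rightarrow>
     ('a \<Rightarrow> 'a \<Rightarrow> real) \<Rightarrow> nat \<Rightarrow> real \<Rightarrow> 'a \<Rightarrow> 'a \<Rightarrow> real" where
  "fk_term \<alpha> p m C F n t x z =
    (if n = 0 then p t x z
     else \<Sum>i=1..n. real (n choose i) *
       (LINT s:{0<..<t}|lborel. LINT w|m. p s x w *
         (LINT y|m. 2 * C w y * F w y ^ i / norm (w - y) powr (real DIM('a) + \<alpha>) *
           fk_term \<alpha> p m C F (n - i) (t - s) y z)))"
  by pat_completeness auto
termination
  by (relation "Wellfounded.measure (\<lambda>(_, _, _, _, _, n, _). n)") auto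

end

declare fk_term.simps [simp del]

text \<open>The \<open>n\<close>-fold composition of the kernel \<open>r\<close>, an \<open>n - 1\<close>-fold integral (for \<open>n \<ge> 1\<close>).\<close>

fun kernel_power ::
    "'a measure \<Rightarrow> ('a \<Rightarrow> 'a \<Rightarrow> real) \<Rightarrow> nat \<Rightarrow> 'a \<Rightarrow> 'a \<Rightarrow> real" where
  "kernel_power m r 0 x z = 0"
| "kernel_power m r (Suc 0) x z = r x z"
| "kernel_power m r (Suc (Suc n)) x z = (LINT y|m. r x y * kernel_power m r (Suc n) y z)"

definition fk_series ::
    "real \<Rightarrow> (real \<Rightarrow> 'a \<Rightarrow> 'a \<Rightarrow> real) \<Rightarrow> 'a::euclidean_space measure \<Rightarrow> ('a \<Rightarrow> 'a \<Rightarrow> real) \<Rightarrow>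
     ('a \<Rightarrow> 'a \<Rightarrow> real) \<Rightarrow> real \<Rightarrow> 'a \<Rightarrow> 'a \<Rightarrow> real" where
  "fk_series \<alpha> p m C F t x z = (\<Sum>n. (- 1) ^ n * fk_term \<alpha> p m C F n t x z / fact n)"

definition fk_density ::
    "real \<Rightarrow> (real \<Rightarrow> 'a \<Rightarrow> 'a \<Rightarrow> real) \<Rightarrow> 'a::euclidean_space measure \<Rightarrow> ('a \<Rightarrow> 'a \<Rightarrow> real) \<Rightarrow>
     ('a \<Rightarrow> 'a \<Rightarrow> real) \<Rightarrow> real \<Rightarrow> real \<Rightarrow> 'a \<Rightarrow> 'a \<Rightarrow> real" where
  "fk_density \<alpha> p m C F t\<^sub>0 t x z =
    (if t \<le> t\<^sub>0 then fk_series \<alpha> p m C F t x z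
     else let N = (LEAST N::nat. 1 \<le> N \<and> t / real N \<le> t\<^sub>0)
          in kernel_power m (fk_series \<alpha> p m C F (t / real N)) N x z)"

end

theory Submission
  imports Defs
begin

text \<open>
  Separating the signs of the terms, \<open>q\<close> is the difference of two series \<open>Q\<^sup>+\<close>, \<open>Q\<^sup>-\<close> of nonnegative
  kernels, and both are dominated by the perturbation series \<open>\<Sum>\<^sub>k (p h)\<^sup>k p\<close> for \<open>h(w, y)\<close> a suitable
  multiple of \<open>\<bar>F(w, y)\<bar> / \<bar>w - y\<bar>\<^sup>d\<^sup>+\<^sup>\<alpha>\<close>. The smallness of \<open>t\<^sub>0\<close> makes the masses of its terms decay
  geometrically, which yields the upper bound for small times.

  The alternating series gives no lower bound by itself. Let \<open>n\<close> be the jump intensity of \<open>X\<close> and \<open>\<beta>\<close> a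
  kernel slightly above \<open>(1 - exp (- F\<^sup>+)) n\<close> but still below \<open>n\<close>, and let \<open>r\<close> be the perturbation of
  \<open>p\<close> by \<open>- \<beta>\<close>. Then \<open>q\<close> is the perturbation of \<open>r\<close> by \<open>\<gamma> = (exp (- F) - 1) n + \<beta> \<ge> \<rho> \<beta>\<close> for some
  \<open>\<rho> > 0\<close>. If \<open>r \<ge> 0\<close>, it follows that
  \<open>q \<ge> \<Sum>\<^sub>k\<^sub><\<^sub>N (r \<gamma>)\<^sup>k r \<ge> \<rho>\<^sup>N \<Sum>\<^sub>k\<^sub><\<^sub>N (r \<beta>)\<^sup>k r \<ge> \<rho>\<^sup>N (p - (p \<beta>)\<^sup>N p) \<ge> \<rho>\<^sup>N p / 2\<close> for large \<open>N\<close>.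

  Positivity of \<open>r\<close> means that jumps may be suppressed at a rate not exceeding their intensity. Let
  \<open>u\<close> be the perturbed semigroup applied to a function with values in \<open>[0, 1]\<close>, and integrate the negative
  part of \<open>u(t)\<close> against the almost excessive density \<open>\<integral>\<^sub>0\<^sup>1 p(s, x\<^sub>0, \<cdot>) ds\<close>. Where \<open>u(t) < 0\<close>, the loss
  caused by \<open>\<beta>\<close> is at most what the jumps of the unperturbed semigroup bring in from \<open>{u > 0}\<close>, because by
  the Levy system \<open>p(h, \<cdot>, \<cdot>) / h\<close> is asymptotically at least \<open>n\<close> off the diagonal as \<open>h \<rightarrow> 0\<close>. So the
  integral satisfies a differential inequality of Gronwall type, and it vanishes.

  Chapman-Kolmogorov, which passes from small to all times, follows from the simple Markov property.
\<close>

section \<open>Convolution of kernels\<close>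

text \<open>Kernels take values in \<open>ennreal\<close>, so every interchange of integrals is
  Tonelli's; a signed kernel is a pair of kernels. Identities are therefore kept free of
  subtraction, and finite terms are cancelled at the end.

  The factor \<Lambda> > 1 by which \<beta> exceeds (1 - exp (- F^+)) n makes the comparison
  possible. Without it \<gamma> would vanish where F > 0; with it \<gamma> equals (\<Lambda> - 1) /
  \<Lambda> times \<beta> there, while \<beta> vanishes where F \<le> 0.

  Two obstacles shape the positivity proof for r: u(t) cannot be differentiated, as it need not lie
  in the domain of a generator, and the jump intensity is singular at the diagonal. So \<beta> is
  first cut off near the diagonal, where it acts as a bounded operator, and the Gronwall inequality
  is derived from difference quotients and lower limits. The Levy system then only has to supply
  lower bounds, which Fatou's lemma gives on open sets. Positivity is first obtained for integrals,
  then almost everywhere, then everywhere; the cutoff is removed last, by monotone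
  convergence.\<close>

definition st_kernel :: "(real \<Rightarrow> 'a::euclidean_space \<Rightarrow> 'a \<Rightarrow> ennreal) \<Rightarrow> bool" where
  "st_kernel A \<longleftrightarrow>
    (\<lambda>(t, x, y). A t x y) \<in> borel_measurable (borel \<Otimes>\<^sub>M borel \<Otimes>\<^sub>M borel) \<and>
    (\<forall>t x y. t \<le> 0 \<longrightarrow> A t x y = 0)"

definition sp_kernel :: "('a::euclidean_space \<Rightarrow> 'a \<Rightarrow> ennreal) \<Rightarrow> bool" where
  "sp_kernel b \<longleftrightarrow> (\<lambda>(x, y). b x y) \<in> borel_measurable (borel \<Otimes>\<^sub>M borel)"

lemma st_kernel_measurable:
  assumes "st_kernel A" "f \<in> N \<rightarrow>\<^sub>M borel" "g \<in> N \<rightarrow>\<^sub>M borel" "h \<in> N \<rightarrow>\<^sub>M borel"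
  shows "(\<lambda>\<omega>. A (f \<omega>) (g \<omega>) (h \<omega>)) \<in> borel_measurable N"
  using measurable_compose[of "\<lambda>\<omega>. (f \<omega>, g \<omega>, h \<omega>)" N, OF _ conjunct1[OF assms(1)[unfolded st_kernel_def]]]
    assms(2-) by simp

lemma sp_kernel_measurable:
  assumes "sp_kernel b" "g \<in> N \<rightarrow>\<^sub>M borel" "h \<in> N \<rightarrow>\<^sub>M borel"
  shows "(\<lambda>\<omega>. b (g \<omega>) (h \<omega>)) \<in> borel_measurable N"
  using measurable_compose[of "\<lambda>\<omega>. (g \<omega>, h \<omega>)" N, OF _ assms(1)[unfolded sp_kernel_def]]
    assms(2-) by simp

lemma st_kernel_0: "st_kernel A \<Longrightarrow> t \<le> 0 \<Longrightarrow> A t x y = 0"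
  by (simp add: st_kernel_def)

lemma st_kernelI:
  assumes "(\<lambda>(t, x, y). A t x y) \<in> borel_measurable (borel \<Otimes>\<^sub>M borel \<Otimes>\<^sub>M borel)"
    "\<And>t x y. t \<le> 0 \<Longrightarrow> A t x y = 0"
  shows "st_kernel A"
  using assms by (simp add: st_kernel_def)

lemma st_kernel_add:
  assumes A: "st_kernel A" and B: "st_kernel B"
  shows "st_kernel (\<lambda>t x y. A t x y + B t x y)"
proof -
  note [measurable (raw)] = st_kernel_measurable[OF A] st_kernel_measurable[OF B]
  show ?thesis
    by (rule st_kernelI) (auto simp: st_kernel_0[OF A] st_kernel_0[OF B] split_beta')
qed

lemma st_kernel_zero: "st_kernel (\<lambda>t x y. 0)"
  by (rule st_kernelI) auto

lemma st_kernel_sum: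
  assumes A: "\<And>i. i \<in> I \<Longrightarrow> st_kernel (A i)"
  shows "st_kernel (\<lambda>t x y. \<Sum>i\<in>I. A i t x y)"
  using A by (induction I rule: infinite_finite_induct) (auto intro: st_kernel_zero st_kernel_add)

lemma st_kernel_suminf:
  assumes A: "\<And>i. st_kernel (A i)"
  shows "st_kernel (\<lambda>t x y. \<Sum>i. A i t x y)"
proof -
  note [measurable (raw)] = st_kernel_measurable[OF A]
  show ?thesis
    by (rule st_kernelI) (auto simp: st_kernel_0[OF A] split_beta')
qed

lemma st_kernel_cut:
  assumes A: "st_kernel A"
  shows "st_kernel (\<lambda>t x y. if t \<le> T then A t x y else 0)"
proof -
  note [measurable (raw)] = st_kernel_measurable[OF A]
  show ?thesis
    by (rule st_kernelI) (auto simp: st_kernel_0[OF A] split_beta')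
qed

lemma st_kernel_diff:
  assumes A: "st_kernel A" and B: "st_kernel B"
  shows "st_kernel (\<lambda>t x y. A t x y - B t x y)"
proof -
  note [measurable (raw)] = st_kernel_measurable[OF A] st_kernel_measurable[OF B]
  show ?thesis
    by (rule st_kernelI) (auto simp: st_kernel_0[OF A] st_kernel_0[OF B] split_beta')
qed

lemma nn_integral_shift:
  fixes c :: real and f :: "real \<Rightarrow> ennreal"
  assumes "f \<in> borel_measurable borel"
  shows "(\<integral>\<^sup>+s. f (s + c) \<partial>lborel) = (\<integral>\<^sup>+s. f s \<partial>lborel)"
  using nn_integral_real_affine[of f 1 c] assms by (simp add: add.commute)

lemma nn_integral_reflect:
  fixes c :: real and f :: "real \<Rightarrow> ennreal"
  assumes "f \<in> borel_measurable borel"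
  shows "(\<integral>\<^sup>+s. f (c - s) \<partial>lborel) = (\<integral>\<^sup>+s. f s \<partial>lborel)"
  using nn_integral_real_affine[of f "-1" c] assms by simp

locale base_measure = sigma_finite_measure m for m :: "'a::euclidean_space measure" +
  assumes sets_m [measurable_cong]: "sets m = sets borel"
begin

lemma space_m: "space m = UNIV"
  using sets_eq_imp_space_eq[OF sets_m] by simp

lemma swap_mm:
  assumes "case_prod f \<in> borel_measurable (m \<Otimes>\<^sub>M m)"
  shows "(\<integral>\<^sup>+y. \<integral>\<^sup>+x. f x y \<partial>m \<partial>m) = (\<integral>\<^sup>+x. \<integral>\<^sup>+y. f x y \<partial>m \<partial>m)"
proof -
  interpret mm: pair_sigma_finite m m ..
  show ?thesis using mm.Fubini[OF assms] by simp
qed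

lemma swap_tm:
  fixes f :: "real \<Rightarrow> 'a \<Rightarrow> ennreal"
  assumes "case_prod f \<in> borel_measurable (lborel \<Otimes>\<^sub>M m)"
  shows "(\<integral>\<^sup>+y. \<integral>\<^sup>+x. f x y \<partial>lborel \<partial>m) = (\<integral>\<^sup>+x. \<integral>\<^sup>+y. f x y \<partial>m \<partial>lborel)"
proof -
  interpret tm: pair_sigma_finite "lborel :: real measure" m ..
  show ?thesis using tm.Fubini[OF assms] by simp
qed

lemma swap_tt:
  fixes f :: "real \<Rightarrow> real \<Rightarrow> ennreal"
  assumes "case_prod f \<in> borel_measurable (lborel \<Otimes>\<^sub>M lborel)"
  shows "(\<integral>\<^sup>+y. \<integral>\<^sup>+x. f x y \<partial>lborel \<partial>lborel) = (\<integral>\<^sup>+x. \<integral>\<^sup>+y. f x y \<partial>lborel \<partial>lborel)"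
  using lborel_pair.Fubini[OF assms] by simp

text \<open>As \<open>st_kernel\<close> includes vanishing for times \<open>t \<le> 0\<close>, the time integral runs over \<open>(0, t)\<close>.\<close>

definition stc :: "(real \<Rightarrow> 'a \<Rightarrow> 'a \<Rightarrow> ennreal) \<Rightarrow> (real \<Rightarrow> 'a \<Rightarrow> 'a \<Rightarrow> ennreal) \<Rightarrow>
    real \<Rightarrow> 'a \<Rightarrow> 'a \<Rightarrow> ennreal" (infixr \<open>\<star>\<close> 70) where
  "(A \<star> B) t x z = (\<integral>\<^sup>+s. \<integral>\<^sup>+y. A s x y * B (t - s) y z \<partial>m \<partial>lborel)"

definition kmul :: "('a \<Rightarrow> 'a \<Rightarrow> ennreal) \<Rightarrow> (real \<Rightarrow> 'a \<Rightarrow> 'a \<Rightarrow> ennreal) \<Rightarrow>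
    real \<Rightarrow> 'a \<Rightarrow> 'a \<Rightarrow> ennreal" (infixr \<open>\<bullet>\<^sub>k\<close> 75) where
  "(b \<bullet>\<^sub>k B) t x z = (\<integral>\<^sup>+y. b x y * B t y z \<partial>m)"

lemma st_kernel_stc:
  assumes A: "st_kernel A" and B: "st_kernel B"
  shows "st_kernel (A \<star> B)"
proof (rule st_kernelI)
  note [measurable (raw)] = st_kernel_measurable[OF A] st_kernel_measurable[OF B]
  show "(\<lambda>(t, x, y). (A \<star> B) t x y) \<in> borel_measurable (borel \<Otimes>\<^sub>M borel \<Otimes>\<^sub>M borel)"
    unfolding stc_def split_beta' by measurable
  fix t x z assume "t \<le> (0::real)"
  then have "A s x y * B (t - s) y z = 0" for s y
    using st_kernel_0[OF A, of s x y] st_kernel_0[OF B, of "t - s" y z] by (cases "s \<le> 0") auto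
  then show "(A \<star> B) t x z = 0" by (simp only: stc_def) simp
qed

lemma st_kernel_kmul:
  assumes b: "sp_kernel b" and B: "st_kernel B"
  shows "st_kernel (b \<bullet>\<^sub>k B)"
proof (rule st_kernelI)
  note [measurable (raw)] = sp_kernel_measurable[OF b] st_kernel_measurable[OF B]
  show "(\<lambda>(t, x, y). (b \<bullet>\<^sub>k B) t x y) \<in> borel_measurable (borel \<Otimes>\<^sub>M borel \<Otimes>\<^sub>M borel)"
    unfolding kmul_def split_beta' by measurable
qed (simp add: kmul_def st_kernel_0[OF B])

lemmas kernel_intros = st_kernel_stc st_kernel_kmul st_kernel_add st_kernel_sum st_kernel_suminf
  st_kernel_zero st_kernel_cut st_kernel_diff

text \<open>Tonelli brings the \<open>s'\<close>-integral outermost; translating the other time by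
  \<open>s'\<close> then exhibits the inner convolution.\<close>

lemma stc_assoc:
  assumes A: "st_kernel A" and B: "st_kernel B" and D: "st_kernel D"
  shows "(A \<star> B) \<star> D = A \<star> (B \<star> D)"
proof (intro ext)
  fix t x z
  note [measurable (raw)] = st_kernel_measurable[OF A] st_kernel_measurable[OF B]
    st_kernel_measurable[OF D]
  have "((A \<star> B) \<star> D) t x z =
      (\<integral>\<^sup>+s. \<integral>\<^sup>+y. \<integral>\<^sup>+s'. \<integral>\<^sup>+w. A s' x w * B (s - s') w y * D (t - s) y z \<partial>m \<partial>lborel \<partial>m \<partial>lborel)"
    by (simp add: stc_def nn_integral_multc)
  also have "\<dots> =
      (\<integral>\<^sup>+s. \<integral>\<^sup>+s'. \<integral>\<^sup>+y. \<integral>\<^sup>+w. A s' x w * B (s - s') w y * D (t - s) y z \<partial>m \<partial>m \<partial>lborel \<partial>lborel)"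
    by (intro nn_integral_cong swap_tm) measurable
  also have "\<dots> =
      (\<integral>\<^sup>+s'. \<integral>\<^sup>+s. \<integral>\<^sup>+y. \<integral>\<^sup>+w. A s' x w * B (s - s') w y * D (t - s) y z \<partial>m \<partial>m \<partial>lborel \<partial>lborel)"
    by (rule swap_tt) measurable
  also have "\<dots> =
      (\<integral>\<^sup>+s'. \<integral>\<^sup>+s. \<integral>\<^sup>+w. \<integral>\<^sup>+y. A s' x w * B (s - s') w y * D (t - s) y z \<partial>m \<partial>m \<partial>lborel \<partial>lborel)"
    by (intro nn_integral_cong swap_mm) measurable
  also have "\<dots> =
      (\<integral>\<^sup>+s'. \<integral>\<^sup>+w. \<integral>\<^sup>+s. \<integral>\<^sup>+y. A s' x w * B (s - s') w y * D (t - s) y z \<partial>m \<partial>lborel \<partial>m \<partial>lborel)"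
    by (intro nn_integral_cong swap_tm[symmetric]) measurable
  also have "\<dots> = (\<integral>\<^sup>+s'. \<integral>\<^sup>+w. A s' x w *
      (\<integral>\<^sup>+s. \<integral>\<^sup>+y. B (s - s') w y * D (t - s) y z \<partial>m \<partial>lborel) \<partial>m \<partial>lborel)"
    by (simp add: nn_integral_cmult mult.assoc)
  also have "\<dots> = (\<integral>\<^sup>+s'. \<integral>\<^sup>+w. A s' x w * (B \<star> D) (t - s') w z \<partial>m \<partial>lborel)"
  proof (intro nn_integral_cong arg_cong2[where f="(*)"] refl)
    fix s' w
    show "(\<integral>\<^sup>+s. \<integral>\<^sup>+y. B (s - s') w y * D (t - s) y z \<partial>m \<partial>lborel) = (B \<star> D) (t - s') w z"
      unfolding stc_def
      by (subst nn_integral_shift[where c=s', symmetric]) (simp_all add: algebra_simps)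
  qed
  finally show "((A \<star> B) \<star> D) t x z = (A \<star> (B \<star> D)) t x z"
    by (simp add: stc_def)
qed

lemma kmul_stc:
  assumes b: "sp_kernel b" and A: "st_kernel A" and B: "st_kernel B"
  shows "b \<bullet>\<^sub>k (A \<star> B) = (b \<bullet>\<^sub>k A) \<star> B"
proof (intro ext)
  fix t x z
  note [measurable (raw)] = st_kernel_measurable[OF A] st_kernel_measurable[OF B]
    sp_kernel_measurable[OF b]
  have "(b \<bullet>\<^sub>k (A \<star> B)) t x z =
      (\<integral>\<^sup>+w. \<integral>\<^sup>+s. \<integral>\<^sup>+y. b x w * (A s w y * B (t - s) y z) \<partial>m \<partial>lborel \<partial>m)"
    by (simp add: stc_def kmul_def nn_integral_cmult)
  also have "\<dots> = (\<integral>\<^sup>+s. \<integral>\<^sup>+w. \<integral>\<^sup>+y. b x w * (A s w y * B (t - s) y z) \<partial>m \<partial>m \<partial>lborel)"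
    by (rule swap_tm) measurable
  also have "\<dots> = (\<integral>\<^sup>+s. \<integral>\<^sup>+y. \<integral>\<^sup>+w. b x w * (A s w y * B (t - s) y z) \<partial>m \<partial>m \<partial>lborel)"
    by (intro nn_integral_cong swap_mm) measurable
  also have "\<dots> = ((b \<bullet>\<^sub>k A) \<star> B) t x z"
    by (simp add: stc_def kmul_def nn_integral_multc mult.assoc[symmetric])
  finally show "(b \<bullet>\<^sub>k (A \<star> B)) t x z = ((b \<bullet>\<^sub>k A) \<star> B) t x z" .
qed

lemma stc_add_right:
  assumes A: "st_kernel A" and B: "st_kernel B" and D: "st_kernel D"
  shows "(A \<star> (\<lambda>t x y. B t x y + D t x y)) t x z = (A \<star> B) t x z + (A \<star> D) t x z"
proof -
  note [measurable (raw)] = st_kernel_measurable[OF A] st_kernel_measurable[OF B]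
    st_kernel_measurable[OF D]
  show ?thesis by (simp add: stc_def distrib_left nn_integral_add)
qed

lemma stc_add_left:
  assumes A: "st_kernel A" and B: "st_kernel B" and D: "st_kernel D"
  shows "((\<lambda>t x y. A t x y + B t x y) \<star> D) t x z = (A \<star> D) t x z + (B \<star> D) t x z"
proof -
  note [measurable (raw)] = st_kernel_measurable[OF A] st_kernel_measurable[OF B]
    st_kernel_measurable[OF D]
  show ?thesis by (simp add: stc_def distrib_right nn_integral_add)
qed

lemma stc_suminf_right:
  assumes A: "st_kernel A" and B: "\<And>i. st_kernel (B i)"
  shows "(A \<star> (\<lambda>t x y. \<Sum>i. B i t x y)) t x z = (\<Sum>i. (A \<star> B i) t x z)"
proof -
  note [measurable (raw)] = st_kernel_measurable[OF A] st_kernel_measurable[OF B]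
  show ?thesis by (simp add: stc_def nn_integral_suminf flip: ennreal_suminf_cmult)
qed

lemma stc_suminf_left:
  assumes A: "\<And>i. st_kernel (A i)" and B: "st_kernel B"
  shows "((\<lambda>t x y. \<Sum>i. A i t x y) \<star> B) t x z = (\<Sum>i. (A i \<star> B) t x z)"
proof -
  note [measurable (raw)] = st_kernel_measurable[OF A] st_kernel_measurable[OF B]
  show ?thesis by (simp add: stc_def nn_integral_suminf flip: ennreal_suminf_multc)
qed

lemma kmul_add_right:
  assumes b: "sp_kernel b" and B: "st_kernel B" and D: "st_kernel D"
  shows "(b \<bullet>\<^sub>k (\<lambda>t x y. B t x y + D t x y)) t x z = (b \<bullet>\<^sub>k B) t x z + (b \<bullet>\<^sub>k D) t x z"
proof -
  note [measurable (raw)] = sp_kernel_measurable[OF b] st_kernel_measurable[OF B]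
    st_kernel_measurable[OF D]
  show ?thesis by (simp add: kmul_def distrib_left nn_integral_add)
qed

lemma kmul_add_left:
  assumes b: "sp_kernel b" and c: "sp_kernel c" and D: "st_kernel D"
  shows "((\<lambda>x y. b x y + c x y) \<bullet>\<^sub>k D) t x z = (b \<bullet>\<^sub>k D) t x z + (c \<bullet>\<^sub>k D) t x z"
proof -
  note [measurable (raw)] = sp_kernel_measurable[OF b] sp_kernel_measurable[OF c]
    st_kernel_measurable[OF D]
  show ?thesis by (simp add: kmul_def distrib_right nn_integral_add)
qed

lemma kmul_suminf_right:
  assumes b: "sp_kernel b" and B: "\<And>i. st_kernel (B i)"
  shows "(b \<bullet>\<^sub>k (\<lambda>t x y. \<Sum>i. B i t x y)) t x z = (\<Sum>i. (b \<bullet>\<^sub>k B i) t x z)"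
proof -
  note [measurable (raw)] = sp_kernel_measurable[OF b] st_kernel_measurable[OF B]
  show ?thesis by (simp add: kmul_def nn_integral_suminf flip: ennreal_suminf_cmult)
qed

lemma kmul_suminf_left:
  assumes b: "\<And>i. sp_kernel (b i)" and B: "st_kernel B"
  shows "((\<lambda>x y. \<Sum>i. b i x y) \<bullet>\<^sub>k B) t x z = (\<Sum>i. (b i \<bullet>\<^sub>k B) t x z)"
proof -
  note [measurable (raw)] = sp_kernel_measurable[OF b] st_kernel_measurable[OF B]
  show ?thesis by (simp add: kmul_def nn_integral_suminf flip: ennreal_suminf_multc)
qed

text \<open>The integrand vanishes unless \<open>s\<close> and \<open>t - s\<close> are both
  positive, so estimates are required for times in (0, t) only. This lets bounds valid up to
  \<open>t0\<close> pass through a convolution.\<close>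

lemma stc_mono_strong:
  assumes A: "st_kernel A" and B: "st_kernel B"
    and "\<And>s x y. 0 < s \<Longrightarrow> s < t \<Longrightarrow> A s x y \<le> A' s x y"
    and "\<And>s x y. 0 < s \<Longrightarrow> s < t \<Longrightarrow> B s x y \<le> B' s x y"
  shows "(A \<star> B) t x z \<le> (A' \<star> B') t x z"
  unfolding stc_def
proof (intro nn_integral_mono)
  fix s y
  show "A s x y * B (t - s) y z \<le> A' s x y * B' (t - s) y z"
    using st_kernel_0[OF A, of s x y] st_kernel_0[OF B, of "t - s" y z] assms(3)[of s x y]
      assms(4)[of "t - s" y z]
    by (cases "s \<le> 0"; cases "t - s \<le> 0") (auto intro: mult_mono)
qed

lemma stc_cong_strong:
  assumes "st_kernel A" "st_kernel B" "st_kernel A'" "st_kernel B'"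
    and "\<And>s x y. 0 < s \<Longrightarrow> s < t \<Longrightarrow> A s x y = A' s x y"
    and "\<And>s x y. 0 < s \<Longrightarrow> s < t \<Longrightarrow> B s x y = B' s x y"
  shows "(A \<star> B) t x z = (A' \<star> B') t x z"
  using assms by (intro antisym stc_mono_strong) auto

lemma kmul_mono:
  assumes "\<And>x y. b x y \<le> b' x y" "\<And>x y. B t x y \<le> B' t x y"
  shows "(b \<bullet>\<^sub>k B) t x z \<le> (b' \<bullet>\<^sub>k B') t x z"
  unfolding kmul_def by (intro nn_integral_mono mult_mono assms) auto

lemma kmul_cong:
  assumes "\<And>x y. B t x y = B' t x y"
  shows "(b \<bullet>\<^sub>k B) t x z = (b \<bullet>\<^sub>k B') t x z"
  unfolding kmul_def by (simp add: assms)

primrec pert :: "('a \<Rightarrow> 'a \<Rightarrow> ennreal) \<Rightarrow> (real \<Rightarrow> 'a \<Rightarrow> 'a \<Rightarrow> ennreal) \<Rightarrow> nat \<Rightarrow>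
    real \<Rightarrow> 'a \<Rightarrow> 'a \<Rightarrow> ennreal" where
  "pert b p 0 = p"
| "pert b p (Suc k) = p \<star> (b \<bullet>\<^sub>k pert b p k)"

lemma st_kernel_pert: "sp_kernel b \<Longrightarrow> st_kernel p \<Longrightarrow> st_kernel (pert b p k)"
  by (induction k) (auto intro: kernel_intros)

text \<open>The recursion inserts the new jump at the first place; associativity allows inserting it
  at the last instead, which is the form behind \<open>part_right\<close>.\<close>

lemma pert_Suc_right:
  assumes b: "sp_kernel b" and p: "st_kernel p"
  shows "pert b p (Suc k) = pert b p k \<star> (b \<bullet>\<^sub>k p)"
proof (induction k)
  case (Suc k)
  note k = st_kernel_pert[OF b p, of k] st_kernel_kmul[OF b st_kernel_pert[OF b p, of k]]
    st_kernel_kmul[OF b p]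
  have "pert b p (Suc (Suc k)) = p \<star> (b \<bullet>\<^sub>k (pert b p k \<star> (b \<bullet>\<^sub>k p)))"
    using Suc by simp
  also have "\<dots> = (p \<star> (b \<bullet>\<^sub>k pert b p k)) \<star> (b \<bullet>\<^sub>k p)"
    using k p b by (simp add: kmul_stc stc_assoc)
  finally show ?case by simp
qed simp

end

section \<open>Perturbation series of a stable heat kernel\<close>

lemma stable_bound_pos:
  fixes x y :: "'a::euclidean_space"
  assumes "0 < t"
  shows "0 < stable_bound \<alpha> t x y"
  using assms by (auto simp: stable_bound_def min_def)

lemma stable_bound_commute: "stable_bound \<alpha> t x y = stable_bound \<alpha> t y x"
  by (simp add: stable_bound_def norm_minus_commute)

text \<open>The minimum of an on-diagonal and an off-diagonal value, the two regimes that the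
  estimates treat separately. The exponents match because (d + \<alpha>) / \<alpha> - d / \<alpha> =
  1.\<close>

lemma stable_bound_cases:
  fixes x y :: "'a::euclidean_space"
  assumes t: "0 < t" and a: "0 < \<alpha>"
  shows "stable_bound \<alpha> t x y =
    (if x = y then t powr (- real DIM('a) / \<alpha>)
     else min (t powr (- real DIM('a) / \<alpha>)) (t / norm (x - y) powr (real DIM('a) + \<alpha>)))"
proof (cases "x = y")
  case False
  define d where "d = real DIM('a)"
  define r where "r = norm (x - y)"
  have r: "r > 0" and d: "d > 0" using False by (auto simp: r_def d_def)
  have eq: "t powr (- d / \<alpha>) * (t powr (1 / \<alpha>) / r) powr (d + \<alpha>) = t / r powr (d + \<alpha>)"
  proof -
    have "t powr (- d / \<alpha>) * t powr ((1 / \<alpha>) * (d + \<alpha>)) = t powr 1"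
      unfolding powr_add[symmetric] using a by (intro arg_cong2[where f="(powr)"]) (auto simp: field_simps)
    then show ?thesis
      using t r by (simp add: powr_divide powr_powr)
  qed
  have "t powr (- d / \<alpha>) * min 1 (t powr (1 / \<alpha>) / r) powr (d + \<alpha>) =
      min (t powr (- d / \<alpha>)) (t powr (- d / \<alpha>) * (t powr (1 / \<alpha>) / r) powr (d + \<alpha>))"
  proof (cases "1 \<le> t powr (1 / \<alpha>) / r")
    case True
    then have "1 \<le> (t powr (1 / \<alpha>) / r) powr (d + \<alpha>)" using a d by (intro ge_one_powr_ge_zero) auto
    then have "t powr (- d / \<alpha>) * 1 \<le> t powr (- d / \<alpha>) * (t powr (1 / \<alpha>) / r) powr (d + \<alpha>)"
      by (intro mult_left_mono) auto
    then show ?thesis using True by (auto simp: min_def)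
  next
    case F: False
    then have "(t powr (1 / \<alpha>) / r) powr (d + \<alpha>) \<le> 1" using a d r by (intro powr_le1) auto
    then have "t powr (- d / \<alpha>) * (t powr (1 / \<alpha>) / r) powr (d + \<alpha>) \<le> t powr (- d / \<alpha>) * 1"
      by (intro mult_left_mono) auto
    then show ?thesis using F by (auto simp: min_def)
  qed
  then show ?thesis
    using False unfolding eq by (simp add: stable_bound_def d_def r_def)
qed (simp add: stable_bound_def)

lemma stable_bound_le_diag:
  fixes x y :: "'a::euclidean_space"
  assumes "0 < t" "0 < \<alpha>"
  shows "stable_bound \<alpha> t x y \<le> t powr (- real DIM('a) / \<alpha>)"
  using stable_bound_cases[OF assms, of x y] by (auto split: if_splits)

lemma stable_bound_le_off:
  fixes x y :: "'a::euclidean_space"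
  assumes "0 < t" "0 < \<alpha>" "x \<noteq> y"
  shows "stable_bound \<alpha> t x y \<le> t / norm (x - y) powr (real DIM('a) + \<alpha>)"
  using stable_bound_cases[OF assms(1,2), of x y] assms(3) by (auto split: if_splits)

lemma stable_boundI:
  fixes x y :: "'a::euclidean_space"
  assumes "0 < t" "0 < \<alpha>" "c \<le> t powr (- real DIM('a) / \<alpha>)"
    "x \<noteq> y \<Longrightarrow> c \<le> t / norm (x - y) powr (real DIM('a) + \<alpha>)"
  shows "c \<le> stable_bound \<alpha> t x y"
  using stable_bound_cases[OF assms(1,2), of x y] assms(3,4) by (auto split: if_splits)

text \<open>The on-diagonal value decreases in time and the off-diagonal one is linear in it, so the
  time ratio is the only loss. A ratio of 4 covers windows such as [t / 2, 2 t].\<close>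

lemma stable_bound_time:
  fixes x y :: "'a::euclidean_space"
  assumes s: "0 < s'" "s' \<le> s" "s \<le> 4 * s'" and a: "0 < \<alpha>"
  shows "stable_bound \<alpha> s x y \<le> 4 * stable_bound \<alpha> s' x y"
proof -
  have "stable_bound \<alpha> s x y / 4 \<le> stable_bound \<alpha> s' x y"
  proof (rule stable_boundI[OF s(1) a])
    have "stable_bound \<alpha> s x y \<le> s powr (- real DIM('a) / \<alpha>)"
      using s a by (intro stable_bound_le_diag) auto
    also have "\<dots> \<le> s' powr (- real DIM('a) / \<alpha>)"
      using s a by (intro powr_mono2') auto
    finally have "stable_bound \<alpha> s x y \<le> s' powr (- real DIM('a) / \<alpha>)" .
    then show "stable_bound \<alpha> s x y / 4 \<le> s' powr (- real DIM('a) / \<alpha>)"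
      using stable_bound_pos[of s \<alpha> x y] s by linarith
    assume "x \<noteq> y"
    then have "stable_bound \<alpha> s x y \<le> s / norm (x - y) powr (real DIM('a) + \<alpha>)"
      using s a by (intro stable_bound_le_off) auto
    also have "\<dots> \<le> (4 * s') / norm (x - y) powr (real DIM('a) + \<alpha>)"
      using s by (intro divide_right_mono) auto
    finally show "stable_bound \<alpha> s x y / 4 \<le> s' / norm (x - y) powr (real DIM('a) + \<alpha>)"
      by (simp add: mult.commute)
  qed
  then show ?thesis by simp
qed

section \<open>Heat kernels with two-sided stable bounds\<close>

locale heat_kernel = base_measure m for m :: "'a::euclidean_space measure" +
  fixes \<alpha> M1 M2 :: real and p :: "real \<Rightarrow> 'a \<Rightarrow> 'a \<Rightarrow> ennreal"
  assumes alpha: "0 < \<alpha>" and M12: "0 < M1" "0 < M2"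
    and p_kernel: "st_kernel p"
    and p_lower: "\<And>t x y. 0 < t \<Longrightarrow> ennreal (M1 * stable_bound \<alpha> t x y) \<le> p t x y"
    and p_upper: "\<And>t x y. 0 < t \<Longrightarrow> p t x y \<le> ennreal (M2 * stable_bound \<alpha> t x y)"
    and p_mass: "\<And>t x. (\<integral>\<^sup>+y. p t x y \<partial>m) \<le> 1"
    and p_CK: "\<And>s t x z. 0 < s \<Longrightarrow> 0 < t \<Longrightarrow> (\<integral>\<^sup>+y. p s x y * p t y z \<partial>m) = p (s + t) x z"
    and p_cont: "\<And>t x y (f :: nat \<Rightarrow> real). 0 < t \<Longrightarrow> f \<longlonglongrightarrow> t \<Longrightarrow> (\<lambda>n. p (f n) x y) \<longlonglongrightarrow> p t x y"
begin

definition jexp :: real where "jexp = real DIM('a) + \<alpha>"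

lemma jexp_pos: "0 < jexp"
  using alpha by (simp add: jexp_def add_nonneg_pos)

lemma p_comparable:
  assumes "0 < s'" "s' \<le> s" "s \<le> 4 * s'"
  shows "p s x y \<le> ennreal (4 * M2 / M1) * p s' x y"
proof -
  have "p s x y \<le> ennreal (M2 * stable_bound \<alpha> s x y)"
    using assms by (intro p_upper) auto
  also have "\<dots> \<le> ennreal (4 * M2 / M1 * (M1 * stable_bound \<alpha> s' x y))"
    using stable_bound_time[OF assms alpha, of x y] M12 by (intro ennreal_leI) simp
  also have "\<dots> = ennreal (4 * M2 / M1) * ennreal (M1 * stable_bound \<alpha> s' x y)"
    using M12 stable_bound_pos[OF assms(1), of \<alpha> x y] by (intro ennreal_mult) auto
  also have "\<dots> \<le> ennreal (4 * M2 / M1) * p s' x y"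
    using assms by (intro mult_left_mono p_lower) auto
  finally show ?thesis .
qed

text \<open>\<open>p\<close> is not symmetric but its two-sided bound is; this replaces symmetry, at
  the price \<open>M2 / M1\<close>, when a mass over the first variable is needed.\<close>

lemma p_commute_le:
  assumes "0 < t"
  shows "p t x y \<le> ennreal (M2 / M1) * p t y x"
proof -
  have "p t x y \<le> ennreal (M2 * stable_bound \<alpha> t x y)"
    using assms by (intro p_upper) auto
  also have "\<dots> = ennreal (M2 / M1 * (M1 * stable_bound \<alpha> t y x))"
    using M12 by (simp add: stable_bound_commute)
  also have "\<dots> = ennreal (M2 / M1) * ennreal (M1 * stable_bound \<alpha> t y x)"
    using M12 stable_bound_pos[OF assms(1), of \<alpha> y x] by (intro ennreal_mult) auto
  also have "\<dots> \<le> ennreal (M2 / M1) * p t y x"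
    using assms by (intro mult_left_mono p_lower) auto
  finally show ?thesis .
qed

lemmas p_measurable = st_kernel_measurable[OF p_kernel]

lemma p_mass_left: "(\<integral>\<^sup>+x. p t x y \<partial>m) \<le> ennreal (M2 / M1)"
proof (cases "0 < t")
  case True
  note [measurable (raw)] = p_measurable
  have "(\<integral>\<^sup>+x. p t x y \<partial>m) \<le> (\<integral>\<^sup>+x. ennreal (M2 / M1) * p t y x \<partial>m)"
    by (intro nn_integral_mono p_commute_le True)
  also have "\<dots> = ennreal (M2 / M1) * (\<integral>\<^sup>+x. p t y x \<partial>m)"
    by (rule nn_integral_cmult) measurable
  also have "\<dots> \<le> ennreal (M2 / M1) * 1"
    by (intro mult_left_mono p_mass) auto
  finally show ?thesis by simp
qed (simp add: st_kernel_0[OF p_kernel])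

lemma p_diag: "0 < t \<Longrightarrow> p t x y \<le> ennreal (M2 * t powr (- real DIM('a) / \<alpha>))"
  using stable_bound_le_diag[of t \<alpha> x y] alpha M12 p_upper[of t x y]
  by (meson ennreal_leI mult_left_mono order_trans less_imp_le)

lemma p_off: "0 < t \<Longrightarrow> x \<noteq> y \<Longrightarrow> p t x y \<le> ennreal (M2 * (t / norm (x - y) powr jexp))"
  using stable_bound_le_off[of t \<alpha> x y] alpha M12 p_upper[of t x y]
  unfolding jexp_def by (meson ennreal_leI mult_left_mono order_trans less_imp_le)

lemma p_finite: "p t x y < \<top>"
  using p_upper[of t x y] st_kernel_0[OF p_kernel, of t x y]
  by (cases "0 < t") (auto intro: order_le_less_trans ennreal_less_top)

lemma p_pos: "0 < t \<Longrightarrow> 0 < p t x y"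
  using M12 stable_bound_pos[of t \<alpha> x y] by (intro less_le_trans[OF _ p_lower]) auto

end

text \<open>\<open>\<kappa>1\<close> bounds the mass of one jump integrated over (0, t0], for paths
  starting at a given point and for paths ending at one. The factor 2 * 2 powr (d / \<alpha>)
  separating it from the decay rate \<open>\<kappa>\<close> covers the losses of a pointwise
  estimate: 2 powr (d / \<alpha>) near the diagonal, 2 away from it.\<close>

locale jump_kernel = heat_kernel m \<alpha> M1 M2 p
  for m :: "'a::euclidean_space measure" and \<alpha> M1 M2 p +
  fixes h :: "'a \<Rightarrow> 'a \<Rightarrow> ennreal" and t0 ch \<kappa>1 \<kappa> :: real
  assumes t0: "0 < t0" and ch: "0 \<le> ch" and h_kernel: "sp_kernel h"
    and h_bound: "\<And>w y. h w y \<le> ennreal (ch / norm (w - y) powr jexp)"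
    and \<kappa>: "0 \<le> \<kappa>1" "0 < \<kappa>" "\<kappa> < 1" "\<kappa>1 * 2 powr (1 + real DIM('a) / \<alpha>) \<le> \<kappa>"
    and mass_right: "\<And>x. (\<integral>\<^sup>+s\<in>{0<..t0}. (\<integral>\<^sup>+w. p s x w * (\<integral>\<^sup>+y. h w y \<partial>m) \<partial>m) \<partial>lborel) \<le> ennreal \<kappa>1"
    and mass_left: "\<And>z. (\<integral>\<^sup>+s\<in>{0<..t0}. (\<integral>\<^sup>+w. (h \<bullet>\<^sub>k p) s w z \<partial>m) \<partial>lborel) \<le> ennreal \<kappa>1"
begin

lemmas h_measurable = sp_kernel_measurable[OF h_kernel]

lemma \<kappa>1_le: "2 * \<kappa>1 \<le> \<kappa>" "2 * (\<kappa>1 * 2 powr (real DIM('a) / \<alpha>)) \<le> \<kappa>"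
proof -
  have "2 powr (1 + real DIM('a) / \<alpha>) = 2 * 2 powr (real DIM('a) / \<alpha>)"
    by (simp add: powr_add)
  then show 2: "2 * (\<kappa>1 * 2 powr (real DIM('a) / \<alpha>)) \<le> \<kappa>" using \<kappa>(4) by simp
  have "1 \<le> 2 powr (real DIM('a) / \<alpha>)" using alpha by (intro ge_one_powr_ge_zero) auto
  then have "\<kappa>1 * 1 \<le> \<kappa>1 * 2 powr (real DIM('a) / \<alpha>)" using \<kappa>(1) by (intro mult_left_mono)
  then show "2 * \<kappa>1 \<le> \<kappa>" using 2 by simp
qed

section \<open>Masses and pointwise bound of one perturbation step\<close>

lemma kmul_finite_time_mass:
  assumes X: "st_kernel X" and nu: "\<And>z. (\<integral>\<^sup>+s\<in>{0<..t0}. (\<integral>\<^sup>+w. (h \<bullet>\<^sub>k X) s w z \<partial>m) \<partial>lborel) \<le> \<nu>"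
    and t: "t \<le> t0"
  shows "(\<integral>\<^sup>+s. (\<integral>\<^sup>+w. (h \<bullet>\<^sub>k X) (t - s) w z \<partial>m) * indicator {0<..} s \<partial>lborel) \<le> \<nu>"
proof -
  note [measurable (raw)] = st_kernel_measurable[OF st_kernel_kmul[OF h_kernel X]]
  have "(\<integral>\<^sup>+s. (\<integral>\<^sup>+w. (h \<bullet>\<^sub>k X) (t - s) w z \<partial>m) * indicator {0<..} s \<partial>lborel) =
     (\<integral>\<^sup>+s. (\<integral>\<^sup>+w. (h \<bullet>\<^sub>k X) (t - (t - s)) w z \<partial>m) * indicator {0<..} (t - s) \<partial>lborel)"
    by (rule nn_integral_reflect[symmetric]) measurable
  also have "\<dots> \<le> (\<integral>\<^sup>+s\<in>{0<..t0}. (\<integral>\<^sup>+w. (h \<bullet>\<^sub>k X) s w z \<partial>m) \<partial>lborel)"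
    using t st_kernel_0[OF st_kernel_kmul[OF h_kernel X]]
    by (intro nn_integral_mono) (auto split: split_indicator simp: not_less)
  finally show ?thesis using nu[of z] by (rule order_trans)
qed

lemma step_mass:
  assumes X: "st_kernel X" and nu: "\<And>z. (\<integral>\<^sup>+s\<in>{0<..t0}. (\<integral>\<^sup>+w. (h \<bullet>\<^sub>k X) s w z \<partial>m) \<partial>lborel) \<le> \<nu>"
    and t: "t \<le> t0"
  shows "(\<integral>\<^sup>+x. (p \<star> (h \<bullet>\<^sub>k X)) t x z \<partial>m) \<le> ennreal (M2 / M1) * \<nu>"
proof -
  note hX = st_kernel_kmul[OF h_kernel X]
  note [measurable (raw)] = p_measurable st_kernel_measurable[OF hX]
  have "(\<integral>\<^sup>+x. (p \<star> (h \<bullet>\<^sub>k X)) t x z \<partial>m) =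
      (\<integral>\<^sup>+s. \<integral>\<^sup>+x. \<integral>\<^sup>+w. p s x w * (h \<bullet>\<^sub>k X) (t - s) w z \<partial>m \<partial>m \<partial>lborel)"
    unfolding stc_def by (rule swap_tm) measurable
  also have "\<dots> = (\<integral>\<^sup>+s. \<integral>\<^sup>+w. \<integral>\<^sup>+x. p s x w * (h \<bullet>\<^sub>k X) (t - s) w z \<partial>m \<partial>m \<partial>lborel)"
    by (intro nn_integral_cong swap_mm) measurable
  also have "\<dots> = (\<integral>\<^sup>+s. \<integral>\<^sup>+w. (\<integral>\<^sup>+x. p s x w \<partial>m) * (h \<bullet>\<^sub>k X) (t - s) w z \<partial>m \<partial>lborel)"
    by (simp add: nn_integral_multc)
  also have "\<dots> \<le> (\<integral>\<^sup>+s. \<integral>\<^sup>+w. (ennreal (M2 / M1) * indicator {0<..} s) * (h \<bullet>\<^sub>k X) (t - s) w z \<partial>m \<partial>lborel)"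
    by (intro nn_integral_mono mult_right_mono)
      (auto split: split_indicator simp: p_mass_left st_kernel_0[OF p_kernel] not_less)
  also have "\<dots> = (\<integral>\<^sup>+s. ennreal (M2 / M1) * ((\<integral>\<^sup>+w. (h \<bullet>\<^sub>k X) (t - s) w z \<partial>m) * indicator {0<..} s) \<partial>lborel)"
    by (simp add: nn_integral_cmult mult_ac)
  also have "\<dots> = ennreal (M2 / M1) * (\<integral>\<^sup>+s. ((\<integral>\<^sup>+w. (h \<bullet>\<^sub>k X) (t - s) w z \<partial>m) * indicator {0<..} s) \<partial>lborel)"
    by (rule nn_integral_cmult) measurable
  also have "\<dots> \<le> ennreal (M2 / M1) * \<nu>"
    by (intro mult_left_mono kmul_finite_time_mass[OF X nu t]) auto
  finally show ?thesis .
qed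

text \<open>After Tonelli, shifting \<open>t\<close> by \<open>s\<close> and enlarging the triangle
  of times to the square of side \<open>t0\<close> decouples the two time integrals:
  \<open>mass_left\<close> bounds the new jump and \<open>\<nu>\<close> the old ones.\<close>

lemma step_jump_mass:
  assumes X: "st_kernel X" and nu: "\<And>z. (\<integral>\<^sup>+s\<in>{0<..t0}. (\<integral>\<^sup>+w. (h \<bullet>\<^sub>k X) s w z \<partial>m) \<partial>lborel) \<le> \<nu>"
  shows "(\<integral>\<^sup>+s\<in>{0<..t0}. (\<integral>\<^sup>+w. (h \<bullet>\<^sub>k (p \<star> (h \<bullet>\<^sub>k X))) s w z \<partial>m) \<partial>lborel) \<le> ennreal \<kappa>1 * \<nu>"
proof -
  note hX = st_kernel_kmul[OF h_kernel X] and hp = st_kernel_kmul[OF h_kernel p_kernel]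
  note [measurable (raw)] = st_kernel_measurable[OF hX] st_kernel_measurable[OF hp]
  let ?V = "h \<bullet>\<^sub>k X" and ?P = "h \<bullet>\<^sub>k p"
  have "(\<integral>\<^sup>+t\<in>{0<..t0}. (\<integral>\<^sup>+w. (h \<bullet>\<^sub>k (p \<star> ?V)) t w z \<partial>m) \<partial>lborel) =
    (\<integral>\<^sup>+t. (\<integral>\<^sup>+w. \<integral>\<^sup>+s. \<integral>\<^sup>+w'. ?P s w w' * ?V (t - s) w' z * indicator {0<..t0} t \<partial>m \<partial>lborel \<partial>m) \<partial>lborel)"
    by (simp add: kmul_stc[OF h_kernel p_kernel hX] stc_def nn_integral_multc)
  also have "\<dots> = (\<integral>\<^sup>+t. (\<integral>\<^sup>+s. \<integral>\<^sup>+w. \<integral>\<^sup>+w'. ?P s w w' * ?V (t - s) w' z * indicator {0<..t0} t \<partial>m \<partial>m \<partial>lborel) \<partial>lborel)"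
    by (intro nn_integral_cong swap_tm) measurable
  also have "\<dots> = (\<integral>\<^sup>+t. (\<integral>\<^sup>+s. \<integral>\<^sup>+w'. \<integral>\<^sup>+w. ?P s w w' * ?V (t - s) w' z * indicator {0<..t0} t \<partial>m \<partial>m \<partial>lborel) \<partial>lborel)"
    by (intro nn_integral_cong swap_mm) measurable
  also have "\<dots> = (\<integral>\<^sup>+s. (\<integral>\<^sup>+t. \<integral>\<^sup>+w'. \<integral>\<^sup>+w. ?P s w w' * ?V (t - s) w' z * indicator {0<..t0} t \<partial>m \<partial>m \<partial>lborel) \<partial>lborel)"
    by (rule swap_tt) measurable
  also have "\<dots> = (\<integral>\<^sup>+s. (\<integral>\<^sup>+w'. \<integral>\<^sup>+t. \<integral>\<^sup>+w. ?P s w w' * ?V (t - s) w' z * indicator {0<..t0} t \<partial>m \<partial>lborel \<partial>m) \<partial>lborel)"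
    by (intro nn_integral_cong swap_tm[symmetric]) measurable
  also have "\<dots> = (\<integral>\<^sup>+w'. (\<integral>\<^sup>+s. \<integral>\<^sup>+t. \<integral>\<^sup>+w. ?P s w w' * ?V (t - s) w' z * indicator {0<..t0} t \<partial>m \<partial>lborel \<partial>lborel) \<partial>m)"
    by (rule swap_tm[symmetric]) measurable
  also have "\<dots> = (\<integral>\<^sup>+w'. (\<integral>\<^sup>+s. (\<integral>\<^sup>+w. ?P s w w' \<partial>m) * (\<integral>\<^sup>+t. ?V (t - s) w' z * indicator {0<..t0} t \<partial>lborel) \<partial>lborel) \<partial>m)"
    by (simp add: nn_integral_multc nn_integral_cmult mult.assoc)
  also have "\<dots> \<le> (\<integral>\<^sup>+w'. (\<integral>\<^sup>+s. ((\<integral>\<^sup>+w. ?P s w w' \<partial>m) * indicator {0<..t0} s) * (\<integral>\<^sup>+t. ?V t w' z * indicator {0<..t0} t \<partial>lborel) \<partial>lborel) \<partial>m)"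
  proof (intro nn_integral_mono)
    fix w' s
    show "(\<integral>\<^sup>+w. ?P s w w' \<partial>m) * (\<integral>\<^sup>+t. ?V (t - s) w' z * indicator {0<..t0} t \<partial>lborel) \<le>
      ((\<integral>\<^sup>+w. ?P s w w' \<partial>m) * indicator {0<..t0} s) * (\<integral>\<^sup>+t. ?V t w' z * indicator {0<..t0} t \<partial>lborel)"
    proof (cases "s \<in> {0<..t0}")
      case True
      have "(\<integral>\<^sup>+t. ?V (t - s) w' z * indicator {0<..t0} t \<partial>lborel) = (\<integral>\<^sup>+t. ?V (t + s - s) w' z * indicator {0<..t0} (t + s) \<partial>lborel)"
        by (rule nn_integral_shift[symmetric]) measurable
      also have "\<dots> \<le> (\<integral>\<^sup>+t. ?V t w' z * indicator {0<..t0} t \<partial>lborel)"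
        using True st_kernel_0[OF hX] by (intro nn_integral_mono) (auto split: split_indicator simp: not_less)
      finally show ?thesis using True by (auto intro: mult_left_mono)
    next
      case False
      then have "(\<integral>\<^sup>+w. ?P s w w' \<partial>m) * (\<integral>\<^sup>+t. ?V (t - s) w' z * indicator {0<..t0} t \<partial>lborel) = 0"
      proof (cases "s \<le> 0")
        case True then show ?thesis by (simp add: st_kernel_0[OF hp])
      next
        case s: False
        have "?V (t - s) w' z * indicator {0<..t0} t = 0" for t
          using s False st_kernel_0[OF hX, of "t - s" w' z] by (cases "t \<le> s") auto
        then have "(\<integral>\<^sup>+t. ?V (t - s) w' z * indicator {0<..t0} t \<partial>lborel) = 0" by (simp only:) simp
        then show ?thesis by simp
      qed
      then show ?thesis by (simp only:) simp
    qed
  qed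
  also have "\<dots> = (\<integral>\<^sup>+w'. (\<integral>\<^sup>+s. ((\<integral>\<^sup>+w. ?P s w w' \<partial>m) * indicator {0<..t0} s) \<partial>lborel) * (\<integral>\<^sup>+t. ?V t w' z * indicator {0<..t0} t \<partial>lborel) \<partial>m)"
    by (simp add: nn_integral_multc)
  also have "\<dots> \<le> (\<integral>\<^sup>+w'. ennreal \<kappa>1 * (\<integral>\<^sup>+t. ?V t w' z * indicator {0<..t0} t \<partial>lborel) \<partial>m)"
    by (intro nn_integral_mono mult_right_mono mass_left) auto
  also have "\<dots> = ennreal \<kappa>1 * (\<integral>\<^sup>+w'. (\<integral>\<^sup>+t. ?V t w' z * indicator {0<..t0} t \<partial>lborel) \<partial>m)"
    by (rule nn_integral_cmult) measurable
  also have "(\<integral>\<^sup>+w'. (\<integral>\<^sup>+t. ?V t w' z * indicator {0<..t0} t \<partial>lborel) \<partial>m) =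
     (\<integral>\<^sup>+t. (\<integral>\<^sup>+w'. ?V t w' z * indicator {0<..t0} t \<partial>m) \<partial>lborel)"
    by (rule swap_tm) measurable
  also have "\<dots> = (\<integral>\<^sup>+t\<in>{0<..t0}. (\<integral>\<^sup>+w'. ?V t w' z \<partial>m) \<partial>lborel)"
    by (simp add: nn_integral_multc)
  also have "ennreal \<kappa>1 * (\<integral>\<^sup>+t\<in>{0<..t0}. (\<integral>\<^sup>+w'. ?V t w' z \<partial>m) \<partial>lborel) \<le> ennreal \<kappa>1 * \<nu>"
    by (intro mult_left_mono nu) auto
  finally show ?thesis .
qed

text \<open>Each summand in \<open>le\<close> omits one of the factors \<open>X\<close>,
  \<open>p\<close>, \<open>h\<close>, which the constant in front is meant to bound; the two
  remaining factors integrate to a mass.\<close>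

lemma step_split:
  fixes c1 c2 c3 :: ennreal
  assumes X: "st_kernel X" and nu: "\<And>z. (\<integral>\<^sup>+s\<in>{0<..t0}. (\<integral>\<^sup>+w. (h \<bullet>\<^sub>k X) s w z \<partial>m) \<partial>lborel) \<le> \<nu>"
    and mu: "\<And>s z. 0 < s \<Longrightarrow> s \<le> t0 \<Longrightarrow> (\<integral>\<^sup>+y. X s y z \<partial>m) \<le> \<mu>"
    and t: "0 < t" "t \<le> t0"
    and le: "\<And>s w y. 0 < s \<Longrightarrow> s < t \<Longrightarrow> p s x w * (h w y * X (t - s) y z) \<le>
      c1 * (p s x w * h w y) + c2 * (h w y * X (t - s) y z) + c3 * (p s x w * X (t - s) y z)"
  shows "(p \<star> (h \<bullet>\<^sub>k X)) t x z \<le> c1 * ennreal \<kappa>1 + c2 * \<nu> + c3 * (ennreal t * \<mu>)"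
proof -
  note [measurable (raw)] = p_measurable h_measurable st_kernel_measurable[OF X]
  let ?I = "indicator {0<..<t} :: real \<Rightarrow> ennreal"
  have "(p \<star> (h \<bullet>\<^sub>k X)) t x z = (\<integral>\<^sup>+s. \<integral>\<^sup>+w. \<integral>\<^sup>+y. p s x w * (h w y * X (t - s) y z) \<partial>m \<partial>m \<partial>lborel)"
    unfolding stc_def kmul_def by (simp add: nn_integral_cmult)
  also have "\<dots> \<le> (\<integral>\<^sup>+s. \<integral>\<^sup>+w. \<integral>\<^sup>+y. c1 * (p s x w * h w y * ?I s) + c2 * (h w y * X (t - s) y z * ?I s)
      + c3 * (p s x w * X (t - s) y z * ?I s) \<partial>m \<partial>m \<partial>lborel)"
  proof (intro nn_integral_mono)
    fix s w y
    show "p s x w * (h w y * X (t - s) y z) \<le> c1 * (p s x w * h w y * ?I s) + c2 * (h w y * X (t - s) y z * ?I s)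
      + c3 * (p s x w * X (t - s) y z * ?I s)"
    proof (cases "0 < s \<and> s < t")
      case True then show ?thesis using le[of s w y] by simp
    next
      case False
      then have "p s x w * (h w y * X (t - s) y z) = 0"
        using st_kernel_0[OF p_kernel, of s x w] st_kernel_0[OF X, of "t - s" y z] by (cases "s \<le> 0") auto
      then show ?thesis by (simp only:) simp
    qed
  qed
  also have "\<dots> = c1 * (\<integral>\<^sup>+s. \<integral>\<^sup>+w. \<integral>\<^sup>+y. p s x w * h w y * ?I s \<partial>m \<partial>m \<partial>lborel)
     + c2 * (\<integral>\<^sup>+s. \<integral>\<^sup>+w. \<integral>\<^sup>+y. h w y * X (t - s) y z * ?I s \<partial>m \<partial>m \<partial>lborel)
     + c3 * (\<integral>\<^sup>+s. \<integral>\<^sup>+w. \<integral>\<^sup>+y. p s x w * X (t - s) y z * ?I s \<partial>m \<partial>m \<partial>lborel)"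
    by (simp add: nn_integral_add nn_integral_cmult)
  also have "\<dots> \<le> c1 * ennreal \<kappa>1 + c2 * \<nu> + c3 * (ennreal t * \<mu>)"
  proof (intro add_mono mult_left_mono)
    have "(\<integral>\<^sup>+s. \<integral>\<^sup>+w. \<integral>\<^sup>+y. p s x w * h w y * ?I s \<partial>m \<partial>m \<partial>lborel) =
        (\<integral>\<^sup>+s. (\<integral>\<^sup>+w. p s x w * (\<integral>\<^sup>+y. h w y \<partial>m) \<partial>m) * ?I s \<partial>lborel)"
      by (simp add: nn_integral_cmult nn_integral_multc)
    also have "\<dots> \<le> (\<integral>\<^sup>+s\<in>{0<..t0}. (\<integral>\<^sup>+w. p s x w * (\<integral>\<^sup>+y. h w y \<partial>m) \<partial>m) \<partial>lborel)"
      using t by (intro nn_integral_mono mult_left_mono) (auto split: split_indicator)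
    finally show "(\<integral>\<^sup>+s. \<integral>\<^sup>+w. \<integral>\<^sup>+y. p s x w * h w y * ?I s \<partial>m \<partial>m \<partial>lborel) \<le> ennreal \<kappa>1"
      using mass_right[of x] by (rule order_trans)
    have "(\<integral>\<^sup>+s. \<integral>\<^sup>+w. \<integral>\<^sup>+y. h w y * X (t - s) y z * ?I s \<partial>m \<partial>m \<partial>lborel) =
      (\<integral>\<^sup>+s. (\<integral>\<^sup>+w. (h \<bullet>\<^sub>k X) (t - s) w z \<partial>m) * ?I s \<partial>lborel)"
      by (simp add: kmul_def nn_integral_multc)
    also have "\<dots> \<le> (\<integral>\<^sup>+s. (\<integral>\<^sup>+w. (h \<bullet>\<^sub>k X) (t - s) w z \<partial>m) * indicator {0<..} s \<partial>lborel)"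
      by (intro nn_integral_mono mult_left_mono) (auto split: split_indicator)
    finally show "(\<integral>\<^sup>+s. \<integral>\<^sup>+w. \<integral>\<^sup>+y. h w y * X (t - s) y z * ?I s \<partial>m \<partial>m \<partial>lborel) \<le> \<nu>"
      using kmul_finite_time_mass[OF X nu t(2)] by (rule order_trans)
    have "(\<integral>\<^sup>+s. \<integral>\<^sup>+w. \<integral>\<^sup>+y. p s x w * X (t - s) y z * ?I s \<partial>m \<partial>m \<partial>lborel) =
        (\<integral>\<^sup>+s. (\<integral>\<^sup>+w. p s x w \<partial>m) * (\<integral>\<^sup>+y. X (t - s) y z \<partial>m) * ?I s \<partial>lborel)"
      by (simp add: nn_integral_cmult nn_integral_multc)
    also have "\<dots> \<le> (\<integral>\<^sup>+s. (1 * \<mu>) * ?I s \<partial>lborel)"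
    proof (intro nn_integral_mono)
      fix s show "(\<integral>\<^sup>+w. p s x w \<partial>m) * (\<integral>\<^sup>+y. X (t - s) y z \<partial>m) * ?I s \<le> (1 * \<mu>) * ?I s"
        using t mu[of "t - s" z] p_mass[of s x] mult_mono[of "\<integral>\<^sup>+w. p s x w \<partial>m" 1 "\<integral>\<^sup>+y. X (t - s) y z \<partial>m" \<mu>]
        by (auto split: split_indicator)
    qed
    also have "\<dots> = ennreal t * \<mu>" using t by (simp add: nn_integral_cmult mult.commute)
    finally show "(\<integral>\<^sup>+s. \<integral>\<^sup>+w. \<integral>\<^sup>+y. p s x w * X (t - s) y z * ?I s \<partial>m \<partial>m \<partial>lborel) \<le> ennreal t * \<mu>" .
  qed auto
  finally show ?thesis .
qed

text \<open>Chosen so that a last leg of length at least \<open>(1 - split_ratio) * R\<close> costs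
  exactly the factor 2 in the off-diagonal bound.\<close>

definition split_ratio :: real where "split_ratio = 1 - 2 powr (- 1 / jexp)"

text \<open>Collects the coefficients of \<open>\<mu>\<close> and \<open>\<nu>\<close> in
  \<open>step_bound\<close>: the first summand comes from the diagonal estimate, the second from a
  leg of length at least \<open>split_ratio * R / 2\<close>.\<close>

definition step_const :: real where
  "step_const = 2 powr (real DIM('a) / \<alpha>) * M2 + (2 / split_ratio) powr jexp * (M2 + ch)"

lemma split_ratio: "0 < split_ratio" "split_ratio < 1" "(1 - split_ratio) powr jexp = 1 / 2"
proof -
  have "2 powr (- 1 / jexp) < 2 powr (0::real)" using jexp_pos by (intro powr_less_mono) auto
  then show "0 < split_ratio" by (simp add: split_ratio_def)
  show "split_ratio < 1" by (simp add: split_ratio_def)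
  show "(1 - split_ratio) powr jexp = 1 / 2"
  proof -
    have "(1 - split_ratio) powr jexp = 2 powr ((- 1 / jexp) * jexp)"
      unfolding split_ratio_def powr_powr[symmetric] by simp
    also have "(- 1 / jexp) * jexp = - 1" using jexp_pos by simp
    finally show ?thesis by (simp add: powr_minus)
  qed
qed

lemma step_const_nonneg: "0 \<le> step_const"
  using M12 ch split_ratio by (auto simp: step_const_def)

text \<open>At large distance \<open>R = \<bar>x - z\<bar>\<close> either one of the first two legs \<open>\<bar>x - w\<bar>\<close>, \<open>\<bar>w - y\<bar>\<close> has length of order \<open>R\<close>,
  so that this factor can be estimated by its supremum and the masses \<open>\<mu>\<close>, \<open>\<nu>\<close> bound the rest, or
  \<open>\<bar>y - z\<bar>\<close> is so close to \<open>R\<close> that the bound of \<open>X\<close> loses only a factor \<open>2\<close>, and \<open>2 * \<kappa>1 \<le> \<kappa>\<close>.\<close>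

lemma step_bound:
  assumes X: "st_kernel X" and pos: "0 \<le> \<theta>" "0 \<le> \<mu>" "0 \<le> \<nu>"
    and nu: "\<And>z. (\<integral>\<^sup>+s\<in>{0<..t0}. (\<integral>\<^sup>+w. (h \<bullet>\<^sub>k X) s w z \<partial>m) \<partial>lborel) \<le> ennreal \<nu>"
    and mu: "\<And>s z. 0 < s \<Longrightarrow> s \<le> t0 \<Longrightarrow> (\<integral>\<^sup>+y. X s y z \<partial>m) \<le> ennreal \<mu>"
    and bound: "\<And>s y z. 0 < s \<Longrightarrow> s \<le> t0 \<Longrightarrow> X s y z \<le> ennreal (\<theta> * stable_bound \<alpha> s y z)"
    and t: "0 < t" "t \<le> t0"
  shows "(p \<star> (h \<bullet>\<^sub>k X)) t x z \<le> ennreal ((\<kappa> * \<theta> + step_const * (\<mu> + \<nu>)) * stable_bound \<alpha> t x z)"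
proof -
  define d where "d = real DIM('a)"
  define V where "V = (p \<star> (h \<bullet>\<^sub>k X)) t x z"
  define c where "c = \<kappa> * \<theta> + step_const * (\<mu> + \<nu>)"
  define \<rho> where "\<rho> = (2 / split_ratio) powr jexp"
  have \<rho>: "0 < \<rho>" using split_ratio by (simp add: \<rho>_def)
  have d: "0 < d" by (simp add: d_def)
  have c: "0 \<le> c" using pos \<kappa> step_const_nonneg by (simp add: c_def)
  have Xd: "X s y z \<le> ennreal (\<theta> * s powr (- d / \<alpha>))" if "0 < s" "s \<le> t0" for s y
    using bound[OF that, of y z] stable_bound_le_diag[of s \<alpha> y z] that alpha pos unfolding d_def
    by (meson ennreal_leI mult_left_mono order_trans)
  have Xo: "X s y z \<le> ennreal (\<theta> * (s / norm (y - z) powr jexp))" if "0 < s" "s \<le> t0" "y \<noteq> z" for s y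
    using bound[OF that(1,2), of y z] stable_bound_le_off[of s \<alpha> y z] that alpha pos unfolding jexp_def
    by (meson ennreal_leI mult_left_mono order_trans)
  have diag: "V \<le> ennreal (c * t powr (- d / \<alpha>))"
  proof -
    \<comment> \<open>One of \<open>s\<close> and \<open>t - s\<close> is at least
      \<open>t / 2\<close>, and the kernel running for that time is replaced by its diagonal
      bound.\<close>
    have half: "s powr (- d / \<alpha>) \<le> 2 powr (d / \<alpha>) * t powr (- d / \<alpha>)" if "t / 2 \<le> s" for s
    proof -
      have "s powr (- d / \<alpha>) \<le> (t / 2) powr (- d / \<alpha>)"
        using that t alpha d by (intro powr_mono2') auto
      also have "\<dots> = 2 powr (d / \<alpha>) * t powr (- d / \<alpha>)"
        using t by (simp add: powr_divide powr_minus field_simps)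
      finally show ?thesis .
    qed
    let ?c1 = "\<theta> * (2 powr (d / \<alpha>) * t powr (- d / \<alpha>))" and ?c2 = "M2 * (2 powr (d / \<alpha>) * t powr (- d / \<alpha>))"
    have "V \<le> ennreal ?c1 * ennreal \<kappa>1 + ennreal ?c2 * ennreal \<nu> + 0 * (ennreal t * ennreal \<mu>)"
      unfolding V_def
    proof (rule step_split[OF X nu mu t])
      fix s w y assume s: "0 < s" "s < t"
      show "p s x w * (h w y * X (t - s) y z) \<le> ennreal ?c1 * (p s x w * h w y) +
        ennreal ?c2 * (h w y * X (t - s) y z) + 0 * (p s x w * X (t - s) y z)"
      proof (cases "s \<le> t / 2")
        case True
        have "X (t - s) y z \<le> ennreal (\<theta> * (t - s) powr (- d / \<alpha>))" using s t by (intro Xd) auto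
        also have "\<dots> \<le> ennreal ?c1" using half[of "t - s"] True pos by (intro ennreal_leI mult_left_mono) auto
        finally have "p s x w * (h w y * X (t - s) y z) \<le> p s x w * (h w y * ennreal ?c1)"
          by (intro mult_left_mono) auto
        then show ?thesis by (simp add: mult_ac add_increasing2)
      next
        case False
        have "p s x w \<le> ennreal (M2 * s powr (- d / \<alpha>))" using s unfolding d_def by (intro p_diag) auto
        also have "\<dots> \<le> ennreal ?c2" using half[of s] False M12 by (intro ennreal_leI mult_left_mono) auto
        finally have "p s x w * (h w y * X (t - s) y z) \<le> ennreal ?c2 * (h w y * X (t - s) y z)"
          by (intro mult_right_mono) auto
        then show ?thesis by (simp add: add_increasing)
      qed
    qed
    also have "\<dots> = ennreal (?c1 * \<kappa>1 + ?c2 * \<nu>)"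
      using pos M12 \<kappa> by (simp add: ennreal_mult' ennreal_plus)
    also have "\<dots> \<le> ennreal (c * t powr (- d / \<alpha>))"
    proof (rule ennreal_leI)
      have 1: "\<kappa>1 * 2 powr (d / \<alpha>) * \<theta> \<le> \<kappa> * \<theta>"
        using \<kappa>1_le(2) pos \<kappa> unfolding d_def by (intro mult_right_mono) auto
      have 2: "2 powr (d / \<alpha>) * M2 * \<nu> \<le> step_const * (\<mu> + \<nu>)"
        using pos M12 ch by (intro mult_mono) (auto simp: step_const_def d_def)
      have "?c1 * \<kappa>1 + ?c2 * \<nu> = (\<kappa>1 * 2 powr (d / \<alpha>) * \<theta> + 2 powr (d / \<alpha>) * M2 * \<nu>) * t powr (- d / \<alpha>)"
        by (simp add: algebra_simps)
      also have "\<dots> \<le> c * t powr (- d / \<alpha>)"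
        unfolding c_def by (rule mult_right_mono[OF add_mono[OF 1 2]]) auto
      finally show "?c1 * \<kappa>1 + ?c2 * \<nu> \<le> c * t powr (- d / \<alpha>)" .
    qed
    finally show ?thesis .
  qed
  have off: "V \<le> ennreal (c * (t / norm (x - z) powr jexp))" if xz: "x \<noteq> z"
  proof -
    define R where "R = norm (x - z)"
    have R: "0 < R" using xz by (simp add: R_def)
    define a where "a = t / R powr jexp"
    have a: "0 < a" using t R by (simp add: a_def)
    have long: "1 / u powr jexp \<le> \<rho> / R powr jexp" if "split_ratio * R / 2 \<le> u" for u
    proof -
      have pos': "0 < split_ratio * R / 2" using split_ratio R by simp
      have "(split_ratio * R / 2) powr jexp \<le> u powr jexp"
        using that pos' jexp_pos by (intro powr_mono2) auto
      then have "1 / u powr jexp \<le> 1 / (split_ratio * R / 2) powr jexp"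
        using pos' split_ratio R by (intro divide_left_mono mult_pos_pos) (auto simp: that)
      also have "\<dots> = \<rho> / R powr jexp"
        using split_ratio R by (simp add: \<rho>_def powr_divide powr_mult)
      finally show ?thesis .
    qed
    have "V \<le> ennreal (2 * \<theta> * a) * ennreal \<kappa>1 + ennreal (M2 * \<rho> * a) * ennreal \<nu>
        + ennreal (ch * \<rho> / R powr jexp) * (ennreal t * ennreal \<mu>)"
      unfolding V_def
    proof (rule step_split[OF X nu mu t])
      fix s w y assume s: "0 < s" "s < t"
      let ?A = "p s x w * h w y" and ?B = "h w y * X (t - s) y z" and ?C = "p s x w * X (t - s) y z"
      have tri: "R \<le> norm (x - w) + norm (w - y) + norm (y - z)"
        unfolding R_def using norm_triangle_ineq[of "x - w" "w - y"] norm_triangle_ineq[of "x - y" "y - z"] by simp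
      \<comment> \<open>If the last leg is shorter than \<open>(1 - split_ratio) * R\<close>, the
        other two together cover \<open>split_ratio * R\<close>, so one of them covers half of
        it.\<close>
      consider "(1 - split_ratio) * R \<le> norm (y - z)" | "split_ratio * R / 2 \<le> norm (x - w)"
        | "split_ratio * R / 2 \<le> norm (w - y)"
        using tri by (argo)
      then show "p s x w * (h w y * X (t - s) y z) \<le> ennreal (2 * \<theta> * a) * ?A + ennreal (M2 * \<rho> * a) * ?B +
        ennreal (ch * \<rho> / R powr jexp) * ?C"
      proof cases
        case 1
        have pos': "0 < (1 - split_ratio) * R" using split_ratio R by simp
        then have yz: "y \<noteq> z" using 1 by auto
        have "X (t - s) y z \<le> ennreal (\<theta> * ((t - s) / norm (y - z) powr jexp))" using s t yz by (intro Xo) auto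
        also have "\<dots> \<le> ennreal (2 * \<theta> * a)"
        proof (rule ennreal_leI)
          have "((1 - split_ratio) * R) powr jexp \<le> norm (y - z) powr jexp"
            using 1 pos' jexp_pos by (intro powr_mono2) auto
          then have le: "R powr jexp / 2 \<le> norm (y - z) powr jexp"
            using split_ratio R by (simp add: powr_mult)
          have "(t - s) / norm (y - z) powr jexp \<le> t / (R powr jexp / 2)"
            using s t le R yz by (intro frac_le) auto
          then have "\<theta> * ((t - s) / norm (y - z) powr jexp) \<le> \<theta> * (t / (R powr jexp / 2))"
            using pos by (intro mult_left_mono) auto
          then show "\<theta> * ((t - s) / norm (y - z) powr jexp) \<le> 2 * \<theta> * a"
            by (simp add: a_def mult_ac)
        qed
        finally have "p s x w * (h w y * X (t - s) y z) \<le> p s x w * (h w y * ennreal (2 * \<theta> * a))"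
          by (intro mult_left_mono) auto
        then show ?thesis by (simp add: mult_ac add_increasing2)
      next
        case 2
        have pos': "0 < split_ratio * R / 2" using split_ratio R by simp
        then have xw: "x \<noteq> w" using 2 by auto
        have "p s x w \<le> ennreal (M2 * (s / norm (x - w) powr jexp))" using s xw by (intro p_off) auto
        also have "\<dots> \<le> ennreal (M2 * \<rho> * a)"
        proof (rule ennreal_leI)
          have "s * (1 / norm (x - w) powr jexp) \<le> t * (\<rho> / R powr jexp)"
            using s t long[OF 2] by (intro mult_mono) auto
          then have "M2 * (s * (1 / norm (x - w) powr jexp)) \<le> M2 * (t * (\<rho> / R powr jexp))"
            using M12 by (intro mult_left_mono) auto
          then show "M2 * (s / norm (x - w) powr jexp) \<le> M2 * \<rho> * a" by (simp add: a_def mult_ac)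
        qed
        finally have "p s x w * (h w y * X (t - s) y z) \<le> ennreal (M2 * \<rho> * a) * (h w y * X (t - s) y z)"
          by (intro mult_right_mono) auto
        also have "\<dots> \<le> ennreal (2 * \<theta> * a) * ?A + ennreal (M2 * \<rho> * a) * ?B"
          by (simp add: add_increasing)
        finally show ?thesis by (rule add_increasing2[rotated]) simp
      next
        case 3
        have "h w y \<le> ennreal (ch * (1 / norm (w - y) powr jexp))" using h_bound[of w y] by simp
        also have "\<dots> \<le> ennreal (ch * \<rho> / R powr jexp)"
          using mult_left_mono[OF long[OF 3] ch] by (intro ennreal_leI) simp
        finally have "p s x w * (h w y * X (t - s) y z) \<le> p s x w * (ennreal (ch * \<rho> / R powr jexp) * X (t - s) y z)"
          by (intro mult_left_mono mult_right_mono) auto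
        also have "\<dots> = ennreal (ch * \<rho> / R powr jexp) * ?C" by (simp add: mult_ac)
        finally show ?thesis by (rule add_increasing[rotated]) simp
      qed
    qed
    also have "\<dots> = ennreal (2 * \<theta> * a * \<kappa>1 + M2 * \<rho> * a * \<nu> + ch * \<rho> / R powr jexp * (t * \<mu>))"
      using pos M12 \<kappa> a \<rho> ch t
      by (simp del: ennreal_plus add: ennreal_mult[symmetric] ennreal_plus[symmetric])
    also have "\<dots> \<le> ennreal (c * a)"
    proof (rule ennreal_leI)
      have 1: "2 * \<kappa>1 * \<theta> \<le> \<kappa> * \<theta>" using \<kappa>1_le(1) pos by (intro mult_right_mono) auto
      have 2: "\<rho> * M2 * \<nu> + \<rho> * ch * \<mu> \<le> step_const * (\<mu> + \<nu>)"
      proof -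
        have "\<rho> * M2 * \<nu> + \<rho> * ch * \<mu> \<le> \<rho> * (M2 + ch) * \<nu> + \<rho> * (M2 + ch) * \<mu>"
          using \<rho> M12 ch pos by (intro add_mono mult_right_mono mult_left_mono) auto
        also have "\<dots> = \<rho> * (M2 + ch) * (\<mu> + \<nu>)" by (simp add: algebra_simps)
        also have "\<dots> \<le> step_const * (\<mu> + \<nu>)"
          using pos M12 by (intro mult_right_mono) (auto simp: step_const_def \<rho>_def)
        finally show ?thesis .
      qed
      have "2 * \<theta> * a * \<kappa>1 + M2 * \<rho> * a * \<nu> + ch * \<rho> / R powr jexp * (t * \<mu>) =
          (2 * \<kappa>1 * \<theta> + (\<rho> * M2 * \<nu> + \<rho> * ch * \<mu>)) * a"
        by (simp add: a_def algebra_simps)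
      also have "\<dots> \<le> c * a"
        unfolding c_def using a by (intro mult_right_mono[OF add_mono[OF 1 2]]) auto
      finally show "2 * \<theta> * a * \<kappa>1 + M2 * \<rho> * a * \<nu> + ch * \<rho> / R powr jexp * (t * \<mu>) \<le> c * a" .
    qed
    finally show ?thesis by (simp add: a_def R_def)
  qed
  show ?thesis
  proof (cases "x = z \<or> t powr (- d / \<alpha>) \<le> t / norm (x - z) powr jexp")
    case True
    then have "stable_bound \<alpha> t x z = t powr (- d / \<alpha>)"
      using stable_bound_cases[OF t(1) alpha, of x z] by (auto simp: jexp_def d_def)
    then show ?thesis using diag by (simp add: V_def c_def)
  next
    case False
    then have "stable_bound \<alpha> t x z = t / norm (x - z) powr jexp"
      using stable_bound_cases[OF t(1) alpha, of x z] by (auto simp: jexp_def d_def)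
    then show ?thesis using off False by (simp add: V_def c_def)
  qed
qed

text \<open>Solves the recursion c(k + 1) = \<kappa> c(k) +
  \<open>step_const * (M2 / M1 + \<kappa>)\<close> \<kappa>^k with c(0) = \<open>M2\<close>, which
  \<open>step_bound\<close> imposes. The forcing term decays at the same rate \<kappa>, hence the
  extra linear factor.\<close>

definition pert_const :: "nat \<Rightarrow> real" where
  "pert_const k = \<kappa> ^ k * (M2 + real k * (step_const * (M2 / M1 + \<kappa>) / \<kappa>))"

lemma pert_const_nonneg: "0 \<le> pert_const k"
  using M12 \<kappa> step_const_nonneg by (simp add: pert_const_def)

text \<open>The three estimates have to advance together: the time-integrated jump mass and the mass
  over the first variable enter the pointwise bound of the next order as \<open>\<nu>\<close> and
  \<open>\<mu>\<close>.\<close>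

lemma pert_bounds:
  "(\<forall>z. (\<integral>\<^sup>+s\<in>{0<..t0}. (\<integral>\<^sup>+w. (h \<bullet>\<^sub>k pert h p k) s w z \<partial>m) \<partial>lborel) \<le> ennreal (\<kappa> ^ Suc k)) \<and>
   (\<forall>t z. 0 < t \<longrightarrow> t \<le> t0 \<longrightarrow> (\<integral>\<^sup>+x. pert h p k t x z \<partial>m) \<le> ennreal (M2 / M1 * \<kappa> ^ k)) \<and>
   (\<forall>t x z. 0 < t \<longrightarrow> t \<le> t0 \<longrightarrow> pert h p k t x z \<le> ennreal (pert_const k * stable_bound \<alpha> t x z))"
proof (induction k)
  case 0
  have "\<kappa>1 \<le> \<kappa>" using \<kappa>1_le \<kappa> by simp
  then have "ennreal \<kappa>1 \<le> ennreal \<kappa>" by (rule ennreal_leI)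
  with mass_left have "(\<integral>\<^sup>+s\<in>{0<..t0}. (\<integral>\<^sup>+w. (h \<bullet>\<^sub>k p) s w z \<partial>m) \<partial>lborel) \<le> ennreal \<kappa>" for z
    by (meson order_trans)
  then show ?case using p_mass_left p_upper by (simp add: pert_const_def)
next
  case (Suc k)
  note X = st_kernel_pert[OF h_kernel p_kernel, of k]
  have IH: "(\<integral>\<^sup>+s\<in>{0<..t0}. (\<integral>\<^sup>+w. (h \<bullet>\<^sub>k pert h p k) s w z \<partial>m) \<partial>lborel) \<le> ennreal (\<kappa> ^ Suc k)"
    "0 < t \<Longrightarrow> t \<le> t0 \<Longrightarrow> (\<integral>\<^sup>+x. pert h p k t x z \<partial>m) \<le> ennreal (M2 / M1 * \<kappa> ^ k)"
    "0 < t \<Longrightarrow> t \<le> t0 \<Longrightarrow> pert h p k t x z \<le> ennreal (pert_const k * stable_bound \<alpha> t x z)" for t x z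
    using Suc by blast+
  have 1: "(\<integral>\<^sup>+s\<in>{0<..t0}. (\<integral>\<^sup>+w. (h \<bullet>\<^sub>k pert h p (Suc k)) s w z \<partial>m) \<partial>lborel) \<le> ennreal (\<kappa> ^ Suc (Suc k))" for z
  proof -
    have "(\<integral>\<^sup>+s\<in>{0<..t0}. (\<integral>\<^sup>+w. (h \<bullet>\<^sub>k pert h p (Suc k)) s w z \<partial>m) \<partial>lborel) \<le> ennreal \<kappa>1 * ennreal (\<kappa> ^ Suc k)"
      unfolding pert.simps by (rule step_jump_mass[OF X IH(1)])
    also have "\<dots> \<le> ennreal \<kappa> * ennreal (\<kappa> ^ Suc k)"
      using \<kappa>1_le \<kappa> by (intro mult_right_mono ennreal_leI) auto
    also have "\<dots> = ennreal (\<kappa> ^ Suc (Suc k))" using \<kappa> by (simp add: ennreal_mult'[symmetric])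
    finally show ?thesis .
  qed
  have 2: "(\<integral>\<^sup>+x. pert h p (Suc k) t x z \<partial>m) \<le> ennreal (M2 / M1 * \<kappa> ^ Suc k)" if "0 < t" "t \<le> t0" for t z
  proof -
    have "(\<integral>\<^sup>+x. pert h p (Suc k) t x z \<partial>m) \<le> ennreal (M2 / M1) * ennreal (\<kappa> ^ Suc k)"
      unfolding pert.simps by (rule step_mass[OF X IH(1) that(2)])
    also have "\<dots> = ennreal (M2 / M1 * \<kappa> ^ Suc k)"
      using M12 \<kappa> by (intro ennreal_mult[symmetric]) auto
    finally show ?thesis .
  qed
  have 3: "pert h p (Suc k) t x z \<le> ennreal (pert_const (Suc k) * stable_bound \<alpha> t x z)" if t: "0 < t" "t \<le> t0" for t x z
  proof -
    have "pert h p (Suc k) t x z \<le>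
        ennreal ((\<kappa> * pert_const k + step_const * (M2 / M1 * \<kappa> ^ k + \<kappa> ^ Suc k)) * stable_bound \<alpha> t x z)"
      unfolding pert.simps using M12 \<kappa> t
      by (intro step_bound[OF X _ _ _ IH]) (auto simp: pert_const_nonneg)
    also have "\<kappa> * pert_const k + step_const * (M2 / M1 * \<kappa> ^ k + \<kappa> ^ Suc k) = pert_const (Suc k)"
    proof -
      define B where "B = step_const * (M2 / M1 + \<kappa>) / \<kappa>"
      have "step_const * (M2 / M1 * \<kappa> ^ k + \<kappa> ^ Suc k) = \<kappa> ^ Suc k * B"
        using \<kappa> by (simp add: B_def field_simps)
      then show ?thesis unfolding pert_const_def B_def[symmetric] by (simp add: algebra_simps)
    qed
    finally show ?thesis .
  qed
  show ?case using 1 2 3 by blast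
qed

lemma pert_bound:
  "0 < t \<Longrightarrow> t \<le> t0 \<Longrightarrow> pert h p k t x z \<le> ennreal (pert_const k * stable_bound \<alpha> t x z)"
  using pert_bounds[of k] by blast

lemma summable_pert_const: "summable pert_const"
proof -
  define b where "b = step_const * (M2 / M1 + \<kappa>) / \<kappa>"
  have "summable (\<lambda>k. real (Suc k) * \<kappa> ^ k)"
    using geometric_deriv_sums[of \<kappa>] \<kappa> by (auto simp: sums_iff)
  then have "summable (\<lambda>k. (M2 + b) * (real (Suc k) * \<kappa> ^ k))" by (rule summable_mult)
  then show ?thesis
  proof (rule summable_comparison_test'[of _ 0])
    fix k :: nat
    have b: "0 \<le> b" using M12 \<kappa> step_const_nonneg by (simp add: b_def)
    have "M2 + real k * b \<le> (M2 + b) * real (Suc k)"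
      using b M12 by (simp add: algebra_simps)
    then have "pert_const k \<le> \<kappa> ^ k * ((M2 + b) * real (Suc k))"
      unfolding pert_const_def b_def[symmetric] using \<kappa> by (intro mult_left_mono) auto
    then show "norm (pert_const k) \<le> (M2 + b) * (real (Suc k) * \<kappa> ^ k)"
      using pert_const_nonneg[of k] by (simp add: mult_ac)
  qed
qed

definition total_const :: real where "total_const = (\<Sum>k. pert_const k)"

lemma pert_suminf_bound:
  assumes t: "0 < t" "t \<le> t0"
  shows "(\<Sum>k. pert h p k t x z) \<le> ennreal (total_const * stable_bound \<alpha> t x z)"
proof -
  have "(\<Sum>k. pert h p k t x z) \<le> (\<Sum>k. ennreal (pert_const k * stable_bound \<alpha> t x z))"
    using pert_bound[OF t] by (intro suminf_le) auto
  also have "\<dots> = ennreal (\<Sum>k. pert_const k * stable_bound \<alpha> t x z)"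
    using pert_const_nonneg stable_bound_pos[OF t(1), of \<alpha> x z] summable_pert_const
    by (intro suminf_ennreal2 summable_mult2) (auto simp: less_imp_le)
  also have "(\<Sum>k. pert_const k * stable_bound \<alpha> t x z) = total_const * stable_bound \<alpha> t x z"
    unfolding total_const_def by (intro suminf_mult2[symmetric] summable_pert_const)
  finally show ?thesis .
qed

lemma total_const_nonneg: "0 \<le> total_const"
  unfolding total_const_def by (intro suminf_nonneg summable_pert_const pert_const_nonneg)

end

section \<open>Processes with a transition density\<close>

definition opt_lift :: "('a \<Rightarrow> ennreal) \<Rightarrow> 'a option \<Rightarrow> ennreal" where
  "opt_lift g v = (case v of None \<Rightarrow> 0 | Some y \<Rightarrow> g y)"

lemma opt_lift_simps [simp]: "opt_lift g None = 0" "opt_lift g (Some y) = g y"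
  by (simp_all add: opt_lift_def)

lemma space_cemetery_borel [simp]: "space cemetery_borel = UNIV"
  by (simp add: cemetery_borel_def space_measure_of_conv)

lemma sets_cemetery_borel:
  "sets cemetery_borel = sigma_sets UNIV {U :: 'a::euclidean_space option set. openin cemetery_top U}"
  by (simp add: cemetery_borel_def sets_measure_of_conv)

lemma openin_cemetery_top_Some:
  fixes U :: "'a::euclidean_space set"
  assumes "open U"
  shows "openin cemetery_top (Some ` U)"
  using assms by (simp add: cemetery_top_def)

lemma Some_image_measurable:
  fixes B :: "'a::euclidean_space set"
  assumes "B \<in> sets borel"
  shows "Some ` B \<in> sets cemetery_borel"
proof -
  have basic: "Some ` U \<in> sets cemetery_borel" if "open U" for U :: "'a set"
    unfolding sets_cemetery_borel using openin_cemetery_top_Some[OF that] by (intro sigma_sets.Basic) simp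
  have "B \<in> sigma_sets UNIV {S. open S}" using assms by (simp add: borel_def sets_measure_of_conv)
  then show ?thesis
  proof induction
    case (Compl a)
    have "Some ` (UNIV - a) = Some ` UNIV - Some ` a" by auto
    then show ?case using basic[of UNIV] Compl.IH by auto
  next
    case (Union a)
    then show ?case by (auto simp: image_UN)
  qed (auto intro: basic)
qed

lemma opt_lift_measurable:
  fixes g :: "'a::euclidean_space \<Rightarrow> ennreal"
  assumes g: "g \<in> borel_measurable borel"
  shows "opt_lift g \<in> borel_measurable cemetery_borel"
proof (rule measurableI)
  fix A :: "ennreal set" assume A: "A \<in> sets borel"
  have "opt_lift g -` A = Some ` (g -` A) \<union> (if 0 \<in> A then UNIV - Some ` UNIV else {})"
  proof (intro set_eqI)
    fix v show "v \<in> opt_lift g -` A \<longleftrightarrow> v \<in> Some ` (g -` A) \<union> (if 0 \<in> A then UNIV - Some ` UNIV else {})"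
      by (cases v) auto
  qed
  moreover have "Some ` (g -` A) \<in> sets cemetery_borel"
    using measurable_sets[OF g A] by (intro Some_image_measurable) simp
  moreover have "UNIV - Some ` (UNIV :: 'a set) \<in> sets cemetery_borel"
    using sets.compl_sets[OF Some_image_measurable[of "UNIV :: 'a set"]] by simp
  ultimately show "opt_lift g -` A \<inter> space cemetery_borel \<in> sets cemetery_borel" by auto
qed simp

lemma Hausdorff_cemetery_top: "Hausdorff_space (cemetery_top :: 'a::euclidean_space option topology)"
proof -
  have "locally_compact_space (euclidean :: 'a topology)"
    using locally_compact_space_euclidean by simp
  then show ?thesis
    unfolding cemetery_top_def by (simp add: Hausdorff_space_Alexandroff_compactification)
qed

section \<open>One-time laws and the Markov property\<close>

locale hunt_density = hunt_process \<M> \<F> X P + base_measure m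
  for \<M> :: "'w measure" and \<F> :: "ennreal \<Rightarrow> 'w measure"
    and X :: "ennreal \<Rightarrow> 'w \<Rightarrow> 'a::euclidean_space option" and P :: "'a option \<Rightarrow> 'w measure"
    and m :: "'a measure" +
  fixes p :: "real \<Rightarrow> 'a \<Rightarrow> 'a \<Rightarrow> ennreal"
  assumes p_kernel': "st_kernel p"
    and p_law: "\<And>t x B. 0 < t \<Longrightarrow> B \<in> sets borel \<Longrightarrow>
      emeasure (P (Some x)) {\<omega> \<in> space (P (Some x)). X (ennreal t) \<omega> \<in> Some ` B} = (\<integral>\<^sup>+y\<in>B. p t x y \<partial>m)"
begin

lemmas p_meas = st_kernel_measurable[OF p_kernel']

lemma space_P: "space (P x) = space \<M>"
  by (rule sets_eq_imp_space_eq[OF sets_P])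

lemma X_measurable: "X t \<in> P x \<rightarrow>\<^sub>M cemetery_borel"
proof -
  have "X t \<in> \<M> \<rightarrow>\<^sub>M cemetery_borel"
    using adapted[of t] filtration_sub[of t] space_F[of t] by (auto simp: measurable_def)
  then show ?thesis using measurable_cong_sets[OF sets_P refl] by blast
qed

lemma opt_lift_X_measurable:
  "g \<in> borel_measurable borel \<Longrightarrow> (\<lambda>\<omega>. opt_lift g (X t \<omega>)) \<in> borel_measurable (P x)"
  using measurable_compose[OF X_measurable opt_lift_measurable] .

lemma X_in_sets: "B \<in> sets borel \<Longrightarrow> {\<omega> \<in> space \<M>. X t \<omega> \<in> Some ` B} \<in> sets (P x)"
  using measurable_sets[OF X_measurable Some_image_measurable, of B t x]
  by (simp add: vimage_def Int_def space_P conj_commute)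

lemma expectation_X:
  assumes t: "0 < t" and g: "g \<in> borel_measurable borel"
  shows "(\<integral>\<^sup>+\<omega>. opt_lift g (X (ennreal t) \<omega>) \<partial>P (Some x)) = (\<integral>\<^sup>+y. p t x y * g y \<partial>m)"
  using g
proof (induction rule: borel_measurable_induct)
  case (cong f g)
  then have "f = g" by auto
  with cong show ?case by simp
next
  case (set A)
  have "(\<integral>\<^sup>+\<omega>. opt_lift (indicator A) (X (ennreal t) \<omega>) \<partial>P (Some x)) =
      (\<integral>\<^sup>+\<omega>. indicator {\<omega> \<in> space \<M>. X (ennreal t) \<omega> \<in> Some ` A} \<omega> \<partial>P (Some x))"
  proof (rule nn_integral_cong)
    fix \<omega> assume "\<omega> \<in> space (P (Some x))"
    then show "opt_lift (indicator A) (X (ennreal t) \<omega>) =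
      (indicator {\<omega> \<in> space \<M>. X (ennreal t) \<omega> \<in> Some ` A} \<omega> :: ennreal)"
      by (cases "X (ennreal t) \<omega>") (auto simp: space_P split: split_indicator)
  qed
  also have "\<dots> = emeasure (P (Some x)) {\<omega> \<in> space \<M>. X (ennreal t) \<omega> \<in> Some ` A}"
    using X_in_sets[OF set] by simp
  also have "\<dots> = (\<integral>\<^sup>+y\<in>A. p t x y \<partial>m)" using p_law[OF t set, of x] by (simp add: space_P)
  finally show ?case .
next
  case (mult u c)
  note [measurable (raw)] = p_meas and [measurable] = mult.hyps(2)
  have "opt_lift (\<lambda>x. c * u x) v = c * opt_lift u v" for v by (cases v) auto
  then have "(\<integral>\<^sup>+\<omega>. opt_lift (\<lambda>x. c * u x) (X (ennreal t) \<omega>) \<partial>P (Some x)) =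
      c * (\<integral>\<^sup>+\<omega>. opt_lift u (X (ennreal t) \<omega>) \<partial>P (Some x))"
    using opt_lift_X_measurable[OF mult.hyps(2)] by (simp add: nn_integral_cmult)
  also have "\<dots> = (\<integral>\<^sup>+y. p t x y * (c * u y) \<partial>m)"
    unfolding mult.IH by (subst nn_integral_cmult[symmetric]) (simp_all add: mult_ac)
  finally show ?case .
next
  case (add u v)
  note [measurable (raw)] = p_meas and [measurable] = add.hyps(1,3)
  have "opt_lift (\<lambda>x. v x + u x) w = opt_lift v w + opt_lift u w" for w by (cases w) auto
  then show ?case
    using opt_lift_X_measurable[OF add.hyps(1)] opt_lift_X_measurable[OF add.hyps(3)] add.IH
    by (simp add: nn_integral_add distrib_left)
next
  case (seq U)
  note [measurable (raw)] = p_meas and [measurable] = seq(1)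
  have inc: "incseq (\<lambda>i. opt_lift (U i) w)" for w
    using seq(3) by (cases w) (auto simp: incseq_def le_fun_def)
  have sup: "opt_lift (SUP i. U i) w = (SUP i. opt_lift (U i) w)" for w
    by (cases w) (simp_all add: image_comp)
  have "(\<integral>\<^sup>+\<omega>. opt_lift (SUP i. U i) (X (ennreal t) \<omega>) \<partial>P (Some x)) =
      (SUP i. \<integral>\<^sup>+\<omega>. opt_lift (U i) (X (ennreal t) \<omega>) \<partial>P (Some x))"
    unfolding sup using inc opt_lift_X_measurable[OF seq(1)]
    by (intro nn_integral_monotone_convergence_SUP) (auto simp: incseq_def le_fun_def)
  also have "\<dots> = (SUP i. \<integral>\<^sup>+y. p t x y * U i y \<partial>m)" using seq.IH by simp
  also have "\<dots> = (\<integral>\<^sup>+y. (SUP i. p t x y * U i y) \<partial>m)"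
    using seq(3) by (intro nn_integral_monotone_convergence_SUP[symmetric])
      (auto simp: incseq_def le_fun_def intro: mult_left_mono)
  also have "\<dots> = (\<integral>\<^sup>+y. p t x y * (SUP i. U i) y \<partial>m)"
    by (simp add: SUP_mult_left_ennreal image_comp)
  finally show ?case .
qed

lemma p_mass': "(\<integral>\<^sup>+y. p t x y \<partial>m) \<le> 1"
proof (cases "0 < t")
  case True
  interpret Px: prob_space "P (Some x)" by (rule prob_space_P)
  have "(\<integral>\<^sup>+y. p t x y \<partial>m) = emeasure (P (Some x)) {\<omega> \<in> space (P (Some x)). X (ennreal t) \<omega> \<in> Some ` UNIV}"
    using p_law[OF True, of UNIV x] by simp
  also have "\<dots> \<le> 1" by (rule Px.emeasure_le_1)
  finally show ?thesis .
qed (simp add: st_kernel_0[OF p_kernel'])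

text \<open>The strong Markov property at the constant time \<open>a\<close>, integrated over an
  event of the past. On that event the path is at a genuine point at time \<open>a\<close>, so
  \<open>p_law\<close> describes the second transition.\<close>

lemma markov_emeasure:
  assumes a: "0 < a" and h: "0 < h" and A: "A \<in> sets borel" and B: "B \<in> sets borel"
  shows "emeasure (P (Some x))
      ({\<omega> \<in> space \<M>. X (ennreal a) \<omega> \<in> Some ` A} \<inter> {\<omega> \<in> space \<M>. X (ennreal (a + h)) \<omega> \<in> Some ` B}) =
    (\<integral>\<^sup>+w. p a x w * (indicator A w * (\<integral>\<^sup>+y. p h w y * indicator B y \<partial>m)) \<partial>m)"
proof -
  note [measurable (raw)] = p_meas
  note [measurable] = A B
  interpret Px: prob_space "P (Some x)" by (rule prob_space_P)
  let ?\<sigma> = "\<lambda>_ :: 'w. ennreal a"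
  let ?EA = "{\<omega> \<in> space \<M>. X (ennreal a) \<omega> \<in> Some ` A}"
  let ?EB = "{\<omega> \<in> space \<M>. X (ennreal (a + h)) \<omega> \<in> Some ` B}"
  have st: "stopping_time \<F> ?\<sigma>" by (rule stopping_time_const)
  \<comment> \<open>For a constant stopping time, the stopped sigma-algebra is that of the
    filtration at this time.\<close>
  have sets_pre: "A \<in> sets (pre_sigma ?\<sigma>) \<longleftrightarrow> A \<in> sets (\<F> (ennreal a))" for A
  proof
    assume "A \<in> sets (pre_sigma ?\<sigma>)"
    from sets_pre_sigmaD[OF st this, of "ennreal a"] show "A \<in> sets (\<F> (ennreal a))" by simp
  next
    assume "A \<in> sets (\<F> (ennreal a))"
    then have "{\<omega> \<in> A. ennreal a \<le> t} \<in> sets (\<F> t)" for t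
      using sets_F_mono[of "ennreal a" t] by (cases "ennreal a \<le> t") auto
    then show "A \<in> sets (pre_sigma ?\<sigma>)" by (rule sets_pre_sigmaI[OF st])
  qed
  have sub: "subalgebra (P (Some x)) (pre_sigma ?\<sigma>)"
    using filtration_sub[of "ennreal a"] by (auto simp: subalgebra_def sets_pre sets_P space_P space_pre_sigma)
  interpret sf: sigma_finite_subalgebra "P (Some x)" "pre_sigma ?\<sigma>"
    by (intro finite_measure_subalgebra_is_sigma_finite finite_measure_subalgebra.intro sub Px.finite_measure_axioms finite_measure_subalgebra_axioms.intro)
  have EA: "?EA \<in> sets (pre_sigma ?\<sigma>)"
    using measurable_sets[OF adapted Some_image_measurable[OF A], of "ennreal a"]
    by (simp add: sets_pre vimage_def Int_def space_F conj_commute)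
  have EAP: "?EA \<in> sets (P (Some x))" and EBP: "?EB \<in> sets (P (Some x))"
    by (intro X_in_sets A B)+
  have intB: "integrable (P (Some x)) (indicat_real ?EB)"
    using EBP by (intro integrable_real_indicator) (auto simp: less_top[symmetric])
  define \<pi> where "\<pi> w = (\<integral>\<^sup>+y. p h w y * indicator B y \<partial>m)" for w
  have \<pi>: "\<pi> \<in> borel_measurable borel" unfolding \<pi>_def by measurable
  have \<pi>1: "\<pi> w \<le> 1" for w
    unfolding \<pi>_def by (rule order_trans[OF _ p_mass'[of h w]]) (auto intro!: nn_integral_mono split: split_indicator)
  have ah: "ennreal a + ennreal h = ennreal (a + h)" using a h by (simp add: ennreal_plus)
  have AE: "AE \<omega> in P (Some x). real_cond_exp (P (Some x)) (pre_sigma ?\<sigma>) (indicat_real ?EB) \<omega> =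
      measure (P (X (ennreal a) \<omega>)) {\<omega>' \<in> space \<M>. X (ennreal h) \<omega>' \<in> Some ` B}"
    using strong_markov[OF st, of "ennreal h" "Some ` B" "Some x"] Some_image_measurable[OF B]
    by (simp add: ah)
  have trans: "ennreal (indicat_real ?EA \<omega> * measure (P (X (ennreal a) \<omega>)) {\<omega>' \<in> space \<M>. X (ennreal h) \<omega>' \<in> Some ` B}) =
      opt_lift (\<lambda>w. indicator A w * \<pi> w) (X (ennreal a) \<omega>)" if "\<omega> \<in> space \<M>" for \<omega>
  proof (cases "X (ennreal a) \<omega>")
    case None
    then show ?thesis by (auto split: split_indicator)
  next
    case (Some w)
    interpret Pw: prob_space "P (Some w)" by (rule prob_space_P)
    have "ennreal (measure (P (Some w)) {\<omega>' \<in> space \<M>. X (ennreal h) \<omega>' \<in> Some ` B}) = \<pi> w"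
      using p_law[OF h B, of w] by (simp add: Pw.emeasure_eq_measure space_P \<pi>_def)
    then show ?thesis using Some that by (auto split: split_indicator)
  qed
  have "emeasure (P (Some x)) (?EA \<inter> ?EB) = ennreal (measure (P (Some x)) (?EA \<inter> ?EB))"
    by (rule Px.emeasure_eq_measure)
  also have "measure (P (Some x)) (?EA \<inter> ?EB) = (\<integral>\<omega>\<in>?EA. indicat_real ?EB \<omega> \<partial>P (Some x))"
    using EAP EBP by (simp add: set_lebesgue_integral_def indicator_inter_arith[symmetric] sets.Int)
  also have "\<dots> = (\<integral>\<omega>\<in>?EA. real_cond_exp (P (Some x)) (pre_sigma ?\<sigma>) (indicat_real ?EB) \<omega> \<partial>P (Some x))"
    by (rule sf.real_cond_exp_intA[OF intB EA])
  also have "\<dots> = (\<integral>\<omega>. enn2real (opt_lift (\<lambda>w. indicator A w * \<pi> w) (X (ennreal a) \<omega>)) \<partial>P (Some x))"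
    unfolding set_lebesgue_integral_def
  proof (rule integral_cong_AE)
    show "(\<lambda>\<omega>. indicat_real ?EA \<omega> *\<^sub>R real_cond_exp (P (Some x)) (pre_sigma ?\<sigma>) (indicat_real ?EB) \<omega>) \<in> borel_measurable (P (Some x))"
      using EAP by measurable
    show "(\<lambda>\<omega>. enn2real (opt_lift (\<lambda>w. indicator A w * \<pi> w) (X (ennreal a) \<omega>))) \<in> borel_measurable (P (Some x))"
      using opt_lift_X_measurable[of "\<lambda>w. indicator A w * \<pi> w" "ennreal a" "Some x"] \<pi> by measurable
    show "AE \<omega> in P (Some x). indicat_real ?EA \<omega> *\<^sub>R real_cond_exp (P (Some x)) (pre_sigma ?\<sigma>) (indicat_real ?EB) \<omega> =
      enn2real (opt_lift (\<lambda>w. indicator A w * \<pi> w) (X (ennreal a) \<omega>))"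
      using AE AE_space
    proof eventually_elim
      case (elim \<omega>)
      then have "\<omega> \<in> space \<M>" by (simp add: space_P)
      from arg_cong[OF trans[OF this], of enn2real] elim show ?case by simp
    qed
  qed
  also have "ennreal \<dots> = (\<integral>\<^sup>+\<omega>. ennreal (enn2real (opt_lift (\<lambda>w. indicator A w * \<pi> w) (X (ennreal a) \<omega>))) \<partial>P (Some x))"
  proof (rule nn_integral_eq_integral[symmetric])
    have "enn2real (opt_lift (\<lambda>w. indicator A w * \<pi> w) v) \<le> 1" for v
      using \<pi>1 by (cases v) (auto split: split_indicator intro: enn2real_leI)
    then show "integrable (P (Some x)) (\<lambda>\<omega>. enn2real (opt_lift (\<lambda>w. indicator A w * \<pi> w) (X (ennreal a) \<omega>)))"
      using opt_lift_X_measurable[of "\<lambda>w. indicator A w * \<pi> w" "ennreal a" "Some x"] \<pi>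
      by (intro Px.integrable_const_bound[of _ 1]) auto
  qed auto
  also have "\<dots> = (\<integral>\<^sup>+\<omega>. opt_lift (\<lambda>w. indicator A w * \<pi> w) (X (ennreal a) \<omega>) \<partial>P (Some x))"
  proof (rule nn_integral_cong)
    fix \<omega>
    have "opt_lift (\<lambda>w. indicator A w * \<pi> w) v \<le> 1" for v
      using \<pi>1 by (cases v) (auto split: split_indicator)
    then have "opt_lift (\<lambda>w. indicator A w * \<pi> w) v < \<top>" for v
      by (rule order_le_less_trans) simp
    then show "ennreal (enn2real (opt_lift (\<lambda>w. indicator A w * \<pi> w) (X (ennreal a) \<omega>))) =
      opt_lift (\<lambda>w. indicator A w * \<pi> w) (X (ennreal a) \<omega>)" by simp
  qed
  also have "\<dots> = (\<integral>\<^sup>+w. p a x w * (indicator A w * \<pi> w) \<partial>m)"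
    using \<pi> by (intro expectation_X a) measurable
  finally show ?thesis by (simp add: \<pi>_def)
qed

end

section \<open>Jumps and increments\<close>

definition off_ind :: "('a \<times> 'a) set \<Rightarrow> 'a option \<Rightarrow> 'a option \<Rightarrow> ennreal" where
  "off_ind Q = off_cemetery (\<lambda>u v. indicator Q (u, v))"

lemma off_ind_simps [simp]:
  "off_ind Q None v = 0" "off_ind Q u None = 0" "off_ind Q (Some a) (Some b) = indicator Q (a, b)"
  by (auto simp: off_ind_def off_cemetery_def split: option.splits)

lemma eventually_at_left_ennrealD:
  assumes "eventually Q (at_left (ennreal s))" "0 < s"
  obtains d where "0 < d" "\<And>r. s - d < r \<Longrightarrow> r < s \<Longrightarrow> 0 \<le> r \<Longrightarrow> Q (ennreal r)"
proof -
  have "(0::ennreal) < ennreal s" using assms by simp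
  from assms(1)[unfolded eventually_at_left[OF this]]
  obtain b where b: "b < ennreal s" "\<And>y. b < y \<Longrightarrow> y < ennreal s \<Longrightarrow> Q y" by blast
  then obtain b' where b': "b = ennreal b'" "0 \<le> b'" by (cases b) auto
  have "b' < s" using b(1) b' assms(2) by (simp add: ennreal_less_iff)
  show ?thesis
  proof (rule that[of "s - b'"])
    fix r assume "s - (s - b') < r" "r < s" "0 \<le> r"
    then show "Q (ennreal r)" using b' by (intro b(2)) (auto simp: ennreal_less_iff)
  qed (use \<open>b' < s\<close> in simp)
qed

lemma eventually_at_right_ennrealD:
  assumes "eventually Q (at_right (ennreal s))" "0 \<le> s"
  obtains d where "0 < d" "\<And>r. s < r \<Longrightarrow> r < s + d \<Longrightarrow> Q (ennreal r)"
proof -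
  have "ennreal s < \<top>" by simp
  from assms(1)[unfolded eventually_at_right[OF this]]
  obtain b where b: "ennreal s < b" "\<And>y. ennreal s < y \<Longrightarrow> y < b \<Longrightarrow> Q y" by blast
  show ?thesis
  proof (cases b)
    case (real b')
    then have "s < b'" using b(1) assms(2) by (simp add: ennreal_less_iff)
    then show ?thesis using real assms(2)
      by (intro that[of "b' - s"] b(2)) (auto simp: ennreal_less_iff)
  next
    case top
    then show ?thesis using assms(2) by (intro that[of 1] b(2)) (auto simp: ennreal_less_iff)
  qed
qed

section \<open>Jumps seen on a fine grid\<close>

context hunt_process
begin

text \<open>The description operator in \<open>left_limit\<close> is justified: a limit exists by
  assumption, and it is unique because the compactification is Hausdorff and the left neighbourhoods
  of a positive time are nontrivial.\<close>

lemma left_limit_limitin: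
  assumes "\<omega> \<in> space \<M>" "0 < s"
  shows "limitin cemetery_top (\<lambda>s. X s \<omega>) (left_limit X (ennreal s) \<omega>) (at_left (ennreal s))"
proof -
  have s: "0 < ennreal s" "ennreal s < \<infinity>" using assms by auto
  obtain l where l: "limitin cemetery_top (\<lambda>s. X s \<omega>) l (at_left (ennreal s))"
    using left_limits[OF assms(1) s] by auto
  have nt: "\<not> trivial_limit (at_left (ennreal s))"
  proof
    assume "trivial_limit (at_left (ennreal s))"
    then have "eventually (\<lambda>_. False) (at_left (ennreal s))" by simp
    then obtain b where b: "b < ennreal s" "\<And>y. b < y \<Longrightarrow> y < ennreal s \<Longrightarrow> False"
      using s(1) by (auto simp: eventually_at_left)
    show False using dense[OF b(1)] b(2) by blast
  qed
  show ?thesis unfolding left_limit_def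
  proof (rule theI)
    show "limitin cemetery_top (\<lambda>s. X s \<omega>) l (at_left (ennreal s))" by (rule l)
  next
    fix l' assume "limitin cemetery_top (\<lambda>s. X s \<omega>) l' (at_left (ennreal s))"
    then show "l' = l"
      using limitin_Hausdorff_unique[OF _ l nt Hausdorff_cemetery_top] by blast
  qed
qed

lemma left_limit_SomeD:
  assumes "\<omega> \<in> space \<M>" "0 < s" "left_limit X (ennreal s) \<omega> = Some u" "open U" "u \<in> U"
  obtains d where "0 < d" "\<And>r. s - d < r \<Longrightarrow> r < s \<Longrightarrow> 0 \<le> r \<Longrightarrow> X (ennreal r) \<omega> \<in> Some ` U"
proof -
  have "eventually (\<lambda>r. X r \<omega> \<in> Some ` U) (at_left (ennreal s))"
    using left_limit_limitin[OF assms(1,2)] assms(3-5) openin_cemetery_top_Some[OF assms(4)]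
    by (auto simp: limitin_def)
  from eventually_at_left_ennrealD[OF this assms(2)] that show ?thesis by blast
qed

lemma right_limitD:
  assumes "\<omega> \<in> space \<M>" "0 \<le> s" "openin cemetery_top U" "X (ennreal s) \<omega> \<in> U"
  obtains d where "0 < d" "\<And>r. s \<le> r \<Longrightarrow> r < s + d \<Longrightarrow> X (ennreal r) \<omega> \<in> U"
proof -
  have "eventually (\<lambda>r. X r \<omega> \<in> U) (at_right (ennreal s))"
    using right_continuous[OF assms(1), of "ennreal s"] assms(3,4) by (auto simp: limitin_def)
  from eventually_at_right_ennrealD[OF this assms(2)]
  obtain d where d: "0 < d" "\<And>r. s < r \<Longrightarrow> r < s + d \<Longrightarrow> X (ennreal r) \<omega> \<in> U" by blast
  show ?thesis
  proof (rule that[OF d(1)])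
    fix r assume "s \<le> r" "r < s + d"
    then show "X (ennreal r) \<omega> \<in> U" using d(2)[of r] assms(4) by (cases "r = s") auto
  qed
qed

text \<open>The left limit controls the path just before \<open>s\<close>, right continuity controls
  it on [s, s + d); so any close pair of times straddling \<open>s\<close> sees the jump. The case
  \<open>r = s\<close> is included because a grid point may hit \<open>s\<close>, and
  \<open>d \<le> s\<close> keeps \<open>l\<close> positive.\<close>

lemma jump_localize:
  assumes "\<omega> \<in> space \<M>" "0 < s" "open Q"
    and jump: "off_ind Q (left_limit X (ennreal s) \<omega>) (X (ennreal s) \<omega>) \<noteq> 0"
  obtains d where "0 < d" "d \<le> s" "\<And>l r. s - d < l \<Longrightarrow> l < s \<Longrightarrow> s \<le> r \<Longrightarrow> r < s + d \<Longrightarrow>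
    off_ind Q (X (ennreal l) \<omega>) (X (ennreal r) \<omega>) = 1"
proof -
  obtain u v where uv: "left_limit X (ennreal s) \<omega> = Some u" "X (ennreal s) \<omega> = Some v" "(u, v) \<in> Q"
    using jump
    by (cases "left_limit X (ennreal s) \<omega>"; cases "X (ennreal s) \<omega>") (auto split: split_indicator_asm)
  obtain U V where UV: "open U" "open V" "u \<in> U" "v \<in> V" "U \<times> V \<subseteq> Q"
    using open_prod_elim[OF assms(3) uv(3)] by (metis mem_Sigma_iff)
  obtain d1 where d1: "0 < d1" "\<And>r. s - d1 < r \<Longrightarrow> r < s \<Longrightarrow> 0 \<le> r \<Longrightarrow> X (ennreal r) \<omega> \<in> Some ` U"
    using left_limit_SomeD[OF assms(1,2) uv(1) UV(1,3)] by blast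
  obtain d2 where d2: "0 < d2" "\<And>r. s \<le> r \<Longrightarrow> r < s + d2 \<Longrightarrow> X (ennreal r) \<omega> \<in> Some ` V"
    using right_limitD[OF assms(1), of s "Some ` V"] openin_cemetery_top_Some[OF UV(2)] uv(2) UV(4) assms(2)
    by (metis imageI less_imp_le)
  show ?thesis
  proof (rule that[of "min s (min d1 d2)"])
    fix l r assume lr: "s - min s (min d1 d2) < l" "l < s" "s \<le> r" "r < s + min s (min d1 d2)"
    then have "X (ennreal l) \<omega> \<in> Some ` U" "X (ennreal r) \<omega> \<in> Some ` V"
      using d1(2)[of l] d2(2)[of r] by auto
    then show "off_ind Q (X (ennreal l) \<omega>) (X (ennreal r) \<omega>) = 1"
      using UV(5) by (auto split: split_indicator)
  qed (use assms(2) d1(1) d2(1) in auto)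
qed

text \<open>Averaging over the shift \<open>\<theta>\<close> of the grid turns the sum over the grid into the time integral in \<open>levy_le_liminf\<close> below.\<close>

lemma finite_jumps_le_discrete:
  assumes \<omega>: "\<omega> \<in> space \<M>" and T: "0 < T" and Q: "open Q" and \<theta>: "0 < \<theta>" "\<theta> < 1"
    and S: "finite S" "S \<subseteq> {0<..T}"
  shows "eventually (\<lambda>k. (\<Sum>s\<in>S. off_ind Q (left_limit X (ennreal s) \<omega>) (X (ennreal s) \<omega>)) \<le>
    (\<Sum>i\<le>k. off_ind Q (X (ennreal ((real i + \<theta>) * (T / real (Suc k)))) \<omega>)
      (X (ennreal ((real i + 1 + \<theta>) * (T / real (Suc k)))) \<omega>))) sequentially"
proof -
  let ?J = "\<lambda>s. off_ind Q (left_limit X (ennreal s) \<omega>) (X (ennreal s) \<omega>)"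
  define S' where "S' = {s \<in> S. ?J s \<noteq> 0}"
  have fin: "finite S'" and sub: "S' \<subseteq> {0<..T}" using S by (auto simp: S'_def)
  have J_le: "?J s \<le> 1" for s
    by (cases "left_limit X (ennreal s) \<omega>"; cases "X (ennreal s) \<omega>") (auto split: split_indicator)
  have "(\<Sum>s\<in>S. ?J s) = (\<Sum>s\<in>S'. ?J s)"
    using S(1) by (intro sum.mono_neutral_right) (auto simp: S'_def)
  also have "\<dots> \<le> (\<Sum>s\<in>S'. 1)" by (intro sum_mono J_le)
  finally have sum_le: "(\<Sum>s\<in>S. ?J s) \<le> of_nat (card S')" by simp
  have "\<exists>d. 0 < d \<and> d \<le> s \<and> (\<forall>l r. s - d < l \<longrightarrow> l < s \<longrightarrow> s \<le> r \<longrightarrow> r < s + d \<longrightarrow>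
      off_ind Q (X (ennreal l) \<omega>) (X (ennreal r) \<omega>) = 1)" if "s \<in> S'" for s
  proof -
    have s: "0 < s" "?J s \<noteq> 0" using that sub by (auto simp: S'_def)
    obtain e where "0 < e" "e \<le> s" "\<And>l r. s - e < l \<Longrightarrow> l < s \<Longrightarrow> s \<le> r \<Longrightarrow> r < s + e \<Longrightarrow>
        off_ind Q (X (ennreal l) \<omega>) (X (ennreal r) \<omega>) = 1"
      by (rule jump_localize[OF \<omega> s(1) Q s(2)]) blast
    then show ?thesis by blast
  qed
  then obtain d where d: "\<And>s. s \<in> S' \<Longrightarrow> 0 < d s" "\<And>s. s \<in> S' \<Longrightarrow> d s \<le> s"
    "\<And>s l r. s \<in> S' \<Longrightarrow> s - d s < l \<Longrightarrow> l < s \<Longrightarrow> s \<le> r \<Longrightarrow> r < s + d s \<Longrightarrow>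
      off_ind Q (X (ennreal l) \<omega>) (X (ennreal r) \<omega>) = 1"
    using bchoice[of S' "\<lambda>s d. 0 < d \<and> d \<le> s \<and> (\<forall>l r. s - d < l \<longrightarrow> l < s \<longrightarrow> s \<le> r \<longrightarrow> r < s + d \<longrightarrow>
      off_ind Q (X (ennreal l) \<omega>) (X (ennreal r) \<omega>) = 1)"] by blast
  \<comment> \<open>A mesh below \<open>D\<close> separates the jump times into different cells and
    stays below every localisation radius.\<close>
  define D where "D = Min (insert 1 (d ` S' \<union> (\<lambda>(s, s'). \<bar>s - s'\<bar>) ` {(s, s') \<in> S' \<times> S'. s \<noteq> s'}))"
  have finD: "finite (insert 1 (d ` S' \<union> (\<lambda>(s, s'). \<bar>s - s'\<bar>) ` {(s, s') \<in> S' \<times> S'. s \<noteq> s'}))"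
    using fin by (auto intro!: finite_imageI intro: finite_subset[of _ "S' \<times> S'"])
  have D0: "0 < D" unfolding D_def using finD d(1) by (subst Min_gr_iff) auto
  have Dd: "D \<le> d s" if "s \<in> S'" for s unfolding D_def using finD that by (intro Min_le) auto
  have Dg: "D \<le> \<bar>s - s'\<bar>" if "s \<in> S'" "s' \<in> S'" "s \<noteq> s'" for s s'
    unfolding D_def using finD that by (intro Min_le) (auto intro!: image_eqI[of _ _ "(s, s')"])
  have "(\<lambda>k. T / real (Suc k)) \<longlonglongrightarrow> 0"
    using LIMSEQ_Suc[OF lim_const_over_n[of T]] by simp
  then have "eventually (\<lambda>k. T / real (Suc k) < D) sequentially"
    using D0 by (rule order_tendstoD)
  then show ?thesis
  proof eventually_elim
    case (elim k)
    define h where "h = T / real (Suc k)"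
    have h: "0 < h" "h < D" using T elim by (auto simp: h_def)
    \<comment> \<open>The index of the cell, open on the left and closed on the right, that contains
      \<open>s\<close>.\<close>
    define i where "i s = nat (\<lceil>s / h - \<theta>\<rceil> - 1)" for s
    \<comment> \<open>\<open>h < D \<le> d s \<le> s\<close> puts \<open>s\<close> to the right of
      the first grid point \<open>\<theta> * h\<close>, so \<open>nat\<close> does not truncate in
      the definition of \<open>i\<close>.\<close>
    have c0: "0 < s / h - \<theta>" if "s \<in> S'" for s
    proof -
      have "h < s" using h Dd[OF that] d(2)[OF that] by linarith
      then have "1 < s / h" using h by simp
      then show ?thesis using \<theta> by linarith
    qed
    have i_eq: "real (i s) = of_int \<lceil>s / h - \<theta>\<rceil> - 1" if "s \<in> S'" for s
      using c0[OF that] by (simp add: i_def)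
    have i_lt: "(real (i s) + \<theta>) * h < s" and i_ge: "s \<le> (real (i s) + 1 + \<theta>) * h" if "s \<in> S'" for s
    proof -
      have "real (i s) < s / h - \<theta>" "s / h - \<theta> \<le> real (i s) + 1"
        unfolding i_eq[OF that] by linarith+
      then show "(real (i s) + \<theta>) * h < s" "s \<le> (real (i s) + 1 + \<theta>) * h"
        using h by (auto simp: field_simps)
    qed
    have i_k: "i s \<le> k" if "s \<in> S'" for s
    proof -
      have "s / h \<le> T / h" using that sub h by (intro divide_right_mono) auto
      also have "\<dots> = real (Suc k)" using T by (simp add: h_def)
      finally have "s / h - \<theta> \<le> real (Suc k)" using \<theta> by linarith
      then have "\<lceil>s / h - \<theta>\<rceil> \<le> int (Suc k)" by (simp add: ceiling_le_iff)
      then show ?thesis by (simp add: i_def nat_le_iff)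
    qed
    have inj: "inj_on i S'"
    proof (rule inj_onI, rule ccontr)
      fix s s' assume s: "s \<in> S'" "s' \<in> S'" "i s = i s'" "s \<noteq> s'"
      have "\<bar>s - s'\<bar> < h"
        using i_lt[OF s(1)] i_ge[OF s(1)] i_lt[OF s(2)] i_ge[OF s(2)] s(3) by (simp add: algebra_simps abs_less_iff)
      then show False using Dg[OF s(1,2,4)] h by linarith
    qed
    let ?K = "\<lambda>i. off_ind Q (X (ennreal ((real i + \<theta>) * h)) \<omega>) (X (ennreal ((real i + 1 + \<theta>) * h)) \<omega>)"
    have one: "?K (i s) = 1" if "s \<in> S'" for s
    proof (rule d(3)[OF that])
      show "s - d s < (real (i s) + \<theta>) * h"
        using i_ge[OF that] h Dd[OF that] by (simp add: algebra_simps)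
      show "(real (i s) + 1 + \<theta>) * h < s + d s"
        using i_lt[OF that] h Dd[OF that] by (simp add: algebra_simps)
    qed (use i_lt[OF that] i_ge[OF that] in auto)
    have "(\<Sum>s\<in>S. ?J s) \<le> (\<Sum>s\<in>S'. ?K (i s))" using sum_le one by simp
    also have "\<dots> = (\<Sum>j\<in>i ` S'. ?K j)" using sum.reindex[OF inj, of ?K] by simp
    also have "\<dots> \<le> (\<Sum>j\<le>k. ?K j)" using i_k by (intro sum_mono2) auto
    finally show ?case by (simp add: h_def)
  qed
qed

lemma jumps_le_liminf:
  assumes \<omega>: "\<omega> \<in> space \<M>" and T: "0 < T" and Q: "open Q" and \<theta>: "0 < \<theta>" "\<theta> < 1"
  shows "(\<Sum>\<^sub>\<infinity>s\<in>{0<..T}. off_ind Q (left_limit X (ennreal s) \<omega>) (X (ennreal s) \<omega>)) \<le>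
    liminf (\<lambda>k. \<Sum>i\<le>k. off_ind Q (X (ennreal ((real i + \<theta>) * (T / real (Suc k)))) \<omega>)
      (X (ennreal ((real i + 1 + \<theta>) * (T / real (Suc k)))) \<omega>))"
proof -
  have "(\<Sum>\<^sub>\<infinity>s\<in>{0<..T}. off_ind Q (left_limit X (ennreal s) \<omega>) (X (ennreal s) \<omega>)) =
      (SUP S\<in>{S. finite S \<and> S \<subseteq> {0<..T}}. \<Sum>s\<in>S. off_ind Q (left_limit X (ennreal s) \<omega>) (X (ennreal s) \<omega>))"
    by (rule nonneg_infsum_complete) simp
  also have "\<dots> \<le> liminf (\<lambda>k. \<Sum>i\<le>k. off_ind Q (X (ennreal ((real i + \<theta>) * (T / real (Suc k)))) \<omega>)
      (X (ennreal ((real i + 1 + \<theta>) * (T / real (Suc k)))) \<omega>))"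
  proof (rule SUP_least)
    fix S assume "S \<in> {S. finite S \<and> S \<subseteq> {0<..T}}"
    then show "(\<Sum>s\<in>S. off_ind Q (left_limit X (ennreal s) \<omega>) (X (ennreal s) \<omega>)) \<le>
      liminf (\<lambda>k. \<Sum>i\<le>k. off_ind Q (X (ennreal ((real i + \<theta>) * (T / real (Suc k)))) \<omega>)
      (X (ennreal ((real i + 1 + \<theta>) * (T / real (Suc k)))) \<omega>))"
      using finite_jumps_le_discrete[OF assms] by (intro Liminf_bounded) auto
  qed
  finally show ?thesis .
qed

end

section \<open>Two-time laws and joint measurability in time\<close>

context hunt_density
begin

text \<open>On rectangles this is \<open>markov_emeasure\<close>; a Dynkin class argument extends it
  to the product sigma-algebra. Measurability belongs to the same induction because the complement
  and union steps integrate the functions of the sets already treated.\<close>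

lemma off_ind_measurable_integral:
  assumes a: "0 < a" and h: "0 < h" and Q: "Q \<in> sets (borel \<Otimes>\<^sub>M borel)"
  shows "(\<lambda>\<omega>. off_ind Q (X (ennreal a) \<omega>) (X (ennreal (a + h)) \<omega>)) \<in> borel_measurable (P (Some x)) \<and>
    (\<integral>\<^sup>+\<omega>. off_ind Q (X (ennreal a) \<omega>) (X (ennreal (a + h)) \<omega>) \<partial>P (Some x)) =
    (\<integral>\<^sup>+w. p a x w * (\<integral>\<^sup>+y. p h w y * indicator Q (w, y) \<partial>m) \<partial>m)"
    (is "?f Q \<in> _ \<and> ?I Q = ?R Q")
proof -
  interpret Px: prob_space "P (Some x)" by (rule prob_space_P)
  note [measurable (raw)] = p_meas
  let ?G = "{A \<times> B | A B. A \<in> sets (borel :: 'a measure) \<and> B \<in> sets (borel :: 'a measure)}"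
  have rect: "?f (A \<times> B) \<in> borel_measurable (P (Some x)) \<and> ?I (A \<times> B) = ?R (A \<times> B)"
    if A: "A \<in> sets borel" and B: "B \<in> sets borel" for A B
  proof -
    note [measurable] = A B
    let ?S = "{\<omega> \<in> space \<M>. X (ennreal a) \<omega> \<in> Some ` A} \<inter> {\<omega> \<in> space \<M>. X (ennreal (a + h)) \<omega> \<in> Some ` B}"
    have S: "?S \<in> sets (P (Some x))" using X_in_sets A B by blast
    have eq: "off_ind (A \<times> B) (X (ennreal a) \<omega>) (X (ennreal (a + h)) \<omega>) = indicator ?S \<omega>"
      if "\<omega> \<in> space (P (Some x))" for \<omega>
      using that by (cases "X (ennreal a) \<omega>"; cases "X (ennreal (a + h)) \<omega>")
        (auto simp: space_P split: split_indicator)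
    have "?f (A \<times> B) \<in> borel_measurable (P (Some x))"
      using S by (subst measurable_cong[OF eq]) auto
    moreover have "?I (A \<times> B) = emeasure (P (Some x)) ?S"
      using S by (subst nn_integral_cong[OF eq]) auto
    moreover have "?R (A \<times> B) = (\<integral>\<^sup>+w. p a x w * (indicator A w * (\<integral>\<^sup>+y. p h w y * indicator B y \<partial>m)) \<partial>m)"
      by (intro nn_integral_cong arg_cong2[where f="(*)"]) (simp_all add: indicator_times nn_integral_cmult mult.left_commute)
    ultimately show ?thesis using markov_emeasure[OF a h A B, of x] by simp
  qed
  have Int: "Int_stable ?G" using Int_stable_pair_measure_generator[of borel borel] by simp
  have sub: "?G \<subseteq> Pow UNIV" by auto
  have "Q \<in> sigma_sets UNIV ?G" using Q by (simp add: sets_pair_measure)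
  from Int sub this show ?thesis
  proof (induction rule: sigma_sets_induct_disjoint)
    case (basic A)
    then show ?case using rect by blast
  next
    case empty
    have "off_ind {} u v = 0" for u v :: "'a option" by (cases u; cases v) auto
    then show ?case by simp
  next
    case (compl A)
    have A: "A \<in> sets (borel \<Otimes>\<^sub>M borel)" using compl(1) by (simp add: sets_pair_measure)
    have A': "A \<in> sets (m \<Otimes>\<^sub>M m)" using A sets_m by (metis sets_pair_measure_cong)
    note [measurable] = conjunct1[OF compl(2)] conjunct1[OF rect[of UNIV UNIV, simplified]] A
    have "off_ind (UNIV - A) u v = off_ind UNIV u v - off_ind A u v" for u v :: "'a option"
      by (cases u; cases v) (auto split: split_indicator)
    then have meas: "?f (UNIV - A) \<in> borel_measurable (P (Some x))" by simp
    have sum: "off_ind (UNIV - A) u v + off_ind A u v = off_ind UNIV u v" for u v :: "'a option"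
      by (cases u; cases v) (auto split: split_indicator)
    have "?I (UNIV - A) + ?I A = ?I UNIV"
      using meas by (subst nn_integral_add[symmetric]) (auto simp: sum)
    also have "\<dots> = ?R UNIV" using rect[of UNIV UNIV] by simp
    also have "\<dots> = ?R (UNIV - A) + ?R A"
    proof -
      have ind: "indicator (UNIV - A) q + indicator A q = (indicator UNIV q :: ennreal)" for q by (auto split: split_indicator)
      have "?R (UNIV - A) + ?R A = (\<integral>\<^sup>+w. p a x w * (\<integral>\<^sup>+y. p h w y * indicator (UNIV - A) (w, y) \<partial>m) +
          p a x w * (\<integral>\<^sup>+y. p h w y * indicator A (w, y) \<partial>m) \<partial>m)"
        by (rule nn_integral_add[symmetric]) measurable
      also have "\<dots> = (\<integral>\<^sup>+w. p a x w * (\<integral>\<^sup>+y. p h w y * indicator (UNIV - A) (w, y) + p h w y * indicator A (w, y) \<partial>m) \<partial>m)"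
        by (subst nn_integral_add) (simp_all add: distrib_left)
      also have "\<dots> = ?R UNIV" unfolding distrib_left[symmetric] ind ..
      finally show ?thesis ..
    qed
    finally have "?I (UNIV - A) + ?I A = ?R (UNIV - A) + ?I A" using compl(2) by simp
    moreover have "?I A < \<top>"
    proof -
      have "?I A \<le> (\<integral>\<^sup>+\<omega>. 1 \<partial>P (Some x))"
      proof (rule nn_integral_mono)
        fix \<omega> show "off_ind A (X (ennreal a) \<omega>) (X (ennreal (a + h)) \<omega>) \<le> 1"
          by (cases "X (ennreal a) \<omega>"; cases "X (ennreal (a + h)) \<omega>") (auto split: split_indicator)
      qed
      also have "\<dots> < \<top>" using Px.emeasure_space_1 by simp
      finally show ?thesis .
    qed
    ultimately show ?case using meas by (auto simp: add.commute[of _ "?I A"] ennreal_add_left_cancel)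
  next
    case (union A)
    have A: "A i \<in> sets (borel \<Otimes>\<^sub>M borel)" for i using union(2) by (auto simp: sets_pair_measure)
    note [measurable] = conjunct1[OF union(3)] A
    have eq: "off_ind (\<Union>i. A i) u v = (\<Sum>i. off_ind (A i) u v)" for u v
      by (cases u; cases v) (auto simp: suminf_indicator[OF union(1)])
    have "?I (\<Union>i. A i) = (\<Sum>i. ?I (A i))"
      unfolding eq by (rule nn_integral_suminf) measurable
    also have "\<dots> = (\<Sum>i. ?R (A i))" using union(3) by simp
    also have "\<dots> = ?R (\<Union>i. A i)"
      by (simp add: suminf_indicator[OF union(1), symmetric] nn_integral_suminf flip: ennreal_suminf_cmult)
    finally show ?case unfolding eq by auto
  qed
qed

lemmas off_ind_measurable = conjunct1[OF off_ind_measurable_integral]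
lemmas off_ind_integral = conjunct2[OF off_ind_measurable_integral]

text \<open>By right continuity, the path is in \<open>U\<close> at time \<open>s\<close> iff on
  some interval to the right of \<open>s\<close> all rational times see one compact set
  \<open>C n\<close> of an exhaustion of \<open>U\<close>. Compactness makes the image of
  \<open>C n\<close> closed in the compactification, which gives the converse direction.\<close>

lemma X_joint_open:
  assumes U: "open U"
  shows "Measurable.pred (borel \<Otimes>\<^sub>M P x) (\<lambda>(s, \<omega>). X (ennreal s) \<omega> \<in> Some ` U)"
proof -
  obtain C :: "nat \<Rightarrow> 'a set" where C: "\<And>n. compact (C n)" "\<And>n. C n \<subseteq> U"
    "\<And>n. C n \<subseteq> interior (C (Suc n))" "(\<Union>n. C n) = U"
    using open_Union_compact_subsets[OF U] by metis
  \<comment> \<open>\<open>max s 0\<close> mirrors the conversion \<open>ennreal\<close>, which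
    sends negative times to 0.\<close>
  let ?Q = "\<lambda>s \<omega> n k (r::rat). max s 0 < of_rat r \<longrightarrow> of_rat r < max s 0 + 1 / real (Suc k) \<longrightarrow> X (ennreal (of_rat r)) \<omega> \<in> Some ` C n"
  have eq: "X (ennreal s) \<omega> \<in> Some ` U \<longleftrightarrow> (\<exists>n k. \<forall>r. ?Q s \<omega> n k r)" if \<omega>: "\<omega> \<in> space \<M>" for s \<omega>
  proof -
    define s' where "s' = max s 0"
    have s': "0 \<le> s'" "ennreal s = ennreal s'" by (auto simp: s'_def max_def ennreal_neg)
    show ?thesis
    proof
      assume "X (ennreal s) \<omega> \<in> Some ` U"
      then obtain u n where u: "X (ennreal s') \<omega> = Some u" "u \<in> C n" using C(4) s' by auto
      then have "X (ennreal s') \<omega> \<in> Some ` interior (C (Suc n))" using C(3) by auto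
      from right_limitD[OF \<omega> s'(1) openin_cemetery_top_Some[OF open_interior] this]
      obtain d where d: "0 < d" "\<And>r. s' \<le> r \<Longrightarrow> r < s' + d \<Longrightarrow> X (ennreal r) \<omega> \<in> Some ` interior (C (Suc n))"
        by blast
      obtain k where k: "1 / real (Suc k) < d" using d(1) nat_approx_posE by blast
      have "?Q s \<omega> (Suc n) k r" for r
      proof (intro impI)
        assume "max s 0 < of_rat r" "of_rat r < max s 0 + 1 / real (Suc k)"
        then have "X (ennreal (of_rat r)) \<omega> \<in> Some ` interior (C (Suc n))"
          using k by (intro d(2)) (auto simp: s'_def)
        then show "X (ennreal (of_rat r)) \<omega> \<in> Some ` C (Suc n)" using interior_subset by blast
      qed
      then show "\<exists>n k. \<forall>r. ?Q s \<omega> n k r" by blast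
    next
      assume "\<exists>n k. \<forall>r. ?Q s \<omega> n k r"
      then obtain n k where Q: "\<And>r. ?Q s \<omega> n k r" by blast
      show "X (ennreal s) \<omega> \<in> Some ` U"
      proof (rule ccontr)
        assume "X (ennreal s) \<omega> \<notin> Some ` U"
        then have "X (ennreal s') \<omega> \<in> UNIV - Some ` C n" using C(2) s' by auto
        moreover have "openin cemetery_top (UNIV - Some ` C n)"
        proof -
          have "closedin cemetery_top (Some ` C n)"
            using C(1)[of n] by (simp add: cemetery_top_def compact_imp_closed)
          moreover have "topspace (cemetery_top :: 'a option topology) = UNIV"
            by (auto simp: cemetery_top_def) (metis option.exhaust rangeI)
          ultimately show ?thesis by (metis closedin_def)
        qed
        ultimately obtain d where d: "0 < d" "\<And>r. s' \<le> r \<Longrightarrow> r < s' + d \<Longrightarrow> X (ennreal r) \<omega> \<in> UNIV - Some ` C n"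
          using right_limitD[OF \<omega> s'(1)] by metis
        have "s' < s' + min d (1 / real (Suc k))" using d(1) by simp
        then obtain r where "s' < of_rat r" "of_rat r < s' + min d (1 / real (Suc k))"
          using of_rat_dense by blast
        then have r: "s' < of_rat r" "of_rat r < s' + d" "of_rat r < s' + 1 / real (Suc k)"
          using min.cobounded1[of d "1 / real (Suc k)"] min.cobounded2[of d "1 / real (Suc k)"] by linarith+
        then have "X (ennreal (of_rat r)) \<omega> \<in> Some ` C n" using Q[of r] unfolding s'_def by blast
        then show False using d(2)[of "of_rat r"] r by auto
      qed
    qed
  qed
  have [measurable]: "Measurable.pred (P x) (\<lambda>\<omega>. X (ennreal (of_rat r)) \<omega> \<in> Some ` C n)" for r n
    using X_in_sets[of "C n" "ennreal (of_rat r)" x] C(1)[of n]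
    by (simp add: pred_def space_P borel_compact)
  have "Measurable.pred (borel \<Otimes>\<^sub>M P x) (\<lambda>(s, \<omega>). \<exists>n k. \<forall>r. ?Q s \<omega> n k r)"
    by measurable
  moreover have "Measurable.pred (borel \<Otimes>\<^sub>M P x) (\<lambda>(s, \<omega>). \<exists>n k. \<forall>r. ?Q s \<omega> n k r) =
    Measurable.pred (borel \<Otimes>\<^sub>M P x) (\<lambda>(s, \<omega>). X (ennreal s) \<omega> \<in> Some ` U)"
  proof (rule measurable_cong)
    fix z :: "real \<times> 'w" assume "z \<in> space (borel \<Otimes>\<^sub>M P x)"
    then obtain s \<omega> where "z = (s, \<omega>)" "\<omega> \<in> space \<M>" by (auto simp: space_pair_measure space_P)
    then show "(case z of (s, \<omega>) \<Rightarrow> \<exists>n k. \<forall>r. ?Q s \<omega> n k r) = (case z of (s, \<omega>) \<Rightarrow> X (ennreal s) \<omega> \<in> Some ` U)"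
      using eq[of \<omega> s] by (simp only: case_prod_conv)
  qed
  ultimately show ?thesis by blast
qed

text \<open>The sigma-algebra generated by the images of Borel sets carries all functions
  \<open>opt_lift g\<close>; with it, no open neighbourhood of the cemetery has to be
  examined.\<close>

lemma X_joint_measurable: "(\<lambda>(s, \<omega>). X (ennreal s) \<omega>) \<in> borel \<Otimes>\<^sub>M P x \<rightarrow>\<^sub>M sigma UNIV ((`) Some ` sets borel)"
proof (rule measurable_measure_of)
  fix V assume V: "V \<in> (`) Some ` sets (borel :: 'a measure)"
  show "(\<lambda>(s, \<omega>). X (ennreal s) \<omega>) -` V \<inter> space (borel \<Otimes>\<^sub>M P x) \<in> sets (borel \<Otimes>\<^sub>M P x)"
  proof -
    let ?N = "(borel :: real measure) \<Otimes>\<^sub>M P x" and ?f = "\<lambda>(s, \<omega>). X (ennreal s) \<omega>"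
    obtain B :: "'a set" where B: "B \<in> sets borel" "V = Some ` B" using V by auto
    have basic: "?f -` (Some ` U) \<inter> space ?N \<in> sets ?N" if "open U" for U
      using X_joint_open[OF that, of x] by (simp add: pred_def vimage_def Int_def conj_commute case_prod_beta')
    have "B \<in> sigma_sets UNIV {S. open S}" using B(1) by (simp add: borel_def sets_measure_of_conv)
    then have "?f -` (Some ` B) \<inter> space ?N \<in> sets ?N"
    proof induction
      case (Compl a)
      have "?f -` (Some ` (UNIV - a)) \<inter> space ?N = (?f -` (Some ` UNIV) \<inter> space ?N) - (?f -` (Some ` a) \<inter> space ?N)" by (auto simp: image_iff)
      then show ?case using basic[of UNIV] Compl.IH by auto
    next
      case (Union a)
      have "?f -` (Some ` (\<Union>i. a i)) \<inter> space ?N = (\<Union>i. ?f -` (Some ` a i) \<inter> space ?N)" unfolding image_UN by blast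
      moreover have "(\<Union>i. ?f -` (Some ` a i) \<inter> space ?N) \<in> sets ?N"
        by (rule sets.countable_nat_UN) (use Union.IH in blast)
      ultimately show ?case by (simp only:)
    qed (auto intro: basic)
    then show ?thesis using B by simp
  qed
qed auto

lemma opt_lift_measurable':
  fixes g :: "'a::euclidean_space \<Rightarrow> ennreal"
  assumes g: "g \<in> borel_measurable borel"
  shows "opt_lift g \<in> borel_measurable (sigma UNIV ((`) Some ` sets borel))"
proof (rule measurableI)
  let ?N = "sigma UNIV ((`) Some ` sets (borel :: 'a measure))"
  have I: "Some ` B \<in> sets ?N" if "B \<in> sets borel" for B :: "'a set"
    using that by (auto simp: sets_measure_of_conv intro!: sigma_sets.Basic)
  have sp: "space ?N = UNIV" by (simp add: space_measure_of_conv)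
  fix A :: "ennreal set" assume A: "A \<in> sets borel"
  have "opt_lift g -` A = Some ` (g -` A) \<union> (if 0 \<in> A then UNIV - Some ` UNIV else {})"
  proof (intro set_eqI)
    fix v show "v \<in> opt_lift g -` A \<longleftrightarrow> v \<in> Some ` (g -` A) \<union> (if 0 \<in> A then UNIV - Some ` UNIV else {})"
      by (cases v) auto
  qed
  moreover have "Some ` (g -` A) \<in> sets ?N"
    using measurable_sets[OF g A] by (intro I) simp
  moreover have "UNIV - Some ` (UNIV :: 'a set) \<in> sets ?N"
    using sets.compl_sets[OF I[of "UNIV :: 'a set"]] sp by simp
  ultimately have "opt_lift g -` A \<in> sets ?N" using sets.Un[of _ ?N] by (cases "0 \<in> A") simp_all
  then show "opt_lift g -` A \<inter> space ?N \<in> sets ?N" using sp by simp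
qed simp

text \<open>Fubini by joint measurability; the time 0, at which there is no density, is a null
  set.\<close>

lemma expectation_time_integral:
  assumes g: "g \<in> borel_measurable borel"
  shows "(\<integral>\<^sup>+\<omega>. (\<integral>\<^sup>+s\<in>{0..T}. opt_lift g (X (ennreal s) \<omega>) \<partial>lborel) \<partial>P (Some x)) =
    (\<integral>\<^sup>+s\<in>{0<..T}. (\<integral>\<^sup>+y. p s x y * g y \<partial>m) \<partial>lborel)"
proof -
  interpret Px: prob_space "P (Some x)" by (rule prob_space_P)
  interpret tP: pair_sigma_finite "lborel :: real measure" "P (Some x)" ..
  have [measurable]: "(\<lambda>(s, \<omega>). opt_lift g (X (ennreal s) \<omega>)) \<in> borel_measurable (lborel \<Otimes>\<^sub>M P (Some x))"
    using measurable_compose[OF X_joint_measurable[of "Some x"] opt_lift_measurable'[OF g]]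
    by (simp add: case_prod_beta' cong: measurable_cong_sets)
  have "(\<integral>\<^sup>+\<omega>. (\<integral>\<^sup>+s\<in>{0..T}. opt_lift g (X (ennreal s) \<omega>) \<partial>lborel) \<partial>P (Some x)) =
      (\<integral>\<^sup>+s. (\<integral>\<^sup>+\<omega>. opt_lift g (X (ennreal s) \<omega>) * indicator {0..T} s \<partial>P (Some x)) \<partial>lborel)"
    by (rule tP.Fubini') measurable
  also have "\<dots> = (\<integral>\<^sup>+s\<in>{0<..T}. (\<integral>\<^sup>+y. p s x y * g y \<partial>m) \<partial>lborel)"
  proof (rule nn_integral_cong_AE)
    have "AE s in (lborel :: real measure). s \<noteq> 0" by (rule AE_lborel_singleton)
    then show "AE s in lborel. (\<integral>\<^sup>+\<omega>. opt_lift g (X (ennreal s) \<omega>) * indicator {0..T} s \<partial>P (Some x)) =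
      (\<integral>\<^sup>+y. p s x y * g y \<partial>m) * indicator {0<..T} s"
    proof eventually_elim
      case (elim s)
      then show ?case
        using expectation_X[of s g x] g
        by (auto split: split_indicator)
    qed
  qed
  finally show ?thesis .
qed

end

lemma sum_interval_indicator_le:
  fixes h s :: real
  assumes "0 < h"
  shows "(\<Sum>i\<le>k. indicator {real i * h<..<(real i + 1) * h} s) \<le> (indicator {0<..real (Suc k) * h} s :: ennreal)"
proof (induction k)
  case (Suc k)
  have "(\<Sum>i\<le>Suc k. indicator {real i * h<..<(real i + 1) * h} s) \<le>
      (indicator {0<..real (Suc k) * h} s :: ennreal) + indicator {real (Suc k) * h<..<(real (Suc k) + 1) * h} s"
    using Suc by (simp add: add_right_mono)
  also have "\<dots> \<le> indicator {0<..real (Suc (Suc k)) * h} s"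
  proof -
    have "real (Suc k) * h \<le> real (Suc (Suc k)) * h" "0 < real (Suc k) * h" using assms by auto
    then show ?thesis by (auto split: split_indicator simp: algebra_simps)
  qed
  finally show ?case .
qed (auto split: split_indicator)

section \<open>Chapman-Kolmogorov and short-time lower bounds\<close>

locale hunt_jump_density = hunt_density \<M> \<F> X P m p
  for \<M> :: "'w measure" and \<F> :: "ennreal \<Rightarrow> 'w measure"
    and X :: "ennreal \<Rightarrow> 'w \<Rightarrow> 'a::euclidean_space option" and P :: "'a option \<Rightarrow> 'w measure"
    and m :: "'a measure" and p +
  fixes n :: "'a \<Rightarrow> 'a \<Rightarrow> ennreal"
  assumes open_pos: "\<And>U. open U \<Longrightarrow> U \<noteq> {} \<Longrightarrow> emeasure m U \<noteq> 0"
    and p_cont_right: "\<And>t x y (f :: nat \<Rightarrow> 'a). 0 < t \<Longrightarrow> f \<longlonglongrightarrow> y \<Longrightarrow> (\<lambda>n. p t x (f n)) \<longlonglongrightarrow> p t x y"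
    and p_sup: "\<And>t. 0 < t \<Longrightarrow> \<exists>c. \<forall>x y. p t x y \<le> ennreal c"
    and n_kernel: "sp_kernel n"
    and levy': "\<And>Q x T. open Q \<Longrightarrow> (\<And>u. (u, u) \<notin> Q) \<Longrightarrow> 0 < T \<Longrightarrow>
      (\<integral>\<^sup>+\<omega>. (\<Sum>\<^sub>\<infinity>s\<in>{0<..T}. off_ind Q (left_limit X (ennreal s) \<omega>) (X (ennreal s) \<omega>)) \<partial>P (Some x)) =
      (\<integral>\<^sup>+\<omega>. (\<integral>\<^sup>+s\<in>{0..T}. opt_lift (\<lambda>u. \<integral>\<^sup>+y. n u y * indicator Q (u, y) \<partial>m) (X (ennreal s) \<omega>) \<partial>lborel)
        \<partial>P (Some x))"
begin

lemmas n_meas = sp_kernel_measurable[OF n_kernel]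

text \<open>By the Markov property both sides are densities of the same measure, hence equal almost
  everywhere. As \<open>m\<close> charges every open set, each \<open>z\<close> is a limit of points
  of equality, and both sides are continuous in \<open>z\<close>: the left one by dominated
  convergence, \<open>p h\<close> being bounded.\<close>

lemma chapman_kolmogorov:
  assumes a: "0 < a" and h: "0 < h"
  shows "(\<integral>\<^sup>+w. p a x w * p h w z \<partial>m) = p (a + h) x z"
proof -
  note [measurable (raw)] = p_meas
  let ?f = "\<lambda>y. \<integral>\<^sup>+w. p a x w * p h w y \<partial>m"
  have eq: "density m (p (a + h) x) = density m ?f"
  proof (rule measure_eqI)
    fix B assume "B \<in> sets (density m (p (a + h) x))"
    then have B[measurable]: "B \<in> sets borel" by (simp add: sets_m)
    then have Bm: "B \<in> sets m" by (simp add: sets_m)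
    have "emeasure (density m (p (a + h) x)) B = (\<integral>\<^sup>+y\<in>B. p (a + h) x y \<partial>m)"
      using Bm by (intro emeasure_density) measurable
    also have "\<dots> = emeasure (P (Some x)) {\<omega> \<in> space (P (Some x)). X (ennreal (a + h)) \<omega> \<in> Some ` B}"
      using p_law[OF _ B, of "a + h" x] a h by simp
    \<comment> \<open>The cemetery is absorbing, so a path alive at \<open>a + h\<close> was alive
      at \<open>a\<close>.\<close>
    also have "{\<omega> \<in> space (P (Some x)). X (ennreal (a + h)) \<omega> \<in> Some ` B} =
       {\<omega> \<in> space \<M>. X (ennreal a) \<omega> \<in> Some ` UNIV} \<inter> {\<omega> \<in> space \<M>. X (ennreal (a + h)) \<omega> \<in> Some ` B}"
    proof -
      have "X (ennreal a) \<omega> \<in> Some ` UNIV" if "\<omega> \<in> space \<M>" "X (ennreal (a + h)) \<omega> \<in> Some ` B" for \<omega>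
        using cemetery_absorbing[OF that(1), of "ennreal a" "ennreal (a + h)"] that(2) a h
        by (cases "X (ennreal a) \<omega>") (auto simp: ennreal_leI)
      then show ?thesis by (auto simp: space_P)
    qed
    also have "emeasure (P (Some x)) \<dots> =
       (\<integral>\<^sup>+w. p a x w * (indicator UNIV w * (\<integral>\<^sup>+y. p h w y * indicator B y \<partial>m)) \<partial>m)"
      by (rule markov_emeasure[OF a h _ B]) simp
    also have "\<dots> = (\<integral>\<^sup>+w. (\<integral>\<^sup>+y. p a x w * (p h w y * indicator B y) \<partial>m) \<partial>m)"
      by (simp add: nn_integral_cmult)
    also have "\<dots> = (\<integral>\<^sup>+y. (\<integral>\<^sup>+w. p a x w * (p h w y * indicator B y) \<partial>m) \<partial>m)"
      by (rule swap_mm[symmetric]) measurable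
    also have "\<dots> = (\<integral>\<^sup>+y\<in>B. ?f y \<partial>m)"
      by (simp add: nn_integral_multc mult.assoc[symmetric])
    also have "\<dots> = emeasure (density m ?f) B"
      using Bm by (intro emeasure_density[symmetric]) measurable
    finally show "emeasure (density m (p (a + h) x)) B = emeasure (density m ?f) B" .
  qed simp
  have AE: "AE y in m. p (a + h) x y = ?f y"
    by (rule density_unique[OF _ _ eq]) measurable
  have "\<exists>y. dist z y < e \<and> p (a + h) x y = ?f y" if "0 < e" for e
  proof (rule ccontr)
    assume neg: "\<not> ?thesis"
    have "ball z e \<subseteq> {y \<in> space m. \<not> p (a + h) x y = ?f y}"
      using neg by (auto simp: space_m)
    moreover obtain N where "{y \<in> space m. \<not> p (a + h) x y = ?f y} \<subseteq> N" "emeasure m N = 0" "N \<in> sets m"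
      using AE by (rule AE_E)
    ultimately have "ball z e \<subseteq> N" by blast
    from emeasure_mono[OF this \<open>N \<in> sets m\<close>] have "emeasure m (ball z e) = 0"
      using \<open>emeasure m N = 0\<close> by simp
    then show False using open_pos[of "ball z e"] that by auto
  qed
  then have "\<exists>y. dist z y < 1 / real (Suc k) \<and> p (a + h) x y = ?f y" for k by simp
  then obtain y where y: "\<And>k. dist z (y k) < 1 / real (Suc k)" "\<And>k. p (a + h) x (y k) = ?f (y k)" by metis
  have yz: "y \<longlonglongrightarrow> z"
  proof (rule metric_LIMSEQ_I)
    fix e :: real assume "0 < e"
    then obtain N where N: "1 / real (Suc N) < e" using nat_approx_posE by blast
    have "dist (y k) z < e" if "k \<ge> N" for k
    proof -
      have "1 / real (Suc k) \<le> 1 / real (Suc N)" using that by (intro divide_left_mono) auto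
      then show ?thesis using y(1)[of k] N by (simp add: dist_commute)
    qed
    then show "\<exists>N. \<forall>k\<ge>N. dist (y k) z < e" by blast
  qed
  obtain c where c: "\<And>x y. p h x y \<le> ennreal c" using p_sup[OF h] by blast
  have "(\<lambda>k. ?f (y k)) \<longlonglongrightarrow> ?f z"
  proof (rule nn_integral_dominated_convergence[where w="\<lambda>w. p a x w * ennreal c"])
    show "AE w in m. p a x w * p h w (y j) \<le> p a x w * ennreal c" for j
      using c by (intro AE_I2 mult_left_mono) auto
    have "(\<integral>\<^sup>+w. p a x w * ennreal c \<partial>m) = (\<integral>\<^sup>+w. p a x w \<partial>m) * ennreal c" by (rule nn_integral_multc) measurable
    also have "\<dots> \<le> 1 * ennreal c" by (intro mult_right_mono p_mass') auto
    also have "\<dots> < \<infinity>" by simp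
    finally show "(\<integral>\<^sup>+w. p a x w * ennreal c \<partial>m) < \<infinity>" .
    have fin: "p a x w < \<top>" for w
    proof -
      obtain c' where "p a x w \<le> ennreal c'" using p_sup[OF a] by blast
      then show ?thesis by (rule order_le_less_trans) simp
    qed
    show "AE w in m. (\<lambda>j. p a x w * p h w (y j)) \<longlonglongrightarrow> p a x w * p h w z"
      using p_cont_right[OF h yz] fin by (intro AE_I2 ennreal_tendsto_cmult) auto
  qed measurable
  moreover have "(\<lambda>k. ?f (y k)) \<longlonglongrightarrow> p (a + h) x z"
    using p_cont_right[OF _ yz, of "a + h" x] a h unfolding y(2) by simp
  ultimately show ?thesis by (rule LIMSEQ_unique)
qed

text \<open>Fatou's lemma along paths: right continuity at time 0 keeps almost every path in
  \<open>Q\<close> at all small times.\<close>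

lemma short_time_open:
  assumes Q: "open Q" "x \<in> Q" and s: "\<And>k. 0 < s k" "s \<longlonglongrightarrow> 0"
  shows "1 \<le> liminf (\<lambda>k. \<integral>\<^sup>+y. p (s k) x y * indicator Q y \<partial>m)"
proof -
  interpret Px: prob_space "P (Some x)" by (rule prob_space_P)
  have QB: "Q \<in> sets borel" using Q by simp
  let ?S = "\<lambda>k. {\<omega> \<in> space \<M>. X (ennreal (s k)) \<omega> \<in> Some ` Q}"
  have S: "?S k \<in> sets (P (Some x))" for k by (rule X_in_sets[OF QB])
  have "1 = (\<integral>\<^sup>+\<omega>. 1 \<partial>P (Some x))" using Px.emeasure_space_1 by simp
  also have "\<dots> \<le> (\<integral>\<^sup>+\<omega>. liminf (\<lambda>k. indicator (?S k) \<omega>) \<partial>P (Some x))"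
  proof (rule nn_integral_mono_AE)
    show "AE \<omega> in P (Some x). 1 \<le> liminf (\<lambda>k. indicator (?S k) \<omega> :: ennreal)"
      using normal[of "Some x"] AE_space
    proof eventually_elim
      case (elim \<omega>)
      then have \<omega>: "\<omega> \<in> space \<M>" "X (ennreal 0) \<omega> \<in> Some ` Q" using Q by (auto simp: space_P)
      obtain d where d: "0 < d" "\<And>r. 0 \<le> r \<Longrightarrow> r < 0 + d \<Longrightarrow> X (ennreal r) \<omega> \<in> Some ` Q"
        using right_limitD[OF \<omega>(1) _ openin_cemetery_top_Some[OF Q(1)] \<omega>(2)] by auto
      have "eventually (\<lambda>k. s k < d) sequentially" using order_tendstoD(2)[OF s(2) d(1)] .
      then have "eventually (\<lambda>k. (1::ennreal) \<le> indicator (?S k) \<omega>) sequentially"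
      proof eventually_elim
        case (elim k)
        then show ?case using d(2)[of "s k"] s(1)[of k] \<omega>(1) by simp
      qed
      then show ?case by (rule Liminf_bounded)
    qed
  qed
  also have "\<dots> \<le> liminf (\<lambda>k. \<integral>\<^sup>+\<omega>. indicator (?S k) \<omega> \<partial>P (Some x))"
    using S by (intro nn_integral_liminf) auto
  also have "(\<lambda>k. \<integral>\<^sup>+\<omega>. indicator (?S k) \<omega> \<partial>P (Some x)) = (\<lambda>k. \<integral>\<^sup>+y. p (s k) x y * indicator Q y \<partial>m)"
    using S p_law[OF s(1) QB] by (simp add: space_P)
  finally show ?thesis .
qed

text \<open>Fatou's lemma turns \<open>jumps_le_liminf\<close> into a bound for expectations, in
  which the Markov property expresses each grid summand by \<open>p\<close>. A single \<theta> would
  leave a Riemann sum; a second use of Fatou, in \<theta>, yields the time integral.\<close>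

lemma levy_le_liminf:
  assumes Q: "open Q" "\<And>u. (u, u) \<notin> Q" and T: "0 < T"
  shows "(\<integral>\<^sup>+s\<in>{0<..T}. (\<integral>\<^sup>+w. p s x w * (\<integral>\<^sup>+y. n w y * indicator Q (w, y) \<partial>m) \<partial>m) \<partial>lborel) \<le>
    liminf (\<lambda>k. ennreal (real (Suc k) / T) *
      (\<integral>\<^sup>+s\<in>{0<..T}. (\<integral>\<^sup>+w. p s x w * (\<integral>\<^sup>+y. p (T / real (Suc k)) w y * indicator Q (w, y) \<partial>m) \<partial>m) \<partial>lborel))"
    (is "?L \<le> _")
proof -
  note [measurable (raw)] = p_meas n_meas
  have Qb: "Q \<in> sets borel" using Q(1) by simp
  then have Qs[measurable]: "Q \<in> sets (borel \<Otimes>\<^sub>M borel)" by (subst borel_prod)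
  define h where "h k = T / real (Suc k)" for k
  have h: "0 < h k" for k using T by (simp add: h_def)
  define \<psi> where "\<psi> k s = (\<integral>\<^sup>+w. p s x w * (\<integral>\<^sup>+y. p (h k) w y * indicator Q (w, y) \<partial>m) \<partial>m)" for k s
  have [measurable]: "\<psi> k \<in> borel_measurable borel" for k unfolding \<psi>_def by measurable
  have g: "(\<lambda>u. \<integral>\<^sup>+y. n u y * indicator Q (u, y) \<partial>m) \<in> borel_measurable borel" by measurable
  let ?J = "\<lambda>\<omega>. \<Sum>\<^sub>\<infinity>s\<in>{0<..T}. off_ind Q (left_limit X (ennreal s) \<omega>) (X (ennreal s) \<omega>)"
  have L: "(\<integral>\<^sup>+\<omega>. ?J \<omega> \<partial>P (Some x)) = ?L"
    unfolding levy'[OF Q T] by (rule expectation_time_integral[OF g])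
  have step: "?L \<le> liminf (\<lambda>k. \<Sum>i\<le>k. \<psi> k ((real i + \<theta>) * h k))" if \<theta>: "0 < \<theta>" "\<theta> < 1" for \<theta>
  proof -
    have eq: "(real i + 1 + \<theta>) * h k = (real i + \<theta>) * h k + h k" for i k by (simp add: algebra_simps)
    have pos: "0 < (real i + \<theta>) * h k" for i k using \<theta> h by (intro mult_pos_pos) auto
    let ?K = "\<lambda>k \<omega>. \<Sum>i\<le>k. off_ind Q (X (ennreal ((real i + \<theta>) * h k)) \<omega>) (X (ennreal ((real i + 1 + \<theta>) * h k)) \<omega>)"
    have meas[measurable]: "(\<lambda>\<omega>. off_ind Q (X (ennreal ((real i + \<theta>) * h k)) \<omega>) (X (ennreal ((real i + 1 + \<theta>) * h k)) \<omega>))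
        \<in> borel_measurable (P (Some x))" for i k
      unfolding eq by (rule off_ind_measurable[OF pos h Qs])
    have "?L \<le> (\<integral>\<^sup>+\<omega>. liminf (\<lambda>k. ?K k \<omega>) \<partial>P (Some x))"
      unfolding L[symmetric] h_def using jumps_le_liminf[OF _ T Q(1) \<theta>]
      by (intro nn_integral_mono) (auto simp: space_P)
    also have "\<dots> \<le> liminf (\<lambda>k. \<integral>\<^sup>+\<omega>. ?K k \<omega> \<partial>P (Some x))"
      by (intro nn_integral_liminf) measurable
    also have "(\<lambda>k. \<integral>\<^sup>+\<omega>. ?K k \<omega> \<partial>P (Some x)) = (\<lambda>k. \<Sum>i\<le>k. \<psi> k ((real i + \<theta>) * h k))"
    proof
      fix k
      have "(\<integral>\<^sup>+\<omega>. ?K k \<omega> \<partial>P (Some x)) = (\<Sum>i\<le>k. \<integral>\<^sup>+\<omega>. off_ind Q (X (ennreal ((real i + \<theta>) * h k)) \<omega>) (X (ennreal ((real i + 1 + \<theta>) * h k)) \<omega>) \<partial>P (Some x))"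
        by (rule nn_integral_sum) measurable
      also have "\<dots> = (\<Sum>i\<le>k. \<psi> k ((real i + \<theta>) * h k))"
        unfolding eq \<psi>_def by (intro sum.cong refl off_ind_integral[OF pos h Qs])
      finally show "(\<integral>\<^sup>+\<omega>. ?K k \<omega> \<partial>P (Some x)) = (\<Sum>i\<le>k. \<psi> k ((real i + \<theta>) * h k))" .
    qed
    finally show ?thesis .
  qed
  let ?I = "indicator {0<..<1} :: real \<Rightarrow> ennreal"
  have "?L = (\<integral>\<^sup>+\<theta>. ?L * ?I \<theta> \<partial>lborel)" by (simp add: nn_integral_cmult)
  also have "\<dots> \<le> (\<integral>\<^sup>+\<theta>. liminf (\<lambda>k. (\<Sum>i\<le>k. \<psi> k ((real i + \<theta>) * h k)) * ?I \<theta>) \<partial>lborel)"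
    using step by (intro nn_integral_mono) (auto split: split_indicator)
  also have "\<dots> \<le> liminf (\<lambda>k. \<integral>\<^sup>+\<theta>. (\<Sum>i\<le>k. \<psi> k ((real i + \<theta>) * h k)) * ?I \<theta> \<partial>lborel)"
    by (intro nn_integral_liminf) measurable
  also have "\<dots> \<le> liminf (\<lambda>k. ennreal (real (Suc k) / T) * (\<integral>\<^sup>+s\<in>{0<..T}. \<psi> k s \<partial>lborel))"
  proof (intro Liminf_mono always_eventually allI)
    fix k
    have "(\<integral>\<^sup>+\<theta>. (\<Sum>i\<le>k. \<psi> k ((real i + \<theta>) * h k)) * ?I \<theta> \<partial>lborel) =
        (\<Sum>i\<le>k. \<integral>\<^sup>+\<theta>. \<psi> k ((real i + \<theta>) * h k) * ?I \<theta> \<partial>lborel)"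
      unfolding sum_distrib_right by (rule nn_integral_sum) measurable
    \<comment> \<open>Substituting \<open>s = (i + \<theta>) * h\<close> turns the average over
      \<theta> into the integral over the i-th cell, divided by
      \<open>h = T / (k + 1)\<close>.\<close>
    also have "\<dots> = (\<Sum>i\<le>k. ennreal (real (Suc k) / T) *
        (\<integral>\<^sup>+s. \<psi> k s * indicator {real i * h k<..<(real i + 1) * h k} s \<partial>lborel))"
    proof (intro sum.cong refl)
      fix i
      have ind: "indicator {real i * h k<..<(real i + 1) * h k} (real i * h k + h k * \<theta>) = ?I \<theta>" for \<theta>
        using h[of k] by (auto split: split_indicator simp: algebra_simps zero_less_mult_iff)
      have "(\<integral>\<^sup>+s. \<psi> k s * indicator {real i * h k<..<(real i + 1) * h k} s \<partial>lborel) =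
        ennreal \<bar>h k\<bar> * (\<integral>\<^sup>+\<theta>. \<psi> k (real i * h k + h k * \<theta>) * indicator {real i * h k<..<(real i + 1) * h k} (real i * h k + h k * \<theta>) \<partial>lborel)"
        using h[of k] by (intro nn_integral_real_affine) auto
      also have "\<dots> = ennreal (h k) * (\<integral>\<^sup>+\<theta>. \<psi> k ((real i + \<theta>) * h k) * ?I \<theta> \<partial>lborel)"
        unfolding ind using h[of k] by (simp add: algebra_simps)
      finally have "ennreal (real (Suc k) / T) * (\<integral>\<^sup>+s. \<psi> k s * indicator {real i * h k<..<(real i + 1) * h k} s \<partial>lborel) =
        (ennreal (real (Suc k) / T) * ennreal (h k)) * (\<integral>\<^sup>+\<theta>. \<psi> k ((real i + \<theta>) * h k) * ?I \<theta> \<partial>lborel)"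
        by (simp add: mult.assoc)
      also have "ennreal (real (Suc k) / T) * ennreal (h k) = 1"
        using T by (simp add: h_def ennreal_mult[symmetric])
      finally show "(\<integral>\<^sup>+\<theta>. \<psi> k ((real i + \<theta>) * h k) * ?I \<theta> \<partial>lborel) =
        ennreal (real (Suc k) / T) * (\<integral>\<^sup>+s. \<psi> k s * indicator {real i * h k<..<(real i + 1) * h k} s \<partial>lborel)" by simp
    qed
    also have "\<dots> = ennreal (real (Suc k) / T) *
        (\<integral>\<^sup>+s. \<psi> k s * (\<Sum>i\<le>k. indicator {real i * h k<..<(real i + 1) * h k} s) \<partial>lborel)"
      unfolding sum_distrib_left by (subst nn_integral_sum) (simp_all add: sum_distrib_left)
    also have "\<dots> \<le> ennreal (real (Suc k) / T) * (\<integral>\<^sup>+s\<in>{0<..T}. \<psi> k s \<partial>lborel)"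
    proof (intro mult_left_mono nn_integral_mono)
      fix s
      have "real (Suc k) * h k = T" by (simp add: h_def)
      then show "(\<Sum>i\<le>k. indicator {real i * h k<..<(real i + 1) * h k} s) \<le> (indicator {0<..T} s :: ennreal)"
        using sum_interval_indicator_le[OF h, of k s k] by simp
    qed auto
    finally show "(\<integral>\<^sup>+\<theta>. (\<Sum>i\<le>k. \<psi> k ((real i + \<theta>) * h k)) * ?I \<theta> \<partial>lborel) \<le>
      ennreal (real (Suc k) / T) * (\<integral>\<^sup>+s\<in>{0<..T}. \<psi> k s \<partial>lborel)" .
  qed
  finally show ?thesis by (simp add: \<psi>_def h_def)
qed

end

section \<open>Short-time asymptotics of the heat kernel\<close>

lemma liminf_add_ennreal: "liminf a + liminf b \<le> liminf (\<lambda>k. a k + b k :: ennreal)"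
proof -
  have inc: "incseq (\<lambda>i. INF k\<in>{i..}. f k)" for f :: "nat \<Rightarrow> ennreal"
    by (auto simp: incseq_def intro!: INF_superset_mono)
  have "liminf a + liminf b = (SUP i. (INF k\<in>{i..}. a k) + (INF k\<in>{i..}. b k))"
    unfolding liminf_SUP_INF by (rule ennreal_SUP_add[symmetric]) (rule inc)+
  also have "\<dots> \<le> (SUP i. INF k\<in>{i..}. a k + b k)"
    by (intro SUP_mono' INF_greatest add_mono INF_lower)
  finally show ?thesis by (simp add: liminf_SUP_INF)
qed

lemma liminf_cmult_ennreal: "c * liminf a \<le> liminf (\<lambda>k. c * a k :: ennreal)"
proof -
  have "c * liminf a = (SUP i. c * (INF k\<in>{i..}. a k))"
    unfolding liminf_SUP_INF by (rule SUP_mult_left_ennreal)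
  also have "\<dots> \<le> (SUP i. INF k\<in>{i..}. c * a k)"
    by (intro SUP_mono' INF_greatest mult_left_mono INF_lower) auto
  finally show ?thesis by (simp add: liminf_SUP_INF)
qed

text \<open>Outer regularity carries the lower bound from open sets to Borel sets; the error is controlled by the
  dominating density.\<close>

lemma liminf_open_imp_borel:
  fixes \<mu> :: "'b::{second_countable_topology, complete_space} measure"
  assumes sets[measurable_cong]: "sets \<mu> = sets borel"
    and d[measurable]: "\<And>k. d k \<in> borel_measurable borel" "d0 \<in> borel_measurable borel" "dbar \<in> borel_measurable borel"
    and le: "\<And>k x. d k x \<le> dbar x" and fin: "(\<integral>\<^sup>+x. dbar x \<partial>\<mu>) < \<top>"
    and opn: "\<And>Q. open Q \<Longrightarrow> (\<integral>\<^sup>+x. d0 x * indicator Q x \<partial>\<mu>) \<le> liminf (\<lambda>k. \<integral>\<^sup>+x. d k x * indicator Q x \<partial>\<mu>)"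
    and g: "g \<in> borel_measurable borel"
  shows "(\<integral>\<^sup>+x. d0 x * g x \<partial>\<mu>) \<le> liminf (\<lambda>k. \<integral>\<^sup>+x. d k x * g x \<partial>\<mu>)"
  using g
proof (induction rule: borel_measurable_induct)
  case (cong f g)
  then have "f = g" by auto
  with cong show ?case by simp
next
  case (set A)
  note [measurable] = set
  let ?N = "density \<mu> dbar"
  have N: "emeasure ?N B = (\<integral>\<^sup>+x. dbar x * indicator B x \<partial>\<mu>)" if "B \<in> sets borel" for B
    using that by (intro emeasure_density) (auto simp: sets)
  have finN: "emeasure ?N (space ?N) \<noteq> \<infinity>"
    using fin N[of UNIV] sets_eq_imp_space_eq[OF sets] by (auto simp: less_top)
  show ?case
  proof (rule ennreal_le_epsilon)
    fix e :: real assume e: "0 < e"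
    have finA: "emeasure ?N A < \<top>"
      using finN emeasure_space[of ?N A] by (metis infinity_ennreal_def le_less_trans less_top)
    have "emeasure ?N A < emeasure ?N A + ennreal e"
      using finA e by (cases "emeasure ?N A") (auto simp: ennreal_less_iff simp flip: ennreal_plus)
    then have "(INF U \<in> {U. A \<subseteq> U \<and> open U}. emeasure ?N U) < emeasure ?N A + ennreal e"
      using outer_regular[of ?N A] finN set by (simp add: sets)
    then obtain U where U: "A \<subseteq> U" "open U" "emeasure ?N U < emeasure ?N A + ennreal e"
      by (auto simp: INF_less_iff)
    have UB[measurable]: "U \<in> sets borel" using U(2) by simp
    have "emeasure ?N A + emeasure ?N (U - A) = emeasure ?N U"
      using U(1) set UB by (subst plus_emeasure) (auto simp: sets Un_absorb1)
    then have "emeasure ?N A + emeasure ?N (U - A) \<le> emeasure ?N A + ennreal e" using U(3) by simp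
    then have small: "emeasure ?N (U - A) \<le> ennreal e" using finA by (auto simp: ennreal_add_left_cancel_le)
    have UA: "(\<integral>\<^sup>+x. d k x * indicator U x \<partial>\<mu>) \<le> (\<integral>\<^sup>+x. d k x * indicator A x \<partial>\<mu>) + ennreal e" for k
    proof -
      have "(\<integral>\<^sup>+x. d k x * indicator U x \<partial>\<mu>) = (\<integral>\<^sup>+x. d k x * indicator A x + d k x * indicator (U - A) x \<partial>\<mu>)"
        using U(1) by (intro nn_integral_cong) (auto split: split_indicator)
      also have "\<dots> = (\<integral>\<^sup>+x. d k x * indicator A x \<partial>\<mu>) + (\<integral>\<^sup>+x. d k x * indicator (U - A) x \<partial>\<mu>)"
        by (rule nn_integral_add) measurable
      also have "(\<integral>\<^sup>+x. d k x * indicator (U - A) x \<partial>\<mu>) \<le> (\<integral>\<^sup>+x. dbar x * indicator (U - A) x \<partial>\<mu>)"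
        by (intro nn_integral_mono mult_right_mono le) auto
      also have "\<dots> \<le> ennreal e" using small N[of "U - A"] by simp
      finally show ?thesis by (simp add: add_left_mono)
    qed
    have "(\<integral>\<^sup>+x. d0 x * indicator A x \<partial>\<mu>) \<le> (\<integral>\<^sup>+x. d0 x * indicator U x \<partial>\<mu>)"
      using U(1) by (intro nn_integral_mono mult_left_mono) (auto split: split_indicator)
    also have "\<dots> \<le> liminf (\<lambda>k. \<integral>\<^sup>+x. d k x * indicator U x \<partial>\<mu>)" by (rule opn[OF U(2)])
    also have "\<dots> \<le> liminf (\<lambda>k. ennreal e + (\<integral>\<^sup>+x. d k x * indicator A x \<partial>\<mu>))"
      using UA by (intro Liminf_mono always_eventually allI) (simp add: add.commute)
    also have "\<dots> = ennreal e + liminf (\<lambda>k. \<integral>\<^sup>+x. d k x * indicator A x \<partial>\<mu>)"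
      by (rule Liminf_const_add) (auto intro!: continuous_intros simp: mono_def)
    finally show "(\<integral>\<^sup>+x. d0 x * indicator A x \<partial>\<mu>) \<le> liminf (\<lambda>k. \<integral>\<^sup>+x. d k x * indicator A x \<partial>\<mu>) + ennreal e"
      by (simp add: add.commute)
  qed
next
  case (mult u c)
  note [measurable] = mult.hyps(2)
  have "(\<integral>\<^sup>+x. d0 x * (c * u x) \<partial>\<mu>) = c * (\<integral>\<^sup>+x. d0 x * u x \<partial>\<mu>)"
    by (subst nn_integral_cmult[symmetric]) (auto simp: mult_ac)
  also have "\<dots> \<le> c * liminf (\<lambda>k. \<integral>\<^sup>+x. d k x * u x \<partial>\<mu>)" by (intro mult_left_mono mult.IH) auto
  also have "\<dots> \<le> liminf (\<lambda>k. c * (\<integral>\<^sup>+x. d k x * u x \<partial>\<mu>))" by (rule liminf_cmult_ennreal)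
  also have "(\<lambda>k. c * (\<integral>\<^sup>+x. d k x * u x \<partial>\<mu>)) = (\<lambda>k. \<integral>\<^sup>+x. d k x * (c * u x) \<partial>\<mu>)"
    by (subst nn_integral_cmult[symmetric]) (auto simp: mult_ac)
  finally show ?case .
next
  case (add u v)
  note [measurable] = add.hyps(1,3)
  have "(\<integral>\<^sup>+x. d0 x * (v x + u x) \<partial>\<mu>) = (\<integral>\<^sup>+x. d0 x * v x \<partial>\<mu>) + (\<integral>\<^sup>+x. d0 x * u x \<partial>\<mu>)"
    by (simp add: distrib_left nn_integral_add)
  also have "\<dots> \<le> liminf (\<lambda>k. \<integral>\<^sup>+x. d k x * v x \<partial>\<mu>) + liminf (\<lambda>k. \<integral>\<^sup>+x. d k x * u x \<partial>\<mu>)"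
    by (intro add_mono add.IH)
  also have "\<dots> \<le> liminf (\<lambda>k. (\<integral>\<^sup>+x. d k x * v x \<partial>\<mu>) + (\<integral>\<^sup>+x. d k x * u x \<partial>\<mu>))" by (rule liminf_add_ennreal)
  also have "(\<lambda>k. (\<integral>\<^sup>+x. d k x * v x \<partial>\<mu>) + (\<integral>\<^sup>+x. d k x * u x \<partial>\<mu>)) = (\<lambda>k. \<integral>\<^sup>+x. d k x * (v x + u x) \<partial>\<mu>)"
    by (simp add: distrib_left nn_integral_add)
  finally show ?case .
next
  case (seq U)
  note [measurable] = seq.hyps(1)
  have "(\<integral>\<^sup>+x. d0 x * (SUP i. U i) x \<partial>\<mu>) = (\<integral>\<^sup>+x. (SUP i. d0 x * U i x) \<partial>\<mu>)"
    by (simp add: SUP_mult_left_ennreal image_comp)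
  also have "\<dots> = (SUP i. \<integral>\<^sup>+x. d0 x * U i x \<partial>\<mu>)"
    using seq.hyps(3) by (intro nn_integral_monotone_convergence_SUP)
      (auto simp: incseq_def le_fun_def intro: mult_left_mono)
  also have "\<dots> \<le> liminf (\<lambda>k. \<integral>\<^sup>+x. d k x * (SUP i. U i) x \<partial>\<mu>)"
  proof (rule SUP_least)
    fix i
    have "U i x \<le> (SUP i. U i) x" for x by (simp add: image_comp) (rule SUP_upper, simp)
    then show "(\<integral>\<^sup>+x. d0 x * U i x \<partial>\<mu>) \<le> liminf (\<lambda>k. \<integral>\<^sup>+x. d k x * (SUP i. U i) x \<partial>\<mu>)"
      by (intro order_trans[OF seq.IH] Liminf_mono always_eventually allI nn_integral_mono mult_left_mono) auto
  qed
  finally show ?case .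
qed

section \<open>Splitting of convolutions at a small time\<close>

context heat_kernel
begin

text \<open>The time integral is cut at \<open>h\<close>; in the part after \<open>h\<close>,
  Chapman-Kolmogorov lets \<open>p h\<close> be factored out.\<close>

lemma stc_split_left:
  assumes V: "st_kernel V" and h: "0 < h"
  shows "(p \<star> V) t x z = (\<integral>\<^sup>+y. p h x y * (p \<star> V) (t - h) y z \<partial>m) +
    (\<integral>\<^sup>+s\<in>{0<..h}. (\<integral>\<^sup>+w. p s x w * V (t - s) w z \<partial>m) \<partial>lborel)"
proof -
  note [measurable (raw)] = p_measurable st_kernel_measurable[OF V]
  have "(\<integral>\<^sup>+y. p h x y * (p \<star> V) (t - h) y z \<partial>m) =
      (\<integral>\<^sup>+y. \<integral>\<^sup>+s. \<integral>\<^sup>+w. p h x y * (p s y w * V (t - h - s) w z) \<partial>m \<partial>lborel \<partial>m)"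
    by (simp add: stc_def nn_integral_cmult)
  also have "\<dots> = (\<integral>\<^sup>+s. \<integral>\<^sup>+y. \<integral>\<^sup>+w. p h x y * (p s y w * V (t - h - s) w z) \<partial>m \<partial>m \<partial>lborel)"
    by (rule swap_tm) measurable
  also have "\<dots> = (\<integral>\<^sup>+s. \<integral>\<^sup>+w. \<integral>\<^sup>+y. p h x y * (p s y w * V (t - h - s) w z) \<partial>m \<partial>m \<partial>lborel)"
    by (intro nn_integral_cong swap_mm) measurable
  also have "\<dots> = (\<integral>\<^sup>+s. \<integral>\<^sup>+w. (\<integral>\<^sup>+y. p h x y * p s y w \<partial>m) * V (t - h - s) w z \<partial>m \<partial>lborel)"
    by (simp add: nn_integral_multc mult.assoc[symmetric])
  also have "\<dots> = (\<integral>\<^sup>+s. (\<integral>\<^sup>+w. p (s + h) x w * V (t - (s + h)) w z \<partial>m) * indicator {h<..} (s + h) \<partial>lborel)"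
  proof (intro nn_integral_cong)
    fix s
    have "(\<integral>\<^sup>+y. p h x y * p s y w \<partial>m) = p (s + h) x w * indicator {h<..} (s + h)" for w
      using p_CK[OF h, of s x w] st_kernel_0[OF p_kernel] by (cases "0 < s") (auto simp: add.commute)
    then show "(\<integral>\<^sup>+w. (\<integral>\<^sup>+y. p h x y * p s y w \<partial>m) * V (t - h - s) w z \<partial>m) =
      (\<integral>\<^sup>+w. p (s + h) x w * V (t - (s + h)) w z \<partial>m) * indicator {h<..} (s + h)"
      by (cases "s + h \<in> {h<..}") (simp_all add: diff_diff_eq add.commute)
  qed
  also have "\<dots> = (\<integral>\<^sup>+s. (\<integral>\<^sup>+w. p s x w * V (t - s) w z \<partial>m) * indicator {h<..} s \<partial>lborel)"
    by (rule nn_integral_shift) measurable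
  finally have "(\<integral>\<^sup>+y. p h x y * (p \<star> V) (t - h) y z \<partial>m) +
    (\<integral>\<^sup>+s\<in>{0<..h}. (\<integral>\<^sup>+w. p s x w * V (t - s) w z \<partial>m) \<partial>lborel) =
    (\<integral>\<^sup>+s. (\<integral>\<^sup>+w. p s x w * V (t - s) w z \<partial>m) * indicator {h<..} s +
      (\<integral>\<^sup>+w. p s x w * V (t - s) w z \<partial>m) * indicator {0<..h} s \<partial>lborel)"
    by (simp add: nn_integral_add)
  also have "\<dots> = (p \<star> V) t x z"
    unfolding stc_def using h st_kernel_0[OF p_kernel]
    by (intro nn_integral_cong) (auto split: split_indicator simp: not_less)
  finally show ?thesis ..
qed

lemma stc_reflect:
  assumes A: "st_kernel A" and B: "st_kernel B"
  shows "(A \<star> B) t x z = (\<integral>\<^sup>+s. \<integral>\<^sup>+y. A (t - s) x y * B s y z \<partial>m \<partial>lborel)"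
proof -
  note [measurable (raw)] = st_kernel_measurable[OF A] st_kernel_measurable[OF B]
  have "(A \<star> B) t x z = (\<integral>\<^sup>+s. \<integral>\<^sup>+y. A (t - s) x y * B (t - (t - s)) y z \<partial>m \<partial>lborel)"
    unfolding stc_def by (rule nn_integral_reflect[symmetric]) measurable
  then show ?thesis by simp
qed

text \<open>The mirror image of \<open>stc_split_left\<close>: in the reflected form the cut is made
  in the time spent in the last factor, next to \<open>z\<close>.\<close>

lemma stc_split_right:
  assumes V: "st_kernel V" and h: "0 < h"
  shows "(V \<star> p) t x z = (\<integral>\<^sup>+y. (V \<star> p) (t - h) x y * p h y z \<partial>m) +
    (\<integral>\<^sup>+s\<in>{0<..h}. (\<integral>\<^sup>+w. V (t - s) x w * p s w z \<partial>m) \<partial>lborel)"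
proof -
  note [measurable (raw)] = p_measurable st_kernel_measurable[OF V]
  have "(\<integral>\<^sup>+y. (V \<star> p) (t - h) x y * p h y z \<partial>m) =
      (\<integral>\<^sup>+y. \<integral>\<^sup>+s. \<integral>\<^sup>+w. (V (t - h - s) x w * p s w y) * p h y z \<partial>m \<partial>lborel \<partial>m)"
    by (simp add: stc_reflect[OF V p_kernel] nn_integral_multc)
  also have "\<dots> = (\<integral>\<^sup>+s. \<integral>\<^sup>+y. \<integral>\<^sup>+w. (V (t - h - s) x w * p s w y) * p h y z \<partial>m \<partial>m \<partial>lborel)"
    by (rule swap_tm) measurable
  also have "\<dots> = (\<integral>\<^sup>+s. \<integral>\<^sup>+w. \<integral>\<^sup>+y. (V (t - h - s) x w * p s w y) * p h y z \<partial>m \<partial>m \<partial>lborel)"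
    by (intro nn_integral_cong swap_mm) measurable
  also have "\<dots> = (\<integral>\<^sup>+s. \<integral>\<^sup>+w. V (t - h - s) x w * (\<integral>\<^sup>+y. p s w y * p h y z \<partial>m) \<partial>m \<partial>lborel)"
    by (simp add: nn_integral_cmult mult.assoc)
  also have "\<dots> = (\<integral>\<^sup>+s. (\<integral>\<^sup>+w. V (t - (s + h)) x w * p (s + h) w z \<partial>m) * indicator {h<..} (s + h) \<partial>lborel)"
  proof (intro nn_integral_cong)
    fix s
    have "(\<integral>\<^sup>+y. p s w y * p h y z \<partial>m) = p (s + h) w z * indicator {h<..} (s + h)" for w
      using p_CK[OF _ h, of s w z] st_kernel_0[OF p_kernel] by (cases "0 < s") auto
    then show "(\<integral>\<^sup>+w. V (t - h - s) x w * (\<integral>\<^sup>+y. p s w y * p h y z \<partial>m) \<partial>m) =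
      (\<integral>\<^sup>+w. V (t - (s + h)) x w * p (s + h) w z \<partial>m) * indicator {h<..} (s + h)"
      by (cases "s + h \<in> {h<..}") (simp_all add: diff_diff_eq add.commute)
  qed
  also have "\<dots> = (\<integral>\<^sup>+s. (\<integral>\<^sup>+w. V (t - s) x w * p s w z \<partial>m) * indicator {h<..} s \<partial>lborel)"
    by (rule nn_integral_shift) measurable
  finally have "(\<integral>\<^sup>+y. (V \<star> p) (t - h) x y * p h y z \<partial>m) +
    (\<integral>\<^sup>+s\<in>{0<..h}. (\<integral>\<^sup>+w. V (t - s) x w * p s w z \<partial>m) \<partial>lborel) =
    (\<integral>\<^sup>+s. (\<integral>\<^sup>+w. V (t - s) x w * p s w z \<partial>m) * indicator {h<..} s +
      (\<integral>\<^sup>+w. V (t - s) x w * p s w z \<partial>m) * indicator {0<..h} s \<partial>lborel)"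
    by (simp add: nn_integral_add)
  also have "\<dots> = (V \<star> p) t x z"
    unfolding stc_reflect[OF V p_kernel] using h st_kernel_0[OF p_kernel]
    by (intro nn_integral_cong) (auto split: split_indicator simp: not_less)
  finally show ?thesis ..
qed

section \<open>An almost excessive weight\<close>

text \<open>The measure with density \<open>occ x0\<close> is almost excessive by \<open>occ_excessive\<close>, and equivalent to \<open>m\<close>.\<close>

definition occ :: "'a \<Rightarrow> 'a \<Rightarrow> ennreal" where
  "occ x0 y = (\<integral>\<^sup>+s\<in>{0<..1}. p s x0 y \<partial>lborel)"

text \<open>Twice the constant \<open>4 * M2 / M1\<close> of \<open>p_comparable\<close>; the 2 is
  the inverse length of the window (1/2, 1] over which \<open>occ_ge\<close> averages.\<close>

definition occ_rate :: real where "occ_rate = 8 * M2 / M1"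

lemma occ_measurable [measurable (raw)]:
  "f \<in> N \<rightarrow>\<^sub>M borel \<Longrightarrow> (\<lambda>\<omega>. occ x0 (f \<omega>)) \<in> borel_measurable N"
proof -
  note [measurable (raw)] = p_measurable
  have "occ x0 \<in> borel_measurable borel" unfolding occ_def by measurable
  then show "f \<in> N \<rightarrow>\<^sub>M borel \<Longrightarrow> (\<lambda>\<omega>. occ x0 (f \<omega>)) \<in> borel_measurable N" by simp
qed

lemma occ_integral:
  assumes g: "g \<in> borel_measurable borel"
  shows "(\<integral>\<^sup>+y. occ x0 y * g y \<partial>m) = (\<integral>\<^sup>+s\<in>{0<..1}. (\<integral>\<^sup>+y. p s x0 y * g y \<partial>m) \<partial>lborel)"
proof -
  note [measurable (raw)] = p_measurable and [measurable] = g
  have "(\<integral>\<^sup>+y. occ x0 y * g y \<partial>m) = (\<integral>\<^sup>+y. \<integral>\<^sup>+s. p s x0 y * indicator {0<..1} s * g y \<partial>lborel \<partial>m)"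
    by (simp add: occ_def nn_integral_multc)
  also have "\<dots> = (\<integral>\<^sup>+s. \<integral>\<^sup>+y. p s x0 y * indicator {0<..1} s * g y \<partial>m \<partial>lborel)"
    by (rule swap_tm) measurable
  also have "\<dots> = (\<integral>\<^sup>+s\<in>{0<..1}. (\<integral>\<^sup>+y. p s x0 y * g y \<partial>m) \<partial>lborel)"
    by (intro nn_integral_cong) (auto split: split_indicator)
  finally show ?thesis .
qed

lemma occ_mass: "(\<integral>\<^sup>+y. occ x0 y \<partial>m) \<le> 1"
proof -
  have "(\<integral>\<^sup>+y. occ x0 y \<partial>m) = (\<integral>\<^sup>+s\<in>{0<..1}. (\<integral>\<^sup>+y. p s x0 y \<partial>m) \<partial>lborel)"
    using occ_integral[of "\<lambda>_. 1"] by simp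
  also have "\<dots> \<le> (\<integral>\<^sup>+s. 1 * indicator {0<..1::real} s \<partial>lborel)"
    by (intro nn_integral_mono mult_right_mono p_mass) auto
  finally show ?thesis by simp
qed

lemma occ_ge:
  assumes "1 < s" "s \<le> 2"
  shows "p s x0 y \<le> ennreal occ_rate * occ x0 y"
proof -
  note [measurable (raw)] = p_measurable
  have "p s x0 y * ennreal (1 / 2) = (\<integral>\<^sup>+\<tau>\<in>{1/2<..1::real}. p s x0 y \<partial>lborel)"
    by (simp add: nn_integral_cmult)
  also have "\<dots> \<le> (\<integral>\<^sup>+\<tau>. ennreal (4 * M2 / M1) * (p \<tau> x0 y * indicator {0<..1} \<tau>) \<partial>lborel)"
  proof (intro nn_integral_mono)
    fix \<tau> :: real
    show "p s x0 y * indicator {1/2<..1} \<tau> \<le> ennreal (4 * M2 / M1) * (p \<tau> x0 y * indicator {0<..1} \<tau>)"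
      using p_comparable[of \<tau> s x0 y] assms by (auto split: split_indicator)
  qed
  also have "\<dots> = ennreal (4 * M2 / M1) * occ x0 y"
    unfolding occ_def by (rule nn_integral_cmult) measurable
  finally have "2 * (p s x0 y * ennreal (1 / 2)) \<le> 2 * (ennreal (4 * M2 / M1) * occ x0 y)"
    by (rule mult_left_mono) simp
  moreover have "2 * (p s x0 y * ennreal (1 / 2)) = p s x0 y"
  proof -
    have "(2::ennreal) * ennreal (1 / 2) = 1"
      by (metis ennreal_numeral ennreal_mult' ennreal_1 mult.commute nonzero_divide_eq_eq zero_le_numeral zero_neq_numeral)
    then show ?thesis by (metis mult.assoc mult.commute mult.right_neutral)
  qed
  moreover have "2 * (ennreal (4 * M2 / M1) * occ x0 y) = ennreal occ_rate * occ x0 y"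
  proof -
    have "2 * ennreal (4 * M2 / M1) = ennreal occ_rate"
      using M12 by (simp add: occ_rate_def ennreal_mult'[symmetric] flip: ennreal_numeral)
    then show ?thesis by (simp add: mult.assoc[symmetric])
  qed
  ultimately show ?thesis by simp
qed

text \<open>Applying \<open>p s\<close> moves the time window (0, 1] to (s, 1 + s]. Only the
  overshoot beyond 1, of length \<open>s\<close>, counts against excessiveness, and there
  \<open>occ_ge\<close> bounds \<open>p\<close> by the weight itself.\<close>

lemma occ_excessive:
  assumes s: "0 < s" "s \<le> 1"
  shows "(\<integral>\<^sup>+w. occ x0 w * p s w y \<partial>m) \<le> ennreal (1 + occ_rate * s) * occ x0 y"
proof -
  note [measurable (raw)] = p_measurable
  have r: "0 \<le> occ_rate" using M12 by (simp add: occ_rate_def)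
  have "(\<integral>\<^sup>+w. occ x0 w * p s w y \<partial>m) = (\<integral>\<^sup>+u\<in>{0<..1}. (\<integral>\<^sup>+w. p u x0 w * p s w y \<partial>m) \<partial>lborel)"
    by (rule occ_integral) measurable
  also have "\<dots> = (\<integral>\<^sup>+u. p (u + s) x0 y * indicator {s<..1 + s} (u + s) \<partial>lborel)"
    using s by (intro nn_integral_cong) (auto split: split_indicator simp: p_CK)
  also have "\<dots> = (\<integral>\<^sup>+u. p u x0 y * indicator {s<..1 + s} u \<partial>lborel)"
    by (rule nn_integral_shift) measurable
  also have "\<dots> \<le> (\<integral>\<^sup>+u. p u x0 y * indicator {0<..1} u + ennreal occ_rate * occ x0 y * indicator {1<..1+s} u \<partial>lborel)"
    using s occ_ge[of _ x0 y] by (intro nn_integral_mono) (auto split: split_indicator)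
  also have "\<dots> = occ x0 y + ennreal occ_rate * occ x0 y * ennreal s"
    using s by (simp add: nn_integral_add nn_integral_cmult occ_def)
  also have "\<dots> = ennreal (1 + occ_rate * s) * occ x0 y"
    using r s by (simp add: ennreal_mult algebra_simps)
  finally show ?thesis .
qed

lemma occ_pos: "0 < occ x0 y"
proof -
  note [measurable (raw)] = p_measurable
  have "ennreal (M1 * stable_bound \<alpha> 1 x0 y / 4) * indicator {1/4<..1} s \<le> p s x0 y * indicator {0<..1} s" for s :: real
  proof (cases "1/4 < s \<and> s \<le> 1")
    case True
    have "stable_bound \<alpha> 1 x0 y \<le> 4 * stable_bound \<alpha> s x0 y"
      using True alpha by (intro stable_bound_time) auto
    then have "M1 * stable_bound \<alpha> 1 x0 y / 4 \<le> M1 * stable_bound \<alpha> s x0 y" using M12 by simp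
    then have "ennreal (M1 * stable_bound \<alpha> 1 x0 y / 4) \<le> p s x0 y"
      using p_lower[of s x0 y] True by (meson ennreal_leI order_trans less_trans zero_less_divide_1_iff zero_less_numeral)
    then show ?thesis using True by simp
  qed (auto split: split_indicator)
  then have "(\<integral>\<^sup>+s. ennreal (M1 * stable_bound \<alpha> 1 x0 y / 4) * indicator {1/4<..1::real} s \<partial>lborel) \<le> occ x0 y"
    unfolding occ_def by (intro nn_integral_mono)
  moreover have "0 < (\<integral>\<^sup>+s. ennreal (M1 * stable_bound \<alpha> 1 x0 y / 4) * indicator {1/4<..1::real} s \<partial>lborel)"
    using M12 stable_bound_pos[of 1 \<alpha> x0 y] by (simp add: nn_integral_cmult ennreal_zero_less_mult_iff)
  ultimately show ?thesis by (rule less_le_trans[rotated])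
qed

section \<open>Jumps longer than \<epsilon>\<close>

definition far :: "real \<Rightarrow> 'a \<Rightarrow> 'a \<Rightarrow> ennreal" where
  "far \<epsilon> w y = ennreal (1 / norm (w - y) powr jexp) * indicator {z. \<epsilon> < norm z} (w - y)"

lemma far_kernel: "sp_kernel (far \<epsilon>)"
  unfolding sp_kernel_def far_def by measurable

text \<open>At time \<open>\<epsilon> powr \<alpha>\<close> and distance more than \<epsilon>, the
  lower heat kernel bound is in its off-diagonal regime and thus a multiple of \<open>far\<close>.
  The mass is then inherited from \<open>p\<close> without computing an integral.\<close>

lemma far_mass:
  assumes "0 < \<epsilon>"
  shows "(\<integral>\<^sup>+y. far \<epsilon> w y \<partial>m) \<le> ennreal (1 / (M1 * \<epsilon> powr \<alpha>))"
proof -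
  note [measurable (raw)] = p_measurable
  let ?t = "\<epsilon> powr \<alpha>"
  have t: "0 < ?t" using assms by simp
  have "far \<epsilon> w y \<le> ennreal (1 / (M1 * ?t)) * p ?t w y" for y
  proof (cases "\<epsilon> < norm (w - y)")
    case True
    have "?t / norm (w - y) powr jexp \<le> stable_bound \<alpha> ?t w y"
    proof (rule stable_boundI[OF t alpha])
      have "\<epsilon> powr jexp \<le> norm (w - y) powr jexp" using True assms jexp_pos by (intro powr_mono2) auto
      then have "?t / norm (w - y) powr jexp \<le> ?t / \<epsilon> powr jexp"
        using assms True by (intro divide_left_mono mult_pos_pos) auto
      also have "\<dots> = ?t powr (- real DIM('a) / \<alpha>)"
      proof -
        have "?t / \<epsilon> powr jexp = \<epsilon> powr (\<alpha> - jexp)" by (simp add: powr_diff)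
        also have "\<alpha> - jexp = \<alpha> * (- real DIM('a) / \<alpha>)" using alpha by (simp add: jexp_def)
        finally show ?thesis by (simp only: powr_powr)
      qed
      finally show "?t / norm (w - y) powr jexp \<le> ?t powr (- real DIM('a) / \<alpha>)" .
    qed (simp add: jexp_def)
    then have "1 / norm (w - y) powr jexp \<le> (1 / (M1 * ?t)) * (M1 * stable_bound \<alpha> ?t w y)"
      using t M12 by (simp add: field_simps)
    then have "far \<epsilon> w y \<le> ennreal ((1 / (M1 * ?t)) * (M1 * stable_bound \<alpha> ?t w y))"
      using True by (simp add: far_def ennreal_leI)
    also have "\<dots> = ennreal (1 / (M1 * ?t)) * ennreal (M1 * stable_bound \<alpha> ?t w y)"
      using M12 t stable_bound_pos[OF t, of \<alpha> w y] by (intro ennreal_mult) auto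
    also have "\<dots> \<le> ennreal (1 / (M1 * ?t)) * p ?t w y" by (intro mult_left_mono p_lower t) auto
    finally show ?thesis .
  qed (simp add: far_def)
  then have "(\<integral>\<^sup>+y. far \<epsilon> w y \<partial>m) \<le> (\<integral>\<^sup>+y. ennreal (1 / (M1 * ?t)) * p ?t w y \<partial>m)"
    by (intro nn_integral_mono)
  also have "\<dots> = ennreal (1 / (M1 * ?t)) * (\<integral>\<^sup>+y. p ?t w y \<partial>m)" by (rule nn_integral_cmult) measurable
  also have "\<dots> \<le> ennreal (1 / (M1 * ?t)) * 1" by (intro mult_left_mono p_mass) auto
  finally show ?thesis by simp
qed

lemma p_far:
  assumes "0 < h" "0 < \<epsilon>"
  shows "p h w y * indicator {z. \<epsilon> < norm z} (w - y) \<le> ennreal (M2 * h) * far \<epsilon> w y"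
proof (cases "\<epsilon> < norm (w - y)")
  case True
  then have "w \<noteq> y" using assms by auto
  from p_off[OF assms(1) this] have "p h w y \<le> ennreal ((M2 * h) * (1 / norm (w - y) powr jexp))" by simp
  also have "\<dots> = ennreal (M2 * h) * ennreal (1 / norm (w - y) powr jexp)"
    using M12 assms by (intro ennreal_mult) auto
  finally show ?thesis using True by (simp add: far_def)
qed simp

end

text \<open>\<open>jump_lower\<close> and \<open>short_open\<close> are the two facts about the
  process on which the positivity of r rests, stated for the kernel \<open>p\<close> alone.\<close>

locale short_time_kernel = heat_kernel m \<alpha> M1 M2 p
  for m :: "'a::euclidean_space measure" and \<alpha> M1 M2 p +
  fixes n :: "'a \<Rightarrow> 'a \<Rightarrow> ennreal"
  assumes n_kernel: "sp_kernel n"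
    and jump_lower: "\<And>Q x. open Q \<Longrightarrow> (\<And>u. (u, u) \<notin> Q) \<Longrightarrow>
      (\<integral>\<^sup>+s\<in>{0<..1}. (\<integral>\<^sup>+w. p s x w * (\<integral>\<^sup>+y. n w y * indicator Q (w, y) \<partial>m) \<partial>m) \<partial>lborel) \<le>
      liminf (\<lambda>k. ennreal (real (Suc k)) *
        (\<integral>\<^sup>+s\<in>{0<..1}. (\<integral>\<^sup>+w. p s x w * (\<integral>\<^sup>+y. p (1 / real (Suc k)) w y * indicator Q (w, y) \<partial>m) \<partial>m) \<partial>lborel))"
    and short_open: "\<And>Q x s. open Q \<Longrightarrow> x \<in> Q \<Longrightarrow> (\<And>k. 0 < s k) \<Longrightarrow> s \<longlonglongrightarrow> 0 \<Longrightarrow>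
      1 \<le> liminf (\<lambda>k. \<integral>\<^sup>+y. p (s k) x y * indicator Q y \<partial>m)"
begin

lemmas n_measurable = sp_kernel_measurable[OF n_kernel]

text \<open>Restricted to jumps longer than \<epsilon>, p(h) / h is dominated by \<open>M2\<close>
  times \<open>far\<close>, uniformly in h, and this is integrable against \<open>occ\<close>. So
  \<open>liminf_open_imp_borel\<close> on the product space extends \<open>jump_lower\<close> from
  open sets to the weights that occur later, where \<open>E\<close> is the set of negativity and
  \<open>a\<close> the positive part.\<close>

lemma far_liminf:
  assumes \<epsilon>: "0 < \<epsilon>" and b: "sp_kernel b" "\<And>w y. b w y \<le> n w y" "\<And>w y. norm (w - y) \<le> \<epsilon> \<Longrightarrow> b w y = 0"
    and E[measurable]: "E \<in> sets borel" and a[measurable]: "a \<in> borel_measurable borel"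
  shows "(\<integral>\<^sup>+w. occ x0 w * indicator E w * (\<integral>\<^sup>+y. b w y * a y \<partial>m) \<partial>m) \<le>
    liminf (\<lambda>k. ennreal (real (Suc k)) * (\<integral>\<^sup>+w. occ x0 w * indicator E w *
      (\<integral>\<^sup>+y. p (1 / real (Suc k)) w y * indicator {z. \<epsilon> < norm z} (w - y) * a y \<partial>m) \<partial>m))"
proof -
  note [measurable (raw)] = p_measurable n_measurable sp_kernel_measurable[OF b(1)]
    sp_kernel_measurable[OF far_kernel]
  let ?i = "\<lambda>w y. indicator {z. \<epsilon> < norm z} (w - y) :: ennreal"
  let ?h = "\<lambda>k. 1 / real (Suc k)"
  define d where "d k q = ennreal (real (Suc k)) * (occ x0 (fst q) * (p (?h k) (fst q) (snd q) * ?i (fst q) (snd q)))" for k q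
  define d0 where "d0 q = occ x0 (fst q) * (n (fst q) (snd q) * ?i (fst q) (snd q))" for q
  define dbar where "dbar q = ennreal M2 * (occ x0 (fst q) * far \<epsilon> (fst q) (snd q))" for q
  define g where "g q = indicator E (fst q) * a (snd q)" for q :: "'a \<times> 'a"
  have sets: "sets (m \<Otimes>\<^sub>M m) = sets borel"
    using sets_pair_measure_cong[OF sets_m sets_m] unfolding borel_prod .
  have m1: "d k \<in> borel_measurable (borel \<Otimes>\<^sub>M borel)" "d0 \<in> borel_measurable (borel \<Otimes>\<^sub>M borel)"
     "dbar \<in> borel_measurable (borel \<Otimes>\<^sub>M borel)" "g \<in> borel_measurable (borel \<Otimes>\<^sub>M borel)" for k
    unfolding d_def d0_def dbar_def g_def by measurable
  have mb: "d k \<in> borel_measurable borel" "d0 \<in> borel_measurable borel" "dbar \<in> borel_measurable borel" "g \<in> borel_measurable borel" for k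
    using m1 unfolding borel_prod .
  have fub: "(\<integral>\<^sup>+q. f q \<partial>(m \<Otimes>\<^sub>M m)) = (\<integral>\<^sup>+w. \<integral>\<^sup>+y. f (w, y) \<partial>m \<partial>m)" if "f \<in> borel_measurable (borel \<Otimes>\<^sub>M borel)" for f
  proof -
    have "f \<in> borel_measurable (m \<Otimes>\<^sub>M m)" using that by measurable
    then show ?thesis by (rule nn_integral_fst[symmetric])
  qed
  have le: "d k q \<le> dbar q" for k q
  proof -
    have "ennreal (real (Suc k)) * (p (?h k) (fst q) (snd q) * ?i (fst q) (snd q)) \<le>
      ennreal (real (Suc k)) * (ennreal (M2 * ?h k) * far \<epsilon> (fst q) (snd q))"
      by (intro mult_left_mono p_far \<epsilon>) auto
    also have "\<dots> = ennreal M2 * far \<epsilon> (fst q) (snd q)"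
    proof -
      have "ennreal (real (Suc k)) * ennreal (M2 * ?h k) = ennreal (real (Suc k) * (M2 * ?h k))"
        using M12 by (intro ennreal_mult[symmetric]) auto
      also have "real (Suc k) * (M2 * ?h k) = M2" by simp
      finally show ?thesis by (simp only: mult.assoc[symmetric])
    qed
    finally have "occ x0 (fst q) * (ennreal (real (Suc k)) * (p (?h k) (fst q) (snd q) * ?i (fst q) (snd q))) \<le>
      occ x0 (fst q) * (ennreal M2 * far \<epsilon> (fst q) (snd q))" by (rule mult_left_mono) simp
    then show ?thesis by (simp add: d_def dbar_def mult_ac)
  qed
  have fin: "(\<integral>\<^sup>+q. dbar q \<partial>(m \<Otimes>\<^sub>M m)) < \<top>"
  proof -
    have "(\<integral>\<^sup>+q. dbar q \<partial>(m \<Otimes>\<^sub>M m)) = ennreal M2 * (\<integral>\<^sup>+w. occ x0 w * (\<integral>\<^sup>+y. far \<epsilon> w y \<partial>m) \<partial>m)"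
      unfolding fub[OF m1(3)] by (simp add: dbar_def nn_integral_cmult)
    also have "\<dots> \<le> ennreal M2 * (\<integral>\<^sup>+w. occ x0 w * ennreal (1 / (M1 * \<epsilon> powr \<alpha>)) \<partial>m)"
      by (intro mult_left_mono nn_integral_mono far_mass \<epsilon>) auto
    also have "\<dots> = ennreal M2 * ((\<integral>\<^sup>+w. occ x0 w \<partial>m) * ennreal (1 / (M1 * \<epsilon> powr \<alpha>)))"
      by (simp add: nn_integral_multc)
    also have "\<dots> \<le> ennreal M2 * (1 * ennreal (1 / (M1 * \<epsilon> powr \<alpha>)))"
      by (intro mult_left_mono mult_right_mono occ_mass) auto
    also have "\<dots> < \<top>" by (simp add: ennreal_mult_less_top)
    finally show ?thesis .
  qed
  have opn: "(\<integral>\<^sup>+q. d0 q * indicator Q q \<partial>(m \<Otimes>\<^sub>M m)) \<le> liminf (\<lambda>k. \<integral>\<^sup>+q. d k q * indicator Q q \<partial>(m \<Otimes>\<^sub>M m))"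
    if Q: "open Q" for Q :: "('a \<times> 'a) set"
  proof -
    let ?D = "{q :: 'a \<times> 'a. \<epsilon> < norm (fst q - snd q)}"
    have "open ?D" by (intro open_Collect_less continuous_intros)
    then have QD: "open (Q \<inter> ?D)" using Q by auto
    have Qb: "Q \<in> sets borel" using Q by simp
    then have [measurable]: "Q \<in> sets (borel \<Otimes>\<^sub>M borel)" by (subst borel_prod)
    have Db: "Q \<inter> ?D \<in> sets borel" using QD by simp
    then have [measurable]: "Q \<inter> ?D \<in> sets (borel \<Otimes>\<^sub>M borel)" by (subst borel_prod)
    have ind: "?i w y * indicator Q (w, y) = indicator (Q \<inter> ?D) (w, y)" for w y
      by (auto split: split_indicator)
    have "(\<integral>\<^sup>+q. d0 q * indicator Q q \<partial>(m \<Otimes>\<^sub>M m)) = (\<integral>\<^sup>+w. \<integral>\<^sup>+y. occ x0 w * (n w y * indicator (Q \<inter> ?D) (w, y)) \<partial>m \<partial>m)"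
      using m1 by (subst fub) (simp_all add: d0_def mult.assoc ind)
    also have "\<dots> = (\<integral>\<^sup>+w. occ x0 w * (\<integral>\<^sup>+y. n w y * indicator (Q \<inter> ?D) (w, y) \<partial>m) \<partial>m)"
      by (intro nn_integral_cong nn_integral_cmult) measurable
    also have "\<dots> = (\<integral>\<^sup>+s\<in>{0<..1}. (\<integral>\<^sup>+w. p s x0 w * (\<integral>\<^sup>+y. n w y * indicator (Q \<inter> ?D) (w, y) \<partial>m) \<partial>m) \<partial>lborel)"
      by (rule occ_integral) measurable
    also have "\<dots> \<le> liminf (\<lambda>k. ennreal (real (Suc k)) *
        (\<integral>\<^sup>+s\<in>{0<..1}. (\<integral>\<^sup>+w. p s x0 w * (\<integral>\<^sup>+y. p (?h k) w y * indicator (Q \<inter> ?D) (w, y) \<partial>m) \<partial>m) \<partial>lborel))"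
      using \<epsilon> by (intro jump_lower[OF QD]) auto
    also have "(\<lambda>k. ennreal (real (Suc k)) *
        (\<integral>\<^sup>+s\<in>{0<..1}. (\<integral>\<^sup>+w. p s x0 w * (\<integral>\<^sup>+y. p (?h k) w y * indicator (Q \<inter> ?D) (w, y) \<partial>m) \<partial>m) \<partial>lborel)) =
      (\<lambda>k. \<integral>\<^sup>+q. d k q * indicator Q q \<partial>(m \<Otimes>\<^sub>M m))"
    proof
      fix k
      have "(\<integral>\<^sup>+s\<in>{0<..1}. (\<integral>\<^sup>+w. p s x0 w * (\<integral>\<^sup>+y. p (?h k) w y * indicator (Q \<inter> ?D) (w, y) \<partial>m) \<partial>m) \<partial>lborel) =
        (\<integral>\<^sup>+w. occ x0 w * (\<integral>\<^sup>+y. p (?h k) w y * indicator (Q \<inter> ?D) (w, y) \<partial>m) \<partial>m)"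
        by (rule occ_integral[symmetric]) measurable
      also have "\<dots> = (\<integral>\<^sup>+w. \<integral>\<^sup>+y. occ x0 w * (p (?h k) w y * indicator (Q \<inter> ?D) (w, y)) \<partial>m \<partial>m)"
        by (intro nn_integral_cong nn_integral_cmult[symmetric]) measurable
      also have "ennreal (real (Suc k)) * \<dots> = (\<integral>\<^sup>+w. ennreal (real (Suc k)) * (\<integral>\<^sup>+y. occ x0 w * (p (?h k) w y * indicator (Q \<inter> ?D) (w, y)) \<partial>m) \<partial>m)"
        by (rule nn_integral_cmult[symmetric]) measurable
      also have "\<dots> = (\<integral>\<^sup>+w. \<integral>\<^sup>+y. ennreal (real (Suc k)) * (occ x0 w * (p (?h k) w y * indicator (Q \<inter> ?D) (w, y))) \<partial>m \<partial>m)"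
        by (intro nn_integral_cong nn_integral_cmult[symmetric]) measurable
      also have "\<dots> = (\<integral>\<^sup>+q. d k q * indicator Q q \<partial>(m \<Otimes>\<^sub>M m))"
        using m1 by (subst fub) (simp_all add: d_def mult.assoc ind)
      finally show "ennreal (real (Suc k)) *
        (\<integral>\<^sup>+s\<in>{0<..1}. (\<integral>\<^sup>+w. p s x0 w * (\<integral>\<^sup>+y. p (?h k) w y * indicator (Q \<inter> ?D) (w, y) \<partial>m) \<partial>m) \<partial>lborel) =
        (\<integral>\<^sup>+q. d k q * indicator Q q \<partial>(m \<Otimes>\<^sub>M m))" .
    qed
    finally show ?thesis .
  qed
  have "(\<integral>\<^sup>+w. occ x0 w * indicator E w * (\<integral>\<^sup>+y. b w y * a y \<partial>m) \<partial>m) =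
     (\<integral>\<^sup>+w. \<integral>\<^sup>+y. occ x0 w * indicator E w * (b w y * a y) \<partial>m \<partial>m)"
    by (intro nn_integral_cong nn_integral_cmult[symmetric]) measurable
  also have "\<dots> \<le> (\<integral>\<^sup>+w. \<integral>\<^sup>+y. d0 (w, y) * g (w, y) \<partial>m \<partial>m)"
  proof (intro nn_integral_mono)
    fix w y
    have "b w y \<le> n w y * ?i w y" using b(2)[of w y] b(3)[of w y] by (cases "\<epsilon> < norm (w - y)") auto
    then have "occ x0 w * indicator E w * (b w y * a y) \<le> occ x0 w * indicator E w * (n w y * ?i w y * a y)"
      by (intro mult_left_mono mult_right_mono) auto
    then show "occ x0 w * indicator E w * (b w y * a y) \<le> d0 (w, y) * g (w, y)"
      by (simp add: d0_def g_def mult_ac)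
  qed
  also have "\<dots> = (\<integral>\<^sup>+q. d0 q * g q \<partial>(m \<Otimes>\<^sub>M m))" using m1 by (subst fub) simp_all
  also have "\<dots> \<le> liminf (\<lambda>k. \<integral>\<^sup>+q. d k q * g q \<partial>(m \<Otimes>\<^sub>M m))"
    by (rule liminf_open_imp_borel[OF sets mb(1,2,3) le fin opn mb(4)])
  also have "(\<lambda>k. \<integral>\<^sup>+q. d k q * g q \<partial>(m \<Otimes>\<^sub>M m)) = (\<lambda>k. ennreal (real (Suc k)) * (\<integral>\<^sup>+w. occ x0 w * indicator E w *
      (\<integral>\<^sup>+y. p (?h k) w y * ?i w y * a y \<partial>m) \<partial>m))"
  proof
    fix k
    have "(\<integral>\<^sup>+q. d k q * g q \<partial>(m \<Otimes>\<^sub>M m)) =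
      (\<integral>\<^sup>+w. \<integral>\<^sup>+y. ennreal (real (Suc k)) * (occ x0 w * indicator E w * (p (?h k) w y * ?i w y * a y)) \<partial>m \<partial>m)"
      using m1 by (subst fub) (simp_all add: d_def g_def mult_ac)
    also have "\<dots> = (\<integral>\<^sup>+w. ennreal (real (Suc k)) * (\<integral>\<^sup>+y. occ x0 w * indicator E w * (p (?h k) w y * ?i w y * a y) \<partial>m) \<partial>m)"
      by (intro nn_integral_cong nn_integral_cmult) measurable
    also have "\<dots> = ennreal (real (Suc k)) * (\<integral>\<^sup>+w. \<integral>\<^sup>+y. occ x0 w * indicator E w * (p (?h k) w y * ?i w y * a y) \<partial>m \<partial>m)"
      by (rule nn_integral_cmult) measurable
    also have "(\<integral>\<^sup>+w. \<integral>\<^sup>+y. occ x0 w * indicator E w * (p (?h k) w y * ?i w y * a y) \<partial>m \<partial>m) =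
      (\<integral>\<^sup>+w. occ x0 w * indicator E w * (\<integral>\<^sup>+y. p (?h k) w y * ?i w y * a y \<partial>m) \<partial>m)"
      by (intro nn_integral_cong nn_integral_cmult) measurable
    finally show "(\<integral>\<^sup>+q. d k q * g q \<partial>(m \<Otimes>\<^sub>M m)) = ennreal (real (Suc k)) * (\<integral>\<^sup>+w. occ x0 w * indicator E w *
      (\<integral>\<^sup>+y. p (?h k) w y * ?i w y * a y \<partial>m) \<partial>m)" .
  qed
  finally show ?thesis .
qed

text \<open>A one-sided approximate identity. For open sets it is \<open>short_open\<close> with
  Fatou; almost excessiveness of \<open>occ\<close> supplies the dominating density needed to pass
  to Borel functions.\<close>

lemma short_liminf:
  assumes E[measurable]: "E \<in> sets borel" and g: "g \<in> borel_measurable borel"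
  shows "(\<integral>\<^sup>+w. occ x0 w * indicator E w * g w \<partial>m) \<le>
    liminf (\<lambda>k. \<integral>\<^sup>+\<theta>\<in>{0<..<1}. (\<integral>\<^sup>+w. occ x0 w * indicator E w * (\<integral>\<^sup>+y. p (\<theta> / real (Suc k)) w y * g y \<partial>m) \<partial>m) \<partial>lborel)"
proof -
  note [measurable (raw)] = p_measurable
  define d where "d k y = (\<integral>\<^sup>+\<theta>\<in>{0<..<1}. (\<integral>\<^sup>+w. occ x0 w * indicator E w * p (\<theta> / real (Suc k)) w y \<partial>m) \<partial>lborel)" for k y
  have eq: "(\<integral>\<^sup>+y. d k y * f y \<partial>m) = (\<integral>\<^sup>+\<theta>\<in>{0<..<1}. (\<integral>\<^sup>+w. occ x0 w * indicator E w * (\<integral>\<^sup>+y. p (\<theta> / real (Suc k)) w y * f y \<partial>m) \<partial>m) \<partial>lborel)"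
    if [measurable]: "f \<in> borel_measurable borel" for f k
  proof -
    let ?P = "\<lambda>\<theta>. p (\<theta> / real (Suc k))" and ?I = "indicator {0<..<1} :: real \<Rightarrow> ennreal"
    have "(\<integral>\<^sup>+y. d k y * f y \<partial>m) = (\<integral>\<^sup>+y. \<integral>\<^sup>+\<theta>. \<integral>\<^sup>+w. occ x0 w * indicator E w * ?P \<theta> w y * ?I \<theta> * f y \<partial>m \<partial>lborel \<partial>m)"
      by (simp add: d_def nn_integral_multc)
    also have "\<dots> = (\<integral>\<^sup>+\<theta>. \<integral>\<^sup>+y. \<integral>\<^sup>+w. occ x0 w * indicator E w * ?P \<theta> w y * ?I \<theta> * f y \<partial>m \<partial>m \<partial>lborel)"
      by (rule swap_tm) measurable
    also have "\<dots> = (\<integral>\<^sup>+\<theta>. \<integral>\<^sup>+w. \<integral>\<^sup>+y. occ x0 w * indicator E w * ?P \<theta> w y * ?I \<theta> * f y \<partial>m \<partial>m \<partial>lborel)"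
      by (intro nn_integral_cong swap_mm) measurable
    also have "\<dots> = (\<integral>\<^sup>+\<theta>. \<integral>\<^sup>+w. \<integral>\<^sup>+y. (occ x0 w * indicator E w) * (?P \<theta> w y * f y) * ?I \<theta> \<partial>m \<partial>m \<partial>lborel)"
      by (simp add: mult_ac)
    also have "\<dots> = (\<integral>\<^sup>+\<theta>\<in>{0<..<1}. (\<integral>\<^sup>+w. occ x0 w * indicator E w * (\<integral>\<^sup>+y. ?P \<theta> w y * f y \<partial>m) \<partial>m) \<partial>lborel)"
      by (simp add: nn_integral_multc nn_integral_cmult)
    finally show ?thesis .
  qed
  have le: "d k y \<le> ennreal (1 + occ_rate) * occ x0 y" for k y
  proof -
    have r: "0 \<le> occ_rate" using M12 by (simp add: occ_rate_def)
    have "d k y \<le> (\<integral>\<^sup>+\<theta>\<in>{0<..<1::real}. (ennreal (1 + occ_rate) * occ x0 y) \<partial>lborel)"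
      unfolding d_def
    proof (intro nn_integral_mono)
      fix \<theta> :: real
      show "(\<integral>\<^sup>+w. occ x0 w * indicator E w * p (\<theta> / real (Suc k)) w y \<partial>m) * indicator {0<..<1} \<theta> \<le>
        ennreal (1 + occ_rate) * occ x0 y * indicator {0<..<1} \<theta>"
      proof (cases "0 < \<theta> \<and> \<theta> < 1")
        case True
        then have t: "0 < \<theta> / real (Suc k)" "\<theta> / real (Suc k) \<le> 1" by (auto simp: divide_le_eq)
        have "(\<integral>\<^sup>+w. occ x0 w * indicator E w * p (\<theta> / real (Suc k)) w y \<partial>m) \<le> (\<integral>\<^sup>+w. occ x0 w * p (\<theta> / real (Suc k)) w y \<partial>m)"
          by (intro nn_integral_mono) (auto split: split_indicator)
        also have "\<dots> \<le> ennreal (1 + occ_rate * (\<theta> / real (Suc k))) * occ x0 y" by (rule occ_excessive[OF t])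
        also have "\<dots> \<le> ennreal (1 + occ_rate) * occ x0 y"
          using t r mult_left_mono[OF t(2) r] by (intro mult_right_mono ennreal_leI) auto
        finally show ?thesis using True by simp
      qed (auto split: split_indicator)
    qed
    also have "\<dots> = ennreal (1 + occ_rate) * occ x0 y" by (simp add: nn_integral_cmult)
    finally show ?thesis .
  qed
  have fin: "(\<integral>\<^sup>+y. ennreal (1 + occ_rate) * occ x0 y \<partial>m) < \<top>"
  proof -
    have "(\<integral>\<^sup>+y. ennreal (1 + occ_rate) * occ x0 y \<partial>m) = ennreal (1 + occ_rate) * (\<integral>\<^sup>+y. occ x0 y \<partial>m)"
      by (rule nn_integral_cmult) measurable
    also have "\<dots> \<le> ennreal (1 + occ_rate) * 1" by (intro mult_left_mono occ_mass) auto
    finally show ?thesis by (rule order_le_less_trans) simp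
  qed
  have opn: "(\<integral>\<^sup>+y. (occ x0 y * indicator E y) * indicator Q y \<partial>m) \<le> liminf (\<lambda>k. \<integral>\<^sup>+y. d k y * indicator Q y \<partial>m)"
    if Q: "open Q" for Q
  proof -
    have [measurable]: "Q \<in> sets borel" using Q by simp
    let ?q = "\<lambda>k \<theta> w. \<integral>\<^sup>+y. p (\<theta> / real (Suc k)) w y * indicator Q y \<partial>m"
    let ?I = "indicator {0<..<1} :: real \<Rightarrow> ennreal"
    have lim: "(\<lambda>k. \<theta> / real (Suc k)) \<longlonglongrightarrow> 0" for \<theta> :: real
      using LIMSEQ_Suc[OF lim_const_over_n[of \<theta>]] by simp
    have "(\<integral>\<^sup>+y. (occ x0 y * indicator E y) * indicator Q y \<partial>m) =
      (\<integral>\<^sup>+\<theta>. (\<integral>\<^sup>+y. (occ x0 y * indicator E y) * indicator Q y \<partial>m) * ?I \<theta> \<partial>lborel)" by (simp add: nn_integral_cmult)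
    also have "\<dots> \<le> (\<integral>\<^sup>+\<theta>. (\<integral>\<^sup>+w. liminf (\<lambda>k. occ x0 w * indicator E w * ?q k \<theta> w) \<partial>m) * ?I \<theta> \<partial>lborel)"
    proof (intro nn_integral_mono)
      fix \<theta> :: real
      have "(occ x0 w * indicator E w) * indicator Q w \<le> liminf (\<lambda>k. occ x0 w * indicator E w * ?q k \<theta> w)" if "0 < \<theta>" for w
      proof -
        have "indicator Q w \<le> liminf (\<lambda>k. ?q k \<theta> w)"
          using short_open[OF Q, of w "\<lambda>k. \<theta> / real (Suc k)"] lim[of \<theta>] that by (auto split: split_indicator)
        then have "(occ x0 w * indicator E w) * indicator Q w \<le> (occ x0 w * indicator E w) * liminf (\<lambda>k. ?q k \<theta> w)"
          by (rule mult_left_mono) simp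
        also have "\<dots> \<le> liminf (\<lambda>k. occ x0 w * indicator E w * ?q k \<theta> w)" by (rule liminf_cmult_ennreal)
        finally show ?thesis .
      qed
      then show "(\<integral>\<^sup>+y. (occ x0 y * indicator E y) * indicator Q y \<partial>m) * ?I \<theta> \<le>
        (\<integral>\<^sup>+w. liminf (\<lambda>k. occ x0 w * indicator E w * ?q k \<theta> w) \<partial>m) * ?I \<theta>"
        by (auto split: split_indicator intro!: nn_integral_mono)
    qed
    also have "\<dots> \<le> (\<integral>\<^sup>+\<theta>. liminf (\<lambda>k. (\<integral>\<^sup>+w. occ x0 w * indicator E w * ?q k \<theta> w \<partial>m) * ?I \<theta>) \<partial>lborel)"
    proof (intro nn_integral_mono)
      fix \<theta> :: real
      have "(\<integral>\<^sup>+w. liminf (\<lambda>k. occ x0 w * indicator E w * ?q k \<theta> w) \<partial>m) \<le> liminf (\<lambda>k. \<integral>\<^sup>+w. occ x0 w * indicator E w * ?q k \<theta> w \<partial>m)"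
        by (intro nn_integral_liminf) measurable
      then show "(\<integral>\<^sup>+w. liminf (\<lambda>k. occ x0 w * indicator E w * ?q k \<theta> w) \<partial>m) * ?I \<theta> \<le>
        liminf (\<lambda>k. (\<integral>\<^sup>+w. occ x0 w * indicator E w * ?q k \<theta> w \<partial>m) * ?I \<theta>)"
        by (auto split: split_indicator)
    qed
    also have "\<dots> \<le> liminf (\<lambda>k. \<integral>\<^sup>+\<theta>. (\<integral>\<^sup>+w. occ x0 w * indicator E w * ?q k \<theta> w \<partial>m) * ?I \<theta> \<partial>lborel)"
      by (intro nn_integral_liminf) measurable
    also have "\<dots> = liminf (\<lambda>k. \<integral>\<^sup>+y. d k y * indicator Q y \<partial>m)" by (simp add: eq)
    finally show ?thesis .
  qed
  have "(\<integral>\<^sup>+w. occ x0 w * indicator E w * g w \<partial>m) \<le> liminf (\<lambda>k. \<integral>\<^sup>+y. d k y * g y \<partial>m)"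
  proof (rule liminf_open_imp_borel[OF sets_m _ _ _ le fin opn g])
    show "d k \<in> borel_measurable borel" for k unfolding d_def by measurable
  qed measurable
  then show ?thesis by (simp add: eq[OF g])
qed

end

section \<open>Suppression of jumps\<close>

lemma suminf_Suc_ennreal: "(\<Sum>k. f k) = f 0 + (\<Sum>k. f (Suc k) :: ennreal)"
proof -
  have "(\<lambda>k. f (Suc k)) sums (\<Sum>k. f (Suc k))" by (rule summable_sums[OF summableI])
  from sums_Suc[OF this] have "f sums (f 0 + (\<Sum>k. f (Suc k)))" by (subst add.commute)
  then show ?thesis by (rule sums_unique[symmetric])
qed

section \<open>Even and odd parts of the perturbation series\<close>

context base_measure
begin

definition rmul :: "(real \<Rightarrow> 'a \<Rightarrow> 'a \<Rightarrow> ennreal) \<Rightarrow> ('a \<Rightarrow> 'a \<Rightarrow> ennreal) \<Rightarrow>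
    real \<Rightarrow> 'a \<Rightarrow> 'a \<Rightarrow> ennreal" where
  "rmul A b t x y = (\<integral>\<^sup>+w. A t x w * b w y \<partial>m)"

lemma st_kernel_rmul:
  assumes b: "sp_kernel b" and A: "st_kernel A"
  shows "st_kernel (rmul A b)"
proof (rule st_kernelI)
  note [measurable (raw)] = sp_kernel_measurable[OF b] st_kernel_measurable[OF A]
  show "(\<lambda>(t, x, y). rmul A b t x y) \<in> borel_measurable (borel \<Otimes>\<^sub>M borel \<Otimes>\<^sub>M borel)"
    unfolding rmul_def split_beta' by measurable
qed (simp add: rmul_def st_kernel_0[OF A])

lemma stc_kmul_eq_rmul_stc:
  assumes b: "sp_kernel b" and A: "st_kernel A" and B: "st_kernel B"
  shows "A \<star> (b \<bullet>\<^sub>k B) = rmul A b \<star> B"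
proof (intro ext)
  fix t x z
  note [measurable (raw)] = sp_kernel_measurable[OF b] st_kernel_measurable[OF A] st_kernel_measurable[OF B]
  have "(A \<star> (b \<bullet>\<^sub>k B)) t x z = (\<integral>\<^sup>+s. \<integral>\<^sup>+w. \<integral>\<^sup>+y. A s x w * (b w y * B (t - s) y z) \<partial>m \<partial>m \<partial>lborel)"
    by (simp add: stc_def kmul_def nn_integral_cmult)
  also have "\<dots> = (\<integral>\<^sup>+s. \<integral>\<^sup>+y. \<integral>\<^sup>+w. A s x w * (b w y * B (t - s) y z) \<partial>m \<partial>m \<partial>lborel)"
    by (intro nn_integral_cong swap_mm) measurable
  also have "\<dots> = (rmul A b \<star> B) t x z"
    by (simp add: stc_def rmul_def nn_integral_multc mult.assoc[symmetric])
  finally show "(A \<star> (b \<bullet>\<^sub>k B)) t x z = (rmul A b \<star> B) t x z" .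
qed

text \<open>The sum of the even (\<open>e = True\<close>) or odd terms of the perturbation series; the perturbation by
  \<open>- b\<close> is the difference of the two.\<close>

definition part :: "('a \<Rightarrow> 'a \<Rightarrow> ennreal) \<Rightarrow> (real \<Rightarrow> 'a \<Rightarrow> 'a \<Rightarrow> ennreal) \<Rightarrow> bool \<Rightarrow>
    real \<Rightarrow> 'a \<Rightarrow> 'a \<Rightarrow> ennreal" where
  "part b p e t x z = (\<Sum>k. (if even k = e then pert b p k t x z else 0))"

lemma st_kernel_if: "(c \<Longrightarrow> st_kernel A) \<Longrightarrow> st_kernel (\<lambda>t x y. if c then A t x y else 0)"
  by (cases c) (auto intro: st_kernel_zero)

lemma part_eq: "part b p e = (\<lambda>t x z. \<Sum>k. (if even k = e then pert b p k t x z else 0))"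
  by (intro ext) (simp add: part_def)

lemma st_kernel_part:
  assumes "sp_kernel b" "st_kernel p"
  shows "st_kernel (part b p e)"
  unfolding part_eq by (intro st_kernel_suminf st_kernel_if st_kernel_pert assms)

lemma part_le: "part b p e t x z \<le> (\<Sum>k. pert b p k t x z)"
  unfolding part_def by (intro suminf_le) auto

text \<open>Taking out the term of order 0 and factoring one jump off the others flips the parity.
  Together, the equations for both parities are Duhamel's formula for the perturbation by
  \<open>- b\<close>.\<close>

lemma part_left:
  assumes b: "sp_kernel b" and p: "st_kernel p"
  shows "part b p e t x z = (if e then p t x z else 0) + (p \<star> (b \<bullet>\<^sub>k part b p (\<not> e))) t x z"
proof -
  note pk = st_kernel_pert[OF b p] and if_k = st_kernel_if[OF st_kernel_pert[OF b p]]
  have "(p \<star> (b \<bullet>\<^sub>k part b p (\<not> e))) t x z =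
      (p \<star> (\<lambda>t x z. \<Sum>k. (b \<bullet>\<^sub>k (\<lambda>t x z. if even k = (\<not> e) then pert b p k t x z else 0)) t x z)) t x z"
  proof (rule arg_cong[where f="\<lambda>V. (p \<star> V) t x z"], intro ext)
    fix t x z
    show "(b \<bullet>\<^sub>k part b p (\<not> e)) t x z = (\<Sum>k. (b \<bullet>\<^sub>k (\<lambda>t x z. if even k = (\<not> e) then pert b p k t x z else 0)) t x z)"
      unfolding part_eq by (rule kmul_suminf_right[OF b if_k])
  qed
  also have "\<dots> = (\<Sum>k. (p \<star> (b \<bullet>\<^sub>k (\<lambda>t x z. if even k = (\<not> e) then pert b p k t x z else 0))) t x z)"
    by (rule stc_suminf_right[OF p st_kernel_kmul[OF b if_k]])
  also have "\<dots> = (\<Sum>k. (if even (Suc k) = e then pert b p (Suc k) t x z else 0))"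
  proof (rule suminf_cong)
    fix k
    have "p \<star> (b \<bullet>\<^sub>k (\<lambda>t x z. 0)) = (\<lambda>t x z. 0)" by (intro ext) (simp add: stc_def kmul_def)
    then show "(p \<star> (b \<bullet>\<^sub>k (\<lambda>t x z. if even k = (\<not> e) then pert b p k t x z else 0))) t x z =
      (if even (Suc k) = e then pert b p (Suc k) t x z else 0)" by (cases "even k = e") auto
  qed
  finally show ?thesis
    unfolding part_def by (subst suminf_Suc_ennreal) simp
qed

lemma part_right:
  assumes b: "sp_kernel b" and p: "st_kernel p"
  shows "part b p e t x z = (if e then p t x z else 0) + (part b p (\<not> e) \<star> (b \<bullet>\<^sub>k p)) t x z"
proof -
  note pk = st_kernel_pert[OF b p] and if_k = st_kernel_if[OF st_kernel_pert[OF b p]]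
  have "(part b p (\<not> e) \<star> (b \<bullet>\<^sub>k p)) t x z = (\<Sum>k. ((\<lambda>t x z. if even k = (\<not> e) then pert b p k t x z else 0) \<star> (b \<bullet>\<^sub>k p)) t x z)"
    unfolding part_eq by (rule stc_suminf_left[OF if_k st_kernel_kmul[OF b p]])
  also have "\<dots> = (\<Sum>k. (if even (Suc k) = e then pert b p (Suc k) t x z else 0))"
  proof (rule suminf_cong)
    fix k
    have "(\<lambda>t x z. 0) \<star> (b \<bullet>\<^sub>k p) = (\<lambda>t x z. 0)" by (intro ext) (simp add: stc_def)
    then show "((\<lambda>t x z. if even k = (\<not> e) then pert b p k t x z else 0) \<star> (b \<bullet>\<^sub>k p)) t x z =
      (if even (Suc k) = e then pert b p (Suc k) t x z else 0)"
      unfolding pert_Suc_right[OF b p] by (cases "even k = e") auto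
  qed
  finally show ?thesis
    unfolding part_def by (subst suminf_Suc_ennreal) simp
qed

text \<open>The last argument is a dummy: it makes a function of time and space formally a kernel,
  so that \<star> and \<open>kmul\<close> and their laws can be reused.\<close>

definition apply_fun :: "(real \<Rightarrow> 'a \<Rightarrow> 'a \<Rightarrow> ennreal) \<Rightarrow> ('a \<Rightarrow> ennreal) \<Rightarrow>
    real \<Rightarrow> 'a \<Rightarrow> 'a \<Rightarrow> ennreal" where
  "apply_fun A f t x _ = (\<integral>\<^sup>+z. A t x z * f z \<partial>m)"

lemma st_kernel_apply_fun:
  assumes A: "st_kernel A" and f: "f \<in> borel_measurable borel"
  shows "st_kernel (apply_fun A f)"
proof (rule st_kernelI)
  note [measurable (raw)] = st_kernel_measurable[OF A] and [measurable] = f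
  show "(\<lambda>(t, x, y). apply_fun A f t x y) \<in> borel_measurable (borel \<Otimes>\<^sub>M borel \<Otimes>\<^sub>M borel)"
    unfolding apply_fun_def split_beta' by measurable
qed (simp add: apply_fun_def st_kernel_0[OF A])

lemma apply_fun_stc:
  assumes A: "st_kernel A" and B: "st_kernel B" and f: "f \<in> borel_measurable borel"
  shows "apply_fun (A \<star> B) f = A \<star> apply_fun B f"
proof (intro ext)
  fix t x u
  note [measurable (raw)] = st_kernel_measurable[OF A] st_kernel_measurable[OF B] and [measurable] = f
  have "apply_fun (A \<star> B) f t x u = (\<integral>\<^sup>+z. \<integral>\<^sup>+s. \<integral>\<^sup>+y. A s x y * B (t - s) y z * f z \<partial>m \<partial>lborel \<partial>m)"
    by (simp add: apply_fun_def stc_def nn_integral_multc)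
  also have "\<dots> = (\<integral>\<^sup>+s. \<integral>\<^sup>+z. \<integral>\<^sup>+y. A s x y * B (t - s) y z * f z \<partial>m \<partial>m \<partial>lborel)"
    by (rule swap_tm) measurable
  also have "\<dots> = (\<integral>\<^sup>+s. \<integral>\<^sup>+y. \<integral>\<^sup>+z. A s x y * B (t - s) y z * f z \<partial>m \<partial>m \<partial>lborel)"
    by (intro nn_integral_cong swap_mm) measurable
  also have "\<dots> = (A \<star> apply_fun B f) t x u"
    by (simp add: apply_fun_def stc_def nn_integral_cmult mult.assoc)
  finally show "apply_fun (A \<star> B) f t x u = (A \<star> apply_fun B f) t x u" .
qed

lemma apply_fun_kmul:
  assumes b: "sp_kernel b" and B: "st_kernel B" and f: "f \<in> borel_measurable borel"
  shows "apply_fun (b \<bullet>\<^sub>k B) f = b \<bullet>\<^sub>k apply_fun B f"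
proof (intro ext)
  fix t x u
  note [measurable (raw)] = sp_kernel_measurable[OF b] st_kernel_measurable[OF B] and [measurable] = f
  have "apply_fun (b \<bullet>\<^sub>k B) f t x u = (\<integral>\<^sup>+z. \<integral>\<^sup>+y. b x y * B t y z * f z \<partial>m \<partial>m)"
    by (simp add: apply_fun_def kmul_def nn_integral_multc)
  also have "\<dots> = (\<integral>\<^sup>+y. \<integral>\<^sup>+z. b x y * B t y z * f z \<partial>m \<partial>m)"
    by (rule swap_mm) measurable
  also have "\<dots> = (b \<bullet>\<^sub>k apply_fun B f) t x u"
    by (simp add: apply_fun_def kmul_def nn_integral_cmult mult.assoc)
  finally show "apply_fun (b \<bullet>\<^sub>k B) f t x u = (b \<bullet>\<^sub>k apply_fun B f) t x u" .
qed

end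

section \<open>Continuity in time\<close>

context heat_kernel
begin

lemma p_integral_continuous:
  assumes g[measurable]: "g \<in> borel_measurable borel" and gK: "\<And>y. g y \<le> ennreal K"
    and \<tau>: "0 < \<tau>" "\<tau>s \<longlonglongrightarrow> \<tau>"
  shows "(\<lambda>k. \<integral>\<^sup>+y. p (\<tau>s k) x y * g y \<partial>m) \<longlonglongrightarrow> (\<integral>\<^sup>+y. p \<tau> x y * g y \<partial>m)"
proof -
  note [measurable (raw)] = p_measurable
  \<comment> \<open>Terms outside (\<tau> / 2, 2 \<tau>) are replaced by \<tau>, so that
    \<open>p (\<tau> / 2)\<close> dominates for all indices and not only eventually.\<close>
  define \<sigma> where "\<sigma> k = (if \<tau> / 2 < \<tau>s k \<and> \<tau>s k < 2 * \<tau> then \<tau>s k else \<tau>)" for k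
  have "eventually (\<lambda>k. \<tau> / 2 < \<tau>s k \<and> \<tau>s k < 2 * \<tau>) sequentially"
    using order_tendstoD[OF \<tau>(2), of "\<tau> / 2"] order_tendstoD[OF \<tau>(2), of "2 * \<tau>"] \<tau>(1)
    by (intro eventually_conj) auto
  then have ev: "eventually (\<lambda>k. \<sigma> k = \<tau>s k) sequentially" by eventually_elim (simp add: \<sigma>_def)
  have \<sigma>: "\<sigma> \<longlonglongrightarrow> \<tau>" by (rule tendsto_cong[OF ev, THEN iffD2, OF \<tau>(2)])
  have \<sigma>b: "\<tau> / 2 \<le> \<sigma> k" "\<sigma> k \<le> 4 * (\<tau> / 2)" for k using \<tau>(1) by (auto simp: \<sigma>_def)
  have "(\<lambda>k. \<integral>\<^sup>+y. p (\<sigma> k) x y * g y \<partial>m) \<longlonglongrightarrow> (\<integral>\<^sup>+y. p \<tau> x y * g y \<partial>m)"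
  proof (rule nn_integral_dominated_convergence[where w="\<lambda>y. ennreal (4 * M2 / M1) * p (\<tau> / 2) x y * ennreal K"])
    show "AE y in m. p (\<sigma> k) x y * g y \<le> ennreal (4 * M2 / M1) * p (\<tau> / 2) x y * ennreal K" for k
      using \<sigma>b \<tau>(1) by (intro AE_I2 mult_mono gK p_comparable) auto
    have "(\<integral>\<^sup>+y. ennreal (4 * M2 / M1) * p (\<tau> / 2) x y * ennreal K \<partial>m) = ennreal (4 * M2 / M1) * (\<integral>\<^sup>+y. p (\<tau> / 2) x y \<partial>m) * ennreal K"
      by (simp add: nn_integral_cmult nn_integral_multc)
    also have "\<dots> \<le> ennreal (4 * M2 / M1) * 1 * ennreal K"
      by (intro mult_right_mono mult_left_mono p_mass) auto
    also have "\<dots> < \<infinity>" by (simp add: ennreal_mult_less_top)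
    finally show "(\<integral>\<^sup>+y. ennreal (4 * M2 / M1) * p (\<tau> / 2) x y * ennreal K \<partial>m) < \<infinity>" .
    show "AE y in m. (\<lambda>k. p (\<sigma> k) x y * g y) \<longlonglongrightarrow> p \<tau> x y * g y"
    proof (intro AE_I2)
      fix y
      have "g y < \<top>" using gK[of y] by (rule order_le_less_trans) simp
      from ennreal_tendsto_cmult[OF this p_cont[OF \<tau>(1) \<sigma>, of x y]]
      show "(\<lambda>k. p (\<sigma> k) x y * g y) \<longlonglongrightarrow> p \<tau> x y * g y" by (simp add: mult.commute)
    qed
  qed measurable
  moreover have ev': "eventually (\<lambda>k. (\<integral>\<^sup>+y. p (\<sigma> k) x y * g y \<partial>m) = (\<integral>\<^sup>+y. p (\<tau>s k) x y * g y \<partial>m)) sequentially"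
    using ev by eventually_elim simp
  ultimately show ?thesis using tendsto_cong[OF ev'] by simp
qed

text \<open>In the reflected form time enters through \<open>p\<close> only, whose integrals are
  continuous at positive times; the singular time \<open>s = t\<close> is a null set.\<close>

lemma stc_continuous:
  assumes V: "st_kernel V" and VK: "\<And>s y. s \<le> t0 \<Longrightarrow> V s y u \<le> ennreal K"
    and t: "0 < t" "ts \<longlonglongrightarrow> t" "\<And>k. ts k \<le> t0"
  shows "(\<lambda>k. (p \<star> V) (ts k) x u) \<longlonglongrightarrow> (p \<star> V) t x u"
proof -
  note [measurable (raw)] = p_measurable st_kernel_measurable[OF V]
  have tt0: "t \<le> t0" using LIMSEQ_le_const2[OF t(2)] t(3) by blast
  show ?thesis
    unfolding stc_reflect[OF p_kernel V]
  proof (rule nn_integral_dominated_convergence[where w="\<lambda>s. ennreal K * indicator {0<..t0} s"])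
    show "AE s in lborel. (\<integral>\<^sup>+y. p (ts k - s) x y * V s y u \<partial>m) \<le> ennreal K * indicator {0<..t0} s" for k
    proof (intro AE_I2)
      fix s
      show "(\<integral>\<^sup>+y. p (ts k - s) x y * V s y u \<partial>m) \<le> ennreal K * indicator {0<..t0} s"
      proof (cases "0 < s \<and> s \<le> t0")
        case True
        have "(\<integral>\<^sup>+y. p (ts k - s) x y * V s y u \<partial>m) \<le> (\<integral>\<^sup>+y. p (ts k - s) x y * ennreal K \<partial>m)"
          using True by (intro nn_integral_mono mult_left_mono VK) auto
        also have "\<dots> = (\<integral>\<^sup>+y. p (ts k - s) x y \<partial>m) * ennreal K" by (rule nn_integral_multc) measurable
        also have "\<dots> \<le> 1 * ennreal K" by (intro mult_right_mono p_mass) auto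
        finally show ?thesis using True by simp
      next
        case False
        then have "p (ts k - s) x y * V s y u = 0" for y
          using st_kernel_0[OF p_kernel, of "ts k - s" x y] st_kernel_0[OF V, of s y u] t(3)[of k]
          by (cases "s \<le> 0") auto
        then show ?thesis by (simp only:) simp
      qed
    qed
    show "(\<integral>\<^sup>+s. ennreal K * indicator {0<..t0} s \<partial>lborel) < \<infinity>"
      by (cases "0 \<le> t0") (simp_all add: nn_integral_cmult ennreal_mult_less_top)
    have "AE s in (lborel :: real measure). s \<noteq> t" by (rule AE_lborel_singleton)
    then show "AE s in lborel. (\<lambda>k. \<integral>\<^sup>+y. p (ts k - s) x y * V s y u \<partial>m) \<longlonglongrightarrow> (\<integral>\<^sup>+y. p (t - s) x y * V s y u \<partial>m)"
    proof eventually_elim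
      case (elim s)
      have lim: "(\<lambda>k. ts k - s) \<longlonglongrightarrow> t - s" by (intro tendsto_intros t(2))
      show ?case
      proof (cases "s < t")
        case True
        then show ?thesis
          using tt0 VK by (intro p_integral_continuous[where K=K, OF _ _ _ lim]) auto
      next
        case False
        then have "eventually (\<lambda>k. ts k - s < 0) sequentially"
          using elim by (intro order_tendstoD(2)[OF lim]) auto
        then have "eventually (\<lambda>k. (\<integral>\<^sup>+y. p (ts k - s) x y * V s y u \<partial>m) = 0) sequentially"
          by eventually_elim (simp add: st_kernel_0[OF p_kernel])
        moreover have "(\<integral>\<^sup>+y. p (t - s) x y * V s y u \<partial>m) = 0"
          using False by (simp add: st_kernel_0[OF p_kernel])
        ultimately show ?thesis by (simp add: tendsto_eventually)
      qed
    qed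
  qed measurable
qed

lemma occ_step:
  assumes s: "0 < s" "s \<le> 1" and g[measurable]: "g \<in> borel_measurable borel"
  shows "(\<integral>\<^sup>+w. occ x0 w * (\<integral>\<^sup>+y. p s w y * g y \<partial>m) \<partial>m) \<le> ennreal (1 + occ_rate * s) * (\<integral>\<^sup>+y. occ x0 y * g y \<partial>m)"
proof -
  note [measurable (raw)] = p_measurable
  have "(\<integral>\<^sup>+w. occ x0 w * (\<integral>\<^sup>+y. p s w y * g y \<partial>m) \<partial>m) = (\<integral>\<^sup>+w. \<integral>\<^sup>+y. occ x0 w * p s w y * g y \<partial>m \<partial>m)"
    by (simp add: nn_integral_cmult mult.assoc)
  also have "\<dots> = (\<integral>\<^sup>+y. \<integral>\<^sup>+w. occ x0 w * p s w y * g y \<partial>m \<partial>m)" by (rule swap_mm) measurable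
  also have "\<dots> = (\<integral>\<^sup>+y. (\<integral>\<^sup>+w. occ x0 w * p s w y \<partial>m) * g y \<partial>m)" by (simp add: nn_integral_multc)
  also have "\<dots> \<le> (\<integral>\<^sup>+y. ennreal (1 + occ_rate * s) * occ x0 y * g y \<partial>m)"
    by (intro nn_integral_mono mult_right_mono occ_excessive s) auto
  also have "\<dots> = ennreal (1 + occ_rate * s) * (\<integral>\<^sup>+y. occ x0 y * g y \<partial>m)"
    by (simp add: nn_integral_cmult mult.assoc)
  finally show ?thesis .
qed

lemma scale_time:
  fixes G :: "real \<Rightarrow> ennreal"
  assumes h: "0 < h" and G: "G \<in> borel_measurable borel"
  shows "(\<integral>\<^sup>+s\<in>{0<..h}. G s \<partial>lborel) = ennreal h * (\<integral>\<^sup>+\<theta>\<in>{0<..<1}. G (\<theta> * h) \<partial>lborel)"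
proof -
  have "(\<integral>\<^sup>+s\<in>{0<..h}. G s \<partial>lborel) = ennreal \<bar>h\<bar> * (\<integral>\<^sup>+\<theta>. G (0 + h * \<theta>) * indicator {0<..h} (0 + h * \<theta>) \<partial>lborel)"
    using h G by (intro nn_integral_real_affine) auto
  also have "(\<integral>\<^sup>+\<theta>. G (0 + h * \<theta>) * indicator {0<..h} (0 + h * \<theta>) \<partial>lborel) = (\<integral>\<^sup>+\<theta>\<in>{0<..<1}. G (\<theta> * h) \<partial>lborel)"
  proof (rule nn_integral_cong_AE)
    have "AE \<theta> in (lborel :: real measure). \<theta> \<noteq> 1" by (rule AE_lborel_singleton)
    then show "AE \<theta> in lborel. G (0 + h * \<theta>) * indicator {0<..h} (0 + h * \<theta>) = G (\<theta> * h) * indicator {0<..<1} \<theta>"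
      by eventually_elim (use h in \<open>auto split: split_indicator simp: mult.commute zero_less_mult_iff\<close>)
  qed
  finally show ?thesis using h by simp
qed

end

text \<open>Here \<open>b\<close> has no jumps of length up to \<epsilon> and therefore bounded
  mass. In \<open>part_False_le_True\<close> this is applied to the truncations of \<beta> with
  \<open>\<epsilon> = 1 / real (Suc j)\<close>.\<close>

locale far_perturbation = short_time_kernel m \<alpha> M1 M2 p n
  for m :: "'a::euclidean_space measure" and \<alpha> M1 M2 p n +
  fixes b :: "'a \<Rightarrow> 'a \<Rightarrow> ennreal" and \<epsilon> cb t0 c :: real
  assumes \<epsilon>: "0 < \<epsilon>" and t0: "0 < t0" and cb: "0 \<le> cb" and c: "0 \<le> c"
    and b_kernel: "sp_kernel b" and b_le_n: "\<And>w y. b w y \<le> n w y"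
    and b_far: "\<And>w y. b w y \<le> ennreal cb * far \<epsilon> w y"
    and series_bound: "\<And>t x z. 0 < t \<Longrightarrow> t \<le> t0 \<Longrightarrow> (\<Sum>k. pert b p k t x z) \<le> ennreal (c * stable_bound \<alpha> t x z)"
begin

lemmas b_measurable = sp_kernel_measurable[OF b_kernel]
lemmas far_measurable = sp_kernel_measurable[OF far_kernel]

lemma b_near: "norm (w - y) \<le> \<epsilon> \<Longrightarrow> b w y = 0"
  using b_far[of w y] by (simp add: far_def)

abbreviation R :: "bool \<Rightarrow> real \<Rightarrow> 'a \<Rightarrow> 'a \<Rightarrow> ennreal" where "R \<equiv> part b p"

lemma R_kernel: "st_kernel (R e)"
  by (rule st_kernel_part[OF b_kernel p_kernel])

lemma R_bound: "0 < t \<Longrightarrow> t \<le> t0 \<Longrightarrow> R e t x z \<le> ennreal (c / M1) * p t x z"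
proof -
  assume t: "0 < t" "t \<le> t0"
  have "R e t x z \<le> ennreal (c * stable_bound \<alpha> t x z)"
    using part_le series_bound[OF t] by (rule order_trans)
  also have "\<dots> = ennreal (c / M1 * (M1 * stable_bound \<alpha> t x z))" using M12 by simp
  also have "\<dots> = ennreal (c / M1) * ennreal (M1 * stable_bound \<alpha> t x z)"
    using M12 c stable_bound_pos[OF t(1), of \<alpha> x z] by (intro ennreal_mult) auto
  also have "\<dots> \<le> ennreal (c / M1) * p t x z" by (intro mult_left_mono p_lower t) auto
  finally show ?thesis .
qed

definition far_total :: real where "far_total = 1 / (M1 * \<epsilon> powr \<alpha>)"

lemma far_total: "0 \<le> far_total" "(\<integral>\<^sup>+y. far \<epsilon> w y \<partial>m) \<le> ennreal far_total"
  using M12 far_mass[OF \<epsilon>] by (auto simp: far_total_def)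

definition bd :: real where "bd = cb * far_total * (c / M1)"

lemma bd_nonneg: "0 \<le> bd"
  using cb c M12 far_total by (simp add: bd_def)

end

section \<open>The perturbed semigroup on functions and its negative part\<close>

locale far_perturbation_fun = far_perturbation m \<alpha> M1 M2 p n b \<epsilon> cb t0 c
  for m :: "'a::euclidean_space measure" and \<alpha> M1 M2 p n b \<epsilon> cb t0 c +
  fixes f :: "'a \<Rightarrow> ennreal"
  assumes f_meas [measurable]: "f \<in> borel_measurable borel" and f_le: "\<And>x. f x \<le> 1"
begin

definition U :: "bool \<Rightarrow> real \<Rightarrow> 'a \<Rightarrow> 'a \<Rightarrow> ennreal" where "U e = apply_fun (R e) f"

lemma U_const: "U e t x u = U e t x v"
  by (simp add: U_def apply_fun_def)

lemma U_kernel: "st_kernel (U e)"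
  unfolding U_def by (rule st_kernel_apply_fun[OF R_kernel f_meas])

lemma U_bound: "t \<le> t0 \<Longrightarrow> U e t x u \<le> ennreal (c / M1)"
proof -
  note [measurable (raw)] = p_measurable
  assume t: "t \<le> t0"
  show ?thesis
  proof (cases "0 < t")
    case True
    have "U e t x u \<le> (\<integral>\<^sup>+z. ennreal (c / M1) * p t x z \<partial>m)"
      unfolding U_def apply_fun_def
    proof (intro nn_integral_mono)
      fix z
      have "R e t x z * f z \<le> (ennreal (c / M1) * p t x z) * 1" by (intro mult_mono R_bound True t f_le) auto
      then show "R e t x z * f z \<le> ennreal (c / M1) * p t x z" by simp
    qed
    also have "\<dots> = ennreal (c / M1) * (\<integral>\<^sup>+z. p t x z \<partial>m)" by (rule nn_integral_cmult) measurable
    also have "\<dots> \<le> ennreal (c / M1) * 1" by (intro mult_left_mono p_mass) auto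
    finally show ?thesis by simp
  qed (simp add: st_kernel_0[OF U_kernel])
qed

lemma U_finite: "t \<le> t0 \<Longrightarrow> U e t x u < \<top>"
  by (rule order_le_less_trans[OF U_bound]) simp_all

lemma b_integral_bound:
  assumes "\<And>y. V y \<le> ennreal (c / M1)"
  shows "(\<integral>\<^sup>+y. b w y * V y \<partial>m) \<le> ennreal bd"
proof -
  note [measurable (raw)] = far_measurable
  have "(\<integral>\<^sup>+y. b w y * V y \<partial>m) \<le> (\<integral>\<^sup>+y. ennreal cb * far \<epsilon> w y * ennreal (c / M1) \<partial>m)"
    by (intro nn_integral_mono mult_mono b_far assms) auto
  also have "\<dots> = ennreal cb * (\<integral>\<^sup>+y. far \<epsilon> w y \<partial>m) * ennreal (c / M1)"
    by (simp add: nn_integral_cmult nn_integral_multc)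
  also have "\<dots> \<le> ennreal cb * ennreal far_total * ennreal (c / M1)"
    by (intro mult_right_mono mult_left_mono far_total) auto
  also have "\<dots> = ennreal bd"
    using cb far_total(1) c M12 by (simp add: bd_def ennreal_mult[symmetric])
  finally show ?thesis .
qed

lemma bU_bound: "t \<le> t0 \<Longrightarrow> (b \<bullet>\<^sub>k U e) t w u \<le> ennreal bd"
  unfolding kmul_def by (intro b_integral_bound U_bound)

lemma bU_kernel: "st_kernel (b \<bullet>\<^sub>k U e)"
  by (rule st_kernel_kmul[OF b_kernel U_kernel])

lemma U_left: "U e t x u = (if e then apply_fun p f t x u else 0) + (p \<star> (b \<bullet>\<^sub>k U (\<not> e))) t x u"
proof -
  note S = st_kernel_stc[OF p_kernel st_kernel_kmul[OF b_kernel R_kernel]]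
  note [measurable (raw)] = p_measurable st_kernel_measurable[OF S]
  have "U e t x u = (\<integral>\<^sup>+z. ((if e then p t x z else 0) + (p \<star> (b \<bullet>\<^sub>k R (\<not> e))) t x z) * f z \<partial>m)"
    unfolding U_def apply_fun_def part_left[OF b_kernel p_kernel, of e] ..
  also have "\<dots> = (\<integral>\<^sup>+z. (if e then p t x z else 0) * f z \<partial>m) + apply_fun (p \<star> (b \<bullet>\<^sub>k R (\<not> e))) f t x u"
    unfolding apply_fun_def distrib_right by (cases e) (simp_all add: nn_integral_add)
  also have "apply_fun (p \<star> (b \<bullet>\<^sub>k R (\<not> e))) f = p \<star> (b \<bullet>\<^sub>k U (\<not> e))"
    unfolding U_def apply_fun_stc[OF p_kernel st_kernel_kmul[OF b_kernel R_kernel] f_meas]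
      apply_fun_kmul[OF b_kernel R_kernel f_meas] ..
  finally show ?thesis by (cases e) (simp_all add: apply_fun_def)
qed

text \<open>\<open>undefined\<close> stands for the irrelevant last argument of the kernel \<open>U\<close>, cf. \<open>U_const\<close>.\<close>

definition src :: "bool \<Rightarrow> real \<Rightarrow> real \<Rightarrow> 'a \<Rightarrow> ennreal" where
  "src e h t x = (\<integral>\<^sup>+s\<in>{0<..h}. (\<integral>\<^sup>+w. p s x w * (b \<bullet>\<^sub>k U e) (t - s) w undefined \<partial>m) \<partial>lborel)"

lemma time_integral_bound:
  assumes h: "0 < h" and V: "\<And>s w. 0 < s \<Longrightarrow> s \<le> h \<Longrightarrow> V s w \<le> ennreal K"
  shows "(\<integral>\<^sup>+s\<in>{0<..h}. (\<integral>\<^sup>+w. p s x w * V s w \<partial>m) \<partial>lborel) \<le> ennreal K * ennreal h"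
proof -
  note [measurable (raw)] = p_measurable
  have "(\<integral>\<^sup>+s\<in>{0<..h}. (\<integral>\<^sup>+w. p s x w * V s w \<partial>m) \<partial>lborel) \<le> (\<integral>\<^sup>+s. ennreal K * indicator {0<..h} s \<partial>lborel)"
  proof (intro nn_integral_mono)
    fix s
    have "(\<integral>\<^sup>+w. p s x w * V s w \<partial>m) \<le> ennreal K" if "0 < s" "s \<le> h"
    proof -
      have "(\<integral>\<^sup>+w. p s x w * V s w \<partial>m) \<le> (\<integral>\<^sup>+w. p s x w * ennreal K \<partial>m)"
        using that by (intro nn_integral_mono mult_left_mono V) auto
      also have "\<dots> = (\<integral>\<^sup>+w. p s x w \<partial>m) * ennreal K" by (rule nn_integral_multc) measurable
      also have "\<dots> \<le> 1 * ennreal K" by (intro mult_right_mono p_mass) auto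
      finally show ?thesis by simp
    qed
    then show "(\<integral>\<^sup>+w. p s x w * V s w \<partial>m) * indicator {0<..h} s \<le> ennreal K * indicator {0<..h} s"
      by (auto split: split_indicator)
  qed
  also have "\<dots> = ennreal K * ennreal h" using h by (simp add: nn_integral_cmult)
  finally show ?thesis .
qed

lemma src_bound: "0 < h \<Longrightarrow> t \<le> t0 \<Longrightarrow> src e h t x \<le> ennreal bd * ennreal h"
  unfolding src_def by (intro time_integral_bound bU_bound) auto

lemma src_finite: "0 < h \<Longrightarrow> t \<le> t0 \<Longrightarrow> src e h t x < \<top>"
  by (rule order_le_less_trans[OF src_bound]) (simp_all add: ennreal_mult_less_top)

text \<open>Either no jump of \<open>b\<close> is recorded before \<open>h\<close> and the free
  kernel acts, or the first one is; the latter changes the sign, hence the opposite parity in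
  \<open>src\<close>.\<close>

lemma U_split:
  assumes h: "0 < h" "h < t"
  shows "U e t x u = (\<integral>\<^sup>+y. p h x y * U e (t - h) y u \<partial>m) + src (\<not> e) h t x"
proof -
  note [measurable (raw)] = p_measurable st_kernel_measurable[OF U_kernel] st_kernel_measurable[OF bU_kernel]
    st_kernel_measurable[OF st_kernel_stc[OF p_kernel bU_kernel]]
    st_kernel_measurable[OF st_kernel_apply_fun[OF p_kernel f_meas]]
  have pf: "(\<integral>\<^sup>+y. p h x y * apply_fun p f (t - h) y u \<partial>m) = apply_fun p f t x u"
  proof -
    have "(\<integral>\<^sup>+y. p h x y * apply_fun p f (t - h) y u \<partial>m) = (\<integral>\<^sup>+y. \<integral>\<^sup>+z. p h x y * (p (t - h) y z * f z) \<partial>m \<partial>m)"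
      by (simp add: apply_fun_def nn_integral_cmult)
    also have "\<dots> = (\<integral>\<^sup>+z. \<integral>\<^sup>+y. p h x y * (p (t - h) y z * f z) \<partial>m \<partial>m)" by (rule swap_mm) measurable
    also have "\<dots> = (\<integral>\<^sup>+z. (\<integral>\<^sup>+y. p h x y * p (t - h) y z \<partial>m) * f z \<partial>m)"
      by (simp add: nn_integral_multc mult.assoc[symmetric])
    also have "\<dots> = apply_fun p f t x u" using h by (simp add: p_CK apply_fun_def)
    finally show ?thesis .
  qed
  have "U e t x u = (if e then apply_fun p f t x u else 0) +
     ((\<integral>\<^sup>+y. p h x y * (p \<star> (b \<bullet>\<^sub>k U (\<not> e))) (t - h) y u \<partial>m) +
      (\<integral>\<^sup>+s\<in>{0<..h}. (\<integral>\<^sup>+w. p s x w * (b \<bullet>\<^sub>k U (\<not> e)) (t - s) w u \<partial>m) \<partial>lborel))"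
    by (simp only: U_left[of e t x u] stc_split_left[OF bU_kernel h(1), of "\<not> e" t x u])
  also have "(\<integral>\<^sup>+s\<in>{0<..h}. (\<integral>\<^sup>+w. p s x w * (b \<bullet>\<^sub>k U (\<not> e)) (t - s) w u \<partial>m) \<partial>lborel) = src (\<not> e) h t x"
    unfolding src_def kmul_def U_const[of _ _ _ u undefined] ..
  also have "(if e then apply_fun p f t x u else 0) +
     ((\<integral>\<^sup>+y. p h x y * (p \<star> (b \<bullet>\<^sub>k U (\<not> e))) (t - h) y u \<partial>m) + src (\<not> e) h t x) =
    (\<integral>\<^sup>+y. p h x y * ((if e then apply_fun p f (t - h) y u else 0) + (p \<star> (b \<bullet>\<^sub>k U (\<not> e))) (t - h) y u) \<partial>m) + src (\<not> e) h t x"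
    by (cases e) (simp_all add: distrib_left nn_integral_add pf add.assoc)
  also have "\<dots> = (\<integral>\<^sup>+y. p h x y * U e (t - h) y u \<partial>m) + src (\<not> e) h t x"
    unfolding U_left[of e, symmetric] ..
  finally show ?thesis .
qed

lemma U_continuous:
  assumes t: "0 < t" "ts \<longlonglongrightarrow> t" "\<And>k. ts k \<le> t0"
  shows "(\<lambda>k. U e (ts k) x u) \<longlonglongrightarrow> U e t x u"
proof -
  have 1: "(\<lambda>k. (p \<star> (b \<bullet>\<^sub>k U (\<not> e))) (ts k) x u) \<longlonglongrightarrow> (p \<star> (b \<bullet>\<^sub>k U (\<not> e))) t x u"
    by (rule stc_continuous[OF bU_kernel bU_bound t])
  have 2: "(\<lambda>k. apply_fun p f (ts k) x u) \<longlonglongrightarrow> apply_fun p f t x u"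
    unfolding apply_fun_def using f_le by (intro p_integral_continuous[OF f_meas _ t(1,2), of 1]) simp
  show ?thesis unfolding U_left[of e] using tendsto_add[OF 2 1] 1 by (cases e) simp_all
qed

text \<open>Truncated subtraction in \<open>ennreal\<close> makes \<open>pos\<close> and
  \<open>neg\<close> the positive and the negative part of the signed function u =
  \<open>U True - U False\<close>.\<close>

definition pos :: "real \<Rightarrow> 'a \<Rightarrow> ennreal" where "pos t y = U True t y undefined - U False t y undefined"
definition neg :: "real \<Rightarrow> 'a \<Rightarrow> ennreal" where "neg t y = U False t y undefined - U True t y undefined"

lemma pos_measurable: "(\<lambda>(t, y). pos t y) \<in> borel_measurable (borel \<Otimes>\<^sub>M borel)"
  and neg_measurable: "(\<lambda>(t, y). neg t y) \<in> borel_measurable (borel \<Otimes>\<^sub>M borel)"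
proof -
  note [measurable (raw)] = st_kernel_measurable[OF U_kernel]
  show "(\<lambda>(t, y). pos t y) \<in> borel_measurable (borel \<Otimes>\<^sub>M borel)" "(\<lambda>(t, y). neg t y) \<in> borel_measurable (borel \<Otimes>\<^sub>M borel)"
    unfolding pos_def neg_def split_beta' by measurable
qed

lemma pos_measurable' [measurable (raw)]:
  assumes "g \<in> N \<rightarrow>\<^sub>M borel" "h \<in> N \<rightarrow>\<^sub>M borel"
  shows "(\<lambda>\<omega>. pos (g \<omega>) (h \<omega>)) \<in> borel_measurable N"
  using measurable_compose[of "\<lambda>\<omega>. (g \<omega>, h \<omega>)" N, OF _ pos_measurable] assms by simp

lemma neg_measurable' [measurable (raw)]:
  assumes "g \<in> N \<rightarrow>\<^sub>M borel" "h \<in> N \<rightarrow>\<^sub>M borel"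
  shows "(\<lambda>\<omega>. neg (g \<omega>) (h \<omega>)) \<in> borel_measurable N"
  using measurable_compose[of "\<lambda>\<omega>. (g \<omega>, h \<omega>)" N, OF _ neg_measurable] assms by simp

lemma pos_bound: "t \<le> t0 \<Longrightarrow> pos t y \<le> ennreal (c / M1)"
  unfolding pos_def using diff_le_self_ennreal U_bound by (rule order_trans)

lemma neg_bound: "t \<le> t0 \<Longrightarrow> neg t y \<le> ennreal (c / M1)"
  unfolding neg_def using diff_le_self_ennreal U_bound by (rule order_trans)

lemma diff_continuous:
  assumes t: "0 < t" "ts \<longlonglongrightarrow> t" "\<And>k. ts k \<le> t0"
  shows "(\<lambda>k. pos (ts k) y) \<longlonglongrightarrow> pos t y" "(\<lambda>k. neg (ts k) y) \<longlonglongrightarrow> neg t y"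
proof -
  have "t \<le> t0" using LIMSEQ_le_const2[OF t(2)] t(3) by blast
  then have fin: "U e t y u \<noteq> \<top>" for e y u using U_finite[of t e y u] by auto
  show "(\<lambda>k. pos (ts k) y) \<longlonglongrightarrow> pos t y" "(\<lambda>k. neg (ts k) y) \<longlonglongrightarrow> neg t y"
    unfolding pos_def neg_def using fin by (intro tendsto_diff_ennreal U_continuous[OF t]; blast)+
qed

lemma pos_neg_balance: "t \<le> t0 \<Longrightarrow> U True t y u + neg t y = U False t y u + pos t y"
proof -
  assume "t \<le> t0"
  then have "U True t y u < \<top>" "U False t y u < \<top>" by (auto intro: U_finite)
  then show ?thesis
    unfolding pos_def neg_def U_const[of _ _ _ undefined u]
  proof (cases "U True t y u"; cases "U False t y u")
    fix r q assume rq: "0 \<le> r" "U True t y u = ennreal r" "0 \<le> q" "U False t y u = ennreal q"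
    then show "U True t y u + (U False t y u - U True t y u) = U False t y u + (U True t y u - U False t y u)"
      by (cases "r \<le> q") (simp_all add: ennreal_minus ennreal_neg flip: ennreal_plus)
  qed auto
qed

text \<open>This is u(t) = p(h) u(t - h) minus the contribution of \<open>b\<close> up to time
  \<open>h\<close>, with every term moved to the side where it is nonnegative.\<close>

lemma balance_split:
  assumes h: "0 < h" "h < t" "t \<le> t0"
  shows "U True t x u + (\<integral>\<^sup>+y. p h x y * neg (t - h) y \<partial>m) + src True h t x =
    U False t x u + (\<integral>\<^sup>+y. p h x y * pos (t - h) y \<partial>m) + src False h t x"
proof -
  note [measurable (raw)] = p_measurable st_kernel_measurable[OF U_kernel]
  have "(\<integral>\<^sup>+y. p h x y * U True (t - h) y u \<partial>m) + (\<integral>\<^sup>+y. p h x y * neg (t - h) y \<partial>m) =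
      (\<integral>\<^sup>+y. p h x y * (U True (t - h) y u + neg (t - h) y) \<partial>m)"
    by (simp add: distrib_left nn_integral_add)
  also have "\<dots> = (\<integral>\<^sup>+y. p h x y * (U False (t - h) y u + pos (t - h) y) \<partial>m)"
    using h by (simp add: pos_neg_balance)
  also have "\<dots> = (\<integral>\<^sup>+y. p h x y * U False (t - h) y u \<partial>m) + (\<integral>\<^sup>+y. p h x y * pos (t - h) y \<partial>m)"
    by (simp add: distrib_left nn_integral_add)
  finally show ?thesis
    unfolding U_split[OF h(1,2), of True x u] U_split[OF h(1,2), of False x u] by (simp add: add_ac)
qed

text \<open>As \<open>U True \<le> U False + pos\<close>, only the positive part of u can cause a
  net loss through \<open>b\<close>.\<close>

lemma src_le:
  assumes h: "0 < h" "t \<le> t0"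
  shows "src True h t x \<le> src False h t x + (\<integral>\<^sup>+s\<in>{0<..h}. (\<integral>\<^sup>+w. p s x w * (\<integral>\<^sup>+y. b w y * pos (t - s) y \<partial>m) \<partial>m) \<partial>lborel)"
proof -
  note [measurable (raw)] = p_measurable b_measurable st_kernel_measurable[OF U_kernel] st_kernel_measurable[OF bU_kernel]
  have "src True h t x \<le> (\<integral>\<^sup>+s. (\<integral>\<^sup>+w. p s x w * (b \<bullet>\<^sub>k U False) (t - s) w undefined \<partial>m) * indicator {0<..h} s +
      (\<integral>\<^sup>+w. p s x w * (\<integral>\<^sup>+y. b w y * pos (t - s) y \<partial>m) \<partial>m) * indicator {0<..h} s \<partial>lborel)"
    unfolding src_def
  proof (intro nn_integral_mono)
    fix s
    have "(\<integral>\<^sup>+w. p s x w * (b \<bullet>\<^sub>k U True) (t - s) w undefined \<partial>m) \<le>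
      (\<integral>\<^sup>+w. p s x w * (b \<bullet>\<^sub>k U False) (t - s) w undefined \<partial>m) + (\<integral>\<^sup>+w. p s x w * (\<integral>\<^sup>+y. b w y * pos (t - s) y \<partial>m) \<partial>m)"
      if "0 < s"
    proof -
      have "(b \<bullet>\<^sub>k U True) (t - s) w undefined \<le> (b \<bullet>\<^sub>k U False) (t - s) w undefined + (\<integral>\<^sup>+y. b w y * pos (t - s) y \<partial>m)" for w
      proof -
        have "(b \<bullet>\<^sub>k U True) (t - s) w undefined \<le> (\<integral>\<^sup>+y. b w y * U False (t - s) y undefined + b w y * pos (t - s) y \<partial>m)"
          unfolding kmul_def
        proof (intro nn_integral_mono)
          fix y
          have "U True (t - s) y undefined \<le> U False (t - s) y undefined + pos (t - s) y"
          proof -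
            have "U True (t - s) y undefined \<le> U True (t - s) y undefined + neg (t - s) y" by simp
            also have "\<dots> = U False (t - s) y undefined + pos (t - s) y"
              using that h by (intro pos_neg_balance) simp
            finally show ?thesis .
          qed
          then show "b w y * U True (t - s) y undefined \<le> b w y * U False (t - s) y undefined + b w y * pos (t - s) y"
            unfolding distrib_left[symmetric] by (rule mult_left_mono) simp
        qed
        also have "\<dots> = (b \<bullet>\<^sub>k U False) (t - s) w undefined + (\<integral>\<^sup>+y. b w y * pos (t - s) y \<partial>m)"
          unfolding kmul_def by (rule nn_integral_add) measurable
        finally show ?thesis .
      qed
      then have "(\<integral>\<^sup>+w. p s x w * (b \<bullet>\<^sub>k U True) (t - s) w undefined \<partial>m) \<le>
        (\<integral>\<^sup>+w. p s x w * ((b \<bullet>\<^sub>k U False) (t - s) w undefined + (\<integral>\<^sup>+y. b w y * pos (t - s) y \<partial>m)) \<partial>m)"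
        by (intro nn_integral_mono mult_left_mono) auto
      also have "\<dots> = (\<integral>\<^sup>+w. p s x w * (b \<bullet>\<^sub>k U False) (t - s) w undefined \<partial>m) + (\<integral>\<^sup>+w. p s x w * (\<integral>\<^sup>+y. b w y * pos (t - s) y \<partial>m) \<partial>m)"
        unfolding distrib_left by (rule nn_integral_add) measurable
      finally show ?thesis .
    qed
    then show "(\<integral>\<^sup>+w. p s x w * (b \<bullet>\<^sub>k U True) (t - s) w undefined \<partial>m) * indicator {0<..h} s \<le>
      (\<integral>\<^sup>+w. p s x w * (b \<bullet>\<^sub>k U False) (t - s) w undefined \<partial>m) * indicator {0<..h} s +
      (\<integral>\<^sup>+w. p s x w * (\<integral>\<^sup>+y. b w y * pos (t - s) y \<partial>m) \<partial>m) * indicator {0<..h} s"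
      by (auto split: split_indicator)
  qed
  also have "\<dots> = src False h t x + (\<integral>\<^sup>+s\<in>{0<..h}. (\<integral>\<^sup>+w. p s x w * (\<integral>\<^sup>+y. b w y * pos (t - s) y \<partial>m) \<partial>m) \<partial>lborel)"
    unfolding src_def by (rule nn_integral_add) measurable
  finally show ?thesis .
qed

definition Neg :: "real \<Rightarrow> 'a set" where
  "Neg t = {y. U True t y undefined < U False t y undefined}"

lemma Neg_measurable [measurable]: "Neg t \<in> sets borel"
proof -
  note [measurable (raw)] = st_kernel_measurable[OF U_kernel]
  have "{y \<in> space borel. U True t y undefined < U False t y undefined} \<in> sets borel" by measurable
  then show ?thesis by (simp add: Neg_def)
qed

text \<open>At a point of \<open>Neg t\<close> the positive part vanishes, and finite common terms
  cancel from the balance. The inflow from the positive part stays on the left, to be played off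
  against the loss through \<open>b\<close> on the right.\<close>

lemma neg_evolution:
  assumes h: "0 < h" "h < t" "t \<le> t0" and x: "x \<in> Neg t"
  shows "neg t x + (\<integral>\<^sup>+y. p h x y * pos (t - h) y \<partial>m) \<le> (\<integral>\<^sup>+y. p h x y * neg (t - h) y \<partial>m) +
    (\<integral>\<^sup>+s\<in>{0<..h}. (\<integral>\<^sup>+w. p s x w * (\<integral>\<^sup>+y. b w y * pos (t - s) y \<partial>m) \<partial>m) \<partial>lborel)"
    (is "_ + ?A \<le> ?N + ?Z")
proof -
  have pos0: "pos t x = 0" using x U_finite[OF h(3), of True x undefined]
    by (simp add: Neg_def pos_def diff_eq_0_ennreal)
  have eqF: "U False t x undefined = U True t x undefined + neg t x"
    using pos_neg_balance[OF h(3), of x undefined] pos0 by simp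
  have "U True t x undefined + (?N + src True h t x) = U True t x undefined + (neg t x + ?A + src False h t x)"
    using balance_split[OF h, of x undefined] unfolding eqF by (simp add: add_ac)
  then have "?N + src True h t x = neg t x + ?A + src False h t x"
    using U_finite[OF h(3), of True x undefined] by (auto simp: ennreal_add_left_cancel)
  then have "src False h t x + (neg t x + ?A) = ?N + src True h t x" by (simp add: add_ac)
  also have "\<dots> \<le> ?N + (src False h t x + ?Z)" by (intro add_left_mono src_le h)
  also have "\<dots> = src False h t x + (?N + ?Z)" by (simp add: add_ac)
  finally show ?thesis
    using src_finite[OF h(1,3), of False x] by (auto simp: ennreal_add_left_cancel_le)
qed

end

section \<open>Differential inequality for the weighted negative part\<close>

context far_perturbation_fun
begin

definition \<Phi> :: "'a \<Rightarrow> real \<Rightarrow> ennreal" where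
  "\<Phi> x0 t = (\<integral>\<^sup>+y. occ x0 y * neg t y \<partial>m)"

text \<open>The absolute difference of the positive parts at times \<open>t\<close> and
  \<open>t - s\<close>, i.e. the error of freezing the positive part at time
  \<open>t\<close>.\<close>

definition gap :: "real \<Rightarrow> real \<Rightarrow> 'a \<Rightarrow> ennreal" where
  "gap t s y = (pos t y - pos (t - s) y) + (pos (t - s) y - pos t y)"

definition gap_total :: "'a \<Rightarrow> real \<Rightarrow> real \<Rightarrow> ennreal" where
  "gap_total x0 t s = (\<integral>\<^sup>+w. occ x0 w * (\<integral>\<^sup>+y. far \<epsilon> w y * gap t s y \<partial>m) \<partial>m)"

lemma gap_measurable [measurable (raw)]:
  assumes "g \<in> N \<rightarrow>\<^sub>M borel" "h \<in> N \<rightarrow>\<^sub>M borel"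
  shows "(\<lambda>\<omega>. gap t (g \<omega>) (h \<omega>)) \<in> borel_measurable N"
  using assms unfolding gap_def by measurable

lemma gap_total_measurable [measurable (raw)]:
  assumes [measurable]: "g \<in> N \<rightarrow>\<^sub>M borel"
  shows "(\<lambda>\<omega>. gap_total x0 t (g \<omega>)) \<in> borel_measurable N"
proof -
  note [measurable (raw)] = far_measurable
  show ?thesis unfolding gap_total_def by measurable
qed

lemma pos_le_gap: "pos t y \<le> pos (t - s) y + gap t s y" "pos (t - s) y \<le> pos t y + gap t s y"
proof -
  have le: "u \<le> v + ((u - v) + (v - u))" for u v :: ennreal
  proof (cases "v \<le> u")
    case True
    then have "u \<le> v + (u - v)" by (simp add: add_diff_inverse_ennreal)
    also have "\<dots> \<le> v + ((u - v) + (v - u))" by (intro add_left_mono) simp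
    finally show ?thesis .
  qed (simp add: add_increasing2)
  show "pos t y \<le> pos (t - s) y + gap t s y" "pos (t - s) y \<le> pos t y + gap t s y"
    unfolding gap_def using le[of "pos t y" "pos (t - s) y"] le[of "pos (t - s) y" "pos t y"]
    by (simp_all add: add.commute)
qed

lemma gap_bound: "t \<le> t0 \<Longrightarrow> 0 \<le> s \<Longrightarrow> gap t s y \<le> ennreal (2 * (c / M1))"
proof -
  assume t: "t \<le> t0" "0 \<le> s"
  have "gap t s y \<le> ennreal (c / M1) + ennreal (c / M1)"
    unfolding gap_def using t
    by (intro add_mono order_trans[OF diff_le_self_ennreal] pos_bound) auto
  also have "\<dots> = ennreal (2 * (c / M1))" using c M12 by (simp flip: ennreal_plus)
  finally show ?thesis .
qed

lemma gap_tendsto: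
  assumes t: "0 < t" "t \<le> t0" and s: "s \<longlonglongrightarrow> 0" "\<And>k. 0 \<le> s k"
  shows "(\<lambda>k. gap t (s k) y) \<longlonglongrightarrow> 0"
proof -
  have lim: "(\<lambda>k. t - s k) \<longlonglongrightarrow> t" using tendsto_diff[OF tendsto_const s(1), of t] by simp
  have le: "t - s k \<le> t0" for k using s(2)[of k] t by linarith
  have fin: "pos t y \<noteq> \<top>" using pos_bound[OF t(2), of y] by (metis ennreal_less_top leD)
  note L = diff_continuous(1)[OF t(1) lim le, of y]
  have "(\<lambda>k. gap t (s k) y) \<longlonglongrightarrow> (pos t y - pos t y) + (pos t y - pos t y)"
    unfolding gap_def using fin by (intro tendsto_add tendsto_diff_ennreal L tendsto_const) auto
  then show ?thesis using fin by (simp add: diff_eq_0_ennreal less_top)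
qed

lemma gap_total_bound:
  assumes "t \<le> t0" "0 \<le> s"
  shows "gap_total x0 t s \<le> ennreal (far_total * (2 * (c / M1)))"
proof -
  note [measurable (raw)] = far_measurable
  have "gap_total x0 t s \<le> (\<integral>\<^sup>+w. occ x0 w * (\<integral>\<^sup>+y. far \<epsilon> w y * ennreal (2 * (c / M1)) \<partial>m) \<partial>m)"
    unfolding gap_total_def by (intro nn_integral_mono mult_left_mono gap_bound assms) auto
  also have "\<dots> \<le> (\<integral>\<^sup>+w. occ x0 w * (ennreal far_total * ennreal (2 * (c / M1))) \<partial>m)"
    by (intro nn_integral_mono mult_left_mono) (simp_all add: nn_integral_multc mult_right_mono far_total)
  also have "\<dots> = (\<integral>\<^sup>+w. occ x0 w \<partial>m) * (ennreal far_total * ennreal (2 * (c / M1)))"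
    by (rule nn_integral_multc) measurable
  also have "\<dots> \<le> 1 * (ennreal far_total * ennreal (2 * (c / M1)))"
    by (intro mult_right_mono occ_mass) auto
  also have "\<dots> = ennreal (far_total * (2 * (c / M1)))"
    using far_total(1) c M12 by (simp add: ennreal_mult[symmetric])
  finally show ?thesis .
qed

text \<open>Dominated convergence twice, in \<open>y\<close> with \<open>far\<close> and in
  \<open>w\<close> with \<open>occ\<close>, from the continuity of u in time.\<close>

lemma gap_total_tendsto:
  assumes t: "0 < t" "t \<le> t0" and s: "s \<longlonglongrightarrow> 0" "\<And>k. 0 \<le> s k"
  shows "(\<lambda>k. gap_total x0 t (s k)) \<longlonglongrightarrow> 0"
proof -
  note [measurable (raw)] = far_measurable
  define K where "K = 2 * (c / M1)"
  have inner: "(\<lambda>k. \<integral>\<^sup>+y. far \<epsilon> w y * gap t (s k) y \<partial>m) \<longlonglongrightarrow> (\<integral>\<^sup>+y. 0 \<partial>m)" for w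
  proof (rule nn_integral_dominated_convergence[where w="\<lambda>y. far \<epsilon> w y * ennreal K"])
    show "AE y in m. far \<epsilon> w y * gap t (s k) y \<le> far \<epsilon> w y * ennreal K" for k
      unfolding K_def using t s by (intro AE_I2 mult_left_mono gap_bound) auto
    have "(\<integral>\<^sup>+y. far \<epsilon> w y * ennreal K \<partial>m) = (\<integral>\<^sup>+y. far \<epsilon> w y \<partial>m) * ennreal K" by (rule nn_integral_multc) measurable
    also have "\<dots> \<le> ennreal far_total * ennreal K" by (intro mult_right_mono far_total) auto
    also have "\<dots> < \<infinity>" by (simp add: ennreal_mult_less_top)
    finally show "(\<integral>\<^sup>+y. far \<epsilon> w y * ennreal K \<partial>m) < \<infinity>" .
    have "far \<epsilon> w y < \<top>" for y unfolding far_def by (simp add: ennreal_mult_less_top split: split_indicator)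
    then have "(\<lambda>k. far \<epsilon> w y * gap t (s k) y) \<longlonglongrightarrow> far \<epsilon> w y * 0" for y
      by (intro ennreal_tendsto_cmult gap_tendsto t s)
    then show "AE y in m. (\<lambda>k. far \<epsilon> w y * gap t (s k) y) \<longlonglongrightarrow> 0" by simp
  qed measurable
  have le: "(\<integral>\<^sup>+y. far \<epsilon> w y * gap t (s k) y \<partial>m) \<le> ennreal far_total * ennreal K" for w k
  proof -
    have "(\<integral>\<^sup>+y. far \<epsilon> w y * gap t (s k) y \<partial>m) \<le> (\<integral>\<^sup>+y. far \<epsilon> w y * ennreal K \<partial>m)"
      unfolding K_def using t s by (intro nn_integral_mono mult_left_mono gap_bound) auto
    also have "\<dots> = (\<integral>\<^sup>+y. far \<epsilon> w y \<partial>m) * ennreal K" by (rule nn_integral_multc) measurable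
    also have "\<dots> \<le> ennreal far_total * ennreal K" by (intro mult_right_mono far_total) auto
    finally show ?thesis .
  qed
  have occ_fin: "AE w in m. occ x0 w < \<top>"
  proof -
    have "(\<integral>\<^sup>+w. occ x0 w \<partial>m) \<noteq> \<infinity>" using occ_mass[of x0] by (auto simp: top_unique)
    from nn_integral_PInf_AE[OF _ this] show ?thesis by (auto simp: less_top)
  qed
  have "(\<lambda>k. gap_total x0 t (s k)) \<longlonglongrightarrow> (\<integral>\<^sup>+w. 0 \<partial>m)"
    unfolding gap_total_def
  proof (rule nn_integral_dominated_convergence[where w="\<lambda>w. occ x0 w * (ennreal far_total * ennreal K)"])
    show "AE w in m. occ x0 w * (\<integral>\<^sup>+y. far \<epsilon> w y * gap t (s k) y \<partial>m) \<le> occ x0 w * (ennreal far_total * ennreal K)" for k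
      by (intro AE_I2 mult_left_mono le) auto
    have "(\<integral>\<^sup>+w. occ x0 w * (ennreal far_total * ennreal K) \<partial>m) = (\<integral>\<^sup>+w. occ x0 w \<partial>m) * (ennreal far_total * ennreal K)"
      by (rule nn_integral_multc) measurable
    also have "\<dots> \<le> 1 * (ennreal far_total * ennreal K)" by (intro mult_right_mono occ_mass) auto
    also have "\<dots> < \<infinity>" by (simp add: ennreal_mult_less_top)
    finally show "(\<integral>\<^sup>+w. occ x0 w * (ennreal far_total * ennreal K) \<partial>m) < \<infinity>" .
    show "AE w in m. (\<lambda>k. occ x0 w * (\<integral>\<^sup>+y. far \<epsilon> w y * gap t (s k) y \<partial>m)) \<longlonglongrightarrow> 0"
      using occ_fin
    proof eventually_elim
      case (elim w)
      from ennreal_tendsto_cmult[OF this inner[of w]] show ?case by simp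
    qed
  qed measurable
  then show ?thesis by simp
qed

lemma \<Phi>_bound: "t \<le> t0 \<Longrightarrow> \<Phi> x0 t \<le> ennreal (c / M1)"
proof -
  assume t: "t \<le> t0"
  have "\<Phi> x0 t \<le> (\<integral>\<^sup>+y. occ x0 y * ennreal (c / M1) \<partial>m)"
    unfolding \<Phi>_def by (intro nn_integral_mono mult_left_mono neg_bound t) auto
  also have "\<dots> = (\<integral>\<^sup>+y. occ x0 y \<partial>m) * ennreal (c / M1)" by (rule nn_integral_multc) measurable
  also have "\<dots> \<le> 1 * ennreal (c / M1)" by (intro mult_right_mono occ_mass) auto
  finally show ?thesis by simp
qed

lemma \<Phi>_finite: "t \<le> t0 \<Longrightarrow> \<Phi> x0 t < \<top>"
  by (rule order_le_less_trans[OF \<Phi>_bound]) simp_all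

text \<open>The negative part is at most \<open>U False\<close>, which starts with a jump and is
  therefore of order \<open>t\<close>. This rate keeps the first time in \<open>\<Phi>_eq_0\<close>
  away from 0.\<close>

lemma \<Phi>_small: "0 < t \<Longrightarrow> t \<le> t0 \<Longrightarrow> \<Phi> x0 t \<le> ennreal (bd * t)"
proof -
  assume t: "0 < t" "t \<le> t0"
  have "neg t y \<le> ennreal (bd * t)" for y
  proof -
    have "neg t y \<le> U False t y undefined" unfolding neg_def by (rule diff_le_self_ennreal)
    also have "\<dots> = (\<integral>\<^sup>+s\<in>{0<..t}. (\<integral>\<^sup>+w. p s y w * (b \<bullet>\<^sub>k U True) (t - s) w undefined \<partial>m) \<partial>lborel)"
      unfolding U_left[of False] stc_def using st_kernel_0[OF p_kernel] st_kernel_0[OF bU_kernel]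
      by (auto intro!: nn_integral_cong split: split_indicator simp: not_less)
    also have "\<dots> \<le> ennreal bd * ennreal t"
      using t by (intro time_integral_bound bU_bound) auto
    also have "\<dots> = ennreal (bd * t)" using bd_nonneg t by (simp add: ennreal_mult)
    finally show ?thesis .
  qed
  then have "\<Phi> x0 t \<le> (\<integral>\<^sup>+y. occ x0 y * ennreal (bd * t) \<partial>m)"
    unfolding \<Phi>_def by (intro nn_integral_mono mult_left_mono) auto
  also have "\<dots> = (\<integral>\<^sup>+y. occ x0 y \<partial>m) * ennreal (bd * t)" by (rule nn_integral_multc) measurable
  also have "\<dots> \<le> 1 * ennreal (bd * t)" by (intro mult_right_mono occ_mass) auto
  finally show ?thesis by simp
qed

lemma \<Phi>_continuous:
  assumes t: "0 < t" "ts \<longlonglongrightarrow> t" "\<And>k. ts k \<le> t0"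
  shows "(\<lambda>k. \<Phi> x0 (ts k)) \<longlonglongrightarrow> \<Phi> x0 t"
  unfolding \<Phi>_def
proof (rule nn_integral_dominated_convergence[where w="\<lambda>y. occ x0 y * ennreal (c / M1)"])
  show "AE y in m. occ x0 y * neg (ts k) y \<le> occ x0 y * ennreal (c / M1)" for k
    by (intro AE_I2 mult_left_mono neg_bound t) auto
  have "(\<integral>\<^sup>+y. occ x0 y * ennreal (c / M1) \<partial>m) = (\<integral>\<^sup>+y. occ x0 y \<partial>m) * ennreal (c / M1)" by (rule nn_integral_multc) measurable
  also have "\<dots> \<le> 1 * ennreal (c / M1)" by (intro mult_right_mono occ_mass) auto
  also have "\<dots> < \<infinity>" by simp
  finally show "(\<integral>\<^sup>+y. occ x0 y * ennreal (c / M1) \<partial>m) < \<infinity>" .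
  have "(\<integral>\<^sup>+w. occ x0 w \<partial>m) \<noteq> \<infinity>" using occ_mass[of x0] by (auto simp: top_unique)
  from nn_integral_PInf_AE[OF _ this] have "AE w in m. occ x0 w < \<top>" by (auto simp: less_top)
  then show "AE y in m. (\<lambda>k. occ x0 y * neg (ts k) y) \<longlonglongrightarrow> occ x0 y * neg t y"
    by eventually_elim (intro ennreal_tendsto_cmult diff_continuous(2)[OF t])
qed measurable

text \<open>\<open>neg_evolution\<close> integrated against \<open>occ x0\<close> over
  \<open>Neg t\<close>; almost excessiveness reduces the transported negative part to a multiple of
  its weighted mass at time \<open>t - h\<close>.\<close>

lemma \<Phi>_evolution:
  assumes h: "0 < h" "h < t" "t \<le> t0" "h \<le> 1"
  shows "\<Phi> x0 t + (\<integral>\<^sup>+w. occ x0 w * indicator (Neg t) w * (\<integral>\<^sup>+y. p h w y * pos (t - h) y \<partial>m) \<partial>m) \<le>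
    ennreal (1 + occ_rate * h) * \<Phi> x0 (t - h) +
    (\<integral>\<^sup>+x. occ x0 x * indicator (Neg t) x *
      (\<integral>\<^sup>+s\<in>{0<..h}. (\<integral>\<^sup>+w. p s x w * (\<integral>\<^sup>+y. b w y * pos (t - s) y \<partial>m) \<partial>m) \<partial>lborel) \<partial>m)"
proof -
  note [measurable (raw)] = p_measurable b_measurable
  let ?A = "\<lambda>x. \<integral>\<^sup>+y. p h x y * pos (t - h) y \<partial>m" and ?N = "\<lambda>x. \<integral>\<^sup>+y. p h x y * neg (t - h) y \<partial>m"
  let ?Z = "\<lambda>x. \<integral>\<^sup>+s\<in>{0<..h}. (\<integral>\<^sup>+w. p s x w * (\<integral>\<^sup>+y. b w y * pos (t - s) y \<partial>m) \<partial>m) \<partial>lborel"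
  let ?o = "\<lambda>x. occ x0 x * indicator (Neg t) x"
  have "\<Phi> x0 t = (\<integral>\<^sup>+x. ?o x * neg t x \<partial>m)"
    unfolding \<Phi>_def
  proof (intro nn_integral_cong)
    fix y
    have "neg t y = 0" if "y \<notin> Neg t"
      using that U_finite[OF h(3), of False y undefined] by (simp add: Neg_def neg_def diff_eq_0_ennreal not_less)
    then show "occ x0 y * neg t y = ?o y * neg t y" by (auto split: split_indicator)
  qed
  then have "\<Phi> x0 t + (\<integral>\<^sup>+x. ?o x * ?A x \<partial>m) = (\<integral>\<^sup>+x. ?o x * (neg t x + ?A x) \<partial>m)"
    by (simp add: distrib_left nn_integral_add)
  also have "\<dots> \<le> (\<integral>\<^sup>+x. occ x0 x * ?N x + ?o x * ?Z x \<partial>m)"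
  proof (intro nn_integral_mono)
    fix x
    show "?o x * (neg t x + ?A x) \<le> occ x0 x * ?N x + ?o x * ?Z x"
    proof (cases "x \<in> Neg t")
      case True
      then show ?thesis using mult_left_mono[OF neg_evolution[OF h(1,2,3) True], of "occ x0 x"]
        by (simp add: distrib_left)
    qed simp
  qed
  also have "\<dots> = (\<integral>\<^sup>+x. occ x0 x * ?N x \<partial>m) + (\<integral>\<^sup>+x. ?o x * ?Z x \<partial>m)"
    by (rule nn_integral_add) measurable
  also have "(\<integral>\<^sup>+x. occ x0 x * ?N x \<partial>m) \<le> ennreal (1 + occ_rate * h) * \<Phi> x0 (t - h)"
    unfolding \<Phi>_def by (intro occ_step h) measurable
  finally show ?thesis by (simp add: add_right_mono)
qed

text \<open>The inflow is reduced to jumps longer than \<epsilon>, to which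
  \<open>far_liminf\<close> applies; for these, \<open>p_far\<close> bounds the freezing error by
  \<open>h\<close> times the gap.\<close>

lemma far_part_le:
  assumes h: "0 < h" and t: "t \<le> t0"
  shows "(\<integral>\<^sup>+w. occ x0 w * indicator (Neg t) w * (\<integral>\<^sup>+y. p h w y * indicator {z. \<epsilon> < norm z} (w - y) * pos t y \<partial>m) \<partial>m) \<le>
    (\<integral>\<^sup>+w. occ x0 w * indicator (Neg t) w * (\<integral>\<^sup>+y. p h w y * pos (t - h) y \<partial>m) \<partial>m) + ennreal (M2 * h) * gap_total x0 t h"
proof -
  note [measurable (raw)] = p_measurable far_measurable
  let ?i = "\<lambda>w y. indicator {z. \<epsilon> < norm z} (w - y) :: ennreal" and ?o = "\<lambda>x. occ x0 x * indicator (Neg t) x"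
  have "(\<integral>\<^sup>+w. ?o w * (\<integral>\<^sup>+y. p h w y * ?i w y * pos t y \<partial>m) \<partial>m) \<le>
     (\<integral>\<^sup>+w. ?o w * (\<integral>\<^sup>+y. p h w y * pos (t - h) y \<partial>m) + ennreal (M2 * h) * (occ x0 w * (\<integral>\<^sup>+y. far \<epsilon> w y * gap t h y \<partial>m)) \<partial>m)"
  proof (intro nn_integral_mono)
    fix w
    have "(\<integral>\<^sup>+y. p h w y * ?i w y * pos t y \<partial>m) \<le> (\<integral>\<^sup>+y. p h w y * pos (t - h) y + ennreal (M2 * h) * (far \<epsilon> w y * gap t h y) \<partial>m)"
    proof (intro nn_integral_mono)
      fix y
      have "p h w y * ?i w y * pos t y \<le> p h w y * ?i w y * (pos (t - h) y + gap t h y)"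
        by (intro mult_left_mono pos_le_gap) auto
      also have "\<dots> = p h w y * ?i w y * pos (t - h) y + p h w y * ?i w y * gap t h y" by (rule distrib_left)
      also have "\<dots> \<le> p h w y * pos (t - h) y + (ennreal (M2 * h) * far \<epsilon> w y) * gap t h y"
      proof (intro add_mono mult_right_mono p_far h \<epsilon>)
        show "p h w y * ?i w y \<le> p h w y" by (auto split: split_indicator)
      qed auto
      finally show "p h w y * ?i w y * pos t y \<le> p h w y * pos (t - h) y + ennreal (M2 * h) * (far \<epsilon> w y * gap t h y)"
        by (simp add: mult.assoc)
    qed
    also have "\<dots> = (\<integral>\<^sup>+y. p h w y * pos (t - h) y \<partial>m) + ennreal (M2 * h) * (\<integral>\<^sup>+y. far \<epsilon> w y * gap t h y \<partial>m)"
      by (simp add: nn_integral_add nn_integral_cmult)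
    finally have "?o w * (\<integral>\<^sup>+y. p h w y * ?i w y * pos t y \<partial>m) \<le>
        ?o w * ((\<integral>\<^sup>+y. p h w y * pos (t - h) y \<partial>m) + ennreal (M2 * h) * (\<integral>\<^sup>+y. far \<epsilon> w y * gap t h y \<partial>m))"
      by (rule mult_left_mono) simp
    also have "\<dots> \<le> ?o w * (\<integral>\<^sup>+y. p h w y * pos (t - h) y \<partial>m) + ennreal (M2 * h) * (occ x0 w * (\<integral>\<^sup>+y. far \<epsilon> w y * gap t h y \<partial>m))"
      by (auto split: split_indicator simp: distrib_left mult_ac)
    finally show "?o w * (\<integral>\<^sup>+y. p h w y * ?i w y * pos t y \<partial>m) \<le>
      ?o w * (\<integral>\<^sup>+y. p h w y * pos (t - h) y \<partial>m) + ennreal (M2 * h) * (occ x0 w * (\<integral>\<^sup>+y. far \<epsilon> w y * gap t h y \<partial>m))" .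
  qed
  also have "\<dots> = (\<integral>\<^sup>+w. ?o w * (\<integral>\<^sup>+y. p h w y * pos (t - h) y \<partial>m) \<partial>m) + ennreal (M2 * h) * gap_total x0 t h"
    unfolding gap_total_def by (simp add: nn_integral_add nn_integral_cmult)
  finally show ?thesis .
qed

text \<open>The counterpart of \<open>far_part_le\<close> for the loss through \<open>b\<close>:
  \<open>b_far\<close> reduces the freezing error to \<open>gap_total\<close>, and
  \<open>occ_step\<close> absorbs the kernel \<open>p s\<close>.\<close>

lemma source_part_le:
  assumes h: "0 < h" "h \<le> 1" and t: "t \<le> t0"
  shows "(\<integral>\<^sup>+x. occ x0 x * indicator (Neg t) x *
      (\<integral>\<^sup>+s\<in>{0<..h}. (\<integral>\<^sup>+w. p s x w * (\<integral>\<^sup>+y. b w y * pos (t - s) y \<partial>m) \<partial>m) \<partial>lborel) \<partial>m) \<le>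
    (\<integral>\<^sup>+s\<in>{0<..h}. (\<integral>\<^sup>+x. occ x0 x * indicator (Neg t) x * (\<integral>\<^sup>+w. p s x w * (\<integral>\<^sup>+y. b w y * pos t y \<partial>m) \<partial>m) \<partial>m) \<partial>lborel) +
    (\<integral>\<^sup>+s\<in>{0<..h}. ennreal ((1 + occ_rate) * cb) * gap_total x0 t s \<partial>lborel)"
proof -
  note [measurable (raw)] = p_measurable far_measurable b_measurable
  let ?o = "\<lambda>x. occ x0 x * indicator (Neg t) x"
  have r: "0 \<le> occ_rate" using M12 by (simp add: occ_rate_def)
  have "(\<integral>\<^sup>+x. ?o x * (\<integral>\<^sup>+s\<in>{0<..h}. (\<integral>\<^sup>+w. p s x w * (\<integral>\<^sup>+y. b w y * pos (t - s) y \<partial>m) \<partial>m) \<partial>lborel) \<partial>m) =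
      (\<integral>\<^sup>+x. (\<integral>\<^sup>+s. ?o x * ((\<integral>\<^sup>+w. p s x w * (\<integral>\<^sup>+y. b w y * pos (t - s) y \<partial>m) \<partial>m) * indicator {0<..h} s) \<partial>lborel) \<partial>m)"
    by (intro nn_integral_cong nn_integral_cmult[symmetric]) measurable
  also have "\<dots> = (\<integral>\<^sup>+s. (\<integral>\<^sup>+x. ?o x * ((\<integral>\<^sup>+w. p s x w * (\<integral>\<^sup>+y. b w y * pos (t - s) y \<partial>m) \<partial>m) * indicator {0<..h} s) \<partial>m) \<partial>lborel)"
    by (rule swap_tm) measurable
  also have "\<dots> \<le> (\<integral>\<^sup>+s. (\<integral>\<^sup>+x. ?o x * (\<integral>\<^sup>+w. p s x w * (\<integral>\<^sup>+y. b w y * pos t y \<partial>m) \<partial>m) \<partial>m) * indicator {0<..h} s +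
     ennreal ((1 + occ_rate) * cb) * gap_total x0 t s * indicator {0<..h} s \<partial>lborel)"
  proof (intro nn_integral_mono)
    fix s
    have "(\<integral>\<^sup>+x. ?o x * (\<integral>\<^sup>+w. p s x w * (\<integral>\<^sup>+y. b w y * pos (t - s) y \<partial>m) \<partial>m) \<partial>m) \<le>
      (\<integral>\<^sup>+x. ?o x * (\<integral>\<^sup>+w. p s x w * (\<integral>\<^sup>+y. b w y * pos t y \<partial>m) \<partial>m) \<partial>m) + ennreal ((1 + occ_rate) * cb) * gap_total x0 t s"
      if s: "0 < s" "s \<le> h"
    proof -
      have "(\<integral>\<^sup>+x. ?o x * (\<integral>\<^sup>+w. p s x w * (\<integral>\<^sup>+y. b w y * pos (t - s) y \<partial>m) \<partial>m) \<partial>m) \<le>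
        (\<integral>\<^sup>+x. ?o x * (\<integral>\<^sup>+w. p s x w * (\<integral>\<^sup>+y. b w y * pos t y \<partial>m) \<partial>m) + occ x0 x * (\<integral>\<^sup>+w. p s x w * (\<integral>\<^sup>+y. b w y * gap t s y \<partial>m) \<partial>m) \<partial>m)"
      proof (intro nn_integral_mono)
        fix x
        have "(\<integral>\<^sup>+w. p s x w * (\<integral>\<^sup>+y. b w y * pos (t - s) y \<partial>m) \<partial>m) \<le>
          (\<integral>\<^sup>+w. p s x w * (\<integral>\<^sup>+y. b w y * (pos t y + gap t s y) \<partial>m) \<partial>m)"
          by (intro nn_integral_mono mult_left_mono pos_le_gap) auto
        also have "\<dots> = (\<integral>\<^sup>+w. p s x w * (\<integral>\<^sup>+y. b w y * pos t y \<partial>m) \<partial>m) + (\<integral>\<^sup>+w. p s x w * (\<integral>\<^sup>+y. b w y * gap t s y \<partial>m) \<partial>m)"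
          by (simp add: distrib_left nn_integral_add)
        finally have "?o x * (\<integral>\<^sup>+w. p s x w * (\<integral>\<^sup>+y. b w y * pos (t - s) y \<partial>m) \<partial>m) \<le>
          ?o x * ((\<integral>\<^sup>+w. p s x w * (\<integral>\<^sup>+y. b w y * pos t y \<partial>m) \<partial>m) + (\<integral>\<^sup>+w. p s x w * (\<integral>\<^sup>+y. b w y * gap t s y \<partial>m) \<partial>m))"
          by (rule mult_left_mono) simp
        also have "\<dots> \<le> ?o x * (\<integral>\<^sup>+w. p s x w * (\<integral>\<^sup>+y. b w y * pos t y \<partial>m) \<partial>m) + occ x0 x * (\<integral>\<^sup>+w. p s x w * (\<integral>\<^sup>+y. b w y * gap t s y \<partial>m) \<partial>m)"
          by (auto split: split_indicator simp: distrib_left)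
        finally show "?o x * (\<integral>\<^sup>+w. p s x w * (\<integral>\<^sup>+y. b w y * pos (t - s) y \<partial>m) \<partial>m) \<le>
          ?o x * (\<integral>\<^sup>+w. p s x w * (\<integral>\<^sup>+y. b w y * pos t y \<partial>m) \<partial>m) + occ x0 x * (\<integral>\<^sup>+w. p s x w * (\<integral>\<^sup>+y. b w y * gap t s y \<partial>m) \<partial>m)" .
      qed
      also have "\<dots> = (\<integral>\<^sup>+x. ?o x * (\<integral>\<^sup>+w. p s x w * (\<integral>\<^sup>+y. b w y * pos t y \<partial>m) \<partial>m) \<partial>m) +
          (\<integral>\<^sup>+x. occ x0 x * (\<integral>\<^sup>+w. p s x w * (\<integral>\<^sup>+y. b w y * gap t s y \<partial>m) \<partial>m) \<partial>m)"
        by (rule nn_integral_add) measurable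
      also have "(\<integral>\<^sup>+x. occ x0 x * (\<integral>\<^sup>+w. p s x w * (\<integral>\<^sup>+y. b w y * gap t s y \<partial>m) \<partial>m) \<partial>m) \<le>
          ennreal (1 + occ_rate * s) * (\<integral>\<^sup>+w. occ x0 w * (\<integral>\<^sup>+y. b w y * gap t s y \<partial>m) \<partial>m)"
        using s h by (intro occ_step) auto
      also have "\<dots> \<le> ennreal (1 + occ_rate) * (\<integral>\<^sup>+w. occ x0 w * (\<integral>\<^sup>+y. ennreal cb * far \<epsilon> w y * gap t s y \<partial>m) \<partial>m)"
        using s h r mult_left_mono[of s 1 occ_rate]
        by (intro mult_mono ennreal_leI nn_integral_mono mult_left_mono mult_right_mono b_far) auto
      also have "(\<integral>\<^sup>+w. occ x0 w * (\<integral>\<^sup>+y. ennreal cb * far \<epsilon> w y * gap t s y \<partial>m) \<partial>m) = ennreal cb * gap_total x0 t s"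
        unfolding gap_total_def by (simp add: nn_integral_cmult mult.assoc mult.left_commute)
      also have "ennreal (1 + occ_rate) * (ennreal cb * gap_total x0 t s) = ennreal ((1 + occ_rate) * cb) * gap_total x0 t s"
        using r cb by (simp add: ennreal_mult mult.assoc)
      finally show ?thesis by (simp add: add_left_mono)
    qed
    then show "(\<integral>\<^sup>+x. ?o x * ((\<integral>\<^sup>+w. p s x w * (\<integral>\<^sup>+y. b w y * pos (t - s) y \<partial>m) \<partial>m) * indicator {0<..h} s) \<partial>m) \<le>
      (\<integral>\<^sup>+x. ?o x * (\<integral>\<^sup>+w. p s x w * (\<integral>\<^sup>+y. b w y * pos t y \<partial>m) \<partial>m) \<partial>m) * indicator {0<..h} s +
      ennreal ((1 + occ_rate) * cb) * gap_total x0 t s * indicator {0<..h} s"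
      by (auto split: split_indicator)
  qed
  also have "\<dots> = (\<integral>\<^sup>+s\<in>{0<..h}. (\<integral>\<^sup>+x. ?o x * (\<integral>\<^sup>+w. p s x w * (\<integral>\<^sup>+y. b w y * pos t y \<partial>m) \<partial>m) \<partial>m) \<partial>lborel) +
    (\<integral>\<^sup>+s\<in>{0<..h}. ennreal ((1 + occ_rate) * cb) * gap_total x0 t s \<partial>lborel)"
    by (rule nn_integral_add) measurable
  finally show ?thesis .
qed

end

section \<open>Vanishing of the negative part\<close>

context far_perturbation_fun
begin

text \<open>The rate \<open>r + 1\<close> beats the growth \<open>1 + r * h\<close> of the weight by
  exp (- h), which is at most 1 - h / 2 on (0, 1].\<close>

lemma exp_half_step:
  fixes r h :: real
  assumes "0 \<le> r" "0 < h" "h \<le> 1"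
  shows "(1 + r * h) * exp (- (r + 1) * h) \<le> 1 - h / 2"
proof -
  have "(1 + r * h) * exp (- (r + 1) * h) \<le> exp (r * h) * exp (- (r + 1) * h)"
    by (intro mult_right_mono exp_ge_add_one_self) auto
  also have "\<dots> = exp (- h)" by (simp add: exp_add[symmetric] algebra_simps)
  also have "\<dots> = inverse (exp h)" by (rule exp_minus)
  also have "\<dots> \<le> inverse (1 + h)" using assms exp_ge_add_one_self[of h] by (intro le_imp_inverse_le) auto
  also have "\<dots> \<le> 1 - h / 2"
  proof -
    have "1 \<le> (1 - h / 2) * (1 + h)"
    proof -
      have "h * h \<le> h * 1" using assms by (intro mult_left_mono) auto
      then show ?thesis by (simp add: algebra_simps)
    qed
    then show ?thesis using assms by (simp add: inverse_eq_divide divide_le_eq)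
  qed
  finally show ?thesis .
qed

text \<open>Dividing \<open>\<Phi>_evolution\<close> by \<open>h = 1 / (k + 1)\<close> and letting \<open>k \<rightarrow> \<infinity>\<close>, \<open>far_liminf\<close> and \<open>short_liminf\<close> cancel
  the two terms containing \<open>b\<close>, and the growth condition \<open>dom\<close> leaves \<open>\<Phi> x0 t / 2 \<le> 0\<close>.\<close>

lemma \<Phi>_zero:
  assumes t: "0 < t" "t \<le> t0"
    and dom: "\<And>h. 0 < h \<Longrightarrow> h < t \<Longrightarrow> \<Phi> x0 (t - h) \<le> ennreal (exp (- (occ_rate + 1) * h)) * \<Phi> x0 t"
  shows "\<Phi> x0 t = 0"
proof -
  note [measurable (raw)] = p_measurable b_measurable far_measurable
  have r: "0 \<le> occ_rate" using M12 by (simp add: occ_rate_def)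
  let ?o = "\<lambda>x. occ x0 x * indicator (Neg t) x"
  let ?N = "\<lambda>k. real (Suc k)"
  let ?i = "\<lambda>w y. indicator {z. \<epsilon> < norm z} (w - y) :: ennreal"
  define Ba where "Ba w = (\<integral>\<^sup>+y. b w y * pos t y \<partial>m)" for w
  have Ba[measurable]: "Ba \<in> borel_measurable borel" unfolding Ba_def by measurable
  have Ba_le: "Ba w \<le> ennreal bd" for w
    unfolding Ba_def by (intro b_integral_bound pos_bound t)
  \<comment> \<open>\<open>W\<close> is the inflow through long jumps and \<open>Z\<close> the loss
    through \<open>b\<close>, both divided by \<open>h\<close>; \<open>E\<close> collects the
    freezing errors. Fatou only gives lower bounds, whereas \<open>Z\<close> needs an upper one:
    \<open>Y\<close>, the same integral for the complement \<open>bd - Ba\<close>, provides it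
    through \<open>Z k + Y k \<le> S\<close>.\<close>
  define W where "W k = ennreal (?N k) * (\<integral>\<^sup>+w. ?o w * (\<integral>\<^sup>+y. p (1 / ?N k) w y * ?i w y * pos t y \<partial>m) \<partial>m)" for k
  define Z where "Z k = (\<integral>\<^sup>+\<theta>\<in>{0<..<1}. (\<integral>\<^sup>+x. ?o x * (\<integral>\<^sup>+w. p (\<theta> / ?N k) x w * Ba w \<partial>m) \<partial>m) \<partial>lborel)" for k
  define Y where "Y k = (\<integral>\<^sup>+\<theta>\<in>{0<..<1}. (\<integral>\<^sup>+x. ?o x * (\<integral>\<^sup>+w. p (\<theta> / ?N k) x w * (ennreal bd - Ba w) \<partial>m) \<partial>m) \<partial>lborel)" for k
  define E where "E k = ennreal M2 * gap_total x0 t (1 / ?N k) +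
      ennreal ((1 + occ_rate) * cb) * (\<integral>\<^sup>+\<theta>\<in>{0<..<1}. gap_total x0 t (\<theta> / ?N k) \<partial>lborel)" for k
  define S where "S = ennreal bd * (\<integral>\<^sup>+x. ?o x \<partial>m)"
  have o_le: "(\<integral>\<^sup>+x. ?o x \<partial>m) \<le> 1"
    by (rule order_trans[OF _ occ_mass[of x0]]) (auto intro!: nn_integral_mono split: split_indicator)
  have S_fin: "S < \<top>"
  proof -
    have "S \<le> ennreal bd * 1" unfolding S_def by (intro mult_left_mono o_le) auto
    then show ?thesis by (rule order_le_less_trans) simp
  qed
  have step: "ennreal (1 / 2) * \<Phi> x0 t + W k \<le> Z k + E k" if k: "1 / ?N k < t" for k
  proof -
    define h where "h = 1 / ?N k"
    have h: "0 < h" "h < t" "h \<le> 1" using k by (auto simp: h_def)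
    define Fp where "Fp = (\<integral>\<^sup>+w. ?o w * (\<integral>\<^sup>+y. p h w y * ?i w y * pos t y \<partial>m) \<partial>m)"
    define A where "A = (\<integral>\<^sup>+w. ?o w * (\<integral>\<^sup>+y. p h w y * pos (t - h) y \<partial>m) \<partial>m)"
    define G where "G = ennreal (M2 * h) * gap_total x0 t h"
    define I2 where "I2 = (\<integral>\<^sup>+x. ?o x * (\<integral>\<^sup>+s\<in>{0<..h}. (\<integral>\<^sup>+w. p s x w * (\<integral>\<^sup>+y. b w y * pos (t - s) y \<partial>m) \<partial>m) \<partial>lborel) \<partial>m)"
    define J where "J = (\<integral>\<^sup>+s\<in>{0<..h}. (\<integral>\<^sup>+x. ?o x * (\<integral>\<^sup>+w. p s x w * Ba w \<partial>m) \<partial>m) \<partial>lborel)"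
    define J' where "J' = (\<integral>\<^sup>+s\<in>{0<..h}. ennreal ((1 + occ_rate) * cb) * gap_total x0 t s \<partial>lborel)"
    have 1: "\<Phi> x0 t + A \<le> ennreal (1 + occ_rate * h) * \<Phi> x0 (t - h) + I2"
      unfolding A_def I2_def by (rule \<Phi>_evolution[OF h(1,2) t(2) h(3)])
    have 2: "Fp \<le> A + G" unfolding Fp_def A_def G_def by (rule far_part_le[OF h(1) t(2)])
    have 3: "I2 \<le> J + J'" unfolding I2_def J_def J'_def Ba_def by (rule source_part_le[OF h(1,3) t(2)])
    have 4: "ennreal (1 + occ_rate * h) * \<Phi> x0 (t - h) \<le> ennreal (1 - h / 2) * \<Phi> x0 t"
    proof -
      have "ennreal (1 + occ_rate * h) * \<Phi> x0 (t - h) \<le> ennreal (1 + occ_rate * h) * (ennreal (exp (- (occ_rate + 1) * h)) * \<Phi> x0 t)"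
        by (intro mult_left_mono dom h) auto
      also have "\<dots> = ennreal ((1 + occ_rate * h) * exp (- (occ_rate + 1) * h)) * \<Phi> x0 t"
        using r h by (simp add: ennreal_mult mult.assoc)
      also have "\<dots> \<le> ennreal (1 - h / 2) * \<Phi> x0 t"
        by (intro mult_right_mono ennreal_leI exp_half_step r h) auto
      finally show ?thesis .
    qed
    have split: "\<Phi> x0 t = ennreal (1 - h / 2) * \<Phi> x0 t + ennreal (h / 2) * \<Phi> x0 t"
      using h by (simp add: distrib_right[symmetric] flip: ennreal_plus)
    have "ennreal (1 - h / 2) * \<Phi> x0 t + (ennreal (h / 2) * \<Phi> x0 t + Fp) = \<Phi> x0 t + Fp"
      using split by (simp add: add.assoc)
    also have "\<dots> \<le> (\<Phi> x0 t + A) + G" using add_left_mono[OF 2, of "\<Phi> x0 t"] by (simp add: add.assoc)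
    also have "\<dots> \<le> (ennreal (1 - h / 2) * \<Phi> x0 t + (J + J')) + G"
      by (intro add_right_mono order_trans[OF 1] add_mono 3 4)
    finally have "ennreal (1 - h / 2) * \<Phi> x0 t + (ennreal (h / 2) * \<Phi> x0 t + Fp) \<le> ennreal (1 - h / 2) * \<Phi> x0 t + (J + J' + G)"
      by (simp add: add.assoc)
    \<comment> \<open>The part \<open>1 - h / 2\<close> of the finite quantity \<Phi> cancels; the
      remaining \<open>h / 2\<close> becomes the factor 1 / 2 after division by
      \<open>h\<close>.\<close>
    then have "ennreal (h / 2) * \<Phi> x0 t + Fp \<le> J + J' + G"
      using \<Phi>_finite[OF t(2), of x0] by (auto simp: ennreal_add_left_cancel_le ennreal_mult_eq_top_iff)
    then have "ennreal (?N k) * (ennreal (h / 2) * \<Phi> x0 t + Fp) \<le> ennreal (?N k) * (J + J' + G)"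
      by (rule mult_left_mono) simp
    moreover have "ennreal (?N k) * (ennreal (h / 2) * \<Phi> x0 t + Fp) = ennreal (1 / 2) * \<Phi> x0 t + W k"
    proof -
      have "ennreal (?N k) * ennreal (h / 2) = ennreal (?N k * (h / 2))" using h by (intro ennreal_mult[symmetric]) auto
      also have "?N k * (h / 2) = 1 / 2" by (simp add: h_def)
      finally show ?thesis unfolding W_def Fp_def h_def[symmetric] distrib_left mult.assoc[symmetric] by simp
    qed
    moreover have "ennreal (?N k) * (J + J' + G) = Z k + E k"
    proof -
      have hN: "\<theta> * h = \<theta> / ?N k" for \<theta> by (simp add: h_def)
      have one: "ennreal (?N k) * ennreal h = 1"
        using h by (simp add: h_def ennreal_mult[symmetric] del: of_nat_Suc)
      have J: "J = ennreal h * Z k"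
        unfolding J_def Z_def by (subst scale_time[OF h(1)]) (measurable, simp add: hN)
      have J': "J' = ennreal h * (ennreal ((1 + occ_rate) * cb) * (\<integral>\<^sup>+\<theta>\<in>{0<..<1}. gap_total x0 t (\<theta> / ?N k) \<partial>lborel))"
        unfolding J'_def by (subst scale_time[OF h(1)]) (measurable, simp add: hN nn_integral_cmult mult.assoc)
      have G: "G = ennreal h * (ennreal M2 * gap_total x0 t (1 / ?N k))"
        unfolding G_def h_def[symmetric] using h M12 by (simp add: ennreal_mult mult_ac)
      have "ennreal (?N k) * (J + J' + G) = (ennreal (?N k) * ennreal h) * (Z k + E k)"
        unfolding J J' G E_def by (simp only: distrib_left mult.assoc add_ac)
      then show ?thesis unfolding one by simp
    qed
    ultimately show ?thesis by simp
  qed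
  have ZY: "Z k + Y k \<le> S" for k
  proof -
    have "Z k + Y k = (\<integral>\<^sup>+\<theta>\<in>{0<..<1}. (\<integral>\<^sup>+x. ?o x * (\<integral>\<^sup>+w. p (\<theta> / ?N k) x w * Ba w \<partial>m) + ?o x * (\<integral>\<^sup>+w. p (\<theta> / ?N k) x w * (ennreal bd - Ba w) \<partial>m) \<partial>m) \<partial>lborel)"
      unfolding Z_def Y_def by (simp add: nn_integral_add distrib_right)
    also have "\<dots> \<le> (\<integral>\<^sup>+\<theta>\<in>{0<..<1::real}. (\<integral>\<^sup>+x. ?o x * ennreal bd \<partial>m) \<partial>lborel)"
    proof (intro nn_integral_mono mult_right_mono)
      fix \<theta> x
      have "(\<integral>\<^sup>+w. p (\<theta> / ?N k) x w * Ba w \<partial>m) + (\<integral>\<^sup>+w. p (\<theta> / ?N k) x w * (ennreal bd - Ba w) \<partial>m) =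
        (\<integral>\<^sup>+w. p (\<theta> / ?N k) x w * (Ba w + (ennreal bd - Ba w)) \<partial>m)"
        unfolding distrib_left by (rule nn_integral_add[symmetric]) measurable
      also have "\<dots> = (\<integral>\<^sup>+w. p (\<theta> / ?N k) x w * ennreal bd \<partial>m)"
        using Ba_le by (simp add: add_diff_inverse_ennreal)
      also have "\<dots> = (\<integral>\<^sup>+w. p (\<theta> / ?N k) x w \<partial>m) * ennreal bd" by (rule nn_integral_multc) measurable
      also have "\<dots> \<le> 1 * ennreal bd" by (intro mult_right_mono p_mass) auto
      finally have "?o x * ((\<integral>\<^sup>+w. p (\<theta> / ?N k) x w * Ba w \<partial>m) + (\<integral>\<^sup>+w. p (\<theta> / ?N k) x w * (ennreal bd - Ba w) \<partial>m)) \<le> ?o x * (1 * ennreal bd)"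
        by (rule mult_left_mono) simp
      then show "?o x * (\<integral>\<^sup>+w. p (\<theta> / ?N k) x w * Ba w \<partial>m) + ?o x * (\<integral>\<^sup>+w. p (\<theta> / ?N k) x w * (ennreal bd - Ba w) \<partial>m) \<le> ?o x * ennreal bd"
        by (simp add: distrib_left)
    qed auto
    also have "\<dots> = S" unfolding S_def by (simp add: nn_integral_cmult nn_integral_multc mult.commute)
    finally show ?thesis .
  qed
  have scale0: "(\<lambda>k. \<theta> / ?N k) \<longlonglongrightarrow> 0" for \<theta> :: real
    using LIMSEQ_Suc[OF lim_const_over_n[of \<theta>]] by simp
  have E0: "E \<longlonglongrightarrow> 0"
  proof -
    have 1: "(\<lambda>k. gap_total x0 t (1 / ?N k)) \<longlonglongrightarrow> 0"
      by (rule gap_total_tendsto[OF t scale0]) simp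
    have 2: "(\<lambda>k. \<integral>\<^sup>+\<theta>. gap_total x0 t (\<theta> / ?N k) * indicator {0<..<1} \<theta> \<partial>lborel) \<longlonglongrightarrow> (\<integral>\<^sup>+\<theta>. 0 \<partial>(lborel :: real measure))"
    proof (rule nn_integral_dominated_convergence[where w="\<lambda>\<theta>. ennreal (far_total * (2 * (c / M1))) * indicator {0<..<1} \<theta>"])
      show "AE \<theta> in lborel. gap_total x0 t (\<theta> / ?N k) * indicator {0<..<1} \<theta> \<le> ennreal (far_total * (2 * (c / M1))) * indicator {0<..<1} \<theta>" for k
        using gap_total_bound[OF t(2), of _ x0] by (intro AE_I2) (auto split: split_indicator)
      show "AE \<theta> in lborel. (\<lambda>k. gap_total x0 t (\<theta> / ?N k) * indicator {0<..<1} \<theta>) \<longlonglongrightarrow> 0"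
        using gap_total_tendsto[OF t scale0] by (intro AE_I2) (auto split: split_indicator)
    qed (auto simp: nn_integral_cmult)
    have "E \<longlonglongrightarrow> ennreal M2 * 0 + ennreal ((1 + occ_rate) * cb) * 0"
      unfolding E_def using 2 by (intro tendsto_add ennreal_tendsto_cmult 1) simp_all
    then show ?thesis by simp
  qed
  have lW: "(\<integral>\<^sup>+w. ?o w * Ba w \<partial>m) \<le> liminf W"
    unfolding W_def Ba_def by (rule far_liminf[OF \<epsilon> b_kernel b_le_n b_near]) measurable
  have lY: "(\<integral>\<^sup>+w. ?o w * (ennreal bd - Ba w) \<partial>m) \<le> liminf Y"
    unfolding Y_def by (rule short_liminf) measurable
  have sum: "(\<integral>\<^sup>+w. ?o w * Ba w \<partial>m) + (\<integral>\<^sup>+w. ?o w * (ennreal bd - Ba w) \<partial>m) = S"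
  proof -
    have "(\<integral>\<^sup>+w. ?o w * Ba w \<partial>m) + (\<integral>\<^sup>+w. ?o w * (ennreal bd - Ba w) \<partial>m) = (\<integral>\<^sup>+w. ?o w * (Ba w + (ennreal bd - Ba w)) \<partial>m)"
      unfolding distrib_left by (rule nn_integral_add[symmetric]) measurable
    also have "\<dots> = (\<integral>\<^sup>+w. ?o w * ennreal bd \<partial>m)" using Ba_le by (simp add: add_diff_inverse_ennreal)
    also have "\<dots> = S" unfolding S_def by (subst nn_integral_multc) (auto simp: mult.commute)
    finally show ?thesis .
  qed
  \<comment> \<open>\<open>S\<close> is at most the sum of the lower limits of \<open>W\<close> and
    \<open>Y\<close>, while \<open>Z + Y\<close> is at most \<open>S\<close>. So \<open>S\<close>
    cancels, and half of \<Phi> is left against the vanishing errors.\<close>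
  have "ennreal (1 / 2) * \<Phi> x0 t + S \<le> liminf (\<lambda>k. ennreal (1 / 2) * \<Phi> x0 t) + (liminf W + liminf Y)"
    unfolding sum[symmetric] by (intro add_mono lW lY) (simp add: Liminf_const)
  also have "\<dots> \<le> liminf (\<lambda>k. ennreal (1 / 2) * \<Phi> x0 t) + liminf (\<lambda>k. W k + Y k)"
    by (intro add_left_mono liminf_add_ennreal)
  also have "\<dots> \<le> liminf (\<lambda>k. ennreal (1 / 2) * \<Phi> x0 t + (W k + Y k))" by (rule liminf_add_ennreal)
  also have "\<dots> \<le> liminf (\<lambda>k. S + E k)"
  proof (rule Liminf_mono)
    have "eventually (\<lambda>k. 1 / ?N k < t) sequentially" by (rule order_tendstoD(2)[OF scale0 t(1)])
    then show "eventually (\<lambda>k. ennreal (1 / 2) * \<Phi> x0 t + (W k + Y k) \<le> S + E k) sequentially"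
    proof eventually_elim
      case (elim k)
      have "ennreal (1 / 2) * \<Phi> x0 t + (W k + Y k) \<le> (Z k + E k) + Y k"
        using add_right_mono[OF step[OF elim], of "Y k"] by (simp add: add.assoc)
      also have "\<dots> \<le> S + E k" using add_right_mono[OF ZY, of k "E k"] by (simp add: add_ac)
      finally show ?case .
    qed
  qed
  also have "\<dots> = S" using tendsto_add[OF tendsto_const E0, of S] by (intro lim_imp_Liminf) auto
  finally have "S + ennreal (1 / 2) * \<Phi> x0 t \<le> S + 0" by (simp add: add.commute)
  then have "ennreal (1 / 2) * \<Phi> x0 t \<le> 0" using S_fin unfolding ennreal_add_left_cancel_le by auto
  then show ?thesis by simp
qed

text \<open>Otherwise \<open>\<Phi>_zero\<close> applies at the first time at which \<open>exp (- (occ_rate + 1) t) \<Phi>(t)\<close> reaches some positive level.\<close>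

lemma \<Phi>_eq_0:
  assumes t: "0 < t" "t \<le> t0"
  shows "\<Phi> x0 t = 0"
proof (rule ccontr)
  assume ne: "\<Phi> x0 t \<noteq> 0"
  define r where "r = occ_rate + 1"
  have r: "1 \<le> r" using M12 by (simp add: r_def occ_rate_def)
  define \<phi> where "\<phi> s = enn2real (\<Phi> x0 s)" for s
  have \<Phi>: "\<Phi> x0 s = ennreal (\<phi> s)" if "s \<le> t0" for s
    unfolding \<phi>_def using \<Phi>_finite[OF that, of x0] by simp
  have \<phi>0: "0 \<le> \<phi> s" for s by (simp add: \<phi>_def)
  define \<psi> where "\<psi> s = exp (- r * s) * \<phi> s" for s
  have cont: "(\<lambda>k. \<psi> (s k)) \<longlonglongrightarrow> \<psi> u" if u: "0 < u" "s \<longlonglongrightarrow> u" "\<And>k. s k \<le> t0" for s u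
  proof -
    have "u \<le> t0" using LIMSEQ_le_const2[OF u(2)] u(3) by blast
    then have "\<Phi> x0 u \<noteq> \<top>" using \<Phi>_finite by (metis less_irrefl)
    then have "(\<lambda>k. \<phi> (s k)) \<longlonglongrightarrow> \<phi> u"
      unfolding \<phi>_def using \<Phi>_continuous[OF u, of x0] by (intro tendsto_enn2real) (auto simp: less_top)
    then show ?thesis unfolding \<psi>_def using u(2) by (intro tendsto_intros)
  qed
  have pos: "0 < \<psi> t" using ne \<Phi>[OF t(2)] \<phi>0[of t] by (auto simp: \<psi>_def less_le)
  \<comment> \<open>The level is \<open>\<psi> t\<close> itself and \<open>u\<close> is the first
    time at which it is reached. Before \<open>u\<close> the function \<psi> stays below the level,
    which is the growth condition of \<open>\<Phi>_zero\<close> at \<open>u\<close>.\<close>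
  define T where "T = {s. 0 < s \<and> s \<le> t \<and> \<psi> t \<le> \<psi> s}"
  have T: "t \<in> T" "bdd_below T" using t by (auto simp: T_def intro!: bdd_belowI[of _ 0])
  define u where "u = Inf T"
  have u_le: "u \<le> s" if "s \<in> T" for s unfolding u_def using T that by (intro cInf_lower) auto
  have small: "\<psi> s \<le> bd * s" if "0 < s" "s \<le> t" for s
  proof -
    have "ennreal (\<phi> s) \<le> ennreal (bd * s)" using \<Phi>_small[of s x0] \<Phi>[of s] that t by auto
    then have "\<phi> s \<le> bd * s" using bd_nonneg that by (subst (asm) ennreal_le_iff) auto
    moreover have "exp (- r * s) * \<phi> s \<le> 1 * \<phi> s" using r that \<phi>0 by (intro mult_right_mono) auto
    ultimately show ?thesis by (simp add: \<psi>_def)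
  qed
  \<comment> \<open>Because \<open>\<psi> s \<le> bd * s\<close>, the level is not reached before
    \<open>\<psi> t / (bd + 1)\<close>; adding 1 avoids division by 0.\<close>
  have u0: "0 < u"
  proof -
    have "\<psi> t / (bd + 1) \<le> s" if "s \<in> T" for s
    proof -
      have "\<psi> t \<le> bd * s" using small[of s] that by (auto simp: T_def)
      also have "\<dots> \<le> (bd + 1) * s" using that by (simp add: T_def algebra_simps)
      finally show ?thesis using bd_nonneg by (simp add: divide_le_eq mult.commute)
    qed
    then have "\<psi> t / (bd + 1) \<le> u" unfolding u_def using T by (intro cInf_greatest) auto
    moreover have "0 < \<psi> t / (bd + 1)" using pos bd_nonneg by simp
    ultimately show ?thesis by linarith
  qed
  have ut: "u \<le> t" by (rule u_le[OF T(1)])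
  have uT: "\<psi> t \<le> \<psi> u"
  proof -
    have "\<exists>s. s \<in> T \<and> s < u + 1 / real (Suc k)" for k
      using cInf_lessD[of T "u + 1 / real (Suc k)"] T(1) by (auto simp: u_def[symmetric])
    then obtain s where s: "\<And>k. s k \<in> T" "\<And>k. s k < u + 1 / real (Suc k)" by metis
    have "(\<lambda>k. 1 / real (Suc k)) \<longlonglongrightarrow> 0" using LIMSEQ_Suc[OF lim_const_over_n[of "1::real"]] by simp
    from tendsto_add[OF tendsto_const this, of u] have lim: "(\<lambda>k. u + 1 / real (Suc k)) \<longlonglongrightarrow> u" by simp
    have "s \<longlonglongrightarrow> u"
    proof (rule tendsto_sandwich[OF _ _ tendsto_const lim])
      show "eventually (\<lambda>k. u \<le> s k) sequentially" using u_le[OF s(1)] by (intro always_eventually allI)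
      show "eventually (\<lambda>k. s k \<le> u + 1 / real (Suc k)) sequentially"
        using s(2) by (intro always_eventually allI less_imp_le)
    qed
    then have "(\<lambda>k. \<psi> (s k)) \<longlonglongrightarrow> \<psi> u" 
    proof (rule cont[OF u0])
      show "s k \<le> t0" for k using s(1)[of k] t(2) by (auto simp: T_def)
    qed
    moreover have "\<psi> t \<le> \<psi> (s k)" for k using s(1)[of k] by (simp add: T_def)
    ultimately show ?thesis by (intro LIMSEQ_le_const) auto
  qed
  have "\<Phi> x0 (u - h) \<le> ennreal (exp (- (occ_rate + 1) * h)) * \<Phi> x0 u" if h: "0 < h" "h < u" for h
  proof -
    have "u - h \<notin> T" using u_le[of "u - h"] h by auto
    then have "\<psi> (u - h) < \<psi> t" using h ut by (auto simp: T_def)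
    then have "\<psi> (u - h) \<le> \<psi> u" using uT by linarith
    then have "exp (- r * (u - h)) * \<phi> (u - h) \<le> exp (- r * u) * \<phi> u" unfolding \<psi>_def .
    then have "exp (r * (u - h)) * (exp (- r * (u - h)) * \<phi> (u - h)) \<le> exp (r * (u - h)) * (exp (- r * u) * \<phi> u)"
      by (rule mult_left_mono) (rule less_imp_le[OF exp_gt_zero])
    moreover have "exp (r * (u - h)) * exp (- r * (u - h)) = 1" "exp (r * (u - h)) * exp (- r * u) = exp (- r * h)"
      unfolding exp_add[symmetric] by (simp_all add: algebra_simps)
    ultimately have "\<phi> (u - h) \<le> exp (- r * h) * \<phi> u"
      by (simp only: mult.assoc[symmetric] mult_1_left)
    then show ?thesis
      using ut t h \<phi>0 by (simp add: \<Phi> ennreal_mult[symmetric] r_def ennreal_leI)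
  qed
  then have "\<Phi> x0 u = 0" using ut t by (intro \<Phi>_zero[OF u0]) auto
  then have "\<phi> u = 0" by (simp add: \<phi>_def)
  then show False using uT pos by (simp add: \<psi>_def)
qed

text \<open>\<open>\<Phi>_eq_0\<close> and positivity of \<open>occ\<close> make the negative part
  vanish almost everywhere. One more step of \<open>p\<close>, of length \<open>h\<close>, removes
  the exceptional null set, and the jumps of \<open>b\<close> during this step contribute at most
  \<open>bd * h\<close>.\<close>

lemma U_le:
  assumes t: "0 < t" "t \<le> t0"
  shows "U False t x u \<le> U True t x u"
proof (rule ennreal_le_epsilon)
  fix e :: real assume e: "0 < e"
  note [measurable (raw)] = p_measurable
  define h where "h = min (t / 2) (e / (bd + 1))"
  have h: "0 < h" "h < t" using t e bd_nonneg by (auto simp: h_def)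
  have "AE y in m. occ x y * neg (t - h) y = 0"
  proof -
    have "(\<integral>\<^sup>+y. occ x y * neg (t - h) y \<partial>m) = 0" using \<Phi>_eq_0[of "t - h" x] h t unfolding \<Phi>_def by simp
    then show ?thesis by (subst (asm) nn_integral_0_iff_AE) auto
  qed
  then have "AE y in m. neg (t - h) y = 0"
    by eventually_elim (metis less_irrefl mult_eq_0_iff occ_pos)
  then have "(\<integral>\<^sup>+y. p h x y * neg (t - h) y \<partial>m) = 0"
    by (subst nn_integral_0_iff_AE) (auto elim: eventually_mono)
  then have "U False t x u \<le> U True t x u + src True h t x"
  proof -
    have "U False t x u \<le> U False t x u + (\<integral>\<^sup>+y. p h x y * pos (t - h) y \<partial>m) + src False h t x"
      by (simp add: add_increasing2)
    then show ?thesis using balance_split[OF h t(2), of x u] \<open>(\<integral>\<^sup>+y. p h x y * neg (t - h) y \<partial>m) = 0\<close> by simp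
  qed
  also have "src True h t x \<le> ennreal bd * ennreal h" by (rule src_bound[OF h(1) t(2)])
  also have "ennreal bd * ennreal h \<le> ennreal e"
  proof -
    have "bd * h \<le> bd * (e / (bd + 1))" unfolding h_def using bd_nonneg by (intro mult_left_mono) auto
    also have "\<dots> \<le> e" using bd_nonneg e by (simp add: divide_le_eq algebra_simps)
    finally show ?thesis using bd_nonneg h by (simp add: ennreal_mult[symmetric] ennreal_leI)
  qed
  finally show "U False t x u \<le> U True t x u + ennreal e" by (simp add: add_left_mono)
qed

end

section \<open>Pointwise positivity for truncated perturbations\<close>

context far_perturbation
begin

lemma R_integral_le:
  assumes t: "0 < t" "t \<le> t0" and f: "f \<in> borel_measurable borel" "\<And>x. f x \<le> 1"
  shows "(\<integral>\<^sup>+z. R False t x z * f z \<partial>m) \<le> (\<integral>\<^sup>+z. R True t x z * f z \<partial>m)"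
proof -
  interpret F: far_perturbation_fun m \<alpha> M1 M2 p n b \<epsilon> cb t0 c f by unfold_locales (use f in auto)
  show ?thesis using F.U_le[OF t, of x undefined] by (simp add: F.U_def apply_fun_def)
qed

lemma R_mass: "0 < t \<Longrightarrow> t \<le> t0 \<Longrightarrow> (\<integral>\<^sup>+z. R e t x z \<partial>m) \<le> ennreal (c / M1)"
proof -
  note [measurable (raw)] = p_measurable
  assume t: "0 < t" "t \<le> t0"
  have "(\<integral>\<^sup>+z. R e t x z \<partial>m) \<le> (\<integral>\<^sup>+z. ennreal (c / M1) * p t x z \<partial>m)"
    by (intro nn_integral_mono R_bound t)
  also have "\<dots> = ennreal (c / M1) * (\<integral>\<^sup>+z. p t x z \<partial>m)" by (rule nn_integral_cmult) measurable
  also have "\<dots> \<le> ennreal (c / M1) * 1" by (intro mult_left_mono p_mass) auto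
  finally show ?thesis by simp
qed

text \<open>The integrated inequality, tested with the indicator of the set on which the pointwise
  one fails.\<close>

lemma R_AE:
  assumes t: "0 < t" "t \<le> t0"
  shows "AE z in m. R False t x z \<le> R True t x z"
proof -
  note [measurable (raw)] = st_kernel_measurable[OF R_kernel]
  let ?D = "{z. R True t x z < R False t x z}"
  have "{z \<in> space borel. R True t x z < R False t x z} \<in> sets borel" by measurable
  then have D[measurable]: "?D \<in> sets borel" by simp
  let ?d = "\<lambda>z. (R False t x z - R True t x z) * indicator ?D z"
  have "(\<integral>\<^sup>+z. R True t x z * indicator ?D z \<partial>m) + (\<integral>\<^sup>+z. ?d z \<partial>m) = (\<integral>\<^sup>+z. R True t x z * indicator ?D z + ?d z \<partial>m)"
    by (rule nn_integral_add[symmetric]) measurable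
  also have "\<dots> = (\<integral>\<^sup>+z. R False t x z * indicator ?D z \<partial>m)"
    by (intro nn_integral_cong) (auto split: split_indicator simp: add_diff_inverse_ennreal)
  also have "\<dots> \<le> (\<integral>\<^sup>+z. R True t x z * indicator ?D z \<partial>m)"
    by (rule R_integral_le[OF t]) (auto split: split_indicator)
  finally have "(\<integral>\<^sup>+z. R True t x z * indicator ?D z \<partial>m) + (\<integral>\<^sup>+z. ?d z \<partial>m) \<le> (\<integral>\<^sup>+z. R True t x z * indicator ?D z \<partial>m) + 0"
    by simp
  moreover have "(\<integral>\<^sup>+z. R True t x z * indicator ?D z \<partial>m) < \<top>"
  proof -
    have "(\<integral>\<^sup>+z. R True t x z * indicator ?D z \<partial>m) \<le> (\<integral>\<^sup>+z. R True t x z \<partial>m)"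
      by (intro nn_integral_mono) (auto split: split_indicator)
    also have "\<dots> \<le> ennreal (c / M1)" by (rule R_mass[OF t])
    finally show ?thesis by (rule order_le_less_trans) simp
  qed
  ultimately have "(\<integral>\<^sup>+z. ?d z \<partial>m) = 0" unfolding ennreal_add_left_cancel_le by auto
  then have "AE z in m. ?d z = 0" by (subst (asm) nn_integral_0_iff_AE) auto
  then show ?thesis
  proof eventually_elim
    case (elim z)
    show ?case
    proof (rule ccontr)
      assume "\<not> R False t x z \<le> R True t x z"
      then show False using elim by (auto simp: not_le diff_eq_0_iff_ennreal)
    qed
  qed
qed

text \<open>As in \<open>U_le\<close>, but now the exceptional set lies in the variable
  \<open>z\<close>, so a last step of \<open>p\<close> is split off on the right; the jumps during
  it contribute at most \<open>L * h\<close>.\<close>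

theorem R_le:
  assumes t: "0 < t" "t \<le> t0"
  shows "R False t x z \<le> R True t x z"
proof (rule ennreal_le_epsilon)
  fix e :: real assume e: "0 < e"
  note bR = st_kernel_rmul[OF b_kernel R_kernel]
  note [measurable (raw)] = p_measurable st_kernel_measurable[OF bR] st_kernel_measurable[OF R_kernel]
    st_kernel_measurable[OF st_kernel_stc[OF bR p_kernel]]
  \<comment> \<open>\<open>b\<close> is pointwise at most \<open>cb / \<epsilon> powr jexp\<close>,
    and \<open>R\<close> has mass at most \<open>c / M1\<close>.\<close>
  define K where "K = c / M1 * (cb / \<epsilon> powr jexp)"
  have K: "0 \<le> K" using c M12 cb by (simp add: K_def)
  define L where "L = K * (M2 / M1)"
  have L: "0 \<le> L" using K M12 by (simp add: L_def)
  define h where "h = min (t / 2) (e / (L + 1))"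
  have h: "0 < h" "h < t" using t e L by (auto simp: h_def)
  have eq: "R e t x z = (if e then p t x z else 0) + (rmul (R (\<not> e)) b \<star> p) t x z" for e t x z
    using part_right[OF b_kernel p_kernel, of e t x z] stc_kmul_eq_rmul_stc[OF b_kernel R_kernel p_kernel, of "\<not> e"] by simp
  have split: "R e t x z = (\<integral>\<^sup>+y. R e (t - h) x y * p h y z \<partial>m) +
      (\<integral>\<^sup>+s\<in>{0<..h}. (\<integral>\<^sup>+w. rmul (R (\<not> e)) b (t - s) x w * p s w z \<partial>m) \<partial>lborel)" for e
  proof -
    have "R e t x z = (if e then p t x z else 0) + ((\<integral>\<^sup>+y. (rmul (R (\<not> e)) b \<star> p) (t - h) x y * p h y z \<partial>m) +
      (\<integral>\<^sup>+s\<in>{0<..h}. (\<integral>\<^sup>+w. rmul (R (\<not> e)) b (t - s) x w * p s w z \<partial>m) \<partial>lborel))"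
      by (simp only: eq[of e t x z] stc_split_right[OF bR h(1), of "\<not> e" t x z])
    also have "(if e then p t x z else 0) = (\<integral>\<^sup>+y. (if e then p (t - h) x y else 0) * p h y z \<partial>m)"
      using p_CK[of "t - h" h x z] h by simp
    finally show ?thesis
      unfolding eq[of e "t - h"] by (cases e) (simp_all add: distrib_right nn_integral_add add.assoc)
  qed
  have rb: "rmul (R e) b s x w \<le> ennreal K" if "s \<le> t0" for e s w
  proof (cases "0 < s")
    case True
    have "b y w \<le> ennreal (cb / \<epsilon> powr jexp)" for y
    proof (cases "\<epsilon> < norm (y - w)")
      case True
      have "\<epsilon> powr jexp \<le> norm (y - w) powr jexp" using True \<epsilon> jexp_pos by (intro powr_mono2) auto
      then have le: "1 / norm (y - w) powr jexp \<le> 1 / \<epsilon> powr jexp"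
        using \<epsilon> True by (intro divide_left_mono mult_pos_pos) auto
      have "b y w \<le> ennreal cb * ennreal (1 / norm (y - w) powr jexp)"
        using b_far[of y w] True by (simp add: far_def)
      also have "\<dots> = ennreal (cb * (1 / norm (y - w) powr jexp))" using cb by (intro ennreal_mult[symmetric]) auto
      also have "\<dots> \<le> ennreal (cb * (1 / \<epsilon> powr jexp))" using le cb by (intro ennreal_leI mult_left_mono) auto
      finally show ?thesis by simp
    qed (simp add: b_near)
    then have "rmul (R e) b s x w \<le> (\<integral>\<^sup>+y. R e s x y * ennreal (cb / \<epsilon> powr jexp) \<partial>m)"
      unfolding rmul_def by (intro nn_integral_mono mult_left_mono) auto
    also have "\<dots> = (\<integral>\<^sup>+y. R e s x y \<partial>m) * ennreal (cb / \<epsilon> powr jexp)" by (rule nn_integral_multc) measurable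
    also have "\<dots> \<le> ennreal (c / M1) * ennreal (cb / \<epsilon> powr jexp)"
      by (intro mult_right_mono R_mass True that) auto
    also have "\<dots> = ennreal K" using c M12 cb by (simp add: K_def ennreal_mult[symmetric])
    finally show ?thesis .
  qed (simp add: rmul_def st_kernel_0[OF R_kernel])
  have rem: "(\<integral>\<^sup>+s\<in>{0<..h}. (\<integral>\<^sup>+w. rmul (R True) b (t - s) x w * p s w z \<partial>m) \<partial>lborel) \<le> ennreal e"
  proof -
    have "(\<integral>\<^sup>+s\<in>{0<..h}. (\<integral>\<^sup>+w. rmul (R True) b (t - s) x w * p s w z \<partial>m) \<partial>lborel) \<le> (\<integral>\<^sup>+s. ennreal L * indicator {0<..h} s \<partial>lborel)"
    proof (intro nn_integral_mono)
      fix s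
      have "(\<integral>\<^sup>+w. rmul (R True) b (t - s) x w * p s w z \<partial>m) \<le> ennreal L" if "0 < s"
      proof -
        have "(\<integral>\<^sup>+w. rmul (R True) b (t - s) x w * p s w z \<partial>m) \<le> (\<integral>\<^sup>+w. ennreal K * p s w z \<partial>m)"
          using that t by (intro nn_integral_mono mult_right_mono rb) auto
        also have "\<dots> = ennreal K * (\<integral>\<^sup>+w. p s w z \<partial>m)" by (rule nn_integral_cmult) measurable
        also have "\<dots> \<le> ennreal K * ennreal (M2 / M1)" by (intro mult_left_mono p_mass_left) auto
        also have "\<dots> = ennreal L" using K M12 by (simp add: L_def ennreal_mult[symmetric])
        finally show ?thesis .
      qed
      then show "(\<integral>\<^sup>+w. rmul (R True) b (t - s) x w * p s w z \<partial>m) * indicator {0<..h} s \<le> ennreal L * indicator {0<..h} s"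
        by (auto split: split_indicator)
    qed
    also have "\<dots> = ennreal (L * h)" using h L by (simp add: nn_integral_cmult ennreal_mult)
    also have "\<dots> \<le> ennreal e"
    proof (rule ennreal_leI)
      have "L * h \<le> L * (e / (L + 1))" unfolding h_def using L by (intro mult_left_mono) auto
      also have "\<dots> \<le> e" using L e by (simp add: divide_le_eq algebra_simps)
      finally show "L * h \<le> e" .
    qed
    finally show ?thesis .
  qed
  have "AE y in m. R False (t - h) x y \<le> R True (t - h) x y" using h t by (intro R_AE) auto
  then have "(\<integral>\<^sup>+y. R False (t - h) x y * p h y z \<partial>m) \<le> (\<integral>\<^sup>+y. R True (t - h) x y * p h y z \<partial>m)"
    by (intro nn_integral_mono_AE) (auto elim!: eventually_mono intro: mult_right_mono)
  also have "\<dots> \<le> R True t x z" unfolding split[of True] by simp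
  finally show "R False t x z \<le> R True t x z + ennreal e"
    unfolding split[of False] using rem by (simp add: add_mono)
qed

end

section \<open>Comparison of resolvents\<close>

lemma SUP_mult_incseq_ennreal:
  fixes f g :: "nat \<Rightarrow> ennreal"
  assumes f: "incseq f" and g: "incseq g"
  shows "(SUP j. f j * g j) = (SUP j. f j) * (SUP j. g j)"
proof (rule antisym)
  show "(SUP j. f j * g j) \<le> (SUP j. f j) * (SUP j. g j)"
    by (intro SUP_least mult_mono SUP_upper) auto
  have "(SUP j. f j) * (SUP j. g j) = (SUP i. f i * (SUP j. g j))" by (rule SUP_mult_right_ennreal)
  also have "\<dots> = (SUP i. SUP j. f i * g j)" by (simp add: SUP_mult_left_ennreal)
  also have "\<dots> \<le> (SUP j. f j * g j)"
  proof (intro SUP_least)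
    fix i j
    have "f i * g j \<le> f (max i j) * g (max i j)"
      using f g by (intro mult_mono) (auto simp: incseq_def)
    also have "\<dots> \<le> (SUP j. f j * g j)" by (rule SUP_upper) simp
    finally show "f i * g j \<le> (SUP j. f j * g j)" .
  qed
  finally show "(SUP j. f j) * (SUP j. g j) \<le> (SUP j. f j * g j)" .
qed

section \<open>Monotone limits in the perturbing kernel\<close>

context base_measure
begin

lemma kmul_SUP:
  assumes b: "\<And>j. sp_kernel (b j)" and X: "\<And>j. st_kernel (X j)"
    and bi: "\<And>w y. incseq (\<lambda>j. b j w y)" and Xi: "\<And>y. incseq (\<lambda>j. X j t y z)"
  shows "incseq (\<lambda>j. (b j \<bullet>\<^sub>k X j) t w z)"
    "(SUP j. (b j \<bullet>\<^sub>k X j) t w z) = (\<integral>\<^sup>+y. (SUP j. b j w y) * (SUP j. X j t y z) \<partial>m)"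
proof -
  note [measurable (raw)] = sp_kernel_measurable[OF b] st_kernel_measurable[OF X]
  have inc: "b i w y * X i t y z \<le> b j w y * X j t y z" if "i \<le> j" for i j y
    using bi Xi that by (intro mult_mono) (auto simp: incseq_def)
  then show "incseq (\<lambda>j. (b j \<bullet>\<^sub>k X j) t w z)"
    unfolding kmul_def incseq_def by (auto intro!: nn_integral_mono)
  show "(SUP j. (b j \<bullet>\<^sub>k X j) t w z) = (\<integral>\<^sup>+y. (SUP j. b j w y) * (SUP j. X j t y z) \<partial>m)"
    unfolding kmul_def SUP_mult_incseq_ennreal[OF bi Xi, symmetric] using inc
    by (intro nn_integral_monotone_convergence_SUP[symmetric]) (auto simp: incseq_def le_fun_def)
qed

lemma stc_SUP:
  assumes A: "st_kernel A" and V: "\<And>j. st_kernel (V j)" and Vi: "\<And>s y. incseq (\<lambda>j. V j s y z)"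
  shows "incseq (\<lambda>j. (A \<star> V j) t x z)"
    "(SUP j. (A \<star> V j) t x z) = (\<integral>\<^sup>+s. \<integral>\<^sup>+y. A s x y * (SUP j. V j (t - s) y z) \<partial>m \<partial>lborel)"
proof -
  note [measurable (raw)] = st_kernel_measurable[OF A] st_kernel_measurable[OF V]
  have inc: "A s x y * V i (t - s) y z \<le> A s x y * V j (t - s) y z" if "i \<le> j" for i j s y
    using Vi that by (intro mult_left_mono) (auto simp: incseq_def)
  then show "incseq (\<lambda>j. (A \<star> V j) t x z)"
    unfolding stc_def incseq_def by (auto intro!: nn_integral_mono)
  have "(SUP j. (A \<star> V j) t x z) = (\<integral>\<^sup>+s. (SUP j. \<integral>\<^sup>+y. A s x y * V j (t - s) y z \<partial>m) \<partial>lborel)"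
    unfolding stc_def using inc
    by (intro nn_integral_monotone_convergence_SUP[symmetric]) (auto simp: incseq_def le_fun_def intro!: nn_integral_mono)
  also have "\<dots> = (\<integral>\<^sup>+s. \<integral>\<^sup>+y. (SUP j. A s x y * V j (t - s) y z) \<partial>m \<partial>lborel)"
    using inc by (intro nn_integral_cong nn_integral_monotone_convergence_SUP[symmetric]) (auto simp: incseq_def le_fun_def)
  finally show "(SUP j. (A \<star> V j) t x z) = (\<integral>\<^sup>+s. \<integral>\<^sup>+y. A s x y * (SUP j. V j (t - s) y z) \<partial>m \<partial>lborel)"
    by (simp add: SUP_mult_left_ennreal)
qed

lemma pert_SUP:
  assumes b: "\<And>j. sp_kernel (b j)" and bi: "\<And>w y. incseq (\<lambda>j. b j w y)" and bs: "\<And>w y. (SUP j. b j w y) = b' w y"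
    and p: "st_kernel p"
  shows "incseq (\<lambda>j. pert (b j) p k t x z) \<and> (SUP j. pert (b j) p k t x z) = pert b' p k t x z"
proof (induction k arbitrary: t x z)
  case (Suc k)
  note X = st_kernel_pert[OF b p, of _ k]
  have Xi: "incseq (\<lambda>j. pert (b j) p k t y z)" for t y z using Suc by blast
  have Xs: "(SUP j. pert (b j) p k t y z) = pert b' p k t y z" for t y z using Suc by blast
  note K = kmul_SUP[OF b X bi Xi]
  have Ks: "(SUP j. (b j \<bullet>\<^sub>k pert (b j) p k) t w z) = (b' \<bullet>\<^sub>k pert b' p k) t w z" for t w z
    by (simp only: K(2) bs Xs) (simp add: kmul_def)
  note S = stc_SUP[OF p st_kernel_kmul[OF b X] K(1)]
  show ?case using S unfolding Ks by (simp add: stc_def)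
qed (simp add: incseq_def)

lemma part_SUP:
  assumes b: "\<And>j. sp_kernel (b j)" and bi: "\<And>w y. incseq (\<lambda>j. b j w y)" and bs: "\<And>w y. (SUP j. b j w y) = b' w y"
    and p: "st_kernel p"
  shows "(SUP j. part (b j) p e t x z) = part b' p e t x z"
proof -
  note P = pert_SUP[OF b bi bs p]
  have "(SUP j. part (b j) p e t x z) = (\<Sum>k. SUP j. (if even k = e then pert (b j) p k t x z else 0))"
    unfolding part_def using P by (intro ennreal_suminf_SUP_eq[symmetric]) (auto simp: incseq_def)
  also have "\<dots> = part b' p e t x z" unfolding part_def using P by (intro suminf_cong) auto
  finally show ?thesis .
qed

lemma pert_mono:
  assumes "sp_kernel b" "sp_kernel b'" "st_kernel p" "\<And>w y. b w y \<le> b' w y"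
  shows "pert b p k t x z \<le> pert b' p k t x z"
  using assms
proof (induction k arbitrary: t x z)
  case (Suc k)
  then show ?case unfolding pert.simps by (intro stc_mono_strong kernel_intros st_kernel_pert kmul_mono) auto
qed simp

end

text \<open>\<open>Q1 - Q2\<close> plays the role of q and \<open>G1 - G2\<close> that of (exp (- F)
  - 1) n. The equation in \<open>G\<close> is \<gamma> = G1 - G2 + \<beta> without subtractions, and
  \<open>Q1_eq\<close>, \<open>Q2_eq\<close> are the two halves of Duhamel's formula for q.\<close>

locale fk_perturbation = short_time_kernel m \<alpha> M1 M2 p n + jump_kernel m \<alpha> M1 M2 p h t0 ch \<kappa>1 \<kappa>
  for m :: "'a::euclidean_space measure" and \<alpha> M1 M2 p n h t0 ch \<kappa>1 \<kappa> +
  fixes \<beta> \<gamma> G1 G2 :: "'a \<Rightarrow> 'a \<Rightarrow> ennreal" and \<rho> :: real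
    and Q1 Q2 :: "real \<Rightarrow> 'a \<Rightarrow> 'a \<Rightarrow> ennreal"
  assumes \<beta>: "sp_kernel \<beta>" "\<And>w y. \<beta> w y \<le> n w y" "\<And>w y. \<beta> w y \<le> h w y"
    and \<gamma>: "sp_kernel \<gamma>" "\<And>w y. \<gamma> w y \<le> h w y" "\<And>w y. ennreal \<rho> * \<beta> w y \<le> \<gamma> w y"
    and \<rho>: "0 < \<rho>" "\<rho> \<le> 1"
    and G: "sp_kernel G1" "sp_kernel G2" "\<And>w y. \<gamma> w y + G2 w y = G1 w y + \<beta> w y"
    and Q_kernel: "st_kernel Q1" "st_kernel Q2"
    and Q1_eq: "\<And>t x z. Q1 t x z = p t x z + (p \<star> (G1 \<bullet>\<^sub>k Q1)) t x z + (p \<star> (G2 \<bullet>\<^sub>k Q2)) t x z"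
    and Q2_eq: "\<And>t x z. Q2 t x z = (p \<star> (G1 \<bullet>\<^sub>k Q2)) t x z + (p \<star> (G2 \<bullet>\<^sub>k Q1)) t x z"
    and Q_le: "\<And>t x z. Q1 t x z \<le> (\<Sum>k. pert h p k t x z)" "\<And>t x z. Q2 t x z \<le> (\<Sum>k. pert h p k t x z)"
begin

text \<open>Removal of the cutoff: the truncations of \<beta> increase to \<beta>, and both parts of
  their series converge monotonically. A single \<open>total_const\<close> serves all truncations,
  since they are dominated by \<open>h\<close>.\<close>

lemma part_False_le_True:
  assumes t: "0 < t" "t \<le> t0"
  shows "part \<beta> p False t x z \<le> part \<beta> p True t x z"
proof -
  define b where "b j w y = \<beta> w y * indicator {v. 1 / real (Suc j) < norm v} (w - y)" for j w y
  have b: "sp_kernel (b j)" for j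
  proof -
    note [measurable (raw)] = sp_kernel_measurable[OF \<beta>(1)]
    show ?thesis unfolding sp_kernel_def b_def by measurable
  qed
  have b_le: "b j w y \<le> \<beta> w y" for j w y by (auto simp: b_def split: split_indicator)
  have bi: "incseq (\<lambda>j. b j w y)" for w y
  proof (rule incseq_SucI)
    fix j
    have "1 / real (Suc (Suc j)) \<le> 1 / real (Suc j)" by (intro divide_left_mono) auto
    then show "b j w y \<le> b (Suc j) w y" by (auto simp: b_def split: split_indicator)
  qed
  have bs: "(SUP j. b j w y) = \<beta> w y" for w y
  proof (rule antisym)
    show "(SUP j. b j w y) \<le> \<beta> w y" by (intro SUP_least b_le)
    show "\<beta> w y \<le> (SUP j. b j w y)"
    proof (cases "w = y")
      case True
      \<comment> \<open>Division by 0 yields 0, so \<open>h_bound\<close> makes \<beta> vanish on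
        the diagonal, as all its truncations do.\<close>
      have "\<beta> w y \<le> ennreal (ch / norm (w - y) powr jexp)" using \<beta>(3) h_bound by (rule order_trans)
      then show ?thesis using True by simp
    next
      case False
      then have "0 < norm (w - y)" by simp
      then obtain j where "1 / real (Suc j) < norm (w - y)" using nat_approx_posE by blast
      then have "\<beta> w y = b j w y" by (simp add: b_def)
      also have "\<dots> \<le> (SUP j. b j w y)" by (rule SUP_upper) simp
      finally show ?thesis .
    qed
  qed
  have le: "part (b j) p False t x z \<le> part (b j) p True t x z" for j
  proof -
    interpret B: far_perturbation m \<alpha> M1 M2 p n "b j" "1 / real (Suc j)" ch t0 total_const
    proof unfold_locales
      show "b j w y \<le> n w y" for w y using b_le \<beta>(2) by (rule order_trans)
      show "b j w y \<le> ennreal ch * far (1 / real (Suc j)) w y" for w y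
      proof (cases "1 / real (Suc j) < norm (w - y)")
        case True
        have "b j w y \<le> ennreal (ch * (1 / norm (w - y) powr jexp))"
          using order_trans[OF b_le order_trans[OF \<beta>(3) h_bound]] by simp
        also have "\<dots> = ennreal ch * ennreal (1 / norm (w - y) powr jexp)" using ch by (intro ennreal_mult) auto
        finally show ?thesis using True by (simp add: far_def)
      qed (simp add: b_def)
      show "(\<Sum>k. pert (b j) p k t x z) \<le> ennreal (total_const * stable_bound \<alpha> t x z)" if "0 < t" "t \<le> t0" for t x z
      proof -
        have "(\<Sum>k. pert (b j) p k t x z) \<le> (\<Sum>k. pert h p k t x z)"
          by (intro suminf_le pert_mono[OF b h_kernel p_kernel] order_trans[OF b_le \<beta>(3)]) auto
        also have "\<dots> \<le> ennreal (total_const * stable_bound \<alpha> t x z)" by (rule pert_suminf_bound[OF that])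
        finally show ?thesis .
      qed
    qed (use t0 ch total_const_nonneg b in auto)
    show ?thesis by (rule B.R_le[OF t])
  qed
  show ?thesis
    unfolding part_SUP[OF b bi bs p_kernel, symmetric] by (intro SUP_mono' le)
qed

abbreviation H :: "real \<Rightarrow> 'a \<Rightarrow> 'a \<Rightarrow> ennreal" where "H t x z \<equiv> \<Sum>k. pert h p k t x z"

lemma H_kernel: "st_kernel (\<lambda>t x z. H t x z)"
  by (intro st_kernel_suminf st_kernel_pert h_kernel p_kernel)

lemma H_bound: "0 < t \<Longrightarrow> t \<le> t0 \<Longrightarrow> H t x z \<le> ennreal (total_const / M1) * p t x z"
proof -
  assume t: "0 < t" "t \<le> t0"
  have "H t x z \<le> ennreal (total_const / M1 * (M1 * stable_bound \<alpha> t x z))"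
    using pert_suminf_bound[OF t, of x z] M12 by simp
  also have "\<dots> = ennreal (total_const / M1) * ennreal (M1 * stable_bound \<alpha> t x z)"
    using M12 total_const_nonneg stable_bound_pos[OF t(1), of \<alpha> x z] by (intro ennreal_mult) auto
  also have "\<dots> \<le> ennreal (total_const / M1) * p t x z" by (intro mult_left_mono p_lower t) auto
  finally show ?thesis .
qed

lemma H_finite: "t \<le> t0 \<Longrightarrow> H t x z < \<top>"
  using H_bound[of t x z] p_finite[of t x z] st_kernel_0[OF H_kernel, of t x z]
  by (cases "0 < t") (auto intro: order_le_less_trans simp: ennreal_mult_less_top)

lemma part_le_H: "part \<beta> p e t x z \<le> H t x z"
proof -
  have "part \<beta> p e t x z \<le> (\<Sum>k. pert \<beta> p k t x z)" by (rule part_le)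
  also have "\<dots> \<le> H t x z"
    by (intro suminf_le pert_mono[OF \<beta>(1) h_kernel p_kernel \<beta>(3)]) auto
  finally show ?thesis .
qed

lemma part_finite: "t \<le> t0 \<Longrightarrow> part \<beta> p e t x z < \<top>"
  using part_le_H H_finite by (rule order_le_less_trans)

text \<open>The cut at \<open>t0\<close> confines r to times at which
  \<open>part_False_le_True\<close> makes the truncated subtraction a genuine one. The equations for
  r below are claimed up to \<open>t0\<close> accordingly.\<close>

definition r :: "real \<Rightarrow> 'a \<Rightarrow> 'a \<Rightarrow> ennreal" where
  "r t x z = (if t \<le> t0 then part \<beta> p True t x z - part \<beta> p False t x z else 0)"

lemma r_kernel: "st_kernel r"
  unfolding r_def[abs_def] by (intro kernel_intros st_kernel_part \<beta> p_kernel)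

lemma r_add: "t \<le> t0 \<Longrightarrow> r t x z + part \<beta> p False t x z = part \<beta> p True t x z"
  using part_False_le_True[of t x z] st_kernel_0[OF st_kernel_part[OF \<beta>(1) p_kernel], of t]
  by (cases "0 < t") (auto simp: r_def diff_add_cancel_ennreal)

text \<open>Duhamel's formula read backwards: p is the perturbation of r by + \<beta>. The even part
  is written as r plus the odd part in the equation for the latter, and a finite common term is
  cancelled.\<close>

lemma p_eq_r:
  assumes t: "t \<le> t0"
  shows "p t x z = r t x z + (r \<star> (\<beta> \<bullet>\<^sub>k p)) t x z"
proof -
  let ?T = "part \<beta> p True" and ?F = "part \<beta> p False"
  note K = st_kernel_part[OF \<beta>(1) p_kernel] and Bp = st_kernel_kmul[OF \<beta>(1) p_kernel]
  have T: "?T t x z = p t x z + (?F \<star> (\<beta> \<bullet>\<^sub>k p)) t x z" using part_right[OF \<beta>(1) p_kernel, of True] by simp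
  have F: "?F t x z = (?T \<star> (\<beta> \<bullet>\<^sub>k p)) t x z" using part_right[OF \<beta>(1) p_kernel, of False] by simp
  also have "\<dots> = ((\<lambda>t x z. r t x z + ?F t x z) \<star> (\<beta> \<bullet>\<^sub>k p)) t x z"
    using t by (intro stc_cong_strong K Bp kernel_intros r_kernel) (auto simp: r_add)
  also have "\<dots> = (r \<star> (\<beta> \<bullet>\<^sub>k p)) t x z + (?F \<star> (\<beta> \<bullet>\<^sub>k p)) t x z"
    by (rule stc_add_left[OF r_kernel K Bp])
  finally have F2: "?F t x z = (r \<star> (\<beta> \<bullet>\<^sub>k p)) t x z + (?F \<star> (\<beta> \<bullet>\<^sub>k p)) t x z" .
  have "(?F \<star> (\<beta> \<bullet>\<^sub>k p)) t x z + p t x z = r t x z + ?F t x z"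
    using r_add[OF t, of x z] T by (simp add: add.commute)
  also have "\<dots> = (?F \<star> (\<beta> \<bullet>\<^sub>k p)) t x z + (r t x z + (r \<star> (\<beta> \<bullet>\<^sub>k p)) t x z)"
    by (subst F2) (simp add: add_ac)
  finally have eq: "(?F \<star> (\<beta> \<bullet>\<^sub>k p)) t x z + p t x z = (?F \<star> (\<beta> \<bullet>\<^sub>k p)) t x z + (r t x z + (r \<star> (\<beta> \<bullet>\<^sub>k p)) t x z)" .
  have "(?F \<star> (\<beta> \<bullet>\<^sub>k p)) t x z \<le> ?T t x z" unfolding T by simp
  then have "(?F \<star> (\<beta> \<bullet>\<^sub>k p)) t x z < \<top>" using part_finite[OF t, of True x z] by (rule order_le_less_trans)
  then show ?thesis using eq by (auto simp: ennreal_add_left_cancel)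
qed

lemma r_le_p: "t \<le> t0 \<Longrightarrow> r t x z \<le> p t x z"
  using p_eq_r[of t x z] by simp

section \<open>Resolvent equations and their iteration\<close>

definition Op :: "('a \<Rightarrow> 'a \<Rightarrow> ennreal) \<Rightarrow> (real \<Rightarrow> 'a \<Rightarrow> 'a \<Rightarrow> ennreal) \<Rightarrow> real \<Rightarrow> 'a \<Rightarrow> 'a \<Rightarrow> ennreal" where
  "Op b X = r \<star> (b \<bullet>\<^sub>k X)"

lemma Op_kernel: "sp_kernel b \<Longrightarrow> st_kernel X \<Longrightarrow> st_kernel (Op b X)"
  unfolding Op_def by (intro kernel_intros r_kernel)

lemma Op_pow_kernel: "sp_kernel b \<Longrightarrow> st_kernel X \<Longrightarrow> st_kernel ((Op b ^^ k) X)"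
  by (induction k) (auto intro: Op_kernel)

lemma Op_cong:
  assumes "sp_kernel b" "st_kernel X" "st_kernel Y" "\<And>t x z. t \<le> t0 \<Longrightarrow> X t x z = Y t x z" "t \<le> t0"
  shows "Op b X t x z = Op b Y t x z"
  unfolding Op_def using assms by (intro stc_cong_strong kernel_intros r_kernel kmul_cong) auto

lemma Op_pow_cong:
  assumes "sp_kernel b" "st_kernel X" "st_kernel Y" "\<And>t x z. t \<le> t0 \<Longrightarrow> X t x z = Y t x z" "t \<le> t0"
  shows "(Op b ^^ k) X t x z = (Op b ^^ k) Y t x z"
  using assms(5)
proof (induction k arbitrary: t x z)
  case (Suc k)
  then show ?case using Op_cong[OF assms(1) Op_pow_kernel[OF assms(1,2)] Op_pow_kernel[OF assms(1,3)], of k k] by simp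
qed (use assms(4) in simp)

lemma Op_add:
  assumes "sp_kernel b" "st_kernel X" "st_kernel Y"
  shows "Op b (\<lambda>t x z. X t x z + Y t x z) = (\<lambda>t x z. Op b X t x z + Op b Y t x z)"
proof (intro ext)
  fix t x z
  have "b \<bullet>\<^sub>k (\<lambda>t x z. X t x z + Y t x z) = (\<lambda>t x z. (b \<bullet>\<^sub>k X) t x z + (b \<bullet>\<^sub>k Y) t x z)"
    by (intro ext kmul_add_right assms)
  then show "Op b (\<lambda>t x z. X t x z + Y t x z) t x z = Op b X t x z + Op b Y t x z"
    unfolding Op_def using assms by (simp add: stc_add_right[OF r_kernel] kernel_intros)
qed

lemma Op_pow_add:
  assumes "sp_kernel b" "st_kernel X" "st_kernel Y"
  shows "(Op b ^^ k) (\<lambda>t x z. X t x z + Y t x z) = (\<lambda>t x z. (Op b ^^ k) X t x z + (Op b ^^ k) Y t x z)"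
  by (induction k) (use assms in \<open>auto simp: Op_add Op_pow_kernel\<close>)

lemma neumann:
  assumes t: "t \<le> t0"
  shows "p t x z = (\<Sum>k<N. (Op \<beta> ^^ k) r t x z) + (Op \<beta> ^^ N) p t x z"
proof (induction N)
  case (Suc N)
  have "(Op \<beta> ^^ N) p t x z = (Op \<beta> ^^ N) (\<lambda>t x z. r t x z + Op \<beta> p t x z) t x z"
    using t p_eq_r by (intro Op_pow_cong \<beta> p_kernel kernel_intros r_kernel Op_kernel) (auto simp: Op_def)
  also have "\<dots> = (Op \<beta> ^^ N) r t x z + (Op \<beta> ^^ Suc N) p t x z"
    by (simp add: Op_pow_add[OF \<beta>(1) r_kernel Op_kernel[OF \<beta>(1) p_kernel]] funpow_swap1)
  finally show ?case using Suc by (simp add: add.assoc)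
qed simp

lemma Op_le:
  assumes "sp_kernel b" "\<And>w y. b w y \<le> h w y" "st_kernel X" "\<And>t x z. t \<le> t0 \<Longrightarrow> X t x z \<le> Y t x z" "t \<le> t0"
  shows "Op b X t x z \<le> (p \<star> (h \<bullet>\<^sub>k Y)) t x z"
  unfolding Op_def using assms by (intro stc_mono_strong kernel_intros r_kernel kmul_mono r_le_p) auto

lemma Op_pow_p_le: "t \<le> t0 \<Longrightarrow> (Op \<beta> ^^ k) p t x z \<le> pert h p k t x z"
proof (induction k arbitrary: t x z)
  case (Suc k)
  then show ?case
    using Op_le[OF \<beta>(1,3) Op_pow_kernel[OF \<beta>(1) p_kernel], where Y="pert h p k" and k1=k] by simp
qed simp

text \<open>Each application of \<open>Op \<gamma>\<close> costs at most one further order of the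
  series for \<open>h\<close>; the iterates are thus tails of a convergent series.\<close>

lemma Op_pow_H_le:
  assumes "st_kernel X" "\<And>t x z. t \<le> t0 \<Longrightarrow> X t x z \<le> H t x z" "t \<le> t0"
  shows "(Op \<gamma> ^^ k) X t x z \<le> (\<Sum>j. pert h p (j + k) t x z)"
  using assms(3)
proof (induction k arbitrary: t x z)
  case (Suc k)
  note P = st_kernel_pert[OF h_kernel p_kernel]
  have "(Op \<gamma> ^^ Suc k) X t x z \<le> (p \<star> (h \<bullet>\<^sub>k (\<lambda>t x z. \<Sum>j. pert h p (j + k) t x z))) t x z"
    using Op_le[OF \<gamma>(1,2) Op_pow_kernel[OF \<gamma>(1) assms(1)], where Y="\<lambda>t x z. \<Sum>j. pert h p (j + k) t x z" and k1=k] Suc by simp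
  also have "h \<bullet>\<^sub>k (\<lambda>t x z. \<Sum>j. pert h p (j + k) t x z) = (\<lambda>t x z. \<Sum>j. (h \<bullet>\<^sub>k pert h p (j + k)) t x z)"
    by (intro ext kmul_suminf_right h_kernel P)
  also have "(p \<star> (\<lambda>t x z. \<Sum>j. (h \<bullet>\<^sub>k pert h p (j + k)) t x z)) t x z = (\<Sum>j. (p \<star> (h \<bullet>\<^sub>k pert h p (j + k))) t x z)"
    by (intro stc_suminf_right p_kernel st_kernel_kmul h_kernel P)
  finally show ?case by simp
qed (use assms(2) in simp)

lemma Op_pow_H_finite:
  assumes "st_kernel X" "\<And>t x z. t \<le> t0 \<Longrightarrow> X t x z \<le> H t x z" "t \<le> t0"
  shows "(Op \<gamma> ^^ k) X t x z < \<top>"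
proof -
  have "(Op \<gamma> ^^ k) X t x z \<le> (\<Sum>j. pert h p (j + k) t x z)" by (rule Op_pow_H_le[OF assms])
  also have "\<dots> \<le> H t x z"
  proof (rule suminf_le_const[OF summableI])
    fix N
    have "(\<Sum>j<N. pert h p (j + k) t x z) = (\<Sum>j\<in>(\<lambda>j. j + k) ` {..<N}. pert h p j t x z)"
      by (subst sum.reindex) auto
    also have "\<dots> \<le> H t x z" by (intro sum_le_suminf summableI) auto
    finally show "(\<Sum>j<N. pert h p (j + k) t x z) \<le> H t x z" .
  qed
  also have "\<dots> < \<top>" by (rule H_finite[OF assms(3)])
  finally show ?thesis .
qed

text \<open>\<open>p_eq_r\<close> convolved with \<open>V\<close>. It converts the equations for
  \<open>Q1\<close> and \<open>Q2\<close>, written with the free kernel p, into equations with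
  r.\<close>

lemma resolvent_step:
  assumes V: "st_kernel V" and t: "t \<le> t0"
  shows "Op \<beta> (p \<star> V) t x z + (r \<star> V) t x z = (p \<star> V) t x z"
proof -
  have "Op \<beta> (p \<star> V) = (r \<star> (\<beta> \<bullet>\<^sub>k p)) \<star> V"
    unfolding Op_def by (simp add: kmul_stc[OF \<beta>(1) p_kernel V] stc_assoc[OF r_kernel st_kernel_kmul[OF \<beta>(1) p_kernel] V])
  then have "Op \<beta> (p \<star> V) t x z + (r \<star> V) t x z = ((\<lambda>t x z. r t x z + (r \<star> (\<beta> \<bullet>\<^sub>k p)) t x z) \<star> V) t x z"
    by (simp add: stc_add_left[OF r_kernel st_kernel_stc[OF r_kernel st_kernel_kmul[OF \<beta>(1) p_kernel]] V] add.commute)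
  also have "\<dots> = (p \<star> V) t x z"
    using t by (intro stc_cong_strong kernel_intros r_kernel \<beta> p_kernel V) (auto simp: p_eq_r)
  finally show ?thesis .
qed

lemma gamma_balance:
  assumes X: "st_kernel X"
  shows "Op \<gamma> X t x z + (r \<star> (G2 \<bullet>\<^sub>k X)) t x z = (r \<star> (G1 \<bullet>\<^sub>k X)) t x z + Op \<beta> X t x z"
proof -
  have "(\<lambda>t x z. (\<gamma> \<bullet>\<^sub>k X) t x z + (G2 \<bullet>\<^sub>k X) t x z) = (\<lambda>t x z. (G1 \<bullet>\<^sub>k X) t x z + (\<beta> \<bullet>\<^sub>k X) t x z)"
    by (intro ext) (simp add: kmul_add_left[OF \<gamma>(1) G(2) X, symmetric] kmul_add_left[OF G(1) \<beta>(1) X, symmetric] G(3))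
  then have "(r \<star> (\<lambda>t x z. (\<gamma> \<bullet>\<^sub>k X) t x z + (G2 \<bullet>\<^sub>k X) t x z)) t x z = (r \<star> (\<lambda>t x z. (G1 \<bullet>\<^sub>k X) t x z + (\<beta> \<bullet>\<^sub>k X) t x z)) t x z"
    by simp
  then show ?thesis
    unfolding Op_def using X by (simp add: stc_add_right[OF r_kernel] st_kernel_kmul G \<gamma> \<beta>)
qed

text \<open>This is q = r + r \<gamma> q for q = Q1 - Q2, with all terms on the side where they are
  nonnegative. Expressing p by r adds a \<beta>-term to each equation, and
  \<open>gamma_balance\<close> merges it with \<open>G1\<close> and \<open>G2\<close> into
  \<gamma>.\<close>

lemma Q_balance:
  assumes t: "t \<le> t0"
  shows "Q1 t x z + Op \<gamma> Q2 t x z = r t x z + Op \<gamma> Q1 t x z + Q2 t x z"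
proof -
  note GQ = st_kernel_kmul[OF G(1) Q_kernel(1)] st_kernel_kmul[OF G(1) Q_kernel(2)]
    st_kernel_kmul[OF G(2) Q_kernel(1)] st_kernel_kmul[OF G(2) Q_kernel(2)]
  note pGQ = GQ[THEN st_kernel_stc[OF p_kernel]]
  have Q1': "Q1 = (\<lambda>t x z. (p t x z + (p \<star> (G1 \<bullet>\<^sub>k Q1)) t x z) + (p \<star> (G2 \<bullet>\<^sub>k Q2)) t x z)"
    and Q2': "Q2 = (\<lambda>t x z. (p \<star> (G1 \<bullet>\<^sub>k Q2)) t x z + (p \<star> (G2 \<bullet>\<^sub>k Q1)) t x z)"
    by (intro ext Q1_eq Q2_eq)+
  have B1: "Op \<beta> Q1 t x z = Op \<beta> p t x z + Op \<beta> (p \<star> (G1 \<bullet>\<^sub>k Q1)) t x z + Op \<beta> (p \<star> (G2 \<bullet>\<^sub>k Q2)) t x z"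
    by (subst Q1') (simp add: Op_add \<beta> p_kernel pGQ st_kernel_add)
  have B2: "Op \<beta> Q2 t x z = Op \<beta> (p \<star> (G1 \<bullet>\<^sub>k Q2)) t x z + Op \<beta> (p \<star> (G2 \<bullet>\<^sub>k Q1)) t x z"
    by (subst Q2') (simp add: Op_add \<beta> pGQ)
  have E1: "Q1 t x z = Op \<beta> Q1 t x z + r t x z + (r \<star> (G1 \<bullet>\<^sub>k Q1)) t x z + (r \<star> (G2 \<bullet>\<^sub>k Q2)) t x z"
  proof -
    have "Q1 t x z = (r t x z + Op \<beta> p t x z) + (Op \<beta> (p \<star> (G1 \<bullet>\<^sub>k Q1)) t x z + (r \<star> (G1 \<bullet>\<^sub>k Q1)) t x z) +
      (Op \<beta> (p \<star> (G2 \<bullet>\<^sub>k Q2)) t x z + (r \<star> (G2 \<bullet>\<^sub>k Q2)) t x z)"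
      unfolding resolvent_step[OF GQ(1) t] resolvent_step[OF GQ(4) t] using p_eq_r[OF t, of x z] Q1_eq[of t x z]
      by (simp add: Op_def)
    then show ?thesis unfolding B1 by (simp add: add_ac)
  qed
  have E2: "Q2 t x z = Op \<beta> Q2 t x z + (r \<star> (G1 \<bullet>\<^sub>k Q2)) t x z + (r \<star> (G2 \<bullet>\<^sub>k Q1)) t x z"
  proof -
    have "Q2 t x z = (Op \<beta> (p \<star> (G1 \<bullet>\<^sub>k Q2)) t x z + (r \<star> (G1 \<bullet>\<^sub>k Q2)) t x z) +
      (Op \<beta> (p \<star> (G2 \<bullet>\<^sub>k Q1)) t x z + (r \<star> (G2 \<bullet>\<^sub>k Q1)) t x z)"
      unfolding resolvent_step[OF GQ(2) t] resolvent_step[OF GQ(3) t] using Q2_eq[of t x z] by simp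
    then show ?thesis unfolding B2 by (simp add: add_ac)
  qed
  have g1: "Op \<gamma> Q1 t x z + (r \<star> (G2 \<bullet>\<^sub>k Q1)) t x z = (r \<star> (G1 \<bullet>\<^sub>k Q1)) t x z + Op \<beta> Q1 t x z"
    and g2: "Op \<gamma> Q2 t x z + (r \<star> (G2 \<bullet>\<^sub>k Q2)) t x z = (r \<star> (G1 \<bullet>\<^sub>k Q2)) t x z + Op \<beta> Q2 t x z"
    by (intro gamma_balance Q_kernel)+
  have "Q1 t x z + Op \<gamma> Q2 t x z = Op \<beta> Q1 t x z + r t x z + (r \<star> (G1 \<bullet>\<^sub>k Q1)) t x z +
      (Op \<gamma> Q2 t x z + (r \<star> (G2 \<bullet>\<^sub>k Q2)) t x z)"
    by (subst E1) (simp add: add_ac)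
  also have "\<dots> = r t x z + (Op \<gamma> Q1 t x z + (r \<star> (G2 \<bullet>\<^sub>k Q1)) t x z) + ((r \<star> (G1 \<bullet>\<^sub>k Q2)) t x z + Op \<beta> Q2 t x z)"
    unfolding g1 g2 by (simp add: add_ac)
  also have "\<dots> = r t x z + Op \<gamma> Q1 t x z + (Op \<beta> Q2 t x z + (r \<star> (G1 \<bullet>\<^sub>k Q2)) t x z + (r \<star> (G2 \<bullet>\<^sub>k Q1)) t x z)"
    by (simp add: add_ac)
  also have "\<dots> = r t x z + Op \<gamma> Q1 t x z + Q2 t x z" by (simp only: E2[symmetric])
  finally show ?thesis .
qed

text \<open>Applying the N-th power of \<open>Op \<gamma>\<close> to \<open>Q_balance\<close>
  extends the sum by one term. Adding this to the induction hypothesis produces common terms, whose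
  finiteness permits cancelling them.\<close>

lemma Q_iterate:
  assumes t: "t \<le> t0"
  shows "Q1 t x z + (Op \<gamma> ^^ N) Q2 t x z = (\<Sum>k<N. (Op \<gamma> ^^ k) r t x z) + (Op \<gamma> ^^ N) Q1 t x z + Q2 t x z"
proof (induction N)
  case (Suc N)
  define D where "D k X = (Op \<gamma> ^^ k) X t x z" for k X
  note K = Op_kernel[OF \<gamma>(1)] and R = r_kernel Q_kernel
  have "D N (\<lambda>t x z. Q1 t x z + Op \<gamma> Q2 t x z) = D N (\<lambda>t x z. (r t x z + Op \<gamma> Q1 t x z) + Q2 t x z)"
    unfolding D_def using t by (intro Op_pow_cong \<gamma> st_kernel_add K R Q_balance)
  then have step: "D N Q1 + D (Suc N) Q2 = D N r + D (Suc N) Q1 + D N Q2"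
    unfolding D_def by (simp add: Op_pow_add \<gamma> st_kernel_add K R funpow_swap1)
  have IH: "Q1 t x z + D N Q2 = (\<Sum>k<N. D k r) + D N Q1 + Q2 t x z" using Suc by (simp add: D_def)
  have "(D N Q1 + D N Q2) + (Q1 t x z + D (Suc N) Q2) = (Q1 t x z + D N Q2) + (D N Q1 + D (Suc N) Q2)"
    by (simp add: add_ac)
  also have "\<dots> = (D N Q1 + D N Q2) + ((\<Sum>k<N. D k r) + D N r + D (Suc N) Q1 + Q2 t x z)"
    unfolding IH step by (simp add: add_ac)
  finally have eq: "(D N Q1 + D N Q2) + (Q1 t x z + D (Suc N) Q2) =
    (D N Q1 + D N Q2) + ((\<Sum>k<N. D k r) + D N r + D (Suc N) Q1 + Q2 t x z)" .
  have "D N Q1 < \<top>" "D N Q2 < \<top>"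
    unfolding D_def using Q_le t by (auto intro!: Op_pow_H_finite Q_kernel)
  then have "D N Q1 + D N Q2 \<noteq> \<top>" by (simp add: less_top)
  then have "Q1 t x z + D (Suc N) Q2 = (\<Sum>k<N. D k r) + D N r + D (Suc N) Q1 + Q2 t x z"
    using eq by (simp add: ennreal_add_left_cancel)
  then show ?case unfolding D_def sum.lessThan_Suc .
qed (simp add: add.commute)

lemma Op_scale_le:
  assumes b: "sp_kernel b" and X: "st_kernel X"
    and le: "\<And>w y. c * b w y \<le> b' w y" "\<And>s y. s \<le> t \<Longrightarrow> d * X s y z \<le> Y s y z"
  shows "(c * d) * Op b X t x z \<le> Op b' Y t x z"
proof -
  note [measurable (raw)] = sp_kernel_measurable[OF b] st_kernel_measurable[OF X] st_kernel_measurable[OF r_kernel]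
    st_kernel_measurable[OF st_kernel_kmul[OF b X]]
  have "(c * d) * Op b X t x z = (\<integral>\<^sup>+s. \<integral>\<^sup>+w. (c * d) * (r s x w * (b \<bullet>\<^sub>k X) (t - s) w z) \<partial>m \<partial>lborel)"
    unfolding Op_def stc_def by (simp add: nn_integral_cmult)
  also have "\<dots> \<le> Op b' Y t x z"
    unfolding Op_def stc_def
  proof (intro nn_integral_mono)
    fix s w
    show "(c * d) * (r s x w * (b \<bullet>\<^sub>k X) (t - s) w z) \<le> r s x w * (b' \<bullet>\<^sub>k Y) (t - s) w z"
    proof (cases "0 < s")
      case True
      have "(c * d) * (b \<bullet>\<^sub>k X) (t - s) w z = (\<integral>\<^sup>+y. (c * d) * (b w y * X (t - s) y z) \<partial>m)"
        unfolding kmul_def by (rule nn_integral_cmult[symmetric]) measurable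
      also have "\<dots> = (\<integral>\<^sup>+y. (c * b w y) * (d * X (t - s) y z) \<partial>m)" by (simp add: mult_ac)
      also have "\<dots> \<le> (b' \<bullet>\<^sub>k Y) (t - s) w z"
        unfolding kmul_def using True by (intro nn_integral_mono mult_mono le) auto
      finally have "r s x w * ((c * d) * (b \<bullet>\<^sub>k X) (t - s) w z) \<le> r s x w * (b' \<bullet>\<^sub>k Y) (t - s) w z"
        by (rule mult_left_mono) simp
      then show ?thesis by (simp add: mult_ac)
    qed (simp add: st_kernel_0[OF r_kernel])
  qed
  finally show ?thesis .
qed

lemma Op_pow_compare: "t \<le> t0 \<Longrightarrow> ennreal (\<rho> ^ k) * (Op \<beta> ^^ k) r t x z \<le> (Op \<gamma> ^^ k) r t x z"
proof (induction k arbitrary: t x z)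
  case (Suc k)
  have "(ennreal \<rho> * ennreal (\<rho> ^ k)) * Op \<beta> ((Op \<beta> ^^ k) r) t x z \<le> Op \<gamma> ((Op \<gamma> ^^ k) r) t x z"
    using Suc.prems by (intro Op_scale_le \<beta> Op_pow_kernel r_kernel \<gamma> Suc.IH) auto
  then show ?case using \<rho> by (simp add: ennreal_mult[symmetric])
qed simp

theorem Q_lower_bound:
  "\<exists>c>0. \<forall>t x z. 0 < t \<longrightarrow> t \<le> t0 \<longrightarrow> Q2 t x z + ennreal c * p t x z \<le> Q1 t x z"
proof -
  \<comment> \<open>This fixes \<open>N\<close>: the remainder of order \<open>N\<close> in the
    expansion of p is then at most p / 2.\<close>
  have "pert_const \<longlonglongrightarrow> 0" by (rule summable_LIMSEQ_zero[OF summable_pert_const])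
  then have "eventually (\<lambda>N. pert_const N < M1 / 2) sequentially" using M12 by (intro order_tendstoD) auto
  then obtain N where N: "pert_const N < M1 / 2" by (auto simp: eventually_sequentially)
  have main: "Q2 t x z + ennreal (\<rho> ^ N / 2) * p t x z \<le> Q1 t x z" if t: "0 < t" "t \<le> t0" for t x z
  proof -
    define S where "S = (\<Sum>k<N. (Op \<beta> ^^ k) r t x z)"
    define e where "e N = (\<Sum>k. pert_const (k + N)) * stable_bound \<alpha> t x z" for N
    have sb: "0 < stable_bound \<alpha> t x z" by (rule stable_bound_pos[OF t(1)])
    have half: "ennreal (1 / 2) * p t x z \<le> S"
    proof -
      have "(Op \<beta> ^^ N) p t x z \<le> ennreal (pert_const N * stable_bound \<alpha> t x z)"
        using Op_pow_p_le[OF t(2)] pert_bound[OF t] by (rule order_trans)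
      also have "\<dots> \<le> ennreal (1 / 2 * (M1 * stable_bound \<alpha> t x z))"
        using N sb by (intro ennreal_leI) simp
      also have "\<dots> = ennreal (1 / 2) * ennreal (M1 * stable_bound \<alpha> t x z)"
        using M12 sb by (intro ennreal_mult) auto
      also have "\<dots> \<le> ennreal (1 / 2) * p t x z" by (intro mult_left_mono p_lower t) auto
      finally have le: "(Op \<beta> ^^ N) p t x z \<le> ennreal (1 / 2) * p t x z" .
      have "ennreal (1 / 2) + ennreal (1 / 2) = ennreal (1 / 2 + 1 / 2)" by (rule ennreal_plus[symmetric]) auto
      then have "ennreal (1 / 2) * p t x z + ennreal (1 / 2) * p t x z = p t x z"
        by (simp only: distrib_right[symmetric]) simp
      also have "\<dots> = S + (Op \<beta> ^^ N) p t x z" unfolding S_def by (rule neumann[OF t(2)])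
      also have "\<dots> \<le> S + ennreal (1 / 2) * p t x z" using le by (rule add_left_mono)
      finally have "ennreal (1 / 2) * p t x z + ennreal (1 / 2) * p t x z \<le> ennreal (1 / 2) * p t x z + S"
        by (simp add: add.commute)
      then show ?thesis using p_finite[of t x z] by (auto simp: ennreal_add_left_cancel_le ennreal_mult_eq_top_iff)
    qed
    have low: "ennreal (\<rho> ^ N) * S \<le> (\<Sum>k<N'. (Op \<gamma> ^^ k) r t x z)" if "N \<le> N'" for N'
    proof -
      have "ennreal (\<rho> ^ N) * S \<le> (\<Sum>k<N. (Op \<gamma> ^^ k) r t x z)"
        unfolding S_def sum_distrib_left
      proof (intro sum_mono)
        fix k assume "k \<in> {..<N}"
        then have "\<rho> ^ N \<le> \<rho> ^ k" using \<rho> by (intro power_decreasing) auto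
        then have "ennreal (\<rho> ^ N) * (Op \<beta> ^^ k) r t x z \<le> ennreal (\<rho> ^ k) * (Op \<beta> ^^ k) r t x z"
          by (intro mult_right_mono ennreal_leI) auto
        also have "\<dots> \<le> (Op \<gamma> ^^ k) r t x z" by (rule Op_pow_compare[OF t(2)])
        finally show "ennreal (\<rho> ^ N) * (Op \<beta> ^^ k) r t x z \<le> (Op \<gamma> ^^ k) r t x z" .
      qed
      also have "\<dots> \<le> (\<Sum>k<N'. (Op \<gamma> ^^ k) r t x z)" using that by (intro sum_mono2) auto
      finally show ?thesis .
    qed
    \<comment> \<open>The remainder in the expansion of q need not have a favourable sign at the
      fixed order \<open>N\<close>. A second index \<open>N'\<close> tends to infinity to remove it,
      while \<open>N\<close> alone determines the constant \<open>\<rho> ^ N / 2\<close>.\<close>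
    have tail: "(Op \<gamma> ^^ N') Q2 t x z \<le> ennreal (e N')" for N'
    proof -
      have "(Op \<gamma> ^^ N') Q2 t x z \<le> (\<Sum>j. pert h p (j + N') t x z)"
        by (intro Op_pow_H_le Q_kernel Q_le t)
      also have "\<dots> \<le> (\<Sum>j. ennreal (pert_const (j + N') * stable_bound \<alpha> t x z))"
        using pert_bound[OF t] by (intro suminf_le) auto
      also have "\<dots> = ennreal (\<Sum>j. pert_const (j + N') * stable_bound \<alpha> t x z)"
        using pert_const_nonneg sb summable_pert_const
        by (intro suminf_ennreal2 summable_mult2 summable_ignore_initial_segment) (auto simp: less_imp_le)
      also have "(\<Sum>j. pert_const (j + N') * stable_bound \<alpha> t x z) = e N'"
        unfolding e_def by (intro suminf_mult2[symmetric] summable_ignore_initial_segment summable_pert_const)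
      finally show ?thesis .
    qed
    have e0: "(\<lambda>N. ennreal (e N)) \<longlonglongrightarrow> 0"
    proof -
      have "(\<lambda>N. \<Sum>k. pert_const (k + N)) \<longlonglongrightarrow> 0" by (rule suminf_exist_split2[OF summable_pert_const])
      then have "e \<longlonglongrightarrow> 0 * stable_bound \<alpha> t x z" unfolding e_def by (intro tendsto_mult tendsto_const)
      then have "(\<lambda>N. ennreal (e N)) \<longlonglongrightarrow> ennreal 0" by (intro tendsto_ennrealI) simp
      then show ?thesis by simp
    qed
    have "Q2 t x z + ennreal (\<rho> ^ N) * S \<le> Q1 t x z + ennreal (e N')" if "N \<le> N'" for N'
    proof -
      have "Q2 t x z + ennreal (\<rho> ^ N) * S \<le> Q2 t x z + (\<Sum>k<N'. (Op \<gamma> ^^ k) r t x z)"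
        by (intro add_left_mono low that)
      also have "\<dots> \<le> (\<Sum>k<N'. (Op \<gamma> ^^ k) r t x z) + (Op \<gamma> ^^ N') Q1 t x z + Q2 t x z"
        by (simp add: add_ac add_increasing)
      also have "\<dots> = Q1 t x z + (Op \<gamma> ^^ N') Q2 t x z" by (rule Q_iterate[OF t(2), symmetric])
      also have "\<dots> \<le> Q1 t x z + ennreal (e N')" by (intro add_left_mono tail)
      finally show ?thesis .
    qed
    then have "Q2 t x z + ennreal (\<rho> ^ N) * S \<le> Q1 t x z + 0"
      by (intro LIMSEQ_le_const[OF tendsto_add[OF tendsto_const e0]]) auto
    then have fin: "Q2 t x z + ennreal (\<rho> ^ N) * S \<le> Q1 t x z" by simp
    have "ennreal (\<rho> ^ N / 2) * p t x z \<le> ennreal (\<rho> ^ N) * S"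
    proof -
      have "ennreal (\<rho> ^ N / 2) = ennreal (\<rho> ^ N * (1 / 2))" by simp
      also have "\<dots> = ennreal (\<rho> ^ N) * ennreal (1 / 2)" using \<rho> by (intro ennreal_mult) auto
      finally have "ennreal (\<rho> ^ N / 2) = ennreal (\<rho> ^ N) * ennreal (1 / 2)" .
      then show ?thesis using mult_left_mono[OF half, of "ennreal (\<rho> ^ N)"] by (simp add: mult.assoc)
    qed
    then show ?thesis by (rule order_trans[OF add_left_mono fin])
  qed
  show ?thesis using main \<rho> by (intro exI[of _ "\<rho> ^ N / 2"]) auto
qed

end

section \<open>The signed perturbation series\<close>

lemma suminf_swap_ennreal:
  fixes f :: "nat \<Rightarrow> nat \<Rightarrow> ennreal"
  shows "(\<Sum>i. \<Sum>j. f i j) = (\<Sum>j. \<Sum>i. f i j)"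
proof -
  have "(\<Sum>j. \<Sum>i. f i j) = (\<integral>\<^sup>+j. (\<Sum>i. f i j) \<partial>count_space UNIV)"
    by (rule nn_integral_count_space_nat[symmetric])
  also have "\<dots> = (\<Sum>i. \<integral>\<^sup>+j. f i j \<partial>count_space UNIV)" by (rule nn_integral_suminf) simp
  finally show ?thesis by (simp add: nn_integral_count_space_nat)
qed

lemma suminf_shift_ennreal:
  fixes f :: "nat \<Rightarrow> ennreal"
  shows "(\<Sum>n. if i \<le> n then f (n - i) else 0) = (\<Sum>j. f j)"
proof (induction i)
  case (Suc i)
  have "(\<lambda>n. if Suc i \<le> Suc n then f (Suc n - Suc i) else 0) = (\<lambda>n. if i \<le> n then f (n - i) else 0)"
    by (intro ext) simp
  then show ?case by (subst suminf_Suc_ennreal) (simp only: Suc, simp)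
qed simp

lemma suminf_Cauchy_ennreal:
  fixes f :: "nat \<Rightarrow> nat \<Rightarrow> ennreal"
  shows "(\<Sum>n. \<Sum>i\<le>n. f i (n - i)) = (\<Sum>i. \<Sum>j. f i j)"
proof -
  have "(\<Sum>i\<le>n. f i (n - i)) = (\<Sum>i. if i \<le> n then f i (n - i) else 0)" for n
    by (subst suminf_finite[of "{..n}"]) auto
  then have "(\<Sum>n. \<Sum>i\<le>n. f i (n - i)) = (\<Sum>n. \<Sum>i. if i \<le> n then f i (n - i) else 0)" by simp
  also have "\<dots> = (\<Sum>i. \<Sum>n. if i \<le> n then f i (n - i) else 0)" by (rule suminf_swap_ennreal)
  also have "\<dots> = (\<Sum>i. \<Sum>j. f i j)" by (intro suminf_cong suminf_shift_ennreal)
  finally show ?thesis .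
qed

text \<open>The bridge between Bochner integrals of signed functions and pairs of nonnegative
  integrals. Finiteness of both excludes the default value 0 of a non-integrable function.\<close>

lemma integral_eq_enn2real_diff:
  assumes f: "f \<in> borel_measurable M" "(\<integral>\<^sup>+x. f x \<partial>M) < \<top>" and g: "g \<in> borel_measurable M" "(\<integral>\<^sup>+x. g x \<partial>M) < \<top>"
    and F: "F \<in> borel_measurable M" "AE x in M. F x = enn2real (f x) - enn2real (g x)"
  shows "(LINT x|M. F x) = enn2real (\<integral>\<^sup>+x. f x \<partial>M) - enn2real (\<integral>\<^sup>+x. g x \<partial>M)"
proof -
  have *: "integrable M (\<lambda>x. enn2real (u x)) \<and> (LINT x|M. enn2real (u x)) = enn2real (\<integral>\<^sup>+x. u x \<partial>M)"
    if [measurable]: "u \<in> borel_measurable M" and fin: "(\<integral>\<^sup>+x. u x \<partial>M) < \<top>" for u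
  proof -
    have "AE x in M. u x \<noteq> \<infinity>" using fin by (intro nn_integral_PInf_AE) auto
    then have eq: "(\<integral>\<^sup>+x. ennreal (enn2real (u x)) \<partial>M) = (\<integral>\<^sup>+x. u x \<partial>M)"
      by (intro nn_integral_cong_AE) (auto simp: less_top)
    have "integrable M (\<lambda>x. enn2real (u x))"
      using fin eq by (intro integrableI_nonneg) auto
    then show ?thesis using eq by (simp add: integral_eq_nn_integral)
  qed
  have "(LINT x|M. F x) = (LINT x|M. enn2real (f x) - enn2real (g x))"
    using f(1) g(1) F by (intro integral_cong_AE) auto
  also have "\<dots> = enn2real (\<integral>\<^sup>+x. f x \<partial>M) - enn2real (\<integral>\<^sup>+x. g x \<partial>M)"
    using *[OF f] *[OF g] by simp
  finally show ?thesis .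
qed

context base_measure
begin

lemma stc_sum_right:
  assumes A: "st_kernel A" and B: "\<And>i. st_kernel (B i)"
  shows "(A \<star> (\<lambda>t x y. \<Sum>i\<in>I. B i t x y)) t x z = (\<Sum>i\<in>I. (A \<star> B i) t x z)"
proof -
  note [measurable (raw)] = st_kernel_measurable[OF A] st_kernel_measurable[OF B]
  show ?thesis by (simp add: stc_def sum_distrib_left nn_integral_sum)
qed

lemma kmul_sum_right:
  assumes b: "sp_kernel b" and B: "\<And>i. st_kernel (B i)"
  shows "(b \<bullet>\<^sub>k (\<lambda>t x y. \<Sum>i\<in>I. B i t x y)) t x z = (\<Sum>i\<in>I. (b \<bullet>\<^sub>k B i) t x z)"
proof -
  note [measurable (raw)] = sp_kernel_measurable[OF b] st_kernel_measurable[OF B]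
  show ?thesis by (simp add: kmul_def sum_distrib_left nn_integral_sum)
qed

lemma kmul_sum_left:
  assumes b: "\<And>i. sp_kernel (b i)" and B: "st_kernel B"
  shows "((\<lambda>x y. \<Sum>i\<in>I. b i x y) \<bullet>\<^sub>k B) t x z = (\<Sum>i\<in>I. (b i \<bullet>\<^sub>k B) t x z)"
proof -
  note [measurable (raw)] = sp_kernel_measurable[OF b] st_kernel_measurable[OF B]
  show ?thesis by (simp add: kmul_def sum_distrib_right nn_integral_sum)
qed

end

text \<open>\<open>g i\<close> is a signed jump kernel of order i. The recursion for the terms uses
  orders from 1 on, hence \<open>Suc i\<close> in \<open>g_sum\<close>.\<close>

locale signed_series = jump_kernel m \<alpha> M1 M2 p h t0 ch \<kappa>1 \<kappa>
  for m :: "'a::euclidean_space measure" and \<alpha> M1 M2 p h t0 ch \<kappa>1 \<kappa> +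
  fixes g :: "nat \<Rightarrow> 'a \<Rightarrow> 'a \<Rightarrow> real"
  assumes g_meas: "\<And>i. (\<lambda>(x, y). g i x y) \<in> borel_measurable (borel \<Otimes>\<^sub>M borel)"
    and g_sum: "\<And>w y. (\<Sum>i. ennreal \<bar>g (Suc i) w y\<bar>) \<le> h w y"
begin

definition gp :: "nat \<Rightarrow> 'a \<Rightarrow> 'a \<Rightarrow> ennreal" where "gp i w y = ennreal (g i w y)"
definition gm :: "nat \<Rightarrow> 'a \<Rightarrow> 'a \<Rightarrow> ennreal" where "gm i w y = ennreal (- g i w y)"

lemma g_measurable:
  assumes "u \<in> N \<rightarrow>\<^sub>M borel" "v \<in> N \<rightarrow>\<^sub>M borel"
  shows "(\<lambda>\<omega>. g i (u \<omega>) (v \<omega>)) \<in> borel_measurable N"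
  using measurable_compose[of "\<lambda>\<omega>. (u \<omega>, v \<omega>)" N, OF _ g_meas] assms by simp

lemma gp_kernel: "sp_kernel (gp i)" and gm_kernel: "sp_kernel (gm i)"
proof -
  note [measurable (raw)] = g_measurable
  show "sp_kernel (gp i)" "sp_kernel (gm i)" unfolding sp_kernel_def gp_def gm_def by measurable
qed

section \<open>Splitting the terms into two nonnegative parts\<close>

context
  notes sum.cong [fundef_cong]
begin

text \<open>Two nonnegative kernels, selected by \<open>e\<close>, whose difference is the signed
  n-th term: the positive part of \<open>g i\<close> keeps the sign of the remaining factor and the
  negative part reverses it.\<close>

function fk_part :: "nat \<Rightarrow> bool \<Rightarrow> real \<Rightarrow> 'a \<Rightarrow> 'a \<Rightarrow> ennreal" where
  "fk_part n e = (if n = 0 then (\<lambda>t x z. if e then p t x z else 0)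
    else (\<lambda>t x z. \<Sum>i=1..n. (p \<star> (gp i \<bullet>\<^sub>k fk_part (n - i) e)) t x z + (p \<star> (gm i \<bullet>\<^sub>k fk_part (n - i) (\<not> e))) t x z))"
  by pat_completeness auto
termination
  by (relation "Wellfounded.measure (\<lambda>(n, _). n)") auto

end

declare fk_part.simps [simp del]

lemma fk_part_0: "fk_part 0 e t x z = (if e then p t x z else 0)"
  by (simp add: fk_part.simps)

lemma fk_part_pos: "0 < n \<Longrightarrow> fk_part n e t x z = (\<Sum>i=1..n. (p \<star> (gp i \<bullet>\<^sub>k fk_part (n - i) e)) t x z +
    (p \<star> (gm i \<bullet>\<^sub>k fk_part (n - i) (\<not> e))) t x z)"
  by (subst fk_part.simps) simp

lemma fk_part_Suc: "fk_part (Suc n) e t x z = (\<Sum>i\<le>n. (p \<star> (gp (Suc i) \<bullet>\<^sub>k fk_part (n - i) e)) t x z +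
    (p \<star> (gm (Suc i) \<bullet>\<^sub>k fk_part (n - i) (\<not> e))) t x z)"
  unfolding fk_part_pos[OF zero_less_Suc] One_nat_def
  by (subst sum.atLeast_Suc_atMost_Suc_shift) (simp add: atMost_atLeast0)

lemma fk_part_kernel: "st_kernel (fk_part n e)"
proof (induction n arbitrary: e rule: less_induct)
  case (less n)
  show ?case
  proof (cases "n = 0")
    case True
    then show ?thesis using p_kernel st_kernel_zero by (cases e) (simp_all add: fk_part.simps)
  next
    case False
    then have "fk_part n e = (\<lambda>t x z. \<Sum>i=1..n. (p \<star> (gp i \<bullet>\<^sub>k fk_part (n - i) e)) t x z +
        (p \<star> (gm i \<bullet>\<^sub>k fk_part (n - i) (\<not> e))) t x z)"
      by (intro ext fk_part_pos) simp
    moreover have "st_kernel \<dots>"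
      using False by (intro kernel_intros p_kernel gp_kernel gm_kernel less) auto
    ultimately show ?thesis by simp
  qed
qed

definition absk :: "nat \<Rightarrow> 'a \<Rightarrow> 'a \<Rightarrow> ennreal" where "absk i w y = gp i w y + gm i w y"

lemma absk_eq: "absk i w y = ennreal \<bar>g i w y\<bar>"
  by (cases "0 \<le> g i w y") (auto simp: absk_def gp_def gm_def ennreal_neg)

lemma absk_kernel: "sp_kernel (absk i)"
proof -
  note [measurable (raw)] = g_measurable
  show ?thesis unfolding sp_kernel_def absk_eq[abs_def] by measurable
qed

definition tot :: "nat \<Rightarrow> real \<Rightarrow> 'a \<Rightarrow> 'a \<Rightarrow> ennreal" where
  "tot n t x z = fk_part n True t x z + fk_part n False t x z"

lemma tot_kernel: "st_kernel (tot n)"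
  unfolding tot_def[abs_def] by (intro st_kernel_add fk_part_kernel)

lemma tot_Suc: "tot (Suc n) t x z = (\<Sum>i\<le>n. (p \<star> (absk (Suc i) \<bullet>\<^sub>k tot (n - i))) t x z)"
proof -
  have "(p \<star> (absk (Suc i) \<bullet>\<^sub>k tot k)) t x z =
    ((p \<star> (gp (Suc i) \<bullet>\<^sub>k fk_part k True)) t x z + (p \<star> (gm (Suc i) \<bullet>\<^sub>k fk_part k False)) t x z) +
    ((p \<star> (gp (Suc i) \<bullet>\<^sub>k fk_part k False)) t x z + (p \<star> (gm (Suc i) \<bullet>\<^sub>k fk_part k True)) t x z)" for i k
  proof -
    note F = fk_part_kernel[of k True] fk_part_kernel[of k False]
    have "absk (Suc i) \<bullet>\<^sub>k tot k = (\<lambda>t x z. (gp (Suc i) \<bullet>\<^sub>k tot k) t x z + (gm (Suc i) \<bullet>\<^sub>k tot k) t x z)"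
      unfolding absk_def[abs_def] by (intro ext kmul_add_left gp_kernel gm_kernel tot_kernel)
    also have "\<dots> = (\<lambda>t x z. ((gp (Suc i) \<bullet>\<^sub>k fk_part k True) t x z + (gp (Suc i) \<bullet>\<^sub>k fk_part k False) t x z) +
       ((gm (Suc i) \<bullet>\<^sub>k fk_part k True) t x z + (gm (Suc i) \<bullet>\<^sub>k fk_part k False) t x z))"
      unfolding tot_def[abs_def] by (intro ext arg_cong2[where f="(+)"] kmul_add_right gp_kernel gm_kernel F)
    finally show ?thesis
      by (simp add: stc_add_right[OF p_kernel] st_kernel_add st_kernel_kmul gp_kernel gm_kernel F add_ac)
  qed
  then show ?thesis unfolding tot_def fk_part_Suc by (simp add: sum.distrib)
qed

text \<open>A single jump may carry any order, so the comparison with the series for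
  \<open>h\<close> is made for partial sums rather than term by term. Enlarging the triangle of
  indices i + j < N to a square lets the double sum factor, and the induction hypothesis applies to
  one factor.\<close>

lemma sum_tot_le: "(\<Sum>n<N. tot n t x z) \<le> (\<Sum>k<N. pert h p k t x z)"
proof (induction N arbitrary: t x z)
  case (Suc N)
  let ?X = "\<lambda>i j. (p \<star> (absk (Suc i) \<bullet>\<^sub>k tot j)) t x z"
  note P = st_kernel_pert[OF h_kernel p_kernel]
  have h_le: "(\<Sum>i<N. absk (Suc i) w y) \<le> h w y" for w y
    unfolding absk_eq by (rule order_trans[OF sum_le_suminf g_sum]) auto
  have *: "(\<Sum>n<Suc N. tot n t x z) = p t x z + (\<Sum>n<N. \<Sum>i\<le>n. ?X i (n - i))"
    unfolding sum.lessThan_Suc_shift tot_Suc by (simp add: tot_def fk_part_0)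
  have "(\<Sum>n<N. \<Sum>i\<le>n. ?X i (n - i)) = (\<Sum>(i, j)\<in>{(i, j). i + j < N}. ?X i j)"
    by (rule sum.triangle_reindex[symmetric])
  also have "\<dots> \<le> (\<Sum>(i, j)\<in>{..<N} \<times> {..<N}. ?X i j)"
    by (intro sum_mono2) auto
  also have "\<dots> = (\<Sum>i<N. \<Sum>j<N. ?X i j)" by (rule sum.cartesian_product[symmetric])
  also have "\<dots> = (p \<star> ((\<lambda>w y. \<Sum>i<N. absk (Suc i) w y) \<bullet>\<^sub>k (\<lambda>t x z. \<Sum>j<N. tot j t x z))) t x z"
  proof -
    have "(\<lambda>w y. \<Sum>i<N. absk (Suc i) w y) \<bullet>\<^sub>k (\<lambda>t x z. \<Sum>j<N. tot j t x z) =
      (\<lambda>t x z. \<Sum>i<N. \<Sum>j<N. (absk (Suc i) \<bullet>\<^sub>k tot j) t x z)"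
      by (intro ext) (simp only: kmul_sum_left[OF absk_kernel st_kernel_sum[OF tot_kernel]] kmul_sum_right[OF absk_kernel tot_kernel])
    then show ?thesis
      by (simp only: stc_sum_right[OF p_kernel st_kernel_sum[OF st_kernel_kmul[OF absk_kernel tot_kernel]]]
          stc_sum_right[OF p_kernel st_kernel_kmul[OF absk_kernel tot_kernel]])
  qed
  also have "\<dots> \<le> (p \<star> (h \<bullet>\<^sub>k (\<lambda>t x z. \<Sum>k<N. pert h p k t x z))) t x z"
  proof (intro stc_mono_strong kmul_mono h_le Suc.IH p_kernel st_kernel_kmul st_kernel_sum tot_kernel order_refl)
    note [measurable (raw)] = sp_kernel_measurable[OF absk_kernel]
    show "sp_kernel (\<lambda>w y. \<Sum>i<N. absk (Suc i) w y)" unfolding sp_kernel_def by measurable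
  qed
  also have "\<dots> = (\<Sum>k<N. pert h p (Suc k) t x z)"
  proof -
    have "h \<bullet>\<^sub>k (\<lambda>t x z. \<Sum>k<N. pert h p k t x z) = (\<lambda>t x z. \<Sum>k<N. (h \<bullet>\<^sub>k pert h p k) t x z)"
      by (intro ext kmul_sum_right h_kernel P)
    then show ?thesis by (simp add: stc_sum_right[OF p_kernel] st_kernel_kmul h_kernel P)
  qed
  finally show ?case unfolding * unfolding sum.lessThan_Suc_shift by (simp add: add_left_mono)
qed simp

definition Q :: "bool \<Rightarrow> real \<Rightarrow> 'a \<Rightarrow> 'a \<Rightarrow> ennreal" where "Q e t x z = (\<Sum>n. fk_part n e t x z)"

lemma Q_kernel: "st_kernel (Q e)"
  unfolding Q_def[abs_def] by (intro st_kernel_suminf fk_part_kernel)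

lemma Q_le: "Q e t x z \<le> (\<Sum>k. pert h p k t x z)"
  unfolding Q_def
proof (rule suminf_le_const[OF summableI])
  fix N
  have "(\<Sum>n<N. fk_part n e t x z) \<le> (\<Sum>n<N. tot n t x z)"
    by (intro sum_mono) (cases e, auto simp: tot_def)
  also have "\<dots> \<le> (\<Sum>k<N. pert h p k t x z)" by (rule sum_tot_le)
  also have "\<dots> \<le> (\<Sum>k. pert h p k t x z)" by (intro sum_le_suminf summableI) auto
  finally show "(\<Sum>n<N. fk_part n e t x z) \<le> (\<Sum>k. pert h p k t x z)" .
qed

definition Gp :: "'a \<Rightarrow> 'a \<Rightarrow> ennreal" where "Gp w y = (\<Sum>i. gp (Suc i) w y)"
definition Gm :: "'a \<Rightarrow> 'a \<Rightarrow> ennreal" where "Gm w y = (\<Sum>i. gm (Suc i) w y)"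

lemma Gp_kernel: "sp_kernel Gp" and Gm_kernel: "sp_kernel Gm"
proof -
  note [measurable (raw)] = sp_kernel_measurable[OF gp_kernel] sp_kernel_measurable[OF gm_kernel]
  show "sp_kernel Gp" "sp_kernel Gm" unfolding sp_kernel_def Gp_def Gm_def by measurable
qed

lemma Cauchy_stc:
  assumes b: "\<And>i. sp_kernel (b i)" and A: "\<And>j. st_kernel (A j)"
  shows "(\<Sum>n. \<Sum>i\<le>n. (p \<star> (b i \<bullet>\<^sub>k A (n - i))) t x z) =
    (p \<star> ((\<lambda>w y. \<Sum>i. b i w y) \<bullet>\<^sub>k (\<lambda>t x z. \<Sum>j. A j t x z))) t x z"
proof -
  have "(\<lambda>w y. \<Sum>i. b i w y) \<bullet>\<^sub>k (\<lambda>t x z. \<Sum>j. A j t x z) = (\<lambda>t x z. \<Sum>i. \<Sum>j. (b i \<bullet>\<^sub>k A j) t x z)"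
    by (intro ext) (simp add: kmul_suminf_left[OF b st_kernel_suminf[OF A]] kmul_suminf_right[OF b A])
  then have "(p \<star> ((\<lambda>w y. \<Sum>i. b i w y) \<bullet>\<^sub>k (\<lambda>t x z. \<Sum>j. A j t x z))) t x z =
      (\<Sum>i. \<Sum>j. (p \<star> (b i \<bullet>\<^sub>k A j)) t x z)"
    by (simp add: stc_suminf_right[OF p_kernel] st_kernel_suminf st_kernel_kmul b A)
  also have "\<dots> = (\<Sum>n. \<Sum>i\<le>n. (p \<star> (b i \<bullet>\<^sub>k A (n - i))) t x z)"
    by (rule suminf_Cauchy_ennreal[symmetric])
  finally show ?thesis ..
qed

text \<open>Summed over n, the recursion is a Cauchy product, that is, one convolution with the
  summed kernels \<open>Gp\<close> and \<open>Gm\<close>.\<close>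

lemma Q_eq: "Q e t x z = (if e then p t x z else 0) + (p \<star> (Gp \<bullet>\<^sub>k Q e)) t x z + (p \<star> (Gm \<bullet>\<^sub>k Q (\<not> e))) t x z"
proof -
  have "Q e t x z = (if e then p t x z else 0) + (\<Sum>n. fk_part (Suc n) e t x z)"
    unfolding Q_def by (subst suminf_Suc_ennreal) (simp add: fk_part_0)
  also have "(\<Sum>n. fk_part (Suc n) e t x z) = (\<Sum>n. \<Sum>i\<le>n. (p \<star> (gp (Suc i) \<bullet>\<^sub>k fk_part (n - i) e)) t x z) +
    (\<Sum>n. \<Sum>i\<le>n. (p \<star> (gm (Suc i) \<bullet>\<^sub>k fk_part (n - i) (\<not> e))) t x z)"
    unfolding fk_part_Suc sum.distrib by (rule suminf_add[symmetric]) (rule summableI)+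
  also have "\<dots> = (p \<star> (Gp \<bullet>\<^sub>k Q e)) t x z + (p \<star> (Gm \<bullet>\<^sub>k Q (\<not> e))) t x z"
    unfolding Gp_def[abs_def] Gm_def[abs_def] Q_def[abs_def]
    by (intro arg_cong2[where f="(+)"] Cauchy_stc gp_kernel gm_kernel fk_part_kernel)
  finally show ?thesis by (simp add: add.assoc)
qed

lemma fk_part_finite: "t \<le> t0 \<Longrightarrow> fk_part n e t x z < \<top>"
proof -
  assume t: "t \<le> t0"
  have "fk_part n e t x z \<le> Q e t x z"
    unfolding Q_def using sum_le_suminf[of "\<lambda>n. fk_part n e t x z" "{n}"] by simp
  also have "\<dots> \<le> (\<Sum>k. pert h p k t x z)" by (rule Q_le)
  also have "\<dots> < \<top>"
  proof (cases "0 < t")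
    case True
    show ?thesis by (rule order_le_less_trans[OF pert_suminf_bound[OF True t]]) simp
  qed (simp add: st_kernel_0[OF st_kernel_pert[OF h_kernel p_kernel]])
  finally show ?thesis .
qed

text \<open>Translates the iterated Bochner integral of the recursion into the two nonnegative
  parts. Finiteness of the totals passes to the inner integrals only for almost all \<open>s\<close>
  and \<open>w\<close>; strict positivity of \<open>p\<close> transfers it from the product with
  \<open>p\<close> to \<open>V\<close>.\<close>

lemma signed_convolution:
  assumes A: "st_kernel A1" "st_kernel A2" and fin: "\<And>s y. s \<le> t0 \<Longrightarrow> A1 s y z < \<top>" "\<And>s y. s \<le> t0 \<Longrightarrow> A2 s y z < \<top>"
    and t: "0 < t" "t \<le> t0"
    and T1: "(p \<star> (gp i \<bullet>\<^sub>k A1)) t x z + (p \<star> (gm i \<bullet>\<^sub>k A2)) t x z < \<top>"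
    and T2: "(p \<star> (gp i \<bullet>\<^sub>k A2)) t x z + (p \<star> (gm i \<bullet>\<^sub>k A1)) t x z < \<top>"
  shows "(LINT s:{0<..<t}|lborel. LINT w|m. enn2real (p s x w) *
      (LINT y|m. g i w y * (enn2real (A1 (t - s) y z) - enn2real (A2 (t - s) y z)))) =
    enn2real ((p \<star> (gp i \<bullet>\<^sub>k A1)) t x z + (p \<star> (gm i \<bullet>\<^sub>k A2)) t x z) -
    enn2real ((p \<star> (gp i \<bullet>\<^sub>k A2)) t x z + (p \<star> (gm i \<bullet>\<^sub>k A1)) t x z)"
proof -
  note [measurable (raw)] = p_measurable g_measurable sp_kernel_measurable[OF gp_kernel] sp_kernel_measurable[OF gm_kernel]
    st_kernel_measurable[OF A(1)] st_kernel_measurable[OF A(2)]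
  define V where "V B1 B2 s w = (gp i \<bullet>\<^sub>k B1) (t - s) w z + (gm i \<bullet>\<^sub>k B2) (t - s) w z" for B1 B2 s w
  define W where "W B1 B2 s = (\<integral>\<^sup>+w. p s x w * V B1 B2 s w \<partial>m)" for B1 B2 s
  have V_eq: "V B1 B2 s w = (\<integral>\<^sup>+y. gp i w y * B1 (t - s) y z + gm i w y * B2 (t - s) y z \<partial>m)"
    if "st_kernel B1" "st_kernel B2" for B1 B2 s w
  proof -
    note [measurable (raw)] = st_kernel_measurable[OF that(1)] st_kernel_measurable[OF that(2)]
    show ?thesis unfolding V_def kmul_def by (rule nn_integral_add[symmetric]) measurable
  qed
  have V_meas: "(\<lambda>(s, w). V B1 B2 s w) \<in> borel_measurable (lborel \<Otimes>\<^sub>M m)" if "st_kernel B1" "st_kernel B2" for B1 B2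
  proof -
    note [measurable (raw)] = st_kernel_measurable[OF st_kernel_kmul[OF gp_kernel that(1)]] st_kernel_measurable[OF st_kernel_kmul[OF gm_kernel that(2)]]
    show ?thesis unfolding V_def by measurable
  qed
  have [measurable]: "V A1 A2 s \<in> borel_measurable m" "V A2 A1 s \<in> borel_measurable m" for s
    using measurable_compose[OF measurable_Pair1' V_meas[OF A]] measurable_compose[OF measurable_Pair1' V_meas[OF A(2,1)]]
    by simp_all
  have W_total: "(\<integral>\<^sup>+s. W B1 B2 s \<partial>lborel) = (p \<star> (gp i \<bullet>\<^sub>k B1)) t x z + (p \<star> (gm i \<bullet>\<^sub>k B2)) t x z"
    if "st_kernel B1" "st_kernel B2" for B1 B2
  proof -
    note [measurable (raw)] = st_kernel_measurable[OF st_kernel_kmul[OF gp_kernel that(1)]] st_kernel_measurable[OF st_kernel_kmul[OF gm_kernel that(2)]]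
    show ?thesis unfolding W_def V_def stc_def by (simp add: distrib_left nn_integral_add)
  qed
  have W_meas[measurable]: "W A1 A2 \<in> borel_measurable lborel" "W A2 A1 \<in> borel_measurable lborel"
  proof -
    note [measurable] = V_meas[OF A] V_meas[OF A(2,1)]
    show "W A1 A2 \<in> borel_measurable lborel" "W A2 A1 \<in> borel_measurable lborel" unfolding W_def by measurable
  qed
  let ?I = "\<lambda>s w. LINT y|m. g i w y * (enn2real (A1 (t - s) y z) - enn2real (A2 (t - s) y z))"
  have inner: "?I s w = enn2real (V A1 A2 s w) - enn2real (V A2 A1 s w)"
    if s: "0 < s" "s < t" and V: "V A1 A2 s w < \<top>" "V A2 A1 s w < \<top>" for s w
    unfolding V_eq[OF A] V_eq[OF A(2,1)]
  proof (rule integral_eq_enn2real_diff)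
    show "(\<integral>\<^sup>+y. gp i w y * A1 (t - s) y z + gm i w y * A2 (t - s) y z \<partial>m) < \<top>"
      "(\<integral>\<^sup>+y. gp i w y * A2 (t - s) y z + gm i w y * A1 (t - s) y z \<partial>m) < \<top>"
      using V unfolding V_eq[OF A] V_eq[OF A(2,1)] .
    have "g i w y * (enn2real (A1 (t - s) y z) - enn2real (A2 (t - s) y z)) =
      enn2real (gp i w y * A1 (t - s) y z + gm i w y * A2 (t - s) y z) - enn2real (gp i w y * A2 (t - s) y z + gm i w y * A1 (t - s) y z)" for y
      using fin(1)[of "t - s" y] fin(2)[of "t - s" y] s t
      by (cases "0 \<le> g i w y") (auto simp: gp_def gm_def ennreal_neg enn2real_mult algebra_simps)
    then show "AE y in m. g i w y * (enn2real (A1 (t - s) y z) - enn2real (A2 (t - s) y z)) =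
      enn2real (gp i w y * A1 (t - s) y z + gm i w y * A2 (t - s) y z) - enn2real (gp i w y * A2 (t - s) y z + gm i w y * A1 (t - s) y z)"
      by simp
  qed measurable
  have middle: "(LINT w|m. enn2real (p s x w) * ?I s w) = enn2real (W A1 A2 s) - enn2real (W A2 A1 s)"
    if s: "0 < s" "s < t" and W: "W A1 A2 s < \<top>" "W A2 A1 s < \<top>" for s
    unfolding W_def
  proof (rule integral_eq_enn2real_diff)
    show "(\<integral>\<^sup>+w. p s x w * V A1 A2 s w \<partial>m) < \<top>" "(\<integral>\<^sup>+w. p s x w * V A2 A1 s w \<partial>m) < \<top>"
      using W by (simp_all add: W_def)
    have *: "AE w in m. V B1 B2 s w < \<top>" if "V B1 B2 s \<in> borel_measurable m" "W B1 B2 s < \<top>" for B1 B2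
    proof -
      note [measurable] = that(1)
      have "AE w in m. p s x w * V B1 B2 s w \<noteq> \<infinity>"
        using that(2) unfolding W_def by (intro nn_integral_PInf_AE) auto
      then show ?thesis
      proof eventually_elim
        case (elim w)
        then show ?case using p_pos[OF s(1), of x w] by (auto simp: ennreal_mult_eq_top_iff less_top)
      qed
    qed
    have "AE w in m. V A1 A2 s w < \<top>" "AE w in m. V A2 A1 s w < \<top>" by (intro * W; measurable)+
    then show "AE w in m. enn2real (p s x w) * ?I s w = enn2real (p s x w * V A1 A2 s w) - enn2real (p s x w * V A2 A1 s w)"
    proof eventually_elim
      case (elim w)
      show ?case unfolding inner[OF s elim] enn2real_mult by (rule right_diff_distrib)
    qed
  qed measurable
  have "(LINT s:{0<..<t}|lborel. LINT w|m. enn2real (p s x w) * ?I s w) =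
    enn2real (\<integral>\<^sup>+s. W A1 A2 s \<partial>lborel) - enn2real (\<integral>\<^sup>+s. W A2 A1 s \<partial>lborel)"
    unfolding set_lebesgue_integral_def
  proof (rule integral_eq_enn2real_diff)
    show fW: "(\<integral>\<^sup>+s. W A1 A2 s \<partial>lborel) < \<top>" "(\<integral>\<^sup>+s. W A2 A1 s \<partial>lborel) < \<top>"
      using T1 T2 unfolding W_total[OF A] W_total[OF A(2,1)] .
    have "AE s in lborel. W A1 A2 s \<noteq> \<infinity>" "AE s in lborel. W A2 A1 s \<noteq> \<infinity>"
      using nn_integral_PInf_AE[of "W A1 A2" lborel] nn_integral_PInf_AE[of "W A2 A1" lborel] fW W_meas by auto
    then show "AE s in lborel. indicat_real {0<..<t} s *\<^sub>R (LINT w|m. enn2real (p s x w) * ?I s w) =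
      enn2real (W A1 A2 s) - enn2real (W A2 A1 s)"
    proof eventually_elim
      case (elim s)
      show ?case
      proof (cases "0 < s \<and> s < t")
        case True
        then show ?thesis using elim middle[of s] by (simp add: less_top)
      next
        case False
        have "W B1 B2 s = 0" if "st_kernel B1" "st_kernel B2" for B1 B2
        proof (cases "s \<le> 0")
          case True
          then show ?thesis by (simp add: W_def st_kernel_0[OF p_kernel])
        next
          case F: False
          then have "t - s \<le> 0" using False by simp
          then show ?thesis
            by (simp add: W_def V_def kmul_def st_kernel_0[OF that(1)] st_kernel_0[OF that(2)])
        qed
        then show ?thesis using False A by (auto split: split_indicator)
      qed
    qed
  qed measurable
  then show ?thesis unfolding W_total[OF A] W_total[OF A(2,1)] .
qed

end

lemma enn2real_suminf:
  assumes "(\<Sum>n. f n) < (\<top> :: ennreal)"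
  shows "(\<lambda>n. enn2real (f n)) sums enn2real (\<Sum>n. f n)"
proof -
  have fin: "f n < \<top>" for n
    using sum_le_suminf[of f "{n}"] assms by (auto intro: order_le_less_trans)
  have eq: "(\<Sum>n. ennreal (enn2real (f n))) = (\<Sum>n. f n)" using fin by simp
  have s: "summable (\<lambda>n. enn2real (f n))"
    using assms by (intro summable_suminf_not_top) (auto simp: eq)
  show ?thesis
    using s eq suminf_ennreal2[of "\<lambda>n. enn2real (f n)"] by (metis enn2real_ennreal enn2real_nonneg suminf_nonneg summable_sums)
qed

section \<open>Identification with the alternating series\<close>

context signed_series
begin

lemma Q_finite: "0 < t \<Longrightarrow> t \<le> t0 \<Longrightarrow> Q e t x z < \<top>"
  by (rule order_le_less_trans[OF Q_le], rule order_le_less_trans[OF pert_suminf_bound]) auto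

context
  fixes pr :: "real \<Rightarrow> 'a \<Rightarrow> 'a \<Rightarrow> real" and C F :: "'a \<Rightarrow> 'a \<Rightarrow> real"
  assumes pr: "\<And>t x y. 0 < t \<Longrightarrow> pr t x y = enn2real (p t x y)"
    and g_eq: "\<And>i w y. g i w y = (- F w y) ^ i / fact i * (2 * C w y / norm (w - y) powr (real DIM('a) + \<alpha>))"
begin

text \<open>The sign \<open>(- 1)\<^sup>n\<close> and the factor \<open>n!\<close> of \<open>q = \<Sum>\<^sub>n (- 1)\<^sup>n q\<^sub>n / n!\<close> are built into \<open>g\<close>, which turns the
  binomial recursion for \<open>q\<^sub>n\<close> into a Cauchy product.\<close>

lemma fk_term_eq:
  assumes "0 < t" "t \<le> t0"
  shows "fk_term \<alpha> pr m C F n t x z =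
    (- 1) ^ n * fact n * (enn2real (fk_part n True t x z) - enn2real (fk_part n False t x z))"
  using assms
proof (induction n arbitrary: t x z rule: less_induct)
  case (less n)
  show ?case
  proof (cases "n = 0")
    case True
    then show ?thesis using less.prems by (simp add: fk_term.simps[of _ _ _ _ _ 0] fk_part_0 pr)
  next
    case False
    define X where "X i = (p \<star> (gp i \<bullet>\<^sub>k fk_part (n - i) True)) t x z + (p \<star> (gm i \<bullet>\<^sub>k fk_part (n - i) False)) t x z" for i
    define Y where "Y i = (p \<star> (gp i \<bullet>\<^sub>k fk_part (n - i) False)) t x z + (p \<star> (gm i \<bullet>\<^sub>k fk_part (n - i) True)) t x z" for i
    have sX: "fk_part n True t x z = (\<Sum>i=1..n. X i)" and sY: "fk_part n False t x z = (\<Sum>i=1..n. Y i)"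
      using False by (simp_all add: fk_part_pos X_def Y_def)
    have XY: "X i < \<top>" "Y i < \<top>" if "i \<in> {1..n}" for i
    proof -
      have "X i \<le> fk_part n True t x z" "Y i \<le> fk_part n False t x z"
        unfolding sX sY by (intro member_le_sum that zero_le finite_atLeastAtMost)+
      then show "X i < \<top>" "Y i < \<top>" using fk_part_finite[OF less.prems(2)] order_le_less_trans by blast+
    qed
    have step: "(LINT s:{0<..<t}|lborel. LINT w|m. pr s x w *
         (LINT y|m. 2 * C w y * F w y ^ i / norm (w - y) powr (real DIM('a) + \<alpha>) * fk_term \<alpha> pr m C F (n - i) (t - s) y z)) =
        (- 1) ^ n * (fact i * fact (n - i)) * (enn2real (X i) - enn2real (Y i))" if i: "i \<in> {1..n}" for i
    proof -
      let ?D = "\<lambda>s y. enn2real (fk_part (n - i) True (t - s) y z) - enn2real (fk_part (n - i) False (t - s) y z)"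
      have coeff: "2 * C w y * F w y ^ i / norm (w - y) powr (real DIM('a) + \<alpha>) = (- 1) ^ i * fact i * g i w y" for w y
        by (simp add: g_eq power_minus[of "F w y"])
      have sign: "(- 1 :: real) ^ i * (- 1) ^ (n - i) = (- 1) ^ n" using i by (simp flip: power_add)
      have "(LINT s:{0<..<t}|lborel. LINT w|m. pr s x w *
         (LINT y|m. 2 * C w y * F w y ^ i / norm (w - y) powr (real DIM('a) + \<alpha>) * fk_term \<alpha> pr m C F (n - i) (t - s) y z)) =
         (LINT s:{0<..<t}|lborel. ((- 1) ^ n * (fact i * fact (n - i))) * (LINT w|m. enn2real (p s x w) * (LINT y|m. g i w y * ?D s y)))"
      proof (intro set_lebesgue_integral_cong allI impI)
        fix s assume s: "s \<in> {0<..<t}"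
        have ih: "fk_term \<alpha> pr m C F (n - i) (t - s) y z = (- 1) ^ (n - i) * fact (n - i) * ?D s y" for y
          using s i less.prems by (intro less.IH) auto
        have "(LINT y|m. 2 * C w y * F w y ^ i / norm (w - y) powr (real DIM('a) + \<alpha>) * fk_term \<alpha> pr m C F (n - i) (t - s) y z)
          = (LINT y|m. ((- 1) ^ n * (fact i * fact (n - i))) * (g i w y * ?D s y))" for w
          unfolding coeff ih sign[symmetric] by (intro Bochner_Integration.integral_cong refl) (simp only: mult_ac)
        then show "(LINT w|m. pr s x w * (LINT y|m. 2 * C w y * F w y ^ i / norm (w - y) powr (real DIM('a) + \<alpha>) *
            fk_term \<alpha> pr m C F (n - i) (t - s) y z)) =
          (- 1) ^ n * (fact i * fact (n - i)) * (LINT w|m. enn2real (p s x w) * (LINT y|m. g i w y * ?D s y))"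
          using s by (simp add: pr mult.left_commute[of "enn2real _"])
      qed simp
      also have "\<dots> = (- 1) ^ n * (fact i * fact (n - i)) *
          (LINT s:{0<..<t}|lborel. LINT w|m. enn2real (p s x w) * (LINT y|m. g i w y * ?D s y))"
        by (rule set_integral_mult_right)
      also have "(LINT s:{0<..<t}|lborel. LINT w|m. enn2real (p s x w) * (LINT y|m. g i w y * ?D s y)) = enn2real (X i) - enn2real (Y i)"
        unfolding X_def Y_def using XY[OF i] less.prems
        by (intro signed_convolution fk_part_kernel fk_part_finite) (simp_all add: X_def Y_def)
      finally show ?thesis .
    qed
    have "fk_term \<alpha> pr m C F n t x z = (\<Sum>i=1..n. real (n choose i) * ((- 1) ^ n * (fact i * fact (n - i)) * (enn2real (X i) - enn2real (Y i))))"
      by (subst fk_term.simps) (simp only: False if_False step cong: sum.cong)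
    also have "\<dots> = (\<Sum>i=1..n. (- 1) ^ n * fact n * (enn2real (X i) - enn2real (Y i)))"
    proof (intro sum.cong refl)
      fix i assume "i \<in> {1..n}"
      then have "fact i * fact (n - i) * real (n choose i) = fact n"
        using binomial_fact_lemma[of i n] by (metis atLeastAtMost_iff of_nat_fact of_nat_mult)
      then show "real (n choose i) * ((- 1) ^ n * (fact i * fact (n - i)) * (enn2real (X i) - enn2real (Y i))) =
          (- 1) ^ n * fact n * (enn2real (X i) - enn2real (Y i))"
        by (metis mult.assoc mult.commute)
    qed
    also have "\<dots> = (- 1) ^ n * fact n * (enn2real (\<Sum>i=1..n. X i) - enn2real (\<Sum>i=1..n. Y i))"
      using XY by (subst (1 2) enn2real_sum) (auto simp: right_diff_distrib sum_subtractf sum_distrib_left)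
    finally show ?thesis unfolding sX sY .
  qed
qed

lemma fk_series_eq:
  assumes t: "0 < t" "t \<le> t0"
  shows "fk_series \<alpha> pr m C F t x z = enn2real (Q True t x z) - enn2real (Q False t x z)"
proof -
  have "(\<lambda>n. enn2real (fk_part n True t x z) - enn2real (fk_part n False t x z)) sums
    (enn2real (Q True t x z) - enn2real (Q False t x z))"
    using Q_finite[OF t] unfolding Q_def by (intro sums_diff enn2real_suminf)
  moreover have "(- 1) ^ n * fk_term \<alpha> pr m C F n t x z / fact n =
    enn2real (fk_part n True t x z) - enn2real (fk_part n False t x z)" for n
    unfolding fk_term_eq[OF t] by (simp flip: mult.assoc power_add)
  ultimately show ?thesis unfolding fk_series_def by (simp add: sums_iff)
qed

end

end

section \<open>Stable-like processes\<close>

locale stable_like_process = hunt_process \<M> \<F> X P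
  for \<M> :: "'w measure" and \<F> :: "ennreal \<Rightarrow> 'w measure"
    and X :: "ennreal \<Rightarrow> 'w \<Rightarrow> 'a::euclidean_space option" and P :: "'a option \<Rightarrow> 'w measure" +
  fixes \<alpha> M0 Mbar Cbar M1 M2 :: real and M :: "'a \<Rightarrow> real" and m :: "'a measure"
    and C :: "'a \<Rightarrow> 'a \<Rightarrow> real" and p :: "real \<Rightarrow> 'a \<Rightarrow> 'a \<Rightarrow> real"
  assumes m_eq: "m = density lborel (\<lambda>x. ennreal (M x))"
    and \<alpha>: "0 < \<alpha>"
    and M: "M \<in> borel_measurable borel" "0 < M0" "\<And>x. M0 \<le> M x" "\<And>x. M x \<le> Mbar"
    and C: "(\<lambda>(x, y). C x y) \<in> borel_measurable borel" "0 < Cbar"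
      "\<And>x y. \<bar>2 * C x y\<bar> \<le> Cbar" "\<And>x y. x \<noteq> y \<Longrightarrow> 0 \<le> C x y"
    and levy: "levy_system X P (stable_kernel \<alpha> m C)"
    and density: "transition_density X P m p"
    and continuous: "continuous_on ({0<..} \<times> UNIV \<times> UNIV) (\<lambda>(t, x, y). p t x y)"
    and bounds: "0 < M1" "0 < M2"
      "\<And>t x y. 0 < t \<Longrightarrow> M1 * stable_bound \<alpha> t x y \<le> p t x y"
      "\<And>t x y. 0 < t \<Longrightarrow> p t x y \<le> M2 * stable_bound \<alpha> t x y"
begin

definition pe :: "real \<Rightarrow> 'a \<Rightarrow> 'a \<Rightarrow> ennreal" where
  "pe t x y = (if 0 < t then ennreal (p t x y) else 0)"

text \<open>The density of the Levy kernel with respect to \<open>m\<close>, the intensity n of the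
  overview. It vanishes on the diagonal, by division by 0.\<close>

definition jump_rate :: "'a \<Rightarrow> 'a \<Rightarrow> real" where
  "jump_rate w y = 2 * C w y / norm (w - y) powr (real DIM('a) + \<alpha>)"

lemma jump_rate_nonneg: "0 \<le> jump_rate w y"
  using C(4)[of w y] by (cases "w = y") (auto simp: jump_rate_def)

lemma jump_rate_le: "jump_rate w y \<le> Cbar / norm (w - y) powr (real DIM('a) + \<alpha>)"
  using C(3)[of w y] by (auto simp: jump_rate_def intro!: divide_right_mono)

lemma C_measurable:
  assumes "u \<in> N \<rightarrow>\<^sub>M borel" "v \<in> N \<rightarrow>\<^sub>M borel"
  shows "(\<lambda>\<omega>. C (u \<omega>) (v \<omega>)) \<in> borel_measurable N"
proof -
  have [measurable]: "(\<lambda>(x, y). C x y) \<in> borel_measurable (borel \<Otimes>\<^sub>M borel)" using C(1) by (simp add: borel_prod)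
  show ?thesis using measurable_compose[of "\<lambda>\<omega>. (u \<omega>, v \<omega>)" N "borel \<Otimes>\<^sub>M borel" "\<lambda>(x, y). C x y"] assms by simp
qed

lemma jump_rate_kernel: "sp_kernel (\<lambda>w y. ennreal (jump_rate w y))"
proof -
  note [measurable (raw)] = C_measurable
  show ?thesis unfolding sp_kernel_def jump_rate_def by measurable
qed

lemma p_nonneg: "0 < t \<Longrightarrow> 0 \<le> p t x y"
  using bounds(3)[of t x y] bounds(1) stable_bound_pos[of t \<alpha> x y]
  by (smt (verit) mult_nonneg_nonneg)

lemma p_eq_pe: "0 < t \<Longrightarrow> p t x y = enn2real (pe t x y)"
  by (simp add: pe_def p_nonneg)

lemma pe_kernel: "st_kernel pe"
proof (rule st_kernelI)
  let ?S = "{0<..} \<times> UNIV \<times> UNIV :: (real \<times> 'a \<times> 'a) set"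
  have "(\<lambda>\<tau>. indicat_real ?S \<tau> *\<^sub>R (case \<tau> of (t, x, y) \<Rightarrow> p t x y)) \<in> borel_measurable borel"
    by (intro borel_measurable_continuous_on_indicator continuous borel_open open_Times) auto
  then have "(\<lambda>\<tau>. ennreal (indicat_real ?S \<tau> *\<^sub>R (case \<tau> of (t, x, y) \<Rightarrow> p t x y))) \<in> borel_measurable (borel \<Otimes>\<^sub>M borel \<Otimes>\<^sub>M borel)"
    by (simp add: borel_prod)
  then show "(\<lambda>(t, x, y). pe t x y) \<in> borel_measurable (borel \<Otimes>\<^sub>M borel \<Otimes>\<^sub>M borel)"
    by (rule back_subst[of "\<lambda>f. f \<in> _"]) (auto simp: pe_def fun_eq_iff split: split_indicator)
qed (simp add: pe_def)

lemma Mbar_pos: "0 < Mbar"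
  using M(2) M(3)[of undefined] M(4)[of undefined] by linarith

lemma base: "base_measure m"
proof
  have "sigma_finite_measure m"
    unfolding m_eq using M(1) by (subst sigma_finite_measure.sigma_finite_iff_density_finite[OF sigma_finite_lborel]) auto
  then show "\<exists>A. countable A \<and> A \<subseteq> sets m \<and> \<Union> A = space m \<and> (\<forall>a\<in>A. emeasure m a \<noteq> \<infinity>)"
    by (rule sigma_finite_measure.sigma_finite_countable)
  show "sets m = sets borel" by (simp add: m_eq)
qed

sublocale base_measure m by (rule base)

lemma nn_integral_m_le:
  assumes "f \<in> borel_measurable borel"
  shows "(\<integral>\<^sup>+x. f x \<partial>m) \<le> ennreal Mbar * (\<integral>\<^sup>+x. f x \<partial>lborel)"
proof -
  have "(\<integral>\<^sup>+x. f x \<partial>m) = (\<integral>\<^sup>+x. ennreal (M x) * f x \<partial>lborel)"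
    unfolding m_eq using M(1) assms by (subst nn_integral_density) auto
  also have "\<dots> \<le> (\<integral>\<^sup>+x. ennreal Mbar * f x \<partial>lborel)"
    by (intro nn_integral_mono mult_right_mono ennreal_leI M(4)) auto
  also have "\<dots> = ennreal Mbar * (\<integral>\<^sup>+x. f x \<partial>lborel)" using assms by (intro nn_integral_cmult) simp
  finally show ?thesis .
qed

lemma open_pos_m:
  assumes U: "open U" "U \<noteq> {}"
  shows "emeasure m U \<noteq> 0"
proof
  assume 0: "emeasure m U = 0"
  have "ennreal M0 * emeasure lborel U = (\<integral>\<^sup>+x. ennreal M0 * indicator U x \<partial>lborel)"
    using U(1) by (subst nn_integral_cmult_indicator) auto
  also have "\<dots> \<le> (\<integral>\<^sup>+x. ennreal (M x) * indicator U x \<partial>lborel)"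
    by (intro nn_integral_mono mult_right_mono ennreal_leI M(3)) auto
  also have "\<dots> = emeasure m U" using M(1) U(1) unfolding m_eq by (subst emeasure_density) auto
  finally have "emeasure lborel U = 0" using 0 M(2) by simp
  then have "negligible U" using U(1) by (simp add: negligible_iff_emeasure0)
  then show False using open_not_negligible U by blast
qed

lemma stable_bound_le: "0 < t \<Longrightarrow> stable_bound \<alpha> t (x :: 'a) y \<le> t powr (- real DIM('a) / \<alpha>)"
  using \<alpha> by (intro stable_bound_le_diag)

lemma p_continuous_compose:
  assumes "0 < t" "(f \<longlongrightarrow> t) G" "(u \<longlongrightarrow> x) G" "(v \<longlongrightarrow> y) G"
  shows "((\<lambda>n. p (f n) (u n) (v n)) \<longlongrightarrow> p t x y) G"
proof -
  have "open ({0<..} \<times> UNIV \<times> UNIV :: (real \<times> 'a \<times> 'a) set)" by (intro open_Times) auto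
  then have "isCont (\<lambda>(t, x, y). p t x y) (t, x, y)"
    using continuous assms(1) by (simp add: continuous_on_eq_continuous_at)
  from isCont_tendsto_compose[OF this tendsto_Pair[OF assms(2) tendsto_Pair[OF assms(3,4)]]]
  show ?thesis by simp
qed

lemma pe_tendsto:
  assumes "0 < t" "(f \<longlongrightarrow> t) G" "(u \<longlongrightarrow> x) G" "(v \<longlongrightarrow> y) G"
  shows "((\<lambda>n. pe (f n) (u n) (v n)) \<longlongrightarrow> pe t x y) G"
proof -
  have "((\<lambda>n. ennreal (p (f n) (u n) (v n))) \<longlongrightarrow> ennreal (p t x y)) G"
    by (intro tendsto_ennrealI p_continuous_compose assms)
  moreover have "eventually (\<lambda>n. 0 < f n) G" using order_tendstoD(1)[OF assms(2,1)] .
  then have "eventually (\<lambda>n. ennreal (p (f n) (u n) (v n)) = pe (f n) (u n) (v n)) G"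
    by eventually_elim (simp add: pe_def)
  ultimately have "((\<lambda>n. pe (f n) (u n) (v n)) \<longlongrightarrow> ennreal (p t x y)) G"
    by (rule Lim_transform_eventually)
  then show ?thesis using assms(1) by (simp add: pe_def[of t])
qed

sublocale hunt_jump_density \<M> \<F> X P m pe "\<lambda>w y. ennreal (jump_rate w y)"
proof
  show "st_kernel pe" by (rule pe_kernel)
  show "emeasure (P (Some x)) {\<omega> \<in> space (P (Some x)). X (ennreal t) \<omega> \<in> Some ` B} = (\<integral>\<^sup>+y\<in>B. pe t x y \<partial>m)"
    if "0 < t" "B \<in> sets borel" for t x B
    using density that unfolding transition_density_def by (simp add: pe_def)
  show "emeasure m U \<noteq> 0" if "open U" "U \<noteq> {}" for U using open_pos_m that .
  show "(\<lambda>n. pe t x (f n)) \<longlonglongrightarrow> pe t x y" if "0 < t" "f \<longlonglongrightarrow> y" for t x y and f :: "nat \<Rightarrow> 'a"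
    using that by (intro pe_tendsto tendsto_const)
  show "\<exists>c. \<forall>x y. pe t x y \<le> ennreal c" if t: "0 < t" for t
  proof (intro exI allI)
    fix x y
    have "p t x y \<le> M2 * t powr (- real DIM('a) / \<alpha>)"
      using bounds(4)[OF t, of x y] mult_left_mono[OF stable_bound_le[OF t, of x y], of M2] bounds(2) by linarith
    then show "pe t x y \<le> ennreal (M2 * t powr (- real DIM('a) / \<alpha>))" using t by (simp add: pe_def ennreal_leI)
  qed
  show "sp_kernel (\<lambda>w y. ennreal (jump_rate w y))" by (rule jump_rate_kernel)
  fix Q :: "('a \<times> 'a) set" and x and T :: real
  assume Q: "open Q" "\<And>u. (u, u) \<notin> Q" and T: "0 < T"
  have Qm: "Q \<in> sets borel" using Q(1) by simp
  note [measurable (raw)] = sp_kernel_measurable[OF jump_rate_kernel]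
  have Qp[measurable]: "Q \<in> sets (borel \<Otimes>\<^sub>M borel)" using Qm unfolding borel_prod .
  have kernel: "(\<integral>\<^sup>+y. indicator Q (u, y) \<partial>stable_kernel \<alpha> m C u) = (\<integral>\<^sup>+y. ennreal (jump_rate u y) * indicator Q (u, y) \<partial>m)" for u
    unfolding stable_kernel_def jump_rate_def[symmetric] by (subst nn_integral_density) measurable
  have "(\<lambda>(u, v). indicator Q (u, v) :: ennreal) \<in> borel_measurable borel" using Qm by simp
  with levy Q(2) T have "(\<integral>\<^sup>+\<omega>. (\<Sum>\<^sub>\<infinity>s\<in>{0<..T}. off_cemetery (\<lambda>u v. indicator Q (u, v)) (left_limit X (ennreal s) \<omega>) (X (ennreal s) \<omega>)) \<partial>P (Some x)) =
      (\<integral>\<^sup>+\<omega>. (\<integral>\<^sup>+s\<in>{0..T}. (case X (ennreal s) \<omega> of None \<Rightarrow> 0 | Some u \<Rightarrow> \<integral>\<^sup>+y. indicator Q (u, y) \<partial>stable_kernel \<alpha> m C u) \<partial>lborel)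
         \<partial>P (Some x))"
    unfolding levy_system_def by (auto dest!: spec[of _ "\<lambda>u v. indicator Q (u, v)"])
  then show "(\<integral>\<^sup>+\<omega>. (\<Sum>\<^sub>\<infinity>s\<in>{0<..T}. off_ind Q (left_limit X (ennreal s) \<omega>) (X (ennreal s) \<omega>)) \<partial>P (Some x)) =
      (\<integral>\<^sup>+\<omega>. (\<integral>\<^sup>+s\<in>{0..T}. opt_lift (\<lambda>u. \<integral>\<^sup>+y. ennreal (jump_rate u y) * indicator Q (u, y) \<partial>m) (X (ennreal s) \<omega>) \<partial>lborel)
        \<partial>P (Some x))"
    unfolding off_ind_def opt_lift_def kernel .
qed

lemma short_time: "short_time_kernel m \<alpha> M1 M2 pe (\<lambda>w y. ennreal (jump_rate w y))"
proof
  show "0 < \<alpha>" by (rule \<alpha>)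
  show "0 < M1" "0 < M2" by (rule bounds)+
  show "st_kernel pe" by (rule pe_kernel)
  show "ennreal (M1 * stable_bound \<alpha> t x y) \<le> pe t x y" "pe t x y \<le> ennreal (M2 * stable_bound \<alpha> t x y)"
    if "0 < t" for t x y using bounds(3,4)[OF that, of x y] that by (auto simp: pe_def ennreal_leI)
  show "(\<integral>\<^sup>+y. pe t x y \<partial>m) \<le> 1" for t x by (rule p_mass')
  show "(\<integral>\<^sup>+y. pe s x y * pe t y z \<partial>m) = pe (s + t) x z" if "0 < s" "0 < t" for s t x z
    using that by (rule chapman_kolmogorov)
  show "(\<lambda>n. pe (f n) x y) \<longlonglongrightarrow> pe t x y" if "0 < t" "f \<longlonglongrightarrow> t" for t x y and f :: "nat \<Rightarrow> real"
    using that by (intro pe_tendsto tendsto_const)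
  show "sp_kernel (\<lambda>w y. ennreal (jump_rate w y))" by (rule jump_rate_kernel)
  show "(\<integral>\<^sup>+s\<in>{0<..1}. (\<integral>\<^sup>+w. pe s x w * (\<integral>\<^sup>+y. ennreal (jump_rate w y) * indicator Q (w, y) \<partial>m) \<partial>m) \<partial>lborel) \<le>
      liminf (\<lambda>k. ennreal (real (Suc k)) *
        (\<integral>\<^sup>+s\<in>{0<..1}. (\<integral>\<^sup>+w. pe s x w * (\<integral>\<^sup>+y. pe (1 / real (Suc k)) w y * indicator Q (w, y) \<partial>m) \<partial>m) \<partial>lborel))"
    if "open Q" "\<And>u. (u, u) \<notin> Q" for Q x
    using levy_le_liminf[OF that zero_less_one, of x] by simp
  show "1 \<le> liminf (\<lambda>k. \<integral>\<^sup>+y. pe (s k) x y * indicator Q y \<partial>m)"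
    if "open Q" "x \<in> Q" "\<And>k. 0 < s k" "s \<longlonglongrightarrow> 0" for Q x s
    using that by (rule short_time_open)
qed

end

text \<open>By convexity, the exponential lies below its chord on [0, L].\<close>

lemma exp_diff_one_le:
  assumes "0 \<le> f" "f \<le> L" "0 < L"
  shows "exp f - 1 \<le> f * ((exp L - 1) / (L::real))"
proof -
  have "exp ((1 - f / L) *\<^sub>R 0 + (f / L) *\<^sub>R L) \<le> (1 - f / L) * exp 0 + (f / L) * exp L"
    using assms by (intro convex_onD[OF exp_convex]) auto
  then have "exp f \<le> 1 - f / L + f / L * exp L" using assms by simp
  then show ?thesis by (simp add: diff_divide_distrib right_diff_distrib)
qed

lemma suminf_ennreal_parts:
  fixes a :: "nat \<Rightarrow> real"
  assumes "summable (\<lambda>i. \<bar>a i\<bar>)"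
  obtains u v where "0 \<le> u" "0 \<le> v" "(\<Sum>i. ennreal (a i)) = ennreal u" "(\<Sum>i. ennreal (- a i)) = ennreal v"
    "u - v = (\<Sum>i. a i)"
proof
  have s: "summable (\<lambda>i. max 0 (a i))" "summable (\<lambda>i. max 0 (- a i))"
    by (rule summable_comparison_test'[OF assms, of 0], simp)+
  show "0 \<le> (\<Sum>i. max 0 (a i))" "0 \<le> (\<Sum>i. max 0 (- a i))" using s by (auto intro!: suminf_nonneg)
  have *: "(\<Sum>i. ennreal (b i)) = (\<Sum>i. ennreal (max 0 (b i)))" for b :: "nat \<Rightarrow> real"
    by (intro suminf_cong) (simp add: max_def ennreal_neg)
  show "(\<Sum>i. ennreal (a i)) = ennreal (\<Sum>i. max 0 (a i))"
    unfolding *[of a] by (rule suminf_ennreal2[OF _ s(1)]) simp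
  show "(\<Sum>i. ennreal (- a i)) = ennreal (\<Sum>i. max 0 (- a i))"
    unfolding *[of "\<lambda>i. - a i"] by (rule suminf_ennreal2[OF _ s(2)]) simp
  show "(\<Sum>i. max 0 (a i)) - (\<Sum>i. max 0 (- a i)) = (\<Sum>i. a i)"
    using s by (subst suminf_diff) (auto intro!: suminf_cong)
qed

section \<open>Constants determined by F and by the choice of t0\<close>

locale stable_feynman_kac = stable_like_process \<M> \<F> X P \<alpha> M0 Mbar Cbar M1 M2 M m C p
  for \<M> :: "'w measure" and \<F> :: "ennreal \<Rightarrow> 'w measure"
    and X :: "ennreal \<Rightarrow> 'w \<Rightarrow> 'a::euclidean_space option" and P :: "'a option \<Rightarrow> 'w measure"
    and \<alpha> M0 Mbar Cbar M1 M2 :: real and M :: "'a \<Rightarrow> real" and m :: "'a measure"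
    and C :: "'a \<Rightarrow> 'a \<Rightarrow> real" and p :: "real \<Rightarrow> 'a \<Rightarrow> 'a \<Rightarrow> real" +
  fixes F :: "'a \<Rightarrow> 'a \<Rightarrow> real" and L K t0 :: real
  assumes F: "(\<lambda>(x, y). F x y) \<in> borel_measurable borel" "\<And>x. F x x = 0" "0 < L" "\<And>x y. \<bar>F x y\<bar> \<le> L / 2"
    and K: "0 < K" "K < 1" and t0: "0 < t0"
    and small: "\<And>n::nat. 1 \<le> n \<Longrightarrow>
      ennreal (2 powr (1 + real DIM('a) / \<alpha>) * Mbar ^ 2 * Cbar) * jump_sup \<alpha> p F t0 *
        ennreal (\<Sum>i=1..n. K ^ (n - i) * L ^ (i - 1) / fact i) \<le> ennreal (K ^ n)"
begin

text \<open>\<open>E\<close> is the limit of the sums \<open>\<Sum>\<^sub>i L\<^sup>i\<^sup>-\<^sup>1 / i!\<close> in the condition on \<open>t\<^sub>0\<close>. That condition leaves room for the factor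
  \<open>1 / sqrt K > 1\<close> in \<open>\<theta>\<close>, which in turn lets \<open>\<beta>\<close> exceed \<open>(1 - exp (- F\<^sup>+)) n\<close>.\<close>

definition E :: real where "E = (exp L - 1) / L"
definition \<theta> :: real where "\<theta> = Cbar * E / sqrt K"
definition Jsup :: real where "Jsup = enn2real (jump_sup \<alpha> p F t0)"
definition majorant :: "'a \<Rightarrow> 'a \<Rightarrow> ennreal" where
  "majorant w y = ennreal (\<theta> * \<bar>F w y\<bar> / norm (w - y) powr (real DIM('a) + \<alpha>))"
definition gF :: "nat \<Rightarrow> 'a \<Rightarrow> 'a \<Rightarrow> real" where
  "gF i w y = (- F w y) ^ i / fact i * jump_rate w y"

lemma E_ge: "1 \<le> E"
  using F(3) exp_ge_add_one_self[of L] by (simp add: E_def field_simps)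

lemma sqrtK: "0 < sqrt K" "sqrt K < 1" "sqrt K * sqrt K = K"
  using K by auto

lemma \<theta>_pos: "0 < \<theta>"
  using E_ge C(2) sqrtK(1) by (simp add: \<theta>_def)

lemma E_sums: "(\<lambda>i. L ^ i / fact (Suc i)) sums E"
proof -
  have "(\<lambda>i. L ^ i / fact i) sums exp L" using exp_converges[of L] by (simp add: divide_inverse mult.commute)
  then have "(\<lambda>i. L ^ Suc i / fact (Suc i)) sums (exp L - L ^ 0 / fact 0)" by (subst sums_Suc_iff) simp
  then have "(\<lambda>i. L ^ Suc i / fact (Suc i) / L) sums ((exp L - 1) / L)" by (intro sums_divide) simp
  then show ?thesis using F(3) by (simp add: E_def del: fact_Suc)
qed

text \<open>The smallness condition for n = 1 makes \<open>jump_sup\<close> finite. In the condition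
  for n + 1, every power K^(n + 1 - i) is at least K^n; dividing by K^n and letting n tend to
  infinity sums the series to \<open>E\<close>.\<close>

lemma Jsup_bound: "jump_sup \<alpha> p F t0 = ennreal Jsup"
    "2 powr (1 + real DIM('a) / \<alpha>) * Mbar ^ 2 * Cbar * Jsup * E \<le> K"
proof -
  define c where "c = 2 powr (1 + real DIM('a) / \<alpha>) * Mbar ^ 2 * Cbar"
  have c: "0 < c" using Mbar_pos C(2) by (simp add: c_def)
  have "ennreal c * jump_sup \<alpha> p F t0 \<le> ennreal K" using small[of 1] by (simp add: c_def)
  then have "ennreal c * jump_sup \<alpha> p F t0 < \<top>" by (rule order_le_less_trans) simp
  then show J: "jump_sup \<alpha> p F t0 = ennreal Jsup"
    using c by (auto simp: Jsup_def ennreal_mult_less_top less_top)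
  have J0: "0 \<le> Jsup" by (simp add: Jsup_def)
  have "c * Jsup * (\<Sum>i<n. L ^ i / fact (Suc i)) \<le> K" for n
  proof -
    let ?S = "\<Sum>i=1..Suc n. K ^ (Suc n - i) * L ^ (i - 1) / fact i"
    have S0: "0 \<le> ?S" using K F(3) by (intro sum_nonneg) simp
    have "ennreal (c * Jsup * ?S) \<le> ennreal (K ^ Suc n)"
      using small[of "Suc n"] c J0 S0 by (simp add: J c_def[symmetric] ennreal_mult mult_nonneg_nonneg del: sum.cl_ivl_Suc)
    then have le: "c * Jsup * ?S \<le> K ^ Suc n" using K by (subst (asm) ennreal_le_iff) auto
    have "K ^ n * (\<Sum>i<n. L ^ i / fact (Suc i)) \<le> K ^ n * (\<Sum>i<Suc n. L ^ i / fact (Suc i))"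
      using K F(3) by (intro mult_left_mono) auto
    also have "\<dots> = (\<Sum>i<Suc n. K ^ n * L ^ i / fact (Suc i))" by (simp add: sum_distrib_left del: sum.lessThan_Suc)
    also have "\<dots> \<le> (\<Sum>i<Suc n. K ^ (n - i) * L ^ i / fact (Suc i))"
      using K F(3) by (intro sum_mono divide_right_mono mult_right_mono power_decreasing) auto
    also have "\<dots> = ?S"
      unfolding One_nat_def sum.atLeast_Suc_atMost_Suc_shift by (simp add: lessThan_Suc_atMost atMost_atLeast0 del: sum.cl_ivl_Suc)
    finally have "K ^ n * (c * Jsup * (\<Sum>i<n. L ^ i / fact (Suc i))) \<le> c * Jsup * ?S"
      using mult_left_mono[of "K ^ n * (\<Sum>i<n. L ^ i / fact (Suc i))" ?S "c * Jsup"] c J0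
      by (simp only: mult.left_commute[of "K ^ n"] mult_nonneg_nonneg less_imp_le)
    also note le
    finally show ?thesis using K by (simp add: mult.commute[of K])
  qed
  then have "c * Jsup * E \<le> K"
    using tendsto_mult_left[OF E_sums[unfolded sums_def], of "c * Jsup"] by (intro LIMSEQ_le_const2) auto
  then show "2 powr (1 + real DIM('a) / \<alpha>) * Mbar ^ 2 * Cbar * Jsup * E \<le> K" by (simp add: c_def)
qed

lemma F_measurable:
  assumes "u \<in> N \<rightarrow>\<^sub>M borel" "v \<in> N \<rightarrow>\<^sub>M borel"
  shows "(\<lambda>\<omega>. F (u \<omega>) (v \<omega>)) \<in> borel_measurable N"
proof -
  have [measurable]: "(\<lambda>(x, y). F x y) \<in> borel_measurable (borel \<Otimes>\<^sub>M borel)" using F(1) by (simp add: borel_prod)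
  show ?thesis using measurable_compose[of "\<lambda>\<omega>. (u \<omega>, v \<omega>)" N "borel \<Otimes>\<^sub>M borel" "\<lambda>(x, y). F x y"] assms by simp
qed

lemma majorant_kernel: "sp_kernel majorant"
proof -
  note [measurable (raw)] = F_measurable
  show ?thesis unfolding sp_kernel_def majorant_def by measurable
qed

text \<open>The Lebesgue density of the measure \<mu>; being symmetrised in F, it controls jumps out
  of a point and into it alike.\<close>

definition JI :: "'a \<Rightarrow> ennreal" where "JI = jump_integral \<alpha> (\<lambda>w y. \<bar>F w y\<bar> + \<bar>F y w\<bar>)"

lemma JI_measurable: "JI \<in> borel_measurable borel"
proof -
  note [measurable (raw)] = F_measurable
  show ?thesis unfolding JI_def jump_integral_def[abs_def] by measurable
qed

lemma majorant_mass: "(\<integral>\<^sup>+y. majorant w y \<partial>m) \<le> ennreal (Mbar * \<theta>) * JI w"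
    "(\<integral>\<^sup>+y. majorant y w \<partial>m) \<le> ennreal (Mbar * \<theta>) * JI w"
proof -
  note [measurable (raw)] = F_measurable sp_kernel_measurable[OF majorant_kernel]
  have *: "(\<integral>\<^sup>+y. f y \<partial>m) \<le> ennreal (Mbar * \<theta>) * JI w"
    if [measurable]: "f \<in> borel_measurable borel"
      and le: "\<And>y. f y \<le> ennreal (\<theta> * (\<bar>\<bar>F w y\<bar> + \<bar>F y w\<bar>\<bar> / norm (w - y) powr (real DIM('a) + \<alpha>)))" for f
  proof -
    have "(\<integral>\<^sup>+y. f y \<partial>m) \<le> ennreal Mbar * (\<integral>\<^sup>+y. f y \<partial>lborel)" by (rule nn_integral_m_le) measurable
    also have "\<dots> \<le> ennreal Mbar * (\<integral>\<^sup>+y. ennreal \<theta> * ennreal (\<bar>\<bar>F w y\<bar> + \<bar>F y w\<bar>\<bar> / norm (w - y) powr (real DIM('a) + \<alpha>)) \<partial>lborel)"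
      by (intro mult_left_mono nn_integral_mono order_trans[OF le])
        (simp_all only: ennreal_mult'[OF less_imp_le[OF \<theta>_pos]] order_refl zero_le)
    also have "\<dots> = ennreal Mbar * (ennreal \<theta> * JI w)"
      unfolding JI_def jump_integral_def by (subst nn_integral_cmult) measurable
    also have "\<dots> = ennreal (Mbar * \<theta>) * JI w" using Mbar_pos \<theta>_pos by (simp add: ennreal_mult mult.assoc)
    finally show ?thesis .
  qed
  show "(\<integral>\<^sup>+y. majorant w y \<partial>m) \<le> ennreal (Mbar * \<theta>) * JI w" "(\<integral>\<^sup>+y. majorant y w \<partial>m) \<le> ennreal (Mbar * \<theta>) * JI w"
    using \<theta>_pos by (intro *; measurable; auto simp: majorant_def norm_minus_commute[of _ w]
        intro!: ennreal_leI divide_right_mono mult_left_mono simp flip: times_divide_eq_right)+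
qed

text \<open>One factor \<open>Mbar\<close> stems from the integration over the jump target in
  \<open>majorant_mass\<close>, the other from replacing \<open>m\<close> by Lebesgue measure
  here.\<close>

lemma kernel_JI_le:
  assumes f: "\<And>s. f s \<in> borel_measurable borel"
    and le: "\<And>s w. 0 < s \<Longrightarrow> f s w \<le> ennreal (p s x w + p s w x)"
  shows "(\<integral>\<^sup>+s\<in>{0<..t0}. (\<integral>\<^sup>+w. f s w * (ennreal (Mbar * \<theta>) * JI w) \<partial>m) \<partial>lborel) \<le> ennreal (Mbar\<^sup>2 * \<theta> * Jsup)"
proof -
  note [measurable] = f JI_measurable
  note [measurable (raw)] = p_meas
  let ?I = "\<lambda>s. \<integral>\<^sup>+w. ennreal (p s x w + p s w x) \<partial>jump_measure \<alpha> F"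
  have meas: "(\<lambda>w. ennreal (p s x w + p s w x)) \<in> borel_measurable borel" if "0 < s" for s
  proof -
    have "(\<lambda>w. pe s x w + pe s w x) \<in> borel_measurable borel" by measurable
    then show ?thesis using that p_nonneg by (simp add: pe_def ennreal_plus)
  qed
  have "(\<integral>\<^sup>+w. f s w * (ennreal (Mbar * \<theta>) * JI w) \<partial>m) \<le> ennreal (Mbar\<^sup>2 * \<theta>) * ?I s" if s: "0 < s" for s
  proof -
    note [measurable] = meas[OF s]
    have "(\<integral>\<^sup>+w. f s w * (ennreal (Mbar * \<theta>) * JI w) \<partial>m) \<le> ennreal Mbar * (\<integral>\<^sup>+w. f s w * (ennreal (Mbar * \<theta>) * JI w) \<partial>lborel)"
      by (intro nn_integral_m_le) measurable
    also have "\<dots> \<le> ennreal Mbar * (\<integral>\<^sup>+w. ennreal (Mbar * \<theta>) * (JI w * ennreal (p s x w + p s w x)) \<partial>lborel)"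
    proof (intro mult_left_mono nn_integral_mono zero_le)
      fix w
      show "f s w * (ennreal (Mbar * \<theta>) * JI w) \<le> ennreal (Mbar * \<theta>) * (JI w * ennreal (p s x w + p s w x))"
        using mult_left_mono[OF le[OF s, of w] zero_le, of "ennreal (Mbar * \<theta>) * JI w"] by (simp only: ac_simps)
    qed
    also have "\<dots> = ennreal Mbar * (ennreal (Mbar * \<theta>) * ?I s)"
      unfolding jump_measure_def JI_def[symmetric] by (subst nn_integral_cmult, measurable) (subst nn_integral_density; simp)
    also have "\<dots> = ennreal (Mbar\<^sup>2 * \<theta>) * ?I s"
      using Mbar_pos \<theta>_pos by (simp add: ennreal_mult power2_eq_square mult.assoc)
    finally show ?thesis .
  qed
  then have "(\<integral>\<^sup>+s\<in>{0<..t0}. (\<integral>\<^sup>+w. f s w * (ennreal (Mbar * \<theta>) * JI w) \<partial>m) \<partial>lborel) \<le>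
      (\<integral>\<^sup>+s\<in>{0<..t0}. ennreal (Mbar\<^sup>2 * \<theta>) * ?I s \<partial>lborel)"
    by (intro nn_integral_mono) (auto split: split_indicator)
  also have "\<dots> = ennreal (Mbar\<^sup>2 * \<theta>) * (\<integral>\<^sup>+s\<in>{0<..t0}. ?I s \<partial>lborel)"
  proof -
    have "(\<lambda>s. \<integral>\<^sup>+w. (pe s x w + pe s w x) * indicator {0<..t0} s * JI w \<partial>lborel) \<in> borel_measurable borel" by measurable
    also have "(\<lambda>s. \<integral>\<^sup>+w. (pe s x w + pe s w x) * indicator {0<..t0} s * JI w \<partial>lborel) = (\<lambda>s. ?I s * indicator {0<..t0} s)"
    proof
      fix s
      show "(\<integral>\<^sup>+w. (pe s x w + pe s w x) * indicator {0<..t0} s * JI w \<partial>lborel) = ?I s * indicator {0<..t0} s"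
      proof (cases "s \<in> {0<..t0}")
        case True
        then show ?thesis unfolding jump_measure_def JI_def[symmetric] using meas[of s] p_nonneg
          by (subst nn_integral_density) (auto simp: pe_def ennreal_plus mult.commute)
      qed simp
    qed
    finally show ?thesis by (simp add: mult.assoc nn_integral_cmult)
  qed
  also have "\<dots> \<le> ennreal (Mbar\<^sup>2 * \<theta>) * jump_sup \<alpha> p F t0"
    unfolding jump_sup_def by (intro mult_left_mono SUP_upper) auto
  also have "\<dots> = ennreal (Mbar\<^sup>2 * \<theta> * Jsup)"
    unfolding Jsup_bound(1) using \<theta>_pos by (simp add: ennreal_mult Jsup_def)
  finally show ?thesis .
qed

lemma pe_le: "0 < s \<Longrightarrow> pe s x w \<le> ennreal (p s x w + p s w x)" "0 < s \<Longrightarrow> pe s w x \<le> ennreal (p s x w + p s w x)"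
  using p_nonneg[of s x w] p_nonneg[of s w x] by (auto simp: pe_def ennreal_leI)

lemma gF_measurable: "(\<lambda>(x, y). gF i x y) \<in> borel_measurable (borel \<Otimes>\<^sub>M borel)"
proof -
  note [measurable (raw)] = F_measurable C_measurable
  show ?thesis unfolding gF_def jump_rate_def by measurable
qed

lemma gF_sums: "(\<lambda>i. gF (Suc i) w y) sums ((exp (- F w y) - 1) * jump_rate w y)"
    "(\<lambda>i. \<bar>gF (Suc i) w y\<bar>) sums ((exp \<bar>F w y\<bar> - 1) * jump_rate w y)"
proof -
  have *: "(\<lambda>i. f ^ Suc i / fact (Suc i) * jump_rate w y) sums ((exp f - 1) * jump_rate w y)" for f :: real
  proof -
    have "(\<lambda>i. f ^ i / fact i) sums exp f" using exp_converges[of f] by (simp add: divide_inverse mult.commute)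
    then have "(\<lambda>i. f ^ Suc i / fact (Suc i)) sums (exp f - f ^ 0 / fact 0)" by (subst sums_Suc_iff) simp
    then show ?thesis by (intro sums_mult2) simp
  qed
  have "\<bar>gF (Suc i) w y\<bar> = \<bar>F w y\<bar> ^ Suc i / fact (Suc i) * jump_rate w y" for i
    using jump_rate_nonneg[of w y] by (simp add: gF_def abs_mult power_abs)
  then show "(\<lambda>i. gF (Suc i) w y) sums ((exp (- F w y) - 1) * jump_rate w y)"
    "(\<lambda>i. \<bar>gF (Suc i) w y\<bar>) sums ((exp \<bar>F w y\<bar> - 1) * jump_rate w y)"
    using *[of "- F w y"] *[of "\<bar>F w y\<bar>"] by (simp_all only: gF_def)
qed

lemma majorantI:
  assumes "a \<le> \<bar>F w y\<bar> * E / sqrt K" "0 \<le> a"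
  shows "ennreal (a * jump_rate w y) \<le> majorant w y"
proof -
  have "a * jump_rate w y \<le> \<bar>F w y\<bar> * E / sqrt K * (Cbar / norm (w - y) powr (real DIM('a) + \<alpha>))"
    using assms jump_rate_le jump_rate_nonneg by (intro mult_mono) auto
  then show ?thesis unfolding majorant_def \<theta>_def by (intro ennreal_leI) (simp add: mult_ac)
qed

lemma exp_F_le: "exp \<bar>F w y\<bar> - 1 \<le> \<bar>F w y\<bar> * E / sqrt K"
proof -
  have "exp \<bar>F w y\<bar> - 1 \<le> \<bar>F w y\<bar> * E"
    unfolding E_def using F(3) F(4)[of w y] by (intro exp_diff_one_le) auto
  also have "\<dots> \<le> \<bar>F w y\<bar> * E / sqrt K"
    using sqrtK E_ge by (simp add: le_divide_eq mult_left_le)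
  finally show ?thesis .
qed

text \<open>The decay rate is \<open>sqrt K\<close>: by \<open>Jsup_bound\<close>, 2 powr (1 + d /
  \<alpha>) times \<open>Mbar\<^sup>2 * \<theta> * Jsup\<close> is at most K / sqrt K. So the factor
  1 / sqrt K in \<theta> is affordable, and the rate is still below 1.\<close>

lemma signed: "signed_series m \<alpha> M1 M2 pe majorant t0 (\<theta> * L / 2) (Mbar\<^sup>2 * \<theta> * Jsup) (sqrt K) gF"
proof -
  interpret short_time_kernel m \<alpha> M1 M2 pe "\<lambda>w y. ennreal (jump_rate w y)" by (rule short_time)
  show ?thesis
  proof
    show "0 < t0" by (rule t0)
    show "0 \<le> \<theta> * L / 2" using \<theta>_pos F(3) by simp
    show "sp_kernel majorant" by (rule majorant_kernel)
    show "majorant w y \<le> ennreal (\<theta> * L / 2 / norm (w - y) powr jexp)" for w y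
      unfolding majorant_def jexp_def using F(4)[of w y] \<theta>_pos
      by (intro ennreal_leI divide_right_mono) auto
    show "0 \<le> Mbar\<^sup>2 * \<theta> * Jsup" using \<theta>_pos by (simp add: Jsup_def)
    show "0 < sqrt K" "sqrt K < 1" using sqrtK by auto
    have "Mbar\<^sup>2 * \<theta> * Jsup * 2 powr (1 + real DIM('a) / \<alpha>) =
        (2 powr (1 + real DIM('a) / \<alpha>) * Mbar ^ 2 * Cbar * Jsup * E) / sqrt K"
      by (simp add: \<theta>_def mult_ac)
    also have "\<dots> \<le> K / sqrt K" using Jsup_bound(2) sqrtK(1) by (intro divide_right_mono) auto
    finally show "Mbar\<^sup>2 * \<theta> * Jsup * 2 powr (1 + real DIM('a) / \<alpha>) \<le> sqrt K"
      using sqrtK K by (simp add: real_div_sqrt)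
    note [measurable (raw)] = p_meas sp_kernel_measurable[OF majorant_kernel]
    note [measurable] = JI_measurable
    show "(\<integral>\<^sup>+s\<in>{0<..t0}. (\<integral>\<^sup>+w. pe s x w * (\<integral>\<^sup>+y. majorant w y \<partial>m) \<partial>m) \<partial>lborel) \<le> ennreal (Mbar\<^sup>2 * \<theta> * Jsup)" for x
    proof (rule order_trans[OF _ kernel_JI_le[of "\<lambda>s w. pe s x w"]])
      show "(\<integral>\<^sup>+s\<in>{0<..t0}. (\<integral>\<^sup>+w. pe s x w * (\<integral>\<^sup>+y. majorant w y \<partial>m) \<partial>m) \<partial>lborel) \<le>
        (\<integral>\<^sup>+s\<in>{0<..t0}. (\<integral>\<^sup>+w. pe s x w * (ennreal (Mbar * \<theta>) * JI w) \<partial>m) \<partial>lborel)"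
        by (intro nn_integral_mono mult_right_mono mult_left_mono majorant_mass) auto
    qed (auto intro: pe_le)
    show "(\<integral>\<^sup>+s\<in>{0<..t0}. (\<integral>\<^sup>+w. (majorant \<bullet>\<^sub>k pe) s w z \<partial>m) \<partial>lborel) \<le> ennreal (Mbar\<^sup>2 * \<theta> * Jsup)" for z
    proof (rule order_trans[OF _ kernel_JI_le[of "\<lambda>s w. pe s w z"]])
      have "(\<integral>\<^sup>+w. (majorant \<bullet>\<^sub>k pe) s w z \<partial>m) = (\<integral>\<^sup>+y. pe s y z * (\<integral>\<^sup>+w. majorant w y \<partial>m) \<partial>m)" for s
      proof -
        have "(\<integral>\<^sup>+w. (majorant \<bullet>\<^sub>k pe) s w z \<partial>m) = (\<integral>\<^sup>+y. \<integral>\<^sup>+w. majorant w y * pe s y z \<partial>m \<partial>m)"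
          unfolding kmul_def by (rule swap_mm[symmetric]) measurable
        also have "\<dots> = (\<integral>\<^sup>+y. pe s y z * (\<integral>\<^sup>+w. majorant w y \<partial>m) \<partial>m)"
          by (intro nn_integral_cong) (subst nn_integral_multc, auto simp: mult.commute)
        finally show ?thesis .
      qed
      then show "(\<integral>\<^sup>+s\<in>{0<..t0}. (\<integral>\<^sup>+w. (majorant \<bullet>\<^sub>k pe) s w z \<partial>m) \<partial>lborel) \<le>
        (\<integral>\<^sup>+s\<in>{0<..t0}. (\<integral>\<^sup>+w. pe s w z * (ennreal (Mbar * \<theta>) * JI w) \<partial>m) \<partial>lborel)"
        by (auto intro!: nn_integral_mono mult_right_mono mult_left_mono majorant_mass)
    qed (auto intro: pe_le)
    show "(\<lambda>(x, y). gF i x y) \<in> borel_measurable (borel \<Otimes>\<^sub>M borel)" for i by (rule gF_measurable)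
    show "(\<Sum>i. ennreal \<bar>gF (Suc i) w y\<bar>) \<le> majorant w y" for w y
      by (subst suminf_ennreal_eq[OF _ gF_sums(2)]) (simp_all add: majorantI exp_F_le)
  qed
qed

end

section \<open>Bounds for the Feynman-Kac density\<close>

context stable_feynman_kac
begin

lemma fk_series_bounds:
  "\<exists>c D. 0 < c \<and> c \<le> 1 \<and> 1 \<le> D \<and> (\<forall>t x z. 0 < t \<longrightarrow> t \<le> t0 \<longrightarrow>
    c * p t x z \<le> fk_series \<alpha> p m C F t x z \<and> fk_series \<alpha> p m C F t x z \<le> D * p t x z)"
  and fk_series_measurable: "0 < t \<Longrightarrow> t \<le> t0 \<Longrightarrow>
    (\<lambda>(x, y). fk_series \<alpha> p m C F t x y) \<in> borel_measurable (borel \<Otimes>\<^sub>M borel)"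
proof -
  interpret S: signed_series m \<alpha> M1 M2 pe majorant t0 "\<theta> * L / 2" "Mbar\<^sup>2 * \<theta> * Jsup" "sqrt K" gF
    by (rule signed)
  have eq: "fk_series \<alpha> p m C F t x z = enn2real (S.Q True t x z) - enn2real (S.Q False t x z)"
    if "0 < t" "t \<le> t0" for t x z
    using that by (intro S.fk_series_eq p_eq_pe) (auto simp: gF_def jump_rate_def)
  show "(\<lambda>(x, y). fk_series \<alpha> p m C F t x y) \<in> borel_measurable (borel \<Otimes>\<^sub>M borel)" if "0 < t" "t \<le> t0" for t
  proof -
    note [measurable (raw)] = st_kernel_measurable[OF S.Q_kernel]
    show ?thesis unfolding eq[OF that] by measurable
  qed
  \<comment> \<open>As F^+ is at most L / 2, the first bound on \<Lambda> keeps \<beta> below the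
    jump rate; the second keeps \<beta> and \<gamma> below the majorant. Both exceed 1.\<close>
  define \<Lambda> where "\<Lambda> = min (1 / (1 - exp (- L / 2))) (1 / sqrt K)"
  define pos where "pos w y = 1 - exp (- max (F w y) 0)" for w y
  \<comment> \<open>Exactly the ratio of \<gamma> to \<beta> where F > 0.\<close>
  define \<rho> where "\<rho> = (\<Lambda> - 1) / \<Lambda>"
  define \<beta> where "\<beta> w y = ennreal (\<Lambda> * pos w y * jump_rate w y)" for w y
  define \<gamma> where "\<gamma> w y = ennreal ((exp (- F w y) - 1 + \<Lambda> * pos w y) * jump_rate w y)" for w y
  have half: "0 < 1 - exp (- L / 2)" "1 - exp (- L / 2) < 1" using F(3) by auto
  have \<Lambda>: "1 < \<Lambda>" "\<Lambda> * (1 - exp (- L / 2)) \<le> 1" "\<Lambda> \<le> 1 / sqrt K"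
  proof -
    show "1 < \<Lambda>" using half sqrtK by (simp add: \<Lambda>_def)
    have "\<Lambda> * (1 - exp (- L / 2)) \<le> 1 / (1 - exp (- L / 2)) * (1 - exp (- L / 2))"
      using half by (intro mult_right_mono) (auto simp: \<Lambda>_def)
    then show "\<Lambda> * (1 - exp (- L / 2)) \<le> 1" using half by simp
  qed (simp add: \<Lambda>_def)
  have pos: "0 \<le> pos w y" "pos w y \<le> 1 - exp (- L / 2)" "pos w y \<le> \<bar>F w y\<bar>" for w y
    using F(3) F(4)[of w y] exp_ge_add_one_self[of "- F w y"] by (auto simp: pos_def max_def)
  have \<gamma>_cases: "exp (- F w y) - 1 + \<Lambda> * pos w y = (if 0 \<le> F w y then (\<Lambda> - 1) * pos w y else exp \<bar>F w y\<bar> - 1)" for w y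
    by (simp add: pos_def max_def algebra_simps)
  have \<Lambda>_pos: "\<Lambda> * pos w y \<le> \<bar>F w y\<bar> * E / sqrt K" for w y
  proof -
    have "\<Lambda> * pos w y \<le> (1 / sqrt K) * (\<bar>F w y\<bar> * E)"
    proof (rule mult_mono)
      have "pos w y * 1 \<le> \<bar>F w y\<bar> * E" using pos[of w y] E_ge by (intro mult_mono) auto
      then show "pos w y \<le> \<bar>F w y\<bar> * E" by simp
    qed (use \<Lambda> pos sqrtK in auto)
    then show ?thesis by simp
  qed
  note [measurable (raw)] = F_measurable C_measurable sp_kernel_measurable[OF jump_rate_kernel]
  have kernels: "sp_kernel \<beta>" "sp_kernel \<gamma>"
    unfolding sp_kernel_def \<beta>_def \<gamma>_def pos_def jump_rate_def by measurable
  interpret P: fk_perturbation m \<alpha> M1 M2 pe "\<lambda>w y. ennreal (jump_rate w y)" majorant t0 "\<theta> * L / 2" "Mbar\<^sup>2 * \<theta> * Jsup" "sqrt K"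
    \<beta> \<gamma> S.Gp S.Gm \<rho> "S.Q True" "S.Q False"
  proof (intro fk_perturbation.intro short_time S.jump_kernel_axioms fk_perturbation_axioms.intro kernels S.Gp_kernel S.Gm_kernel S.Q_kernel S.Q_le)
    fix w y
    have "\<Lambda> * pos w y \<le> 1"
      using \<Lambda> pos[of w y] mult_left_mono[of "pos w y" "1 - exp (- L / 2)" \<Lambda>] by linarith
    then show "\<beta> w y \<le> ennreal (jump_rate w y)"
      unfolding \<beta>_def using jump_rate_nonneg[of w y] by (intro ennreal_leI mult_left_le_one_le) (use pos \<Lambda> in auto)
    show "\<beta> w y \<le> majorant w y"
      unfolding \<beta>_def using \<Lambda> pos by (intro majorantI \<Lambda>_pos) auto
    have c0: "0 \<le> exp (- F w y) - 1 + \<Lambda> * pos w y" unfolding \<gamma>_cases using \<Lambda> pos by auto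
    have le: "(\<Lambda> - 1) * pos w y \<le> \<Lambda> * pos w y" using pos by (intro mult_right_mono) auto
    show "\<gamma> w y \<le> majorant w y"
      unfolding \<gamma>_def using c0 le exp_F_le[of w y] \<Lambda>_pos[of w y] by (intro majorantI) (auto simp: \<gamma>_cases)
    have "\<rho> * (\<Lambda> * pos w y) = (\<Lambda> - 1) * pos w y" using \<Lambda> by (simp add: \<rho>_def)
    also have "\<dots> \<le> exp (- F w y) - 1 + \<Lambda> * pos w y"
      unfolding \<gamma>_cases by (auto simp: pos_def)
    finally have "\<rho> * (\<Lambda> * pos w y) * jump_rate w y \<le> (exp (- F w y) - 1 + \<Lambda> * pos w y) * jump_rate w y"
      using jump_rate_nonneg by (intro mult_right_mono)
    moreover have "0 \<le> \<rho>" using \<Lambda> by (simp add: \<rho>_def)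
    ultimately show "ennreal \<rho> * \<beta> w y \<le> \<gamma> w y"
      unfolding \<beta>_def \<gamma>_def by (simp add: ennreal_leI mult.assoc flip: ennreal_mult')
    have "summable (\<lambda>i. \<bar>gF (Suc i) w y\<bar>)" using gF_sums(2) by (rule sums_summable)
    then obtain u v where uv: "0 \<le> u" "0 \<le> v" "S.Gp w y = ennreal u" "S.Gm w y = ennreal v"
      "u - v = (\<Sum>i. gF (Suc i) w y)"
      using suminf_ennreal_parts[of "\<lambda>i. gF (Suc i) w y"] unfolding S.Gp_def S.Gm_def S.gp_def S.gm_def by blast
    have "u - v = (exp (- F w y) - 1) * jump_rate w y" using uv(5) gF_sums(1)[of w y] by (simp add: sums_iff)
    then have "(exp (- F w y) - 1 + \<Lambda> * pos w y) * jump_rate w y + v = u + \<Lambda> * pos w y * jump_rate w y"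
      by (simp add: algebra_simps)
    moreover have "0 \<le> (exp (- F w y) - 1 + \<Lambda> * pos w y) * jump_rate w y" "0 \<le> \<Lambda> * pos w y * jump_rate w y"
      using c0 jump_rate_nonneg[of w y] \<Lambda> pos[of w y] by auto
    ultimately show "\<gamma> w y + S.Gm w y = S.Gp w y + \<beta> w y"
      using uv by (simp add: \<gamma>_def \<beta>_def flip: ennreal_plus)
  next
    show "0 < \<rho>" "\<rho> \<le> 1" using \<Lambda> by (auto simp: \<rho>_def)
    show "S.Q True t x z = pe t x z + (pe \<star> (S.Gp \<bullet>\<^sub>k S.Q True)) t x z + (pe \<star> (S.Gm \<bullet>\<^sub>k S.Q False)) t x z"
      "S.Q False t x z = (pe \<star> (S.Gp \<bullet>\<^sub>k S.Q False)) t x z + (pe \<star> (S.Gm \<bullet>\<^sub>k S.Q True)) t x z" for t x z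
      using S.Q_eq[of True t x z] S.Q_eq[of False t x z] by simp_all
  qed
  obtain c where c: "0 < c" "\<And>t x z. 0 < t \<Longrightarrow> t \<le> t0 \<Longrightarrow> S.Q False t x z + ennreal c * pe t x z \<le> S.Q True t x z"
    using P.Q_lower_bound by blast
  define D where "D = max 1 (S.total_const / M1)"
  have "min c 1 * p t x z \<le> fk_series \<alpha> p m C F t x z \<and> fk_series \<alpha> p m C F t x z \<le> D * p t x z"
    if t: "0 < t" "t \<le> t0" for t x z
  proof -
    have fin: "S.Q e t x z < \<top>" for e by (rule S.Q_finite[OF t])
    have "ennreal (enn2real (S.Q False t x z) + c * p t x z) = S.Q False t x z + ennreal c * pe t x z"
      using fin[of False] c(1) p_nonneg[OF t(1)] t(1) by (simp add: ennreal_plus ennreal_mult pe_def)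
    also have "\<dots> \<le> ennreal (enn2real (S.Q True t x z))" using c(2)[OF t] fin[of True] by simp
    finally have "c * p t x z \<le> fk_series \<alpha> p m C F t x z" unfolding eq[OF t] by (simp add: ennreal_le_iff)
    moreover have "min c 1 * p t x z \<le> c * p t x z" using p_nonneg[OF t(1)] by (intro mult_right_mono) auto
    moreover have "S.Q True t x z \<le> ennreal D * pe t x z"
      using order_trans[OF S.Q_le P.H_bound[OF t]] by (rule order_trans) (auto intro!: mult_right_mono ennreal_leI simp: D_def)
    then have "S.Q True t x z \<le> ennreal (D * p t x z)"
      using t(1) p_nonneg[OF t(1)] by (simp add: pe_def ennreal_mult' D_def)
    then have "enn2real (S.Q True t x z) \<le> D * p t x z"
      using p_nonneg[OF t(1)] by (intro enn2real_leI) (auto simp: D_def)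
    moreover have "0 \<le> enn2real (S.Q False t x z)" by simp
    ultimately show ?thesis unfolding eq[OF t] by linarith
  qed
  then show "\<exists>c D. 0 < c \<and> c \<le> 1 \<and> 1 \<le> D \<and> (\<forall>t x z. 0 < t \<longrightarrow> t \<le> t0 \<longrightarrow>
      c * p t x z \<le> fk_series \<alpha> p m C F t x z \<and> fk_series \<alpha> p m C F t x z \<le> D * p t x z)"
    using c(1) by (intro exI[of _ "min c 1"] exI[of _ D]) (auto simp: D_def)
qed

section \<open>Passage from small to all times\<close>

lemma real_chapman_kolmogorov:
  assumes "0 < s" "0 < t"
  shows "integrable m (\<lambda>y. p s x y * p t y z)" "(LINT y|m. p s x y * p t y z) = p (s + t) x z"
proof -
  note [measurable (raw)] = p_meas
  have nn: "0 \<le> p s x y * p t y z" for y using p_nonneg assms by simp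
  have [measurable]: "(\<lambda>y. p s x y * p t y z) \<in> borel_measurable m"
    unfolding p_eq_pe[OF assms(1)] p_eq_pe[OF assms(2)] by measurable
  have "(\<integral>\<^sup>+y. ennreal (p s x y * p t y z) \<partial>m) = (\<integral>\<^sup>+y. pe s x y * pe t y z \<partial>m)"
    using assms by (simp add: pe_def ennreal_mult p_nonneg)
  also have "\<dots> = ennreal (p (s + t) x z)" using chapman_kolmogorov[OF assms] assms by (simp add: pe_def)
  finally have eq: "(\<integral>\<^sup>+y. ennreal (p s x y * p t y z) \<partial>m) = ennreal (p (s + t) x z)" .
  show "integrable m (\<lambda>y. p s x y * p t y z)" using eq nn by (intro integrableI_nonneg) auto
  show "(LINT y|m. p s x y * p t y z) = p (s + t) x z"
    using eq nn p_nonneg[of "s + t"] assms by (simp add: integral_eq_nn_integral)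
qed

text \<open>Chapman-Kolmogorov preserves the shape of the bound, so each factor costs only c or D.
  The lower bound also gives the nonnegativity needed to multiply the estimates, and measurability
  in \<open>x\<close> is carried along for the next integration.\<close>

lemma kernel_power_bounds:
  assumes s: "0 < s" and c: "0 \<le> c" "0 \<le> D"
    and r: "(\<lambda>(x, y). r x y) \<in> borel_measurable (borel \<Otimes>\<^sub>M borel)" "\<And>x z. c * p s x z \<le> r x z" "\<And>x z. r x z \<le> D * p s x z"
  shows "(\<lambda>x. kernel_power m r (Suc N) x z) \<in> borel_measurable borel \<and>
    (\<forall>x. c ^ Suc N * p (real (Suc N) * s) x z \<le> kernel_power m r (Suc N) x z \<and>
      kernel_power m r (Suc N) x z \<le> D ^ Suc N * p (real (Suc N) * s) x z)"
proof (induction N)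
  case 0
  have "(\<lambda>x. (x, z)) \<in> borel \<rightarrow>\<^sub>M borel \<Otimes>\<^sub>M borel" by measurable
  from measurable_compose[OF this r(1)] show ?case using r(2,3) by simp
next
  case (Suc N)
  let ?k = "\<lambda>y. kernel_power m r (Suc N) y z"
  have t: "0 < real (Suc N) * s" using s by simp
  have [measurable]: "?k \<in> borel_measurable borel" using Suc by simp
  have [measurable (raw)]: "(\<lambda>\<omega>. r (u \<omega>) (v \<omega>)) \<in> borel_measurable N'"
    if "u \<in> N' \<rightarrow>\<^sub>M borel" "v \<in> N' \<rightarrow>\<^sub>M borel" for u v and N' :: "'b measure"
    using measurable_compose[of "\<lambda>\<omega>. (u \<omega>, v \<omega>)" N', OF _ r(1)] that by simp
  have sum_eq: "s + real (Suc N) * s = real (Suc (Suc N)) * s" by (simp add: algebra_simps)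
  have pn: "0 \<le> p s x y" "0 \<le> p (real (Suc N) * s) y z" for x y using p_nonneg s t by auto
  have bounds: "c ^ Suc (Suc N) * (p s x y * p (real (Suc N) * s) y z) \<le> r x y * ?k y"
    "r x y * ?k y \<le> D ^ Suc (Suc N) * (p s x y * p (real (Suc N) * s) y z)" "0 \<le> r x y * ?k y" for x y
  proof -
    have lo: "0 \<le> c * p s x y" "0 \<le> c ^ Suc N * p (real (Suc N) * s) y z"
      using c(1) pn by (simp_all add: mult_nonneg_nonneg del: power_Suc of_nat_Suc)
    have k: "c ^ Suc N * p (real (Suc N) * s) y z \<le> ?k y" "?k y \<le> D ^ Suc N * p (real (Suc N) * s) y z"
      using Suc by auto
    have "(c * p s x y) * (c ^ Suc N * p (real (Suc N) * s) y z) \<le> r x y * ?k y"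
      using lo k r(2)[of x y] by (intro mult_mono) auto
    then show "c ^ Suc (Suc N) * (p s x y * p (real (Suc N) * s) y z) \<le> r x y * ?k y"
      by (simp only: power_Suc[of c "Suc N"] mult_ac)
    have "r x y * ?k y \<le> (D * p s x y) * (D ^ Suc N * p (real (Suc N) * s) y z)"
      using lo k r(2,3)[of x y] c(2) pn by (intro mult_mono) auto
    then show "r x y * ?k y \<le> D ^ Suc (Suc N) * (p s x y * p (real (Suc N) * s) y z)"
      by (simp only: power_Suc[of D "Suc N"] mult_ac)
    show "0 \<le> r x y * ?k y" using lo k r(2)[of x y] by (intro mult_nonneg_nonneg) auto
  qed
  note CK = real_chapman_kolmogorov[OF s t, unfolded sum_eq]
  have int: "integrable m (\<lambda>y. r x y * ?k y)" for x
  proof (rule Bochner_Integration.integrable_bound)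
    show "integrable m (\<lambda>y. D ^ Suc (Suc N) * (p s x y * p (real (Suc N) * s) y z))"
      using CK(1) by (rule integrable_mult_right)
    show "AE y in m. norm (r x y * ?k y) \<le> norm (D ^ Suc (Suc N) * (p s x y * p (real (Suc N) * s) y z))"
      using bounds(2,3)[of x] unfolding real_norm_def by (intro AE_I2) (smt (verit))
  qed measurable
  have "c ^ Suc (Suc N) * p (real (Suc (Suc N)) * s) x z \<le> (LINT y|m. r x y * ?k y)"
    "(LINT y|m. r x y * ?k y) \<le> D ^ Suc (Suc N) * p (real (Suc (Suc N)) * s) x z" for x
    unfolding CK(2)[symmetric] integral_mult_right_zero[symmetric]
    by (intro integral_mono int integrable_mult_right CK(1) bounds)+
  moreover have "(\<lambda>x. LINT y|m. r x y * ?k y) \<in> borel_measurable borel" by measurable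
  ultimately show ?case by (simp only: kernel_power.simps) blast
qed

theorem fk_density_bounds:
  "\<exists>C3 C4 C5 C6. 0 < C3 \<and> 0 < C4 \<and> 0 < C5 \<and> 0 < C6 \<and>
    (\<forall>t>0. \<forall>x z. C3 * exp (- C4 * t) * stable_bound \<alpha> t x z \<le> fk_density \<alpha> p m C F t0 t x z \<and>
      fk_density \<alpha> p m C F t0 t x z \<le> C5 * exp (C6 * t) * stable_bound \<alpha> t x z)"
proof -
  obtain c D where cD: "0 < c" "c \<le> 1" "1 \<le> D"
    and q: "\<And>t x z. 0 < t \<Longrightarrow> t \<le> t0 \<Longrightarrow> c * p t x z \<le> fk_series \<alpha> p m C F t x z"
      "\<And>t x z. 0 < t \<Longrightarrow> t \<le> t0 \<Longrightarrow> fk_series \<alpha> p m C F t x z \<le> D * p t x z"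
    using fk_series_bounds by blast
  \<comment> \<open>The number of factors is at most \<open>t / t0 + 1\<close>, which turns powers
    of c and D into exponentials in t.\<close>
  have power: "\<exists>N. real N \<le> t / t0 + 1 \<and> c ^ N * p t x z \<le> fk_density \<alpha> p m C F t0 t x z \<and>
      fk_density \<alpha> p m C F t0 t x z \<le> D ^ N * p t x z" if t: "0 < t" for t x z
  proof (cases "t \<le> t0")
    case True
    then show ?thesis using q[OF t True, of x z] t t0 by (intro exI[of _ 1]) (simp add: fk_density_def)
  next
    case False
    let ?P = "\<lambda>N::nat. 1 \<le> N \<and> t / real N \<le> t0"
    define N where "N = (LEAST N. ?P N)"
    obtain k :: nat where k: "t / t0 < real k" using reals_Archimedean2 by blast
    then have "0 < real k" using t t0 by (smt (verit) divide_pos_pos)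
    then have "?P k" using k t0 by (auto simp: field_simps)
    then have N: "1 \<le> N" "t / real N \<le> t0" unfolding N_def using LeastI[of ?P] by blast+
    have "N \<noteq> 1" using N(2) False by auto
    \<comment> \<open>Minimality of \<open>N\<close>, applied to \<open>N - 1\<close>, which is at
      least 1 because t exceeds \<open>t0\<close>.\<close>
    then have "\<not> ?P (N - 1)" unfolding N_def by (intro not_less_Least) (use N in \<open>auto simp: N_def\<close>)
    then have "t0 < t / real (N - 1)" using N(1) \<open>N \<noteq> 1\<close> by auto
    then have "real (N - 1) < t / t0" using t0 N(1) \<open>N \<noteq> 1\<close> by (simp add: field_simps)
    then have le: "real N \<le> t / t0 + 1" using N(1) by (simp add: of_nat_diff)
    obtain n where n: "N = Suc n" using N(1) by (cases N) auto
    have s: "0 < t / real N" using t N(1) by simp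
    have "fk_density \<alpha> p m C F t0 t x z = kernel_power m (fk_series \<alpha> p m C F (t / real N)) N x z"
      using False unfolding fk_density_def N_def by (simp add: Let_def)
    moreover have "real N * (t / real N) = t" using N(1) by simp
    ultimately show ?thesis
      using kernel_power_bounds[OF s less_imp_le[OF cD(1)] _ fk_series_measurable[OF s N(2)] q[OF s N(2)], where N = n and z = z] cD(3) le
      by (intro exI[of _ N]) (simp add: n del: of_nat_Suc power_Suc kernel_power.simps)
  qed
  \<comment> \<open>The logarithms come from c^N and D^N with N at most \<open>t / t0 + 1\<close>;
    the summand 1 keeps \<open>C4\<close> and \<open>C6\<close> positive even if c = 1 or D =
    1.\<close>
  define C4 where "C4 = 1 - ln c / t0"
  define C6 where "C6 = 1 + ln D / t0"
  have "ln c / t0 \<le> 0" "0 \<le> ln D / t0" using cD t0 by (auto simp: divide_le_0_iff)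
  then have C46: "0 < C4" "0 < C6" by (auto simp: C4_def C6_def)
  have "c * M1 * exp (- C4 * t) * stable_bound \<alpha> t x z \<le> fk_density \<alpha> p m C F t0 t x z \<and>
      fk_density \<alpha> p m C F t0 t x z \<le> D * M2 * exp (C6 * t) * stable_bound \<alpha> t x z" if t: "0 < t" for t x z
  proof -
    obtain N where N: "real N \<le> t / t0 + 1" "c ^ N * p t x z \<le> fk_density \<alpha> p m C F t0 t x z"
      "fk_density \<alpha> p m C F t0 t x z \<le> D ^ N * p t x z" using power[OF t] by blast
    have sb: "0 \<le> stable_bound \<alpha> t x z" using stable_bound_pos[OF t, of \<alpha> x z] by simp
    have "c * exp (- C4 * t) \<le> exp (ln c * (t / t0 + 1))"
    proof -
      have "c * exp (- C4 * t) = exp (ln c * (t / t0 + 1) - t)"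
        using cD(1) by (simp add: C4_def algebra_simps exp_add exp_diff exp_minus flip: exp_ln_iff)
      then show ?thesis using t by simp
    qed
    also have "\<dots> \<le> exp (ln c * real N)" using N(1) cD by (simp add: mult_left_mono_neg)
    also have "\<dots> = c ^ N" using cD(1) by (simp add: mult.commute exp_of_nat_mult)
    finally have lo: "c * exp (- C4 * t) \<le> c ^ N" .
    have "D ^ N = exp (ln D * real N)" using cD(3) by (simp add: mult.commute exp_of_nat_mult)
    also have "\<dots> \<le> exp (ln D * (t / t0 + 1))" using N(1) cD by (simp add: mult_left_mono)
    also have "\<dots> \<le> D * exp (C6 * t)"
    proof -
      have "D * exp (C6 * t) = exp (ln D * (t / t0 + 1) + t)"
        using cD(3) by (simp add: C6_def algebra_simps exp_add)
      then show ?thesis using t by simp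
    qed
    finally have up: "D ^ N \<le> D * exp (C6 * t)" .
    have "(c * exp (- C4 * t)) * (M1 * stable_bound \<alpha> t x z) \<le> c ^ N * p t x z"
      using lo bounds(1) bounds(3)[OF t, of x z] sb cD by (intro mult_mono) auto
    moreover have "D ^ N * p t x z \<le> (D * exp (C6 * t)) * (M2 * stable_bound \<alpha> t x z)"
      using up bounds(2) bounds(4)[OF t, of x z] p_nonneg[OF t] cD by (intro mult_mono) auto
    ultimately show ?thesis using N by (simp add: mult_ac)
  qed
  then show ?thesis using C46 cD bounds(1,2)
    by (intro exI[of _ "c * M1"] exI[of _ C4] exI[of _ "D * M2"] exI[of _ C6]) auto
qed

end

theorem theorem3p9:
  fixes \<alpha> M\<^sub>0 Mbar Cbar M\<^sub>1 M\<^sub>2 L K t\<^sub>0 :: real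
    and M :: "'a::euclidean_space \<Rightarrow> real"
    and C F :: "'a \<Rightarrow> 'a \<Rightarrow> real"
    and p :: "real \<Rightarrow> 'a \<Rightarrow> 'a \<Rightarrow> real"
    and \<M> :: "'w measure" and \<F> :: "ennreal \<Rightarrow> 'w measure"
    and X :: "ennreal \<Rightarrow> 'w \<Rightarrow> 'a option"
    and P :: "'a option \<Rightarrow> 'w measure"
  defines "m \<equiv> density lborel (\<lambda>x. ennreal (M x))"
  assumes \<alpha>: "0 < \<alpha>" "\<alpha> < 2"
    and M: "M \<in> borel_measurable borel" "0 < M\<^sub>0" "\<And>x. M\<^sub>0 \<le> M x" "\<And>x. M x \<le> Mbar"
    and C: "(\<lambda>(x, y). C x y) \<in> borel_measurable borel" "0 < Cbar"
      "\<And>x y. \<bar>2 * C x y\<bar> \<le> Cbar" "\<And>x y. x \<noteq> y \<Longrightarrow> 0 \<le> C x y"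
    and hunt: "hunt_process \<M> \<F> X P"
    and levy: "levy_system X P (stable_kernel \<alpha> m C)"
    and density: "transition_density X P m p"
    and continuous: "continuous_on ({0<..} \<times> UNIV \<times> UNIV) (\<lambda>(t, x, y). p t x y)"
    and bounds: "0 < M\<^sub>1" "0 < M\<^sub>2"
      "\<And>t x y. 0 < t \<Longrightarrow> M\<^sub>1 * stable_bound \<alpha> t x y \<le> p t x y"
      "\<And>t x y. 0 < t \<Longrightarrow> p t x y \<le> M\<^sub>2 * stable_bound \<alpha> t x y"
    and F: "F \<in> J_class \<alpha> p" "(\<lambda>x y. F y x) \<in> J_class \<alpha> p"
      "0 < L" "\<And>x y. \<bar>F x y\<bar> \<le> L / 2"
    and K: "0 < K" "K < 1" and t\<^sub>0: "0 < t\<^sub>0"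
    and small: "\<And>n::nat. 1 \<le> n \<Longrightarrow>
      ennreal (2 powr (1 + real DIM('a) / \<alpha>) * Mbar ^ 2 * Cbar) * jump_sup \<alpha> p F t\<^sub>0 *
        ennreal (\<Sum>i=1..n. K ^ (n - i) * L ^ (i - 1) / fact i) \<le> ennreal (K ^ n)"
  shows "\<exists>C\<^sub>3 C\<^sub>4 C\<^sub>5 C\<^sub>6. 0 < C\<^sub>3 \<and> 0 < C\<^sub>4 \<and> 0 < C\<^sub>5 \<and> 0 < C\<^sub>6 \<and>
    (\<forall>t>0. \<forall>x z.
      C\<^sub>3 * exp (- C\<^sub>4 * t) * stable_bound \<alpha> t x z \<le> fk_density \<alpha> p m C F t\<^sub>0 t x z \<and>
      fk_density \<alpha> p m C F t\<^sub>0 t x z \<le> C\<^sub>5 * exp (C\<^sub>6 * t) * stable_bound \<alpha> t x z)"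
proof -
  have "stable_feynman_kac \<M> \<F> X P \<alpha> M\<^sub>0 Mbar Cbar M\<^sub>1 M\<^sub>2 M m C p F L K t\<^sub>0"
    using F(1,3,4) \<alpha>(1) M C levy density continuous bounds K t\<^sub>0 small
    by (intro stable_feynman_kac.intro stable_like_process.intro hunt stable_like_process_axioms.intro
        stable_feynman_kac_axioms.intro) (auto simp: m_def J_class_def)
  then show ?thesis by (rule stable_feynman_kac.fk_density_bounds)
qed

end
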